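(* Let $A$ be a constant with $\frac12\cdot\frac1{4\pi}<A<\frac1{4\pi}$, let $n\ge1$ be an integer, let $U_n(y)=y+\frac{A}{n}\sin(4n\pi y)$, $y\in[0,1]$, and let $0<\beta<1$. There is a local bifurcation curve of travelling wave solutions of the 2D Euler equation with stream function $\psi=\psi^{\alpha}\left(\alpha\left(x-\tfrac12 t\right),y\right)$, which stems out of the oscillatory shear $(U_n(y),0)$. Here $\alpha$ is near $\alpha_n$, where $\alpha_n\ge c_0 n$ with a constant $c_0>0$ independent of $n$; the function $$\psi^{\alpha}(\xi,y)\in C^{2,\beta}\left((0,2\pi)\times(0,1)\right)$$ is periodic and even in $\xi$ with period $2\pi$, and $\psi^\alpha$ is constant on $\{y=0\}$ and constant on $\{y=1\}$. Near $y=\frac12$ the streamlines of these new (bifurcating) solutions have a Kelvin cat's eye structure, with the following leading order expression: parametrizing the curve by a small real parameter $s$, with $\alpha=\alpha(s)$ continuous and $\alpha(0)=\alpha_n$, the relative stream function is $$\psi^{\alpha(s)}_{\mathrm{rel}}(\xi,y)=\frac12\left(y-\frac12\right)^2+\phi_*(y)+s\,\phi_n(y)\cos\xi+o(s),$$ where $$\phi_*(y)=-\frac{A}{4n^2\pi}\cos(4n\pi y)+\frac{A}{4n^2\pi}.$$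
   Context: The 2D Euler equation is considered in the channel $\{(x,y):0\le y\le1\}$ with zero normal velocity on $y=0$ and $y=1$; the velocity is $(u_1,u_2)=(\partial_y\psi,-\partial_x\psi)$. Set $\xi=\alpha(x-\frac12t)$. The relative stream function, in the frame moving with velocity $\frac12$ in $x$, is $\psi_{\mathrm{rel}}(\xi,y)=\psi(\xi,y)-\frac12y$, stream functions being determined up to an additive constant. The number $\alpha_n>0$ and the function $\phi_n$ are defined as follows: $-\alpha_n^2$ is the negative (lowest) eigenvalue of the operator $L=-\frac{d^2}{dy^2}+Q(y)$ on $(0,1)$ with Dirichlet boundary conditions $\varphi(0)=\varphi(1)=0$, where $$Q(y)=\frac{U_n''(y)}{U_n(y)-\frac12},$$ and $\phi_n$ is a corresponding eigenfunction chosen so that $\phi_n(y)>0$ for $y\in(0,1)$. "Cat's eye structure" means that, in the moving frame, the streamlines (level curves of $\psi_{\mathrm{rel}}$) near $y=\frac12$ form the usual cat's eye pattern: a periodic row of saddle stagnation points whose separatrices enclose regions of closed streamlines. *)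

theory Defs
  imports "HOL-Analysis.Analysis"
begin

text \<open>Functions on the channel are total functions of type \<^typ>\<open>real \<times> real \<Rightarrow> real\<close>; only their
  values on the closed strip matter. The second variable is differentiated within
  \<^term>\<open>{0..1::real}\<close>, so derivatives on the walls are one-sided.\<close>

definition strip :: "(real \<times> real) set" where
  "strip = UNIV \<times> {0..1}"

definition D1 :: "(real \<times> real \<Rightarrow> real) \<Rightarrow> real \<times> real \<Rightarrow> real" where
  "D1 f = (\<lambda>(x, y). vector_derivative (\<lambda>t. f (t, y)) (at x))"

definition D2 :: "(real \<times> real \<Rightarrow> real) \<Rightarrow> real \<times> real \<Rightarrow> real" where
  "D2 f = (\<lambda>(x, y). vector_derivative (\<lambda>t. f (x, t)) (at y within {0..1}))"

primrec Ck_strip :: "nat \<Rightarrow> (real \<times> real \<Rightarrow> real) \<Rightarrow> bool" where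
  "Ck_strip 0 f \<longleftrightarrow> continuous_on strip f"
| "Ck_strip (Suc k) f \<longleftrightarrow>
     continuous_on strip f \<and>
     (\<forall>x. \<forall>y\<in>{0..1}. (\<lambda>t. f (t, y)) differentiable (at x) \<and>
                     (\<lambda>t. f (x, t)) differentiable (at y within {0..1})) \<and>
     Ck_strip k (D1 f) \<and> Ck_strip k (D2 f)"

definition sup_norm :: "(real \<times> real \<Rightarrow> real) \<Rightarrow> ennreal" where
  "sup_norm f = (SUP p\<in>strip. ennreal \<bar>f p\<bar>)"

definition holder_seminorm :: "real \<Rightarrow> (real \<times> real \<Rightarrow> real) \<Rightarrow> ennreal" where
  "holder_seminorm \<beta> f =
     (SUP (p, q)\<in>{(p, q). p \<in> strip \<and> q \<in> strip \<and> p \<noteq> q}.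
        ennreal (\<bar>f p - f q\<bar> / dist p q powr \<beta>))"

text \<open>The value is the Hoelder norm only for arguments that are twice continuously
  differentiable on the strip. A function in \<open>C\<^sup>2\<^sup>,\<^sup>\<beta>\<close> of the open strip
  extends with its derivatives to the closed strip.\<close>

definition C2_holder_norm :: "real \<Rightarrow> (real \<times> real \<Rightarrow> real) \<Rightarrow> ennreal" where
  "C2_holder_norm \<beta> f =
     sup_norm f + sup_norm (D1 f) + sup_norm (D2 f) +
     (\<Sum>g\<leftarrow>[D1 (D1 f), D1 (D2 f), D2 (D2 f)]. sup_norm g + holder_seminorm \<beta> g)"

definition C2_holder :: "real \<Rightarrow> (real \<times> real \<Rightarrow> real) \<Rightarrow> bool" where
  "C2_holder \<beta> f \<longleftrightarrow> Ck_strip 2 f \<and> C2_holder_norm \<beta> f < \<infinity>"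

definition euler_channel ::
  "(real \<Rightarrow> real \<times> real \<Rightarrow> real) \<Rightarrow> (real \<Rightarrow> real \<times> real \<Rightarrow> real) \<Rightarrow>
   (real \<Rightarrow> real \<times> real \<Rightarrow> real) \<Rightarrow> bool" where
  "euler_channel u1 u2 p \<longleftrightarrow>
     (\<forall>t. Ck_strip 1 (u1 t) \<and> Ck_strip 1 (u2 t) \<and> Ck_strip 1 (p t)) \<and>
     (\<forall>t. \<forall>z\<in>strip.
        (\<lambda>\<tau>. u1 \<tau> z) differentiable (at t) \<and> (\<lambda>\<tau>. u2 \<tau> z) differentiable (at t) \<and>
        vector_derivative (\<lambda>\<tau>. u1 \<tau> z) (at t)
          + u1 t z * D1 (u1 t) z + u2 t z * D2 (u1 t) z = - D1 (p t) z \<and>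
        vector_derivative (\<lambda>\<tau>. u2 \<tau> z) (at t)
          + u1 t z * D1 (u2 t) z + u2 t z * D2 (u2 t) z = - D2 (p t) z \<and>
        D1 (u1 t) z + D2 (u2 t) z = 0) \<and>
     (\<forall>t x. u2 t (x, 0) = 0 \<and> u2 t (x, 1) = 0)"

text \<open>The velocity is \<open>(\<partial>\<^sub>y\<psi>, -\<partial>\<^sub>x\<psi>)\<close>.\<close>

definition euler_stream :: "(real \<Rightarrow> real \<times> real \<Rightarrow> real) \<Rightarrow> bool" where
  "euler_stream \<Phi> \<longleftrightarrow>
     (\<exists>p. euler_channel (\<lambda>t. D2 (\<Phi> t)) (\<lambda>t z. - D1 (\<Phi> t) z) p)"

definition travelling :: "real \<Rightarrow> (real \<times> real \<Rightarrow> real) \<Rightarrow> real \<Rightarrow> real \<times> real \<Rightarrow> real" where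
  "travelling \<alpha> \<psi> = (\<lambda>t (x, y). \<psi> (\<alpha> * (x - t / 2), y))"

definition rel_stream :: "(real \<times> real \<Rightarrow> real) \<Rightarrow> real \<times> real \<Rightarrow> real" where
  "rel_stream \<psi> = (\<lambda>(\<xi>, y). \<psi> (\<xi>, y) - y / 2)"

definition shear :: "real \<Rightarrow> nat \<Rightarrow> real \<Rightarrow> real" where
  "shear A n y = y + A / real n * sin (4 * real n * pi * y)"

text \<open>For \<open>0 < A < 1 / (4\<pi>)\<close> the shear is increasing and takes the value \<open>1/2\<close> only at \<open>y = 1/2\<close>,
  where its second derivative vanishes too. The quotient is completed there by its limit.\<close>

definition Qpot :: "real \<Rightarrow> nat \<Rightarrow> real \<Rightarrow> real" where
  "Qpot A n y =
     (let q = (\<lambda>z. (deriv ^^ 2) (shear A n) z / (shear A n z - 1 / 2))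
      in if y = 1 / 2 then Lim (at (1 / 2)) q else q y)"

definition dirichlet_eigenfunction :: "(real \<Rightarrow> real) \<Rightarrow> real \<Rightarrow> (real \<Rightarrow> real) \<Rightarrow> bool" where
  "dirichlet_eigenfunction Q \<nu> \<phi> \<longleftrightarrow>
     (\<exists>\<phi>' \<phi>''. \<forall>y\<in>{0..1}.
        (\<phi> has_real_derivative \<phi>' y) (at y within {0..1}) \<and>
        (\<phi>' has_real_derivative \<phi>'' y) (at y within {0..1}) \<and>
        - \<phi>'' y + Q y * \<phi> y = \<nu> * \<phi> y) \<and>
     \<phi> 0 = 0 \<and> \<phi> 1 = 0 \<and> (\<exists>y\<in>{0..1}. \<phi> y \<noteq> 0)"

definition lowest_dirichlet_eigenvalue :: "(real \<Rightarrow> real) \<Rightarrow> real \<Rightarrow> bool" where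
  "lowest_dirichlet_eigenvalue Q \<nu> \<longleftrightarrow>
     (\<exists>\<phi>. dirichlet_eigenfunction Q \<nu> \<phi>) \<and>
     (\<forall>\<mu> \<phi>. dirichlet_eigenfunction Q \<mu> \<phi> \<longrightarrow> \<nu> \<le> \<mu>)"

definition phi_star :: "real \<Rightarrow> nat \<Rightarrow> real \<Rightarrow> real" where
  "phi_star A n y =
     - (A / (4 * (real n)\<^sup>2 * pi)) * cos (4 * real n * pi * y) + A / (4 * (real n)\<^sup>2 * pi)"

definition rel_stream_shear :: "real \<Rightarrow> nat \<Rightarrow> real \<times> real \<Rightarrow> real" where
  "rel_stream_shear A n = (\<lambda>(\<xi>, y). 1 / 2 * (y - 1 / 2)\<^sup>2 + phi_star A n y)"

definition stagnation :: "(real \<times> real \<Rightarrow> real) \<Rightarrow> real \<times> real \<Rightarrow> bool" where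
  "stagnation \<Psi> z \<longleftrightarrow> D1 \<Psi> z = 0 \<and> D2 \<Psi> z = 0"

definition saddle :: "(real \<times> real \<Rightarrow> real) \<Rightarrow> real \<times> real \<Rightarrow> bool" where
  "saddle \<Psi> z \<longleftrightarrow>
     stagnation \<Psi> z \<and> D1 (D1 \<Psi>) z * D2 (D2 \<Psi>) z - (D1 (D2 \<Psi>) z)\<^sup>2 < 0"

definition streamline :: "(real \<times> real \<Rightarrow> real) \<Rightarrow> real \<times> real \<Rightarrow> (real \<times> real) set" where
  "streamline \<Psi> z = connected_component_set {w \<in> strip. \<Psi> w = \<Psi> z} z"

definition closed_streamline_around ::
  "real \<times> real \<Rightarrow> (real \<times> real \<Rightarrow> real) \<Rightarrow> real \<times> real \<Rightarrow> bool" where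
  "closed_streamline_around c \<Psi> z \<longleftrightarrow>
     (\<exists>g. simple_path g \<and> pathfinish g = pathstart g \<and>
          path_image g = streamline \<Psi> z \<and> c \<in> inside (path_image g))"

text \<open>Cat's eyes of period \<open>2\<pi>\<close> in the band of half-width \<open>\<delta>\<close> about \<open>y = 1/2\<close>: the saddles are
  \<open>(\<xi>\<^sub>s + 2\<pi>k, y\<^sub>s)\<close>, the lower and upper separatrices joining consecutive saddles are the graphs
  of \<open>l\<close> and \<open>u\<close>, and the eye between two consecutive saddles consists of its centre
  \<open>(\<xi>\<^sub>c, y\<^sub>c)\<close> and of closed streamlines around it. Inside the band there are no
  other stagnation points, and no other points at the level of the saddles.\<close>

definition cats_eyes :: "real \<Rightarrow> (real \<times> real \<Rightarrow> real) \<Rightarrow> bool" where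
  "cats_eyes \<delta> \<Psi> \<longleftrightarrow>
     (\<exists>\<xi>s ys \<xi>c yc l u.
        let band = {(\<xi>, y) \<in> strip. \<bar>y - 1 / 2\<bar> < \<delta>};
            saddles = {(\<xi>s + 2 * pi * of_int k, ys) | k :: int. True};
            centres = {(\<xi>c + 2 * pi * of_int k, yc) | k :: int. True};
            eye = {(\<xi>, y). \<xi>s < \<xi> \<and> \<xi> < \<xi>s + 2 * pi \<and> l \<xi> < y \<and> y < u \<xi>}
        in (\<forall>z\<in>saddles. saddle \<Psi> z) \<and>
           {z \<in> band. stagnation \<Psi> z} = saddles \<union> centres \<and>
           continuous_on UNIV l \<and> continuous_on UNIV u \<and>
           (\<forall>\<xi>. l (\<xi> + 2 * pi) = l \<xi> \<and> u (\<xi> + 2 * pi) = u \<xi> \<and> l \<xi> \<le> u \<xi>) \<and>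
           (\<forall>\<xi>. l \<xi> = u \<xi> \<longleftrightarrow> (\<exists>k :: int. \<xi> = \<xi>s + 2 * pi * of_int k)) \<and>
           l \<xi>s = ys \<and>
           {z \<in> band. \<Psi> z = \<Psi> (\<xi>s, ys)} = range (\<lambda>\<xi>. (\<xi>, l \<xi>)) \<union> range (\<lambda>\<xi>. (\<xi>, u \<xi>)) \<and>
           (\<xi>c, yc) \<in> eye \<and>
           (\<forall>z \<in> eye - {(\<xi>c, yc)}.
              streamline \<Psi> z \<subseteq> eye \<and> closed_streamline_around (\<xi>c, yc) \<Psi> z))"

text \<open>A curve \<open>s \<mapsto> (\<alpha> s, \<psi> s)\<close>, \<open>\<bar>s\<bar> < s\<^sub>0\<close>, continuous into \<open>\<real> \<times> C\<^sup>2\<^sup>,\<^sup>\<beta>\<close>, of travelling waves that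
  passes through the shear at \<open>s = 0\<close>. The additive constant of \<open>\<psi> s\<close> is the one for which
  the relative stream function at \<open>s = 0\<close> is \<^const>\<open>rel_stream_shear\<close>.\<close>

definition bifurcation_curve ::
  "real \<Rightarrow> nat \<Rightarrow> real \<Rightarrow> real \<Rightarrow> real \<Rightarrow> (real \<Rightarrow> real) \<Rightarrow> (real \<Rightarrow> real \<times> real \<Rightarrow> real) \<Rightarrow> bool" where
  "bifurcation_curve A n \<beta> \<alpha>n s0 \<alpha> \<psi> \<longleftrightarrow>
     continuous_on {-s0<..<s0} \<alpha> \<and> \<alpha> 0 = \<alpha>n \<and>
     (\<forall>s\<in>{-s0<..<s0}.
        ((\<lambda>\<sigma>. C2_holder_norm \<beta> (\<lambda>z. \<psi> \<sigma> z - \<psi> s z)) \<longlongrightarrow> 0) (at s)) \<and>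
     (\<forall>z\<in>strip. rel_stream (\<psi> 0) z = rel_stream_shear A n z) \<and>
     (\<forall>z\<in>strip. D2 (\<psi> 0) z = shear A n (snd z) \<and> D1 (\<psi> 0) z = 0) \<and>
     (\<forall>s\<in>{-s0<..<s0}.
        0 < \<alpha> s \<and>
        C2_holder \<beta> (\<psi> s) \<and>
        (\<forall>\<xi>. \<forall>y\<in>{0..1}. \<psi> s (\<xi> + 2 * pi, y) = \<psi> s (\<xi>, y) \<and> \<psi> s (- \<xi>, y) = \<psi> s (\<xi>, y)) \<and>
        (\<exists>c. \<forall>\<xi>. \<psi> s (\<xi>, 0) = c) \<and> (\<exists>c. \<forall>\<xi>. \<psi> s (\<xi>, 1) = c) \<and>
        euler_stream (travelling (\<alpha> s) (\<psi> s)))"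

text \<open>The \<open>o(s)\<close> is understood in \<open>C\<^sup>2\<^sup>,\<^sup>\<beta>\<close>.\<close>

definition leading_order ::
  "real \<Rightarrow> nat \<Rightarrow> real \<Rightarrow> (real \<Rightarrow> real) \<Rightarrow> (real \<Rightarrow> real \<times> real \<Rightarrow> real) \<Rightarrow> bool" where
  "leading_order A n \<beta> \<phi> \<psi> \<longleftrightarrow>
     (\<forall>\<epsilon>>0. \<forall>\<^sub>F s in at 0.
        C2_holder_norm \<beta>
          (\<lambda>(\<xi>, y). rel_stream (\<psi> s) (\<xi>, y)
             - (rel_stream_shear A n (\<xi>, y) + s * \<phi> y * cos \<xi>))
        \<le> ennreal (\<epsilon> * \<bar>s\<bar>))"

end

theory Submission
  imports Defs "HOL-Complex_Analysis.Complex_Analysis"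
begin

text \<open>In the moving frame a travelling wave is a solution \<open>\<Psi>\<close> of \<open>\<alpha>\<^sup>2 \<Psi>\<^sub>\<xi>\<^sub>\<xi> + \<Psi>\<^sub>y\<^sub>y = F(\<Psi>)\<close>, where \<open>F\<close> is the
  vorticity function of the shear; it is analytic because the vorticity and the relative stream function of the
  shear are even analytic functions of \<open>y - 1/2\<close>. Linearised at the shear, the \<open>k\<close>-th cosine mode sees
  \<open>-d\<^sup>2/dy\<^sup>2 + Q + \<alpha>\<^sup>2 k\<^sup>2\<close>. A trial function supported in one oscillation of the shear has energy of order \<open>-n\<^sup>2\<close>, so the lowest
  eigenvalue is \<open>-\<alpha>\<^sub>n\<^sup>2\<close> with \<open>\<alpha>\<^sub>n\<close> at least of order \<open>n\<close>; zero is not an eigenvalue, because \<open>U\<^sub>n - 1/2\<close> solves \<open>w'' = Q w\<close>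
  and vanishes only at \<open>1/2\<close>. Hence the kernel at \<open>\<alpha>\<^sub>n\<close> is spanned by \<open>\<phi>\<^sub>n cos \<xi>\<close>, and a contraction argument in a
  Banach algebra of cosine series gives the bifurcating curve, even in \<open>\<xi>\<close> and symmetric about \<open>y = 1/2\<close>. Along it \<open>\<Psi>\<close> is
  strictly convex in \<open>y\<close> and \<open>\<Psi>\<^sub>\<xi>\<close> has the sign of \<open>- s sin \<xi>\<close> on the axis, which forces the cat's eyes.\<close>

text \<open>The wave number multiplies an unbounded operator: shifting
  \<open>\<alpha>\<^sup>2\<close> by \<open>lam\<close> adds \<open>lam * k\<^sup>2\<close> to mode
  \<open>k\<close>. The contraction survives because the Green operator of mode \<open>k\<close>
  gains \<open>(1 + k)\<^sup>2\<close>, so that on series with a fixed weight the shift acts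
  boundedly. In \<open>y\<close> the coefficients are measured in the supremum norm only, which
  makes products easy; derivatives in \<open>y\<close> are recovered afterwards from the equation of
  each mode, at the price of two powers of \<open>k\<close>. The weight is large enough for
  Lipschitz second derivatives, so one family of waves serves all Hoelder exponents. Analyticity
  turns the nonlinearity into a power series of convolutions with geometric bounds. An error of
  order o(s) in \<open>\<Psi>\<^sub>\<xi>\<close> does not decide its sign where sin \<xi> vanishes.
  The error is therefore bounded by \<open>s\<^sup>2 * \<bar>sin \<xi>\<bar>\<close>, term by term
  in the series. The lower bound on \<open>A\<close> makes the potential deep enough in the central
  cell; the small margin left by the trial function there is the origin of the number 1000 in the
  constant bounding the eigenvalue.\<close>

section \<open>Linear second-order equations on the unit interval\<close>

abbreviation cont01 :: "(real \<Rightarrow> real) \<Rightarrow> bool" where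
  "cont01 f \<equiv> continuous_on {0..1} f"

text \<open>A retraction of the line onto the unit interval. Bounded continuous functions form a
  Banach space over a whole type, so a function on the interval is represented by its constant
  extension.\<close>

definition unit_clamp :: "real => real" where
  "unit_clamp y = max 0 (min 1 y)"

lemma unit_clamp_in [simp]: "unit_clamp y \<in> {0..1}" "0 <= unit_clamp y" "unit_clamp y <= 1"
  by (auto simp: unit_clamp_def)

lemma unit_clamp_id [simp]: "y \<in> {0..1} ==> unit_clamp y = y"
  by (auto simp: unit_clamp_def)

lemma continuous_on_unit_clamp: "continuous_on S unit_clamp"
  unfolding unit_clamp_def by (intro continuous_intros)

lemma continuous_on_compose_unit_clamp:
  assumes "cont01 h"
  shows "continuous_on S (\<lambda>y. h (unit_clamp y))"
  by (rule continuous_on_compose2[OF assms continuous_on_unit_clamp]) auto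

lemma compose_unit_clamp_bcontfun:
  fixes h :: "real => real"
  assumes "cont01 h"
  shows "(\<lambda>y. h (unit_clamp y)) \<in> bcontfun"
proof -
  have "bounded (h ` {0..1})"
    using assms by (intro compact_imp_bounded compact_continuous_image) auto
  moreover have "range (\<lambda>y. h (unit_clamp y)) \<subseteq> h ` {0..1}" by auto
  ultimately show ?thesis
    using continuous_on_compose_unit_clamp[OF assms] bounded_subset
    unfolding bcontfun_def by blast
qed

lemma bounded_abs_on_unit_interval:
  fixes h :: "real => real"
  assumes "cont01 h"
  obtains M where "0 < M" "!!y. y \<in> {0..1} ==> \<bar>h y\<bar> <= M"
proof -
  have "bounded (h ` {0..1})"
    using assms by (intro compact_imp_bounded compact_continuous_image) auto
  then obtain M where "0 < M" "\<forall>x\<in>h ` {0..1}. norm x <= M" using bounded_pos by blast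
  then show ?thesis using that[of M] by auto
qed

lemma mvt_unit_interval:
  fixes f f' :: "real => real"
  assumes "!!y. y \<in> {0..1} ==> (f has_real_derivative f' y) (at y within {0..1})"
    and "0 <= x" "x < y" "y <= 1"
  obtains z where "x < z" "z < y" "f y - f x = (y - x) * f' z"
proof -
  have "\<exists>z\<in>{x<..<y}. f y - f x = (\<lambda>h. f' z * h) (y - x)"
  proof (rule mvt_simple[OF assms(3)])
    fix z assume "x <= z" "z <= y"
    then have "(f has_real_derivative f' z) (at z within {0..1})" using assms by auto
    then have "(f has_real_derivative f' z) (at z within {x..y})"
      by (rule DERIV_subset) (use assms in auto)
    then show "(f has_derivative (\<lambda>h. f' z * h)) (at z within {x..y})"
      by (simp add: has_field_derivative_def)
  qed
  then show ?thesis using that by (auto simp: mult.commute)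
qed

lemma nonincreasing_unit_interval:
  fixes f f' :: "real => real"
  assumes "!!y. y \<in> {0..1} ==> (f has_real_derivative f' y) (at y within {0..1})"
    and "!!y. y \<in> {0..1} ==> f' y <= 0" and "0 <= x" "x <= y" "y <= 1"
  shows "f y <= f x"
proof (cases "x = y")
  case False
  then have "x < y" using assms by simp
  obtain z where "x < z" "z < y" "f y - f x = (y - x) * f' z"
    using mvt_unit_interval[OF assms(1) assms(3) \<open>x < y\<close> assms(5)] .
  moreover have "(y - x) * f' z <= 0"
    using assms calculation by (intro mult_nonneg_nonpos) auto
  ultimately show ?thesis by simp
qed simp

text \<open>The equation \<open>a'' = q * a + g\<close>, kept as a first-order pair so that slopes
  can be named as initial data.\<close>

definition linear_ode ::
  "(real => real) => (real => real) => (real => real) => (real => real) => bool" where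
  "linear_ode q g a a' \<longleftrightarrow> (\<forall>y\<in>{0..1}.
     (a has_real_derivative a' y) (at y within {0..1}) &
     (a' has_real_derivative q y * a y + g y) (at y within {0..1}))"

lemma linear_odeD:
  assumes "linear_ode q g a a'" "y \<in> {0..1}"
  shows "(a has_real_derivative a' y) (at y within {0..1})"
    and "(a' has_real_derivative q y * a y + g y) (at y within {0..1})"
  using assms unfolding linear_ode_def by auto

lemma linear_ode_continuous:
  assumes "linear_ode q g a a'"
  shows "cont01 a" "cont01 a'"
  by (rule DERIV_continuous_on, rule linear_odeD[OF assms], assumption)+

lemma linear_ode_add:
  assumes "linear_ode q g a a'" "linear_ode q h b b'"
  shows "linear_ode q (\<lambda>y. g y + h y) (\<lambda>y. a y + b y) (\<lambda>y. a' y + b' y)"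
  using assms unfolding linear_ode_def
  by (auto intro!: derivative_eq_intros simp: algebra_simps)

lemma linear_ode_scale:
  assumes "linear_ode q g a a'"
  shows "linear_ode q (\<lambda>y. c * g y) (\<lambda>y. c * a y) (\<lambda>y. c * a' y)"
  using assms unfolding linear_ode_def
  by (auto intro!: derivative_eq_intros simp: algebra_simps)

lemma linear_ode_diff:
  assumes "linear_ode q g a a'" "linear_ode q h b b'"
  shows "linear_ode q (\<lambda>y. g y - h y) (\<lambda>y. a y - b y) (\<lambda>y. a' y - b' y)"
  using assms unfolding linear_ode_def
  by (auto intro!: derivative_eq_intros simp: algebra_simps)

lemma linear_ode_cong:
  assumes "linear_ode q g a a'"
    and "!!y. y \<in> {0..1} ==> q y * a y + g y = r y * a y + h y"
  shows "linear_ode r h a a'"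
  using assms unfolding linear_ode_def by auto

lemma linear_ode_reflect:
  assumes "linear_ode q g a a'"
  shows "linear_ode (\<lambda>y. q (1 - y)) (\<lambda>y. g (1 - y)) (\<lambda>y. a (1 - y)) (\<lambda>y. - a' (1 - y))"
  unfolding linear_ode_def
proof (intro ballI conjI)
  fix y :: real assume y: "y \<in> {0..1}"
  then have y': "1 - y \<in> {0..1}" by auto
  have im: "(\<lambda>y. 1 - y) ` {0..1} = {0..1::real}"
  proof (intro equalityI subsetI)
    fix x :: real assume "x \<in> {0..1}"
    then have "x = 1 - (1 - x)" "1 - x \<in> {0..1}" by auto
    then show "x \<in> (\<lambda>y. 1 - y) ` {0..1}" by blast
  qed auto
  have d: "((\<lambda>y. 1 - y) has_real_derivative -1) (at y within {0..1})"
    by (auto intro!: derivative_eq_intros)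
  show "((\<lambda>y. a (1 - y)) has_real_derivative - a' (1 - y)) (at y within {0..1})"
    using DERIV_image_chain[of a "a' (1 - y)" "\<lambda>y. 1 - y" y "{0..1}" "-1"] linear_odeD[OF assms y'] d
    unfolding im o_def by simp
  have "((\<lambda>y. a' (1 - y)) has_real_derivative - (q (1 - y) * a (1 - y) + g (1 - y))) (at y within {0..1})"
    using DERIV_image_chain[of a' "q (1 - y) * a (1 - y) + g (1 - y)" "\<lambda>y. 1 - y" y "{0..1}" "-1"]
      linear_odeD[OF assms y'] d
    unfolding im o_def by simp
  from this show "((\<lambda>y. - a' (1 - y)) has_real_derivative q (1 - y) * a (1 - y) + g (1 - y)) (at y within {0..1})"
    by (drule_tac DERIV_minus) (simp add: add.commute)
qed

text \<open>Gronwall's argument: the derivative of \<open>a\<^sup>2 + a'\<^sup>2\<close> is at most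
  \<open>K + 2\<close> times that quantity plus \<open>G\<^sup>2\<close>, by the inequality between
  product and squares in each mixed term. Hence the energy damped by \<open>exp (- c * y)\<close>,
  minus \<open>G\<^sup>2 * y\<close>, cannot increase.\<close>

lemma linear_ode_energy_bound:
  assumes ode: "linear_ode q g a a'"
    and q: "!!y. y \<in> {0..1} ==> \<bar>q y\<bar> <= K" and g: "!!y. y \<in> {0..1} ==> \<bar>g y\<bar> <= G"
    and y: "y \<in> {0..1}"
  shows "(a y)\<^sup>2 + (a' y)\<^sup>2 <= exp (K + 2) * ((a 0)\<^sup>2 + (a' 0)\<^sup>2 + G\<^sup>2)"
proof -
  define c where "c = K + 2"
  have K: "0 <= K" using q[of 0] by auto
  then have c: "0 <= c" by (simp add: c_def)
  define f where "f y = exp (- c * y) * ((a y)\<^sup>2 + (a' y)\<^sup>2) - G\<^sup>2 * y" for y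
  define f' where "f' y = exp (- c * y) * (- c * ((a y)\<^sup>2 + (a' y)\<^sup>2)
      + 2 * a y * a' y + 2 * a' y * (q y * a y + g y)) - G\<^sup>2" for y
  have "f y <= f 0"
  proof (rule nonincreasing_unit_interval[of f f'])
    fix y :: real assume y: "y \<in> {0..1}"
    show "(f has_real_derivative f' y) (at y within {0..1})"
      unfolding f_def f'_def
      by (rule derivative_eq_intros linear_odeD[OF ode y] refl)+ (simp add: algebra_simps)
    have 1: "2 * a y * a' y <= (a y)\<^sup>2 + (a' y)\<^sup>2"
      using sum_squares_bound by blast
    have 2: "2 * a' y * g y <= (a' y)\<^sup>2 + (g y)\<^sup>2"
      using sum_squares_bound by blast
    have "(g y)\<^sup>2 <= G\<^sup>2" using g[OF y] by (simp add: abs_le_square_iff [symmetric])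
    moreover have "2 * a' y * (q y * a y) <= K * ((a y)\<^sup>2 + (a' y)\<^sup>2)"
    proof -
      have "2 * a' y * (q y * a y) <= \<bar>q y\<bar> * \<bar>2 * a y * a' y\<bar>"
        by (metis (no_types, opaque_lifting) abs_ge_self abs_mult mult.assoc mult.commute mult.left_commute)
      also have "\<dots> <= K * ((a y)\<^sup>2 + (a' y)\<^sup>2)"
      proof (rule mult_mono)
        have "- (2 * a y * a' y) <= (a y)\<^sup>2 + (a' y)\<^sup>2"
          using sum_squares_bound[of "- a y" "a' y"] by simp
        then show "\<bar>2 * a y * a' y\<bar> <= (a y)\<^sup>2 + (a' y)\<^sup>2" using 1 by simp
      qed (use q[OF y] K in auto)
      finally show ?thesis .
    qed
    moreover have "0 <= (a y)\<^sup>2" by simp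
    moreover have aux: "X + Y + Z <= W + 2 * S + H" if "X <= S" "Y <= W" "Z <= b + h" "h <= H" "S = c + b" "0 <= c"
      for X Y Z W S H b c h :: real using that by linarith
    ultimately have "2 * a y * a' y + 2 * a' y * (q y * a y) + 2 * a' y * g y \<le>
        K * ((a y)\<^sup>2 + (a' y)\<^sup>2) + 2 * ((a y)\<^sup>2 + (a' y)\<^sup>2) + G\<^sup>2"
      using 1 2 by (intro aux[OF 1 _ 2 _ refl]) auto
    then have "- c * ((a y)\<^sup>2 + (a' y)\<^sup>2)
      + 2 * a y * a' y + 2 * a' y * (q y * a y + g y) <= G\<^sup>2"
      unfolding c_def by (simp add: algebra_simps)
    then have "exp (- c * y) * (- c * ((a y)\<^sup>2 + (a' y)\<^sup>2)
      + 2 * a y * a' y + 2 * a' y * (q y * a y + g y)) <= exp (- c * y) * G\<^sup>2"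
      by (intro mult_left_mono) auto
    also have "\<dots> <= 1 * G\<^sup>2"
      using c y by (intro mult_right_mono) auto
    finally show "f' y <= 0" by (simp add: f'_def)
  qed (use y in auto)
  then have "exp (- c * y) * ((a y)\<^sup>2 + (a' y)\<^sup>2) <= (a 0)\<^sup>2 + (a' 0)\<^sup>2 + G\<^sup>2 * y"
    by (simp add: f_def)
  also have "\<dots> <= (a 0)\<^sup>2 + (a' 0)\<^sup>2 + G\<^sup>2"
    using y mult_left_le[of y "G\<^sup>2"] by simp
  finally have "exp (c * y) * (exp (- c * y) * ((a y)\<^sup>2 + (a' y)\<^sup>2))
      <= exp (c * y) * ((a 0)\<^sup>2 + (a' 0)\<^sup>2 + G\<^sup>2)"
    by (intro mult_left_mono) auto
  then have "(a y)\<^sup>2 + (a' y)\<^sup>2 <= exp (c * y) * ((a 0)\<^sup>2 + (a' 0)\<^sup>2 + G\<^sup>2)"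
    by (simp add: mult.assoc[symmetric] exp_add[symmetric])
  also have "\<dots> <= exp c * ((a 0)\<^sup>2 + (a' 0)\<^sup>2 + G\<^sup>2)"
    using c y by (intro mult_right_mono) (auto intro: mult_left_le)
  finally show ?thesis by (simp add: c_def)
qed

lemma linear_ode_bound:
  assumes ode: "linear_ode q g a a'"
    and q: "!!y. y \<in> {0..1} ==> \<bar>q y\<bar> <= K" and g: "!!y. y \<in> {0..1} ==> \<bar>g y\<bar> <= G"
    and y: "y \<in> {0..1}"
  shows "\<bar>a y\<bar> <= exp (K + 2) * (\<bar>a 0\<bar> + \<bar>a' 0\<bar> + G)"
    and "\<bar>a' y\<bar> <= exp (K + 2) * (\<bar>a 0\<bar> + \<bar>a' 0\<bar> + G)"
proof -
  have G: "0 <= G" using g[OF y] by auto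
  have K: "0 <= K" using q[OF y] by auto
  have e: "1 <= exp (K + 2)" using K by simp
  have "(a y)\<^sup>2 + (a' y)\<^sup>2 <= exp (K + 2) * ((a 0)\<^sup>2 + (a' 0)\<^sup>2 + G\<^sup>2)"
    by (rule linear_ode_energy_bound[OF assms])
  also have "\<dots> <= (exp (K + 2))\<^sup>2 * (\<bar>a 0\<bar> + \<bar>a' 0\<bar> + G)\<^sup>2"
  proof (rule mult_mono)
    show "exp (K + 2) <= (exp (K + 2))\<^sup>2" using e by (simp add: power2_eq_square)
    have "0 <= \<bar>a 0\<bar> * \<bar>a' 0\<bar>" "0 <= \<bar>a 0\<bar> * G" "0 <= \<bar>a' 0\<bar> * G" using G by auto
    then show "(a 0)\<^sup>2 + (a' 0)\<^sup>2 + G\<^sup>2 <= (\<bar>a 0\<bar> + \<bar>a' 0\<bar> + G)\<^sup>2"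
      by (simp add: power2_sum algebra_simps)
  qed auto
  finally have *: "(a y)\<^sup>2 + (a' y)\<^sup>2 <= (exp (K + 2) * (\<bar>a 0\<bar> + \<bar>a' 0\<bar> + G))\<^sup>2"
    by (simp add: power_mult_distrib)
  have nn: "0 <= exp (K + 2) * (\<bar>a 0\<bar> + \<bar>a' 0\<bar> + G)" using G by simp
  have "\<bar>a y\<bar>\<^sup>2 <= (exp (K + 2) * (\<bar>a 0\<bar> + \<bar>a' 0\<bar> + G))\<^sup>2"
    using * zero_le_power2[of "a' y"] unfolding power2_abs by linarith
  then show "\<bar>a y\<bar> <= exp (K + 2) * (\<bar>a 0\<bar> + \<bar>a' 0\<bar> + G)"
    using nn by (rule power2_le_imp_le)
  have "\<bar>a' y\<bar>\<^sup>2 <= (exp (K + 2) * (\<bar>a 0\<bar> + \<bar>a' 0\<bar> + G))\<^sup>2"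
    using * zero_le_power2[of "a y"] unfolding power2_abs by linarith
  then show "\<bar>a' y\<bar> <= exp (K + 2) * (\<bar>a 0\<bar> + \<bar>a' 0\<bar> + G)"
    using nn by (rule power2_le_imp_le)
qed

lemma linear_ode_unique:
  assumes "linear_ode q g a a'" "linear_ode q g b b'" "cont01 q"
    and "a 0 = b 0" "a' 0 = b' 0" and y: "y \<in> {0..1}"
  shows "a y = b y" "a' y = b' y"
proof -
  obtain K where "!!y. y \<in> {0..1} ==> \<bar>q y\<bar> <= K"
    using bounded_abs_on_unit_interval[OF assms(3)] by blast
  moreover have "linear_ode q (\<lambda>y. g y - g y) (\<lambda>y. a y - b y) (\<lambda>y. a' y - b' y)"
    by (rule linear_ode_diff[OF assms(1,2)])
  ultimately show "a y = b y" "a' y = b' y"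
    using linear_ode_bound[of q "\<lambda>y. g y - g y" "\<lambda>y. a y - b y" "\<lambda>y. a' y - b' y" K 0] assms
    by fastforce+
qed

text \<open>Integration divides the norm weighted by \<open>exp (\<gamma> * t)\<close> by
  \<open>\<gamma>\<close>. This makes the Picard map contracting without shrinking the
  interval.\<close>

lemma abs_integral_exp_le:
  fixes f :: "real => real"
  assumes f: "cont01 f" and b: "!!t. t \<in> {0..1} ==> \<bar>f t\<bar> <= C * exp (\<gamma> * t)"
    and "0 < \<gamma>" and s: "s \<in> {0..1}"
  shows "\<bar>integral {0..s} f\<bar> <= C * exp (\<gamma> * s) / \<gamma>"
proof -
  have C: "0 <= C" using b[of 0] by auto
  have "((\<lambda>t. C * exp (\<gamma> * t)) has_integral C * exp (\<gamma> * s) / \<gamma> - C * exp (\<gamma> * 0) / \<gamma>) {0..s}"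
    using s assms(3)
    by (intro fundamental_theorem_of_calculus)
       (auto intro!: derivative_eq_intros simp: has_real_derivative_iff_has_vector_derivative[symmetric])
  then have i: "(\<lambda>t. C * exp (\<gamma> * t)) integrable_on {0..s}"
    and v: "integral {0..s} (\<lambda>t. C * exp (\<gamma> * t)) = C * exp (\<gamma> * s) / \<gamma> - C / \<gamma>"
    by (auto simp: has_integral_integrable_integral)
  have "norm (integral {0..s} f) <= integral {0..s} (\<lambda>t. C * exp (\<gamma> * t))"
    using s b
    by (intro integral_norm_bound_integral integrable_continuous_real continuous_on_subset[OF f] i) auto
  moreover have "0 <= C / \<gamma>" using C \<open>0 < \<gamma>\<close> by simp
  ultimately show ?thesis unfolding v by simp
qed

text \<open>Picard iteration in Bielecki's norm: the unknown of the fixed point problem is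
  \<open>exp (- \<gamma> * y) * a y\<close>, so its ordinary supremum norm is an exponentially
  weighted norm of \<open>a\<close>.\<close>

lemma linear_ode_exists:
  assumes q: "cont01 q" and g: "cont01 g"
  obtains a a' where "linear_ode q g a a'" "a 0 = a0" "a' 0 = a1"
proof -
  obtain M where M: "0 < M" "!!y. y \<in> {0..1} ==> \<bar>q y\<bar> <= M"
    using bounded_abs_on_unit_interval[OF q] by blast
  \<comment> \<open>Two integrations produce the factor \<open>M / \<gamma>\<^sup>2\<close>, which
    this choice keeps at most one half.\<close>
  define \<gamma> where "\<gamma> = M + 2"
  have \<gamma>: "0 < \<gamma>" "M / \<gamma>\<^sup>2 <= 1 / 2"
    using M(1) by (auto simp: \<gamma>_def field_simps power2_eq_square add_pos_pos)
  define I where "I f y = integral {0..y} f" for f :: "real => real" and y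
  have I: "(I f has_real_derivative f y) (at y within {0..1})" if "cont01 f" "y \<in> {0..1}" for f y
    using integral_has_real_derivative[OF that] unfolding I_def .
  have Ic: "cont01 (I f)" if "cont01 f" for f
    using I[OF that] by (rule DERIV_continuous_on)
  define r where "r b t = q t * (exp (\<gamma> * t) * b t) + g t" for b :: "real => real" and t
  define h where "h b y = exp (- \<gamma> * y) * (a0 + a1 * y + I (I (r b)) y)" for b y
  have rc: "cont01 (r b)" if "cont01 b" for b
    unfolding r_def by (intro continuous_intros q g that)
  have hc: "cont01 (h b)" if "cont01 b" for b
    unfolding h_def by (intro continuous_intros Ic rc that)
  define \<Phi> where "\<Phi> b = Bcontfun (\<lambda>y. h (apply_bcontfun b) (unit_clamp y))" for b :: "real \<Rightarrow>\<^sub>C real"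
  have \<Phi>: "apply_bcontfun (\<Phi> b) y = h (apply_bcontfun b) (unit_clamp y)" for b y
    unfolding \<Phi>_def by (subst Bcontfun_inverse) (auto intro!: compose_unit_clamp_bcontfun hc)
  have "dist (\<Phi> b) (\<Phi> c) <= 1 / 2 * dist b c" for b c
  proof (rule dist_bound)
    fix x
    define y where "y = unit_clamp x"
    have y: "y \<in> {0..1}" by (simp add: y_def)
    have rb: "cont01 (r (apply_bcontfun b))" for b by (intro rc) auto
    have "\<bar>r b t - r c t\<bar> <= M * dist b c * exp (\<gamma> * t)" if "t \<in> {0..1}" for t
    proof -
      have "r b t - r c t = q t * exp (\<gamma> * t) * (b t - c t)" by (simp add: r_def algebra_simps)
      then have "\<bar>r b t - r c t\<bar> = \<bar>q t\<bar> * exp (\<gamma> * t) * \<bar>b t - c t\<bar>" by (simp add: abs_mult)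
      also have "\<dots> <= M * exp (\<gamma> * t) * dist b c"
        using M(1) M(2)[OF that] dist_bounded[of b t c]
        by (intro mult_mono) (auto simp: dist_real_def)
      finally show ?thesis by (simp add: mult_ac)
    qed
    then have "\<bar>I (\<lambda>t. r b t - r c t) s\<bar> <= M * dist b c * exp (\<gamma> * s) / \<gamma>" if "s \<in> {0..1}" for s
      unfolding I_def using \<gamma>(1) that by (intro abs_integral_exp_le) (auto intro!: continuous_intros rb)
    moreover have "I (\<lambda>t. r b t - r c t) s = I (r b) s - I (r c) s" if "s \<in> {0..1}" for s
      unfolding I_def using that
      by (intro Henstock_Kurzweil_Integration.integral_diff integrable_continuous_real
          continuous_on_subset[OF rb]) auto
    ultimately have "\<bar>I (r b) s - I (r c) s\<bar> <= M * dist b c / \<gamma> * exp (\<gamma> * s)" if "s \<in> {0..1}" for s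
      using that by simp
    then have "\<bar>I (\<lambda>s. I (r b) s - I (r c) s) y\<bar> <= M * dist b c / \<gamma> * exp (\<gamma> * y) / \<gamma>"
      unfolding I_def[of "\<lambda>s. I (r b) s - I (r c) s"] using \<gamma>(1) y
      by (intro abs_integral_exp_le) (auto intro!: continuous_intros Ic rb)
    moreover have "I (\<lambda>s. I (r b) s - I (r c) s) y = I (I (r b)) y - I (I (r c)) y"
      unfolding I_def[of "\<lambda>s. I (r b) s - I (r c) s"] I_def[of "I _"] using y
      by (intro Henstock_Kurzweil_Integration.integral_diff integrable_continuous_real
          continuous_on_subset[OF Ic[OF rb]]) auto
    ultimately have *: "\<bar>I (I (r b)) y - I (I (r c)) y\<bar> <= M / \<gamma>\<^sup>2 * dist b c * exp (\<gamma> * y)"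
      by (simp add: power2_eq_square mult_ac)
    have "dist (\<Phi> b x) (\<Phi> c x) = exp (- \<gamma> * y) * \<bar>I (I (r b)) y - I (I (r c)) y\<bar>"
      by (simp add: \<Phi> y_def[symmetric] h_def dist_real_def right_diff_distrib[symmetric] abs_mult)
    also have "\<dots> <= exp (- \<gamma> * y) * (M / \<gamma>\<^sup>2 * dist b c * exp (\<gamma> * y))"
      by (intro mult_left_mono *) auto
    also have "\<dots> = M / \<gamma>\<^sup>2 * dist b c" by (simp add: exp_minus)
    also have "\<dots> <= 1 / 2 * dist b c" using \<gamma>(2) by (intro mult_right_mono) auto
    finally show "dist (\<Phi> b x) (\<Phi> c x) <= 1 / 2 * dist b c" .
  qed
  then have "\<exists>!b. \<Phi> b = b" by (intro banach_fix_type[of "1/2"]) auto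
  then obtain b where b: "\<Phi> b = b" by blast
  define a where "a y = a0 + a1 * y + I (I (r b)) y" for y
  define a' where "a' y = a1 + I (r b) y" for y
  have rb: "cont01 (r b)" by (intro rc) auto
  have "exp (\<gamma> * y) * b y = a y" if "y \<in> {0..1}" for y
  proof -
    have "b y = h b y" using \<Phi>[of b y] b that by simp
    then show ?thesis by (simp add: h_def a_def mult.assoc[symmetric] exp_add[symmetric])
  qed
  then have r: "r b y = q y * a y + g y" if "y \<in> {0..1}" for y
    using that by (simp add: r_def)
  have "linear_ode q g a a'"
    unfolding linear_ode_def
  proof (intro ballI conjI)
    fix y :: real assume y: "y \<in> {0..1}"
    show "(a has_real_derivative a' y) (at y within {0..1})"
      unfolding a_def a'_def by (rule derivative_eq_intros I[OF Ic[OF rb] y] refl | simp)+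
    show "(a' has_real_derivative q y * a y + g y) (at y within {0..1})"
      unfolding a'_def r[OF y, symmetric] by (rule derivative_eq_intros I[OF rb y] refl | simp)+
  qed
  moreover have "a 0 = a0" "a' 0 = a1" by (simp_all add: a_def a'_def I_def)
  ultimately show ?thesis using that by blast
qed

lemma ode_linear_lower_bound:
  assumes ode: "linear_ode q g f f'" and f0: "f 0 = 0" and e: "e <= 1"
    and c: "!!t. 0 <= t ==> t <= e ==> c <= f' t" and y: "0 <= y" "y <= e"
  shows "c * y <= f y"
proof (cases "y = 0")
  case False
  obtain z where "0 < z" "z < y" "f y - f 0 = (y - 0) * f' z"
    using mvt_unit_interval[of f f' 0 y] linear_odeD(1)[OF ode] False y e by auto
  then show ?thesis using c[of z] f0 y mult_left_mono[of c "f' z" y] by (simp add: mult.commute)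
qed (simp add: f0)

text \<open>Shooting solutions vanish at the left end, so positivity there is controlled through the
  slope. The slack between 1 and 1/2 survives a small change of the parameter.\<close>

lemma ode_derivative_positive_near_0:
  assumes ode: "linear_ode q g f f'" and f0: "f' 0 = 1"
  obtains e where "0 < e" "e < 1" "!!t. 0 <= t ==> t <= e ==> 1 / 2 <= f' t"
proof -
  have "continuous (at 0 within {0..1}) f'"
    using linear_ode_continuous[OF ode] by (simp add: continuous_on_eq_continuous_within)
  then obtain d where d: "d > 0" "\<forall>x\<in>{0..1}. dist x 0 < d --> dist (f' x) (f' 0) < 1 / 2"
    unfolding continuous_within_eps_delta by (metis half_gt_zero_iff zero_less_one)
  show ?thesis
  proof (rule that[of "min (d / 2) (1 / 2)"])
    fix t assume "0 <= t" "t <= min (d / 2) (1 / 2)"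
    then have "t \<in> {0..1}" "dist t 0 < d" using d by (auto simp: dist_real_def)
    then have "dist (f' t) (f' 0) < 1 / 2" using d by blast
    then show "1 / 2 <= f' t" unfolding dist_real_def f0 by linarith
  qed (use d in auto)
qed

lemma wronskian_derivative:
  assumes "linear_ode q g a a'" "linear_ode r h b b'" "y \<in> {0..1}"
  shows "((\<lambda>y. a' y * b y - a y * b' y) has_real_derivative
     (q y - r y) * a y * b y + g y * b y - a y * h y) (at y within {0..1})"
  by (rule derivative_eq_intros linear_odeD[OF assms(1,3)] linear_odeD[OF assms(2,3)] refl)+
     (simp add: algebra_simps)

lemma wronskian_constant:
  assumes "linear_ode q (\<lambda>y. 0) a a'" "linear_ode q (\<lambda>y. 0) b b'" "y \<in> {0..1}"
  shows "a' y * b y - a y * b' y = a' 0 * b 0 - a 0 * b' 0"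
proof (cases "y = 0")
  case False
  obtain z where "a' y * b y - a y * b' y - (a' 0 * b 0 - a 0 * b' 0) = (y - 0) * 0"
    using mvt_unit_interval[of "\<lambda>y. a' y * b y - a y * b' y" "\<lambda>_. 0" 0 y]
      wronskian_derivative[OF assms(1,2)] False assms(3) by (auto simp del: mult_zero_right)
  then show ?thesis by simp
qed simp

text \<open>At a double zero the Wronskian with the solution of data \<open>(1, 0)\<close> would
  vanish, but it is constant and equals 1 at the left end.\<close>

lemma ode_zero_transversal:
  assumes q: "cont01 q" and ode: "linear_ode q (\<lambda>y. 0) a a'"
    and a0: "a 0 = 0" "a' 0 = 1" and z: "z \<in> {0..1}" "a z = 0"
  shows "a' z \<noteq> 0"
proof
  assume "a' z = 0"
  obtain b b' where b: "linear_ode q (\<lambda>y. 0) b b'" "b 0 = 1" "b' 0 = 0"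
    using linear_ode_exists[OF q continuous_on_const] by metis
  then show False using wronskian_constant[OF ode b(1) z(1)] z \<open>a' z = 0\<close> a0 by auto
qed

section \<open>Principal Dirichlet eigenvalue by shooting\<close>

text \<open>Shooting in the spectral parameter. \<open>f k\<close> has value 0 and slope 1 at the
  left end and potential \<open>q + k\<close>; \<open>m\<close> is the supremum of the set
  \<open>Z\<close> of those \<open>k\<close> for which it vanishes again. The hypothesis makes
  \<open>Z\<close> nonempty, continuity in \<open>k\<close> makes the supremum attained, and
  \<open>f m\<close> can neither change sign nor touch zero inside, so its second zero is the right
  end. Above \<open>m\<close> the shooting solution misses zero at 1, which excludes Dirichlet
  solutions.\<close>

lemma ground_state_exists:
  assumes q: "cont01 q"
    and zero: "!!f f'. linear_ode (\<lambda>y. q y + m0) (\<lambda>y. 0) f f' ==> f 0 = 0 ==> f' 0 = 1 ==>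
      \<exists>z\<in>{0<..1}. f z = 0"
  obtains m f f' where "m0 <= m" "linear_ode (\<lambda>y. q y + m) (\<lambda>y. 0) f f'" "f 0 = 0" "f' 0 = 1" "f 1 = 0"
    "!!y. y \<in> {0<..<1} ==> 0 < f y"
    "!!k a a' y. m < k ==> linear_ode (\<lambda>y. q y + k) (\<lambda>y. 0) a a' ==> a 0 = 0 ==> a 1 = 0 ==>
       y \<in> {0..1} ==> a y = 0"
proof -
  have qc: "cont01 (\<lambda>y. q y + k)" for k by (intro continuous_intros q)
  have "\<exists>p. linear_ode (\<lambda>y. q y + k) (\<lambda>y. 0) (fst p) (snd p) & fst p 0 = 0 & snd p 0 = 1" for k
  proof -
    obtain a a' where "linear_ode (\<lambda>y. q y + k) (\<lambda>y. 0) a a'" "a 0 = 0" "a' 0 = 1"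
      using linear_ode_exists[OF qc continuous_on_const] by metis
    then show ?thesis by (intro exI[of _ "(a, a')"]) auto
  qed
  then obtain F where F: "!!k. linear_ode (\<lambda>y. q y + k) (\<lambda>y. 0) (fst (F k)) (snd (F k)) & fst (F k) 0 = 0 & snd (F k) 0 = 1"
    by metis
  define f where "f k = fst (F k)" for k
  define f' where "f' k = snd (F k)" for k
  have ode: "linear_ode (\<lambda>y. q y + k) (\<lambda>y. 0) (f k) (f' k)" and f0: "f k 0 = 0" "f' k 0 = 1" for k
    using F[of k] by (auto simp: f_def f'_def)
  obtain K where K: "0 < K" "!!y. y \<in> {0..1} ==> \<bar>q y\<bar> <= K"
    using bounded_abs_on_unit_interval[OF q] by blast
  define Z where "Z = {k. \<exists>z\<in>{0<..1}. f k z = 0}"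
  have m0: "m0 \<in> Z" using zero[OF ode f0] by (simp add: Z_def)
  \<comment> \<open>For \<open>k \<ge> K\<close> the potential is nonnegative, so
    \<open>f k * f' k\<close> and with it \<open>(f k)\<^sup>2\<close> are nondecreasing. A zero at
    \<open>z\<close> would force \<open>f k\<close> to vanish on all of \<open>{0..z}\<close>,
    against its slope at 0.\<close>
  have ub: "k < K" if kZ: "k \<in> Z" for k
  proof (rule ccontr)
    assume "\<not> k < K"
    obtain z where z: "0 < z" "z <= 1" "f k z = 0" using kZ by (auto simp: Z_def)
    have mono: "- (f k y * f' k y) <= - (f k 0 * f' k 0)" if "y \<in> {0..1}" for y
    proof (rule nonincreasing_unit_interval[of "\<lambda>y. - (f k y * f' k y)" "\<lambda>y. - ((f' k y)\<^sup>2 + (q y + k) * (f k y)\<^sup>2)"])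
      fix y :: real assume y: "y \<in> {0..1}"
      show "((\<lambda>y. - (f k y * f' k y)) has_real_derivative - ((f' k y)\<^sup>2 + (q y + k) * (f k y)\<^sup>2)) (at y within {0..1})"
        by (rule derivative_eq_intros linear_odeD[OF ode y] refl)+ (simp add: algebra_simps power2_eq_square)
      have "0 <= q y + k" using K(2)[OF y] \<open>\<not> k < K\<close> by auto
      then have "0 <= (q y + k) * (f k y)\<^sup>2" by simp
      then show "- ((f' k y)\<^sup>2 + (q y + k) * (f k y)\<^sup>2) <= 0" using zero_le_power2[of "f' k y"] by linarith
    qed (use that in auto)
    have sq: "- ((f k y)\<^sup>2) \<ge> - ((f k z)\<^sup>2)" if "0 <= y" "y <= z" for y
    proof (rule nonincreasing_unit_interval[of "\<lambda>y. - ((f k y)\<^sup>2)" "\<lambda>y. - (2 * (f k y * f' k y))"])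
      fix y :: real assume y: "y \<in> {0..1}"
      show "((\<lambda>y. - ((f k y)\<^sup>2)) has_real_derivative - (2 * (f k y * f' k y))) (at y within {0..1})"
        by (rule derivative_eq_intros linear_odeD[OF ode y] refl)+ simp
      show "- (2 * (f k y * f' k y)) <= 0" using mono[OF y] f0 by simp
    qed (use that z in auto)
    obtain e where e: "0 < e" "e < 1" "!!t. 0 <= t ==> t <= e ==> 1 / 2 <= f' k t"
      using ode_derivative_positive_near_0[OF ode f0(2)] by blast
    have "1 / 2 * min e z <= f k (min e z)"
      by (rule ode_linear_lower_bound[OF ode f0(1), of e]) (use e z in auto)
    moreover have "(f k (min e z))\<^sup>2 <= 0" using sq[of "min e z"] z e by simp
    ultimately show False using e z by (auto simp: min_def split: if_splits)
  qed
  define m where "m = Sup Z"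
  have bdd: "bdd_above Z" using ub by (intro bdd_aboveI[of _ K]) (auto intro: less_imp_le)
  have m_ge: "k <= m" if "k \<in> Z" for k unfolding m_def by (rule cSup_upper[OF that bdd])
  have m_approx: "\<exists>k\<in>Z. m - d < k" if "0 < d" for d
    using less_cSup_iff[of Z "m - d"] bdd m0 that unfolding m_def by auto
  \<comment> \<open>Lipschitz dependence on the parameter: \<open>f k - f m\<close> has zero data
    and solves the equation for \<open>k\<close> with the small forcing
    \<open>(k - m) * f m\<close>.\<close>
  have "\<exists>C>0. \<forall>k. \<bar>k - m\<bar> <= 1 --> (\<forall>y\<in>{0..1}. \<bar>f k y - f m y\<bar> <= C * \<bar>k - m\<bar> & \<bar>f' k y - f' m y\<bar> <= C * \<bar>k - m\<bar>)"
  proof -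
    obtain B where B: "0 < B" "!!y. y \<in> {0..1} ==> \<bar>f m y\<bar> <= B"
      using bounded_abs_on_unit_interval[OF linear_ode_continuous(1)[OF ode]] by blast
    define C where "C = exp (K + \<bar>m\<bar> + 1 + 2) * B"
    have "\<bar>f k y - f m y\<bar> <= C * \<bar>k - m\<bar> & \<bar>f' k y - f' m y\<bar> <= C * \<bar>k - m\<bar>"
      if k: "\<bar>k - m\<bar> <= 1" and y: "y \<in> {0..1}" for k y
    proof -
      have "linear_ode (\<lambda>y. q y + k) (\<lambda>y. (m - k) * f m y) (f m) (f' m)"
        by (rule linear_ode_cong[OF ode[of m]]) (simp add: algebra_simps)
      then have d: "linear_ode (\<lambda>y. q y + k) (\<lambda>y. 0 - (m - k) * f m y) (\<lambda>y. f k y - f m y) (\<lambda>y. f' k y - f' m y)"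
        by (rule linear_ode_diff[OF ode[of k]])
      have qk: "\<bar>q y + k\<bar> <= K + \<bar>m\<bar> + 1" if "y \<in> {0..1}" for y
        using K(2)[OF that] k by linarith
      have g: "\<bar>0 - (m - k) * f m y\<bar> <= \<bar>k - m\<bar> * B" if "y \<in> {0..1}" for y
        using mult_left_mono[OF B(2)[OF that], of "\<bar>k - m\<bar>"] by (simp add: abs_mult abs_minus_commute)
      show ?thesis
        using linear_ode_bound[OF d qk g y] by (simp add: f0 C_def mult_ac)
    qed
    moreover have "0 < C" using B by (simp add: C_def)
    ultimately show ?thesis by blast
  qed
  then obtain C where C: "0 < C" "!!k y. \<bar>k - m\<bar> <= 1 ==> y \<in> {0..1} ==> \<bar>f k y - f m y\<bar> <= C * \<bar>k - m\<bar>"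
    "!!k y. \<bar>k - m\<bar> <= 1 ==> y \<in> {0..1} ==> \<bar>f' k y - f' m y\<bar> <= C * \<bar>k - m\<bar>" by blast
  obtain e where e: "0 < e" "e < 1" "!!t. 0 <= t ==> t <= e ==> 1 / 2 <= f' m t"
    using ode_derivative_positive_near_0[OF ode f0(2)] by blast
  \<comment> \<open>A lower bound uniform in \<open>k\<close> near \<open>m\<close> keeps zeros from
    escaping into the left end.\<close>
  have near0: "1 / 4 * y <= f k y" if k: "\<bar>k - m\<bar> <= 1" "C * \<bar>k - m\<bar> <= 1 / 4" and y: "0 <= y" "y <= e" for k y
  proof (rule ode_linear_lower_bound[OF ode f0(1), of e])
    fix t assume t: "0 <= t" "t <= e"
    have "\<bar>f' k t - f' m t\<bar> <= 1 / 4" using C(3)[OF k(1), of t] k t e by simp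
    then show "1 / 4 <= f' k t" using e(3)[OF t] by linarith
  qed (use e y in auto)
  have fc: "cont01 (f k)" for k by (rule linear_ode_continuous[OF ode])
  \<comment> \<open>Otherwise \<open>f m\<close> has a positive minimum \<open>p\<close> on
    \<open>{e..1}\<close>, and parameters of \<open>Z\<close> close to \<open>m\<close> would have
    zeros where \<open>f k\<close> is still at least \<open>p / 2\<close>.\<close>
  have "m \<in> Z"
  proof (rule ccontr)
    assume "m \<notin> Z"
    then have nz: "f m y \<noteq> 0" if "y \<in> {0<..1}" for y using that by (auto simp: Z_def)
    have pos: "0 < f m y" if ye: "y \<in> {e..1}" for y
    proof (rule ccontr)
      assume "\<not> 0 < f m y"
      moreover have "0 <= f m e" using near0[of m e] e by auto
      ultimately obtain x where "e <= x" "x <= y" "f m x = 0"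
        using IVT2'[of "f m" y 0 e] continuous_on_subset[OF fc] ye e by fastforce
      then show False using nz[of x] e ye by auto
    qed
    obtain x where x: "x \<in> {e..1}" "\<forall>y\<in>{e..1}. f m x <= f m y"
      using continuous_attains_inf[of "{e..1}" "f m"] continuous_on_subset[OF fc, of "{e..1}" m] e by auto
    define p where "p = f m x"
    have p: "0 < p" "!!y. y \<in> {e..1} ==> p <= f m y" using pos[OF x(1)] x(2) by (auto simp: p_def)
    define d where "d = min 1 (min (1 / (4 * C)) (p / (2 * C)))"
    have d: "0 < d" using C p by (simp add: d_def)
    then obtain k where k: "k \<in> Z" "m - d < k" using m_approx by blast
    then have kd: "\<bar>k - m\<bar> < d" using m_ge[OF k(1)] by auto
    then have kc: "\<bar>k - m\<bar> <= 1" "C * \<bar>k - m\<bar> <= 1 / 4" "C * \<bar>k - m\<bar> <= p / 2"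
      using C(1) unfolding d_def by (auto simp: field_simps)
    obtain z where z: "0 < z" "z <= 1" "f k z = 0" using k by (auto simp: Z_def)
    show False
    proof (cases "z <= e")
      case True
      then show False using near0[OF kc(1,2), of z] z by auto
    next
      case False
      then have "p <= f m z" "\<bar>f k z - f m z\<bar> <= p / 2" using p(2)[of z] C(2)[OF kc(1), of z] kc z by auto
      then show False using z p by simp
    qed
  qed
  then obtain z where z: "0 < z" "z <= 1" "f m z = 0" by (auto simp: Z_def)
  \<comment> \<open>A negative value would persist for some \<open>k\<close> above \<open>m\<close>
    and force a zero there, against the choice of \<open>m\<close> as a supremum.\<close>
  have nonneg: "0 <= f m y" if y01: "y \<in> {0..1}" for y
  proof (rule ccontr)
    assume neg: "\<not> 0 <= f m y"
    have "e < y"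
    proof (rule ccontr)
      assume "\<not> e < y"
      then have "1 / 4 * y <= f m y" using near0[of m y] y01 by simp
      then show False using neg y01 by auto
    qed
    define d where "d = min 1 (min (1 / (4 * C)) (- f m y / (2 * C)))"
    have "0 < - f m y / (2 * C)" using C neg by (intro divide_pos_pos) auto
    then have d: "0 < d" using C by (simp add: d_def)
    define k where "k = m + d / 2"
    have kd: "\<bar>k - m\<bar> = d / 2" using d by (simp add: k_def)
    have "d <= 1" "d <= 1 / (4 * C)" "d <= - f m y / (2 * C)" by (simp_all add: d_def)
    then have dle: "d / 2 <= 1" "d / 2 <= 1 / (4 * C)" "d / 2 <= - f m y / (2 * C)" using d by linarith+
    then have kc: "\<bar>k - m\<bar> <= 1" "C * \<bar>k - m\<bar> <= 1 / 4" "C * \<bar>k - m\<bar> <= - f m y / 2"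
      using C(1) unfolding kd by (auto simp: field_simps)
    have "f k y < 0" using C(2)[OF kc(1) y01] kc(3) neg by linarith
    moreover have "0 < f k e" using near0[OF kc(1,2), of e] e by simp
    ultimately obtain x where "e <= x" "x <= y" "f k x = 0"
      using IVT2'[of "f k" y 0 e] continuous_on_subset[OF fc] y01 e \<open>e < y\<close> by fastforce
    then have "k \<in> Z" unfolding Z_def using e y01 by (intro CollectI bexI[of _ x]) auto
    then show False using m_ge d by (fastforce simp: k_def)
  qed
  \<comment> \<open>An interior zero of a nonnegative function is a minimum, hence a double
    zero.\<close>
  have pos: "0 < f m y" if y: "y \<in> {0<..<1}" for y
  proof (rule ccontr)
    assume "\<not> 0 < f m y"
    then have fy: "f m y = 0" using nonneg[of y] y by auto
    have "(f m has_real_derivative f' m y) (at y within {0..1})" using linear_odeD(1)[OF ode] y by auto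
    then have d: "(f m has_real_derivative f' m y) (at y)"
      using y by (metis (no_types, lifting) at_within_interior atLeastAtMost_iff greaterThanLessThan_iff interior_atLeastAtMost_real)
    have "f' m y = 0"
    proof (rule DERIV_local_min[OF d, of "min y (1 - y)"])
      show "\<forall>x. \<bar>y - x\<bar> < min y (1 - y) --> f m y <= f m x"
        unfolding fy by (intro allI impI nonneg) (auto simp: abs_less_iff)
    qed (use y in auto)
    then show False using ode_zero_transversal[OF qc ode f0, of y m] fy y by auto
  qed
  have "z = 1" using pos[of z] z by (cases "z < 1") auto
  show ?thesis
  proof (rule that[of m "f m" "f' m"])
    show "m0 <= m" by (rule m_ge[OF m0])
    show "f m 1 = 0" using z \<open>z = 1\<close> by simp
    fix k a a' y assume k: "m < k" and a: "linear_ode (\<lambda>y. q y + k) (\<lambda>y. 0) a a'" "a 0 = 0" "a 1 = 0" and y: "y \<in> {0..1::real}"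
    have *: "a y = a' 0 * f k y" if "y \<in> {0..1}" for y
    proof (rule linear_ode_unique[OF a(1) _ qc])
      show "linear_ode (\<lambda>y. q y + k) (\<lambda>y. 0) (\<lambda>y. a' 0 * f k y) (\<lambda>y. a' 0 * f' k y)"
        using linear_ode_scale[OF ode[of k], of "a' 0"] by simp
    qed (use a f0 that in auto)
    have "k \<notin> Z" using m_ge k by fastforce
    then have "f k 1 \<noteq> 0" by (auto simp: Z_def)
    then have "a' 0 = 0" using *[of 1] a by simp
    then show "a y = 0" using *[OF y] by simp
  qed (use ode f0 pos in auto)
qed

text \<open>Picone's identity: \<open>(\<tau>\<^sup>2 f' / f)' = \<tau>'\<^sup>2 + r \<tau>\<^sup>2 - (\<tau>' - \<tau> f' / f)\<^sup>2\<close>, so a positive solution of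
  \<open>f'' = r f\<close> excludes a test function of negative energy.\<close>

lemma negative_energy_forces_zero:
  assumes ode: "linear_ode r (\<lambda>y. 0) f f'" and y: "0 < y1" "y1 < y2" "y2 < 1"
    and tau: "!!y. (\<tau> has_real_derivative \<tau>' y) (at y)" "\<tau> y1 = 0" "\<tau> y2 = 0"
    and E: "!!y. (E has_real_derivative E' y) (at y)" "E y2 < E y1"
    and le: "!!y. y1 <= y ==> y <= y2 ==> (\<tau>' y)\<^sup>2 + r y * (\<tau> y)\<^sup>2 <= E' y"
  shows "\<exists>y\<in>{y1..y2}. f y <= 0"
proof (rule ccontr)
  assume "\<not> ?thesis"
  then have pos: "0 < f y" if "y1 <= y" "y <= y2" for y using that by force
  define W where "W y = (\<tau> y)\<^sup>2 * f' y / f y - E y" for y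
  define W' where "W' y = (\<tau>' y)\<^sup>2 + r y * (\<tau> y)\<^sup>2 - (\<tau>' y - \<tau> y * f' y / f y)\<^sup>2 - E' y" for y
  have "\<exists>z\<in>{y1<..<y2}. W y2 - W y1 = (\<lambda>h. W' z * h) (y2 - y1)"
  proof (rule mvt_simple[OF y(2)])
    fix z assume z: "y1 <= z" "z <= y2"
    have d: "(f has_real_derivative f' z) (at z within {y1..y2})"
      "(f' has_real_derivative r z * f z) (at z within {y1..y2})"
      using linear_odeD[OF ode, of z] z y by (auto intro: DERIV_subset)
    have t: "(\<tau> has_real_derivative \<tau>' z) (at z within {y1..y2})" "(E has_real_derivative E' z) (at z within {y1..y2})"
      using tau(1) E(1) by (auto intro: has_field_derivative_at_within)
    have nz: "f z \<noteq> 0" using pos[OF z] by simp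
    have "(W has_real_derivative W' z) (at z within {y1..y2})"
      unfolding W_def W'_def
      by (rule derivative_eq_intros d t nz refl)+ (use nz in \<open>simp add: field_simps power2_eq_square\<close>)
    then show "(W has_derivative (\<lambda>h. W' z * h)) (at z within {y1..y2})"
      by (simp add: has_field_derivative_def)
  qed
  then obtain z where z: "y1 < z" "z < y2" "W y2 - W y1 = W' z * (y2 - y1)" by auto
  have "W' z <= 0" using le[of z] z by (simp add: W'_def) (smt (verit) zero_le_power2)
  then have "W y2 <= W y1" using z y by (smt (verit) mult_nonpos_nonneg)
  then show False using tau E by (simp add: W_def)
qed

section \<open>Dirichlet problems and the Green operators of the modes\<close>

definition dirichlet_bvp ::
  "(real => real) => (real => real) => (real => real) => bool" where
  "dirichlet_bvp q g a \<longleftrightarrow> (\<exists>a'. linear_ode q g a a') & a 0 = 0 & a 1 = 0"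

lemma dirichlet_bvp_continuous: "dirichlet_bvp q g a ==> cont01 a"
  unfolding dirichlet_bvp_def using linear_ode_continuous by blast

lemma dirichlet_bvp_add:
  "dirichlet_bvp q g a ==> dirichlet_bvp q h b ==> dirichlet_bvp q (\<lambda>y. g y + h y) (\<lambda>y. a y + b y)"
  unfolding dirichlet_bvp_def using linear_ode_add by fastforce

lemma dirichlet_bvp_scale:
  "dirichlet_bvp q g a ==> dirichlet_bvp q (\<lambda>y. c * g y) (\<lambda>y. c * a y)"
  unfolding dirichlet_bvp_def using linear_ode_scale by fastforce

lemma dirichlet_bvp_diff:
  "dirichlet_bvp q g a ==> dirichlet_bvp q h b ==> dirichlet_bvp q (\<lambda>y. g y - h y) (\<lambda>y. a y - b y)"
  unfolding dirichlet_bvp_def using linear_ode_diff by fastforce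

lemma dirichlet_bvp_cong:
  "dirichlet_bvp q g a ==> (!!y. y \<in> {0..1} ==> q y * a y + g y = r y * a y + h y) ==> dirichlet_bvp r h a"
  unfolding dirichlet_bvp_def using linear_ode_cong by blast

lemma dirichlet_bvp_reflect:
  "dirichlet_bvp q g a ==> dirichlet_bvp (\<lambda>y. q (1 - y)) (\<lambda>y. g (1 - y)) (\<lambda>y. a (1 - y))"
  unfolding dirichlet_bvp_def using linear_ode_reflect by fastforce

text \<open>Shooting: subtract from the solution with zero data at \<open>0\<close> a multiple of the homogeneous one.\<close>

lemma nonresonant_bvp:
  assumes q: "cont01 q"
    and nr: "!!a y. dirichlet_bvp q (\<lambda>y. 0) a ==> y \<in> {0..1} ==> a y = 0"
  shows "\<exists>C>0. (\<forall>g. cont01 g --> (\<exists>a. dirichlet_bvp q g a)) &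
    (\<forall>g a G. dirichlet_bvp q g a --> (\<forall>y\<in>{0..1}. \<bar>g y\<bar> <= G) --> (\<forall>y\<in>{0..1}. \<bar>a y\<bar> <= C * G))"
proof -
  obtain K where K: "0 < K" "!!y. y \<in> {0..1} ==> \<bar>q y\<bar> <= K"
    using bounded_abs_on_unit_interval[OF q] by blast
  obtain h h' where h: "linear_ode q (\<lambda>y. 0) h h'" "h 0 = 0" "h' 0 = 1"
    using linear_ode_exists[OF q continuous_on_const] by metis
  have h1: "h 1 \<noteq> 0"
  proof
    assume "h 1 = 0"
    then have z: "h y = 0" if "y \<in> {0..1}" for y using nr[of h y] h that unfolding dirichlet_bvp_def by blast
    obtain e where "0 < e" "e < 1" "!!t. 0 <= t ==> t <= e ==> 1 / 2 <= h' t"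
      using ode_derivative_positive_near_0[OF h(1,3)] by blast
    then have "1 / 2 * e <= h e" by (intro ode_linear_lower_bound[OF h(1,2), of e]) auto
    then show False using z[of e] \<open>0 < e\<close> \<open>e < 1\<close> by simp
  qed
  define E where "E = exp (K + 2)"
  have E: "0 < E" by (simp add: E_def)
  have hb: "\<bar>h y\<bar> <= E" if "y \<in> {0..1}" for y
    using linear_ode_bound(1)[OF h(1) K(2), of 0 y] that h by (simp add: E_def)
  define C where "C = E + E / \<bar>h 1\<bar> * E"
  have "0 < C" using E h1 by (simp add: C_def add_pos_pos)
  moreover have "\<exists>a. dirichlet_bvp q g a" if g: "cont01 g" for g
  proof -
    obtain p p' where p: "linear_ode q g p p'" "p 0 = 0" "p' 0 = 0"
      using linear_ode_exists[OF q g] by metis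
    have "linear_ode q g (\<lambda>y. p y - p 1 / h 1 * h y) (\<lambda>y. p' y - p 1 / h 1 * h' y)"
      using linear_ode_diff[OF p(1) linear_ode_scale[OF h(1), of "p 1 / h 1"]] by simp
    then have "dirichlet_bvp q g (\<lambda>y. p y - p 1 / h 1 * h y)" unfolding dirichlet_bvp_def using p h h1 by auto
    then show ?thesis by blast
  qed
  moreover have "\<bar>a y\<bar> <= C * G"
    if a: "dirichlet_bvp q g a" and G: "!!y. y \<in> {0..1} ==> \<bar>g y\<bar> <= G" and y: "y \<in> {0..1}" for g a G y
  proof -
    obtain p where p: "linear_ode q g a p" using a unfolding dirichlet_bvp_def by blast
    have G0: "0 <= G" using G[of 0] by auto
    have "linear_ode q g (\<lambda>y. a y - p 0 * h y) (\<lambda>y. p y - p 0 * h' y)"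
      using linear_ode_diff[OF p linear_ode_scale[OF h(1), of "p 0"]] by simp
    from linear_ode_bound(1)[OF this K(2) G] have *: "\<bar>a y - p 0 * h y\<bar> <= E * G" if "y \<in> {0..1}" for y
      using that a h unfolding dirichlet_bvp_def E_def by simp
    have "\<bar>p 0\<bar> * \<bar>h 1\<bar> <= E * G" using *[of 1] a unfolding dirichlet_bvp_def by (simp add: abs_mult)
    then have p0: "\<bar>p 0\<bar> <= E * G / \<bar>h 1\<bar>" using h1 by (simp add: field_simps)
    have "\<bar>a y\<bar> <= E * G + \<bar>p 0\<bar> * \<bar>h y\<bar>" using *[OF y] unfolding abs_mult[symmetric] by linarith
    also have "\<dots> <= E * G + E * G / \<bar>h 1\<bar> * E"
      using p0 hb[OF y] E G0 by (intro add_mono mult_mono) auto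
    finally show "\<bar>a y\<bar> <= C * G" by (simp add: C_def algebra_simps)
  qed
  ultimately show ?thesis by blast
qed

text \<open>At an interior maximum above \<open>G / m\<close> the right-hand side
  \<open>q * a + g\<close> is positive, so \<open>a\<close> would increase just to the right of it.
  The constant \<open>1 / m\<close> is the point: it decays like \<open>1 / k\<^sup>2\<close> for
  the high modes.\<close>

lemma maximum_principle_upper:
  assumes a: "dirichlet_bvp q g a" and m: "0 < m" "!!y. y \<in> {0..1} ==> m <= q y"
    and G: "!!y. y \<in> {0..1} ==> \<bar>g y\<bar> <= G" and y: "y \<in> {0..1}"
  shows "a y <= G / m"
proof (rule ccontr)
  assume neg: "\<not> a y <= G / m"
  obtain a' where ode: "linear_ode q g a a'" and bc: "a 0 = 0" "a 1 = 0"
    using a unfolding dirichlet_bvp_def by blast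
  have G0: "0 <= G" using G[OF y] by auto
  obtain x where x: "x \<in> {0..1}" "\<forall>z\<in>{0..1}. a z <= a x"
    using continuous_attains_sup[of "{0..1}" a] linear_ode_continuous[OF ode] by auto
  have ax: "G / m < a x" using neg x(2) y by force
  then have "0 < a x" using G0 m by (smt (verit) divide_nonneg_pos)
  then have xi: "0 < x" "x < 1" using x(1) bc by (metis atLeastAtMost_iff less_eq_real_def less_irrefl)+
  have d: "(a has_real_derivative a' x) (at x)"
    using linear_odeD(1)[OF ode x(1)] xi
    by (metis at_within_interior greaterThanLessThan_iff interior_atLeastAtMost_real)
  have a'x: "a' x = 0"
  proof (rule DERIV_local_max[OF d, of "min x (1 - x)"])
    show "\<forall>z. \<bar>x - z\<bar> < min x (1 - x) --> a z <= a x"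
      using x(2) by (auto simp: abs_less_iff)
  qed (use xi in auto)
  have pos: "0 < q z * a z + g z" if z: "z \<in> {0..1}" and az: "G / m < a z" for z
  proof -
    have "G < m * a z" using az m by (simp add: field_simps)
    also have "\<dots> <= q z * a z" using m(2)[OF z] az G0 m(1)
      by (intro mult_right_mono) (auto intro: order_trans[OF _ less_imp_le[OF az]] divide_nonneg_pos)
    finally show ?thesis using G[OF z] by linarith
  qed
  have "continuous (at x within {0..1}) a"
    using linear_ode_continuous(1)[OF ode] x(1) by (simp add: continuous_on_eq_continuous_within)
  then obtain e where e: "0 < e" "\<forall>z\<in>{0..1}. dist z x < e --> dist (a z) (a x) < a x - G / m"
    unfolding continuous_within_eps_delta using ax by (metis diff_gt_0_iff_gt)
  define z where "z = x + min (e / 2) ((1 - x) / 2)"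
  have z: "x < z" "z < 1" "z - x < e" using e xi by (auto simp: z_def min_def field_simps)
  have near: "0 < q t * a t + g t" if "x <= t" "t <= z" for t
  proof (rule pos)
    show t: "t \<in> {0..1}" using that xi z by auto
    have "dist (a t) (a x) < a x - G / m" using e(2) t that z by (auto simp: dist_real_def)
    then show "G / m < a t" by (auto simp: dist_real_def)
  qed
  have a'pos: "0 < a' t" if t: "x < t" "t <= z" for t
  proof -
    obtain w where "x < w" "w < t" "a' t - a' x = (t - x) * (q w * a w + g w)"
      using mvt_unit_interval[OF linear_odeD(2)[OF ode], of x t] t xi z by auto
    then show ?thesis using near[of w] t a'x by simp
  qed
  obtain w where w: "x < w" "w < z" "a z - a x = (z - x) * a' w"
    using mvt_unit_interval[OF linear_odeD(1)[OF ode], of x z] xi z by auto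
  then have "a x < a z" using a'pos[of w] z by (smt (verit) mult_pos_pos)
  then show False using x(2) z xi by (auto simp: not_le[symmetric])
qed

lemma maximum_principle:
  assumes a: "dirichlet_bvp q g a" and m: "0 < m" "!!y. y \<in> {0..1} ==> m <= q y"
    and G: "!!y. y \<in> {0..1} ==> \<bar>g y\<bar> <= G" and y: "y \<in> {0..1}"
  shows "\<bar>a y\<bar> <= G / m"
proof -
  have "dirichlet_bvp q (\<lambda>y. - 1 * g y) (\<lambda>y. - 1 * a y)" by (rule dirichlet_bvp_scale[OF a])
  from maximum_principle_upper[OF this m _ y, of G] maximum_principle_upper[OF a m G y]
  show ?thesis using G by simp
qed

definition ip :: "(real => real) => (real => real) => real" where
  "ip f g = integral {0..1} (\<lambda>y. f y * g y)"

lemma ip_integrable: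
  fixes f g :: "real => real"
  assumes "cont01 f" "cont01 g"
  shows "(\<lambda>y. f y * g y) integrable_on {0..1::real}"
  by (intro integrable_continuous_real continuous_intros assms)

lemma ip_add:
  assumes "cont01 f" "cont01 g" "cont01 h"
  shows "ip (\<lambda>y. f y + g y) h = ip f h + ip g h"
  unfolding ip_def using integral_add[OF ip_integrable ip_integrable] assms by (simp add: distrib_right)

lemma ip_diff:
  assumes "cont01 f" "cont01 g" "cont01 h"
  shows "ip (\<lambda>y. f y - g y) h = ip f h - ip g h"
  unfolding ip_def
  using Henstock_Kurzweil_Integration.integral_diff[OF ip_integrable ip_integrable] assms by (simp add: left_diff_distrib)

lemma ip_scale: "ip (\<lambda>y. c * f y) h = c * ip f h"
  unfolding ip_def by (simp add: mult.assoc)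

lemma ip_diff_scale:
  assumes "cont01 f" "cont01 h"
  shows "ip (\<lambda>y. f y - c * h y) h = ip f h - c * ip h h"
  using ip_diff[OF assms(1) continuous_on_mult[OF continuous_on_const assms(2)] assms(2), of c] by (simp add: ip_scale)

lemma ip_cong: "(!!y. y \<in> {0..1} ==> f y = g y) ==> ip f h = ip g h"
  unfolding ip_def by (rule integral_cong) simp

lemma ip_bound:
  assumes "cont01 f" "cont01 g"
    and "!!y. y \<in> {0..1} ==> \<bar>f y\<bar> <= F" "!!y. y \<in> {0..1} ==> \<bar>g y\<bar> <= G"
  shows "\<bar>ip f g\<bar> <= F * G"
proof -
  have F: "0 <= F" using assms(3)[of 0] by auto
  have "norm (ip f g) <= integral {0..1} (\<lambda>y::real. F * G)"
    unfolding ip_def using assms F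
    by (intro integral_norm_bound_integral ip_integrable) (auto simp: abs_mult intro!: mult_mono)
  then show ?thesis by simp
qed

text \<open>Solutions vanishing at 0 form a line. The reflected eigenfunction lies on it, and its
  value at the midpoint shows the factor to be 1; on that line only 0 is orthogonal to
  \<open>\<phi>\<close>.\<close>

lemma positive_eigenfunction_facts:
  assumes q: "cont01 q" and sym: "!!y. y \<in> {0..1} ==> q (1 - y) = q y"
    and \<phi>: "linear_ode q (\<lambda>y. 0) \<phi> \<phi>'" "\<phi> 0 = 0" "\<phi> 1 = 0" "!!y. y \<in> {0<..<1} ==> 0 < \<phi> y"
  shows "\<phi>' 0 \<noteq> 0" "\<phi>' 1 \<noteq> 0" "!!y. y \<in> {0..1} ==> \<phi> (1 - y) = \<phi> y" "0 < ip \<phi> \<phi>"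
    "!!a y. dirichlet_bvp q (\<lambda>y. 0) a ==> ip a \<phi> = 0 ==> y \<in> {0..1} ==> a y = 0"
proof -
  have \<phi>c: "cont01 \<phi>" using linear_ode_continuous[OF \<phi>(1)] by blast
  have z: "linear_ode q (\<lambda>y. 0) (\<lambda>y. 0) (\<lambda>y. 0)" by (auto simp: linear_ode_def)
  show d0: "\<phi>' 0 \<noteq> 0"
  proof
    assume "\<phi>' 0 = 0"
    then have "\<phi> (1 / 2) = 0" using linear_ode_unique(1)[OF \<phi>(1) z q, of "1 / 2"] \<phi> by simp
    then show False using \<phi>(4)[of "1 / 2"] by simp
  qed
  have mult: "a y = a' 0 / \<phi>' 0 * \<phi> y" if a: "linear_ode q (\<lambda>y. 0) a a'" "a 0 = 0" and y: "y \<in> {0..1}" for a a' y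
  proof (rule linear_ode_unique(1)[OF a(1) _ q])
    show "linear_ode q (\<lambda>y. 0) (\<lambda>y. a' 0 / \<phi>' 0 * \<phi> y) (\<lambda>y. a' 0 / \<phi>' 0 * \<phi>' y)"
      using linear_ode_scale[OF \<phi>(1), of "a' 0 / \<phi>' 0"] by simp
  qed (use a \<phi> d0 y in auto)
  have r: "linear_ode q (\<lambda>y. 0) (\<lambda>y. \<phi> (1 - y)) (\<lambda>y. - \<phi>' (1 - y))"
    by (rule linear_ode_cong[OF linear_ode_reflect[OF \<phi>(1)]]) (simp add: sym)
  have *: "\<phi> (1 - y) = - \<phi>' 1 / \<phi>' 0 * \<phi> y" if "y \<in> {0..1}" for y
    using mult[OF r _ that] \<phi> by simp
  have "\<phi> (1 / 2) = - \<phi>' 1 / \<phi>' 0 * \<phi> (1 / 2)" using *[of "1 / 2"] by simp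
  then have c: "- \<phi>' 1 / \<phi>' 0 = 1"
    using \<phi>(4)[of "1 / 2"] mult_cancel_right1[of "\<phi> (1 / 2)" "- \<phi>' 1 / \<phi>' 0"] by auto
  then show "\<phi>' 1 \<noteq> 0" by auto
  show "\<phi> (1 - y) = \<phi> y" if "y \<in> {0..1}" for y using *[OF that] unfolding c by simp
  show pos: "0 < ip \<phi> \<phi>"
  proof -
    have "0 <= ip \<phi> \<phi>" unfolding ip_def by (rule integral_nonneg[OF ip_integrable[OF \<phi>c \<phi>c]]) simp
    moreover have "ip \<phi> \<phi> \<noteq> 0"
    proof
      assume "ip \<phi> \<phi> = 0"
      then have "\<forall>x\<in>{0..1::real}. \<phi> x * \<phi> x = 0"
        unfolding ip_def
        by (subst (asm) integral_eq_0_iff) (auto intro!: continuous_intros \<phi>c)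
      then have "\<phi> (1 / 2) = 0" by simp
      then show False using \<phi>(4)[of "1 / 2"] by simp
    qed
    ultimately show ?thesis by linarith
  qed
  show "a y = 0" if a: "dirichlet_bvp q (\<lambda>y. 0) a" "ip a \<phi> = 0" and y: "y \<in> {0..1}" for a y
  proof -
    obtain a' where a': "linear_ode q (\<lambda>y. 0) a a'" "a 0 = 0" using a unfolding dirichlet_bvp_def by blast
    have "ip a \<phi> = ip (\<lambda>y. a' 0 / \<phi>' 0 * \<phi> y) \<phi>" by (rule ip_cong) (rule mult[OF a'])
    then have "a' 0 / \<phi>' 0 * ip \<phi> \<phi> = 0" using a by (simp only: ip_scale)
    then have "a' 0 / \<phi>' 0 = 0" using pos by simp
    then show ?thesis unfolding mult[OF a' y] by (simp only: mult_zero_left)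
  qed
qed

text \<open>At resonance the equation is solved for the component of the right-hand side orthogonal to the
  kernel; the Wronskian with the kernel function turns this orthogonality into the boundary
  condition at \<open>1\<close>.\<close>

lemma resonant_bvp:
  assumes q: "cont01 q" and sym: "!!y. y \<in> {0..1} ==> q (1 - y) = q y"
    and \<phi>: "linear_ode q (\<lambda>y. 0) \<phi> \<phi>'" "\<phi> 0 = 0" "\<phi> 1 = 0" "!!y. y \<in> {0<..<1} ==> 0 < \<phi> y"
  obtains C where "0 < C"
    "!!g. cont01 g ==>
       \<exists>a. dirichlet_bvp q (\<lambda>y. g y - ip g \<phi> / ip \<phi> \<phi> * \<phi> y) a & ip a \<phi> = 0 &
         (\<forall>G. (\<forall>y\<in>{0..1}. \<bar>g y\<bar> <= G) --> (\<forall>y\<in>{0..1}. \<bar>a y\<bar> <= C * G))"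
proof -
  note facts = positive_eigenfunction_facts[OF q sym \<phi>]
  have \<phi>c: "cont01 \<phi>" using linear_ode_continuous[OF \<phi>(1)] by blast
  obtain K where K: "0 < K" "!!y. y \<in> {0..1} ==> \<bar>q y\<bar> <= K"
    using bounded_abs_on_unit_interval[OF q] by blast
  obtain P where P: "0 < P" "!!y. y \<in> {0..1} ==> \<bar>\<phi> y\<bar> <= P"
    using bounded_abs_on_unit_interval[OF \<phi>c] by blast
  define I where "I = ip \<phi> \<phi>"
  have I: "0 < I" using facts(4) by (simp add: I_def)
  \<comment> \<open>Norm bound of the projection along \<open>\<phi>\<close>. It enters twice, for
    the right-hand side and for the solution.\<close>
  define D where "D = 1 + P / I * P"
  have D: "0 < D" using P I by (simp add: D_def add_pos_nonneg)
  define C where "C = D * exp (K + 2) * D"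
  have proj: "\<bar>h y - ip h \<phi> / I * \<phi> y\<bar> <= D * H"
    if h: "cont01 h" "!!y. y \<in> {0..1} ==> \<bar>h y\<bar> <= H" and y: "y \<in> {0..1}" for h H y
  proof -
    have H: "0 <= H" using h(2)[of 0] by auto
    have "\<bar>h y - ip h \<phi> / I * \<phi> y\<bar> <= \<bar>h y\<bar> + \<bar>ip h \<phi>\<bar> / I * \<bar>\<phi> y\<bar>"
      using I by (metis abs_divide abs_mult abs_of_pos abs_triangle_ineq4)
    also have "\<dots> <= H + H * P / I * P"
      using ip_bound[OF h(1) \<phi>c h(2) P(2)] P(1) P(2)[OF y] h(2)[OF y] I H
      by (intro add_mono mult_mono divide_right_mono) auto
    finally show ?thesis by (simp add: D_def algebra_simps)
  qed
  have "\<exists>a. dirichlet_bvp q (\<lambda>y. g y - ip g \<phi> / I * \<phi> y) a & ip a \<phi> = 0 &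
         (\<forall>G. (\<forall>y\<in>{0..1}. \<bar>g y\<bar> <= G) --> (\<forall>y\<in>{0..1}. \<bar>a y\<bar> <= C * G))"
    if g: "cont01 g" for g
  proof -
    define h where "h y = g y - ip g \<phi> / I * \<phi> y" for y
    have hc: "cont01 h" unfolding h_def by (intro continuous_intros g \<phi>c)
    have h0: "ip h \<phi> = 0"
      unfolding h_def using I by (simp only: ip_diff_scale[OF g \<phi>c] I_def, simp)
    obtain p p' where p: "linear_ode q h p p'" "p 0 = 0" "p' 0 = 0"
      using linear_ode_exists[OF q hc] by metis
    have pc: "cont01 p" using linear_ode_continuous[OF p(1)] by blast
    have "((\<lambda>y. h y * \<phi> y) has_integral (p' 1 * \<phi> 1 - p 1 * \<phi>' 1) - (p' 0 * \<phi> 0 - p 0 * \<phi>' 0)) {0..1}"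
    proof (rule fundamental_theorem_of_calculus)
      fix y :: real assume "y \<in> {0..1}"
      from wronskian_derivative[OF p(1) \<phi>(1) this]
      show "((\<lambda>y. p' y * \<phi> y - p y * \<phi>' y) has_vector_derivative h y * \<phi> y) (at y within {0..1})"
        by (simp add: has_real_derivative_iff_has_vector_derivative)
    qed simp
    then have "ip h \<phi> = - (p 1 * \<phi>' 1)" using \<phi> p unfolding ip_def by (simp add: integral_unique)
    then have p1: "p 1 = 0" using h0 facts(2) by simp
    define a where "a y = p y - ip p \<phi> / I * \<phi> y" for y
    have "linear_ode q h a (\<lambda>y. p' y - ip p \<phi> / I * \<phi>' y)"
      using linear_ode_diff[OF p(1) linear_ode_scale[OF \<phi>(1), of "ip p \<phi> / I"]] by (simp add: a_def [abs_def])
    then have "dirichlet_bvp q h a" unfolding dirichlet_bvp_def using p p1 \<phi> by (auto simp: a_def)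
    moreover have "ip a \<phi> = 0"
      unfolding a_def using I by (simp only: ip_diff_scale[OF pc \<phi>c] I_def, simp)
    moreover have "\<bar>a y\<bar> <= C * G" if G: "\<forall>y\<in>{0..1}. \<bar>g y\<bar> <= G" and y: "y \<in> {0..1}" for G y
    proof -
      have hb: "\<bar>h y\<bar> <= D * G" if "y \<in> {0..1}" for y
        unfolding h_def by (rule proj[OF g _ that]) (use G in auto)
      have "\<bar>p y\<bar> <= exp (K + 2) * (D * G)" if "y \<in> {0..1}" for y
        using linear_ode_bound(1)[OF p(1) K(2) hb, of y] that p by simp
      then have "\<bar>a y\<bar> <= D * (exp (K + 2) * (D * G))" unfolding a_def by (rule proj[OF pc _ y])
      then show ?thesis by (simp add: C_def mult_ac)
    qed
    ultimately show ?thesis unfolding h_def by blast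
  qed
  moreover have "0 < C" using D by (simp add: C_def)
  ultimately show ?thesis using that unfolding I_def by blast
qed

text \<open>Mode 1 is inverted modulo its kernel, the others exactly. The essential output is the
  gain of \<open>(1 + real k)\<^sup>2\<close> uniformly in \<open>k\<close>: finitely many modes are
  covered by their own constants, the rest by the maximum principle. The gain later absorbs the
  factor \<open>k\<^sup>2\<close> with which a change of the wave number enters.\<close>

theorem green_operators:
  fixes \<alpha> :: real
  assumes Q: "cont01 Q" and sym: "!!y. y \<in> {0..1} ==> Q (1 - y) = Q y" and \<alpha>: "0 < \<alpha>"
    and \<phi>: "linear_ode (\<lambda>y. Q y + \<alpha>\<^sup>2) (\<lambda>y. 0) \<phi> \<phi>'" "\<phi> 0 = 0" "\<phi> 1 = 0" "!!y. y \<in> {0<..<1} ==> 0 < \<phi> y"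
    and nr0: "!!a y. dirichlet_bvp Q (\<lambda>y. 0) a ==> y \<in> {0..1} ==> a y = 0"
    and nr: "!!m a y. \<alpha>\<^sup>2 < m ==> dirichlet_bvp (\<lambda>y. Q y + m) (\<lambda>y. 0) a ==> y \<in> {0..1} ==> a y = 0"
  obtains G :: "nat => (real => real) => real => real" and C :: real where "0 < C"
    "!!k g. k \<noteq> 1 ==> cont01 g ==> dirichlet_bvp (\<lambda>y. Q y + \<alpha>\<^sup>2 * (real k)\<^sup>2) g (G k g)"
    "!!g. cont01 g ==> dirichlet_bvp (\<lambda>y. Q y + \<alpha>\<^sup>2) (\<lambda>y. g y - ip g \<phi> / ip \<phi> \<phi> * \<phi> y) (G 1 g)"
    "!!g. cont01 g ==> ip (G 1 g) \<phi> = 0"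
    "!!k g B y. cont01 g ==> (!!y. y \<in> {0..1} ==> \<bar>g y\<bar> <= B) ==> y \<in> {0..1} ==>
       (1 + real k)\<^sup>2 * \<bar>G k g y\<bar> <= C * B"
    "!!k g h y. cont01 g ==> cont01 h ==> y \<in> {0..1} ==>
       G k (\<lambda>y. g y + h y) y = G k g y + G k h y"
    "!!k g c y. cont01 g ==> y \<in> {0..1} ==> G k (\<lambda>y. c * g y) y = c * G k g y"
    "!!k g y. cont01 g ==> (!!y. y \<in> {0..1} ==> g (1 - y) = g y) ==> y \<in> {0..1} ==>
       G k g (1 - y) = G k g y"
proof -
  define q where "q k y = Q y + \<alpha>\<^sup>2 * (real k)\<^sup>2" for k y
  have qc: "cont01 (q k)" for k unfolding q_def by (intro continuous_intros Q)
  have qs: "q k (1 - y) = q k y" if "y \<in> {0..1}" for k y using sym[OF that] by (simp add: q_def)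
  have q1: "(\<lambda>y. Q y + \<alpha>\<^sup>2) = q 1" by (simp add: q_def fun_eq_iff)
  note \<phi>1 = \<phi>(1)[unfolded q1]
  have \<phi>c: "cont01 \<phi>" using linear_ode_continuous[OF \<phi>(1)] by blast
  define I where "I = ip \<phi> \<phi>"
  note facts = positive_eigenfunction_facts[OF qc qs \<phi>1 \<phi>(2-4)]
  have I: "0 < I" using facts(4) by (simp add: I_def)
  define pr where "pr k g y = (if k = 1 then g y - ip g \<phi> / I * \<phi> y else g y)" for k :: nat and g y
  define ok where "ok k g a \<longleftrightarrow> dirichlet_bvp (q k) (pr k g) a & (k = 1 --> ip a \<phi> = 0)" for k g a
  have okc: "cont01 a" if "ok k g a" for k g a
    using that dirichlet_bvp_continuous unfolding ok_def by blast
  have uniq0: "a y = 0" if "dirichlet_bvp (q k) (\<lambda>y. 0) a" "k = 1 --> ip a \<phi> = 0" "y \<in> {0..1}" for k a y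
  proof -
    consider "k = 0" | "k = 1" | "2 <= k" by linarith
    then show ?thesis
    proof cases
      case 1
      then have "q k = Q" by (simp add: q_def fun_eq_iff)
      then show ?thesis using nr0 that by simp
    next
      case 2
      then show ?thesis using facts(5) that by blast
    next
      case 3
      then have "1 < real k" by simp
      then have "1 < (real k)\<^sup>2" by (simp add: one_less_power)
      then have "\<alpha>\<^sup>2 < \<alpha>\<^sup>2 * (real k)\<^sup>2" using \<alpha> by simp
      from nr[OF this] show ?thesis using that by (simp add: q_def [abs_def])
    qed
  qed
  \<comment> \<open>Linearity and reflection symmetry of the chosen solutions reduce to this
    uniqueness, because both sides of each identity solve the same normalised problem.\<close>
  have uniq: "a y = b y" if "ok k g a" "ok k h b" "!!y. y \<in> {0..1} ==> pr k g y = pr k h y" "y \<in> {0..1}" for k g h a b y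
  proof -
    have "dirichlet_bvp (q k) (\<lambda>y. 0) (\<lambda>y. a y - b y)"
      using that(1,2) unfolding ok_def
      by (intro dirichlet_bvp_cong[OF dirichlet_bvp_diff[of "q k" "pr k g" a "pr k h" b]]) (auto simp: that(3))
    moreover have "k = 1 --> ip (\<lambda>y. a y - b y) \<phi> = 0"
      using that okc \<phi>c by (auto simp: ip_diff ok_def)
    ultimately have "a y - b y = 0" using uniq0 that(4) by blast
    then show ?thesis by simp
  qed
  have ex: "\<exists>C>0. \<forall>g. cont01 g --> (\<exists>a. ok k g a &
      (\<forall>B. (\<forall>y\<in>{0..1}. \<bar>g y\<bar> <= B) --> (\<forall>y\<in>{0..1}. \<bar>a y\<bar> <= C * B)))" for k
  proof (cases "k = 1")
    case True
    obtain C where "0 < C" "!!g. cont01 g ==>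
       \<exists>a. dirichlet_bvp (q 1) (\<lambda>y. g y - ip g \<phi> / ip \<phi> \<phi> * \<phi> y) a & ip a \<phi> = 0 &
         (\<forall>G. (\<forall>y\<in>{0..1}. \<bar>g y\<bar> <= G) --> (\<forall>y\<in>{0..1}. \<bar>a y\<bar> <= C * G))"
      using resonant_bvp[OF qc qs \<phi>1 \<phi>(2-4)] by blast
    then show ?thesis using True by (intro exI[of _ C]) (simp add: ok_def pr_def [abs_def] I_def)
  next
    case False
    have "\<exists>C>0. (\<forall>g. cont01 g --> (\<exists>a. dirichlet_bvp (q k) g a)) &
      (\<forall>g a G. dirichlet_bvp (q k) g a --> (\<forall>y\<in>{0..1}. \<bar>g y\<bar> <= G) --> (\<forall>y\<in>{0..1}. \<bar>a y\<bar> <= C * G))"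
      by (rule nonresonant_bvp[OF qc]) (use uniq0 False in blast)
    then obtain C where C: "0 < C" "!!g. cont01 g ==> \<exists>a. dirichlet_bvp (q k) g a"
      "!!g a. dirichlet_bvp (q k) g a ==> \<forall>G. (\<forall>y\<in>{0..1}. \<bar>g y\<bar> <= G) --> (\<forall>y\<in>{0..1}. \<bar>a y\<bar> <= C * G)"
      by blast
    have "pr k g = g" for g using False by (simp add: pr_def fun_eq_iff)
    then have ok_eq: "ok k g a \<longleftrightarrow> dirichlet_bvp (q k) g a" for g a using False by (simp add: ok_def)
    show ?thesis
    proof (intro exI[of _ C] conjI allI impI)
      show "0 < C" by (rule C)
      fix g :: "real => real" assume "cont01 g"
      then obtain a where "dirichlet_bvp (q k) g a" using C(2) by blast
      then show "\<exists>a. ok k g a & (\<forall>B. (\<forall>y\<in>{0..1}. \<bar>g y\<bar> <= B) --> (\<forall>y\<in>{0..1}. \<bar>a y\<bar> <= C * B))"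
        using C(3) ok_eq by blast
    qed
  qed
  then obtain c where c: "!!k. 0 < c k" "!!k g. cont01 g ==> \<exists>a. ok k g a &
      (\<forall>B. (\<forall>y\<in>{0..1}. \<bar>g y\<bar> <= B) --> (\<forall>y\<in>{0..1}. \<bar>a y\<bar> <= c k * B))" by metis
  define G where "G k g = (SOME a. ok k g a &
      (\<forall>B. (\<forall>y\<in>{0..1}. \<bar>g y\<bar> <= B) --> (\<forall>y\<in>{0..1}. \<bar>a y\<bar> <= c k * B)))" for k g
  have G: "ok k g (G k g)" "!!B y. (!!y. y \<in> {0..1} ==> \<bar>g y\<bar> <= B) ==> y \<in> {0..1} ==> \<bar>G k g y\<bar> <= c k * B"
    if "cont01 g" for k g
    using someI_ex[OF c(2)[OF that, of k]] unfolding G_def by blast+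
  obtain K where K: "0 < K" "!!y. y \<in> {0..1} ==> \<bar>Q y\<bar> <= K"
    using bounded_abs_on_unit_interval[OF Q] by blast
  obtain k0 :: nat where k0: "2 * K / \<alpha>\<^sup>2 < real k0" using reals_Archimedean2 by blast
  \<comment> \<open>For \<open>k > k0 + 1\<close> the potential is at least
    \<open>\<alpha>\<^sup>2 * k\<^sup>2 / 2\<close>; with \<open>1 + k \<le> 2 * k\<close> the
    maximum principle then gives the constant \<open>8 / \<alpha>\<^sup>2\<close>. The sum covers
    the remaining modes.\<close>
  define C where "C = (\<Sum>k\<le>k0 + 1. (1 + real k)\<^sup>2 * c k) + 8 / \<alpha>\<^sup>2"
  have sum_nn: "0 <= (\<Sum>k\<le>k0 + 1. (1 + real k)\<^sup>2 * c k)"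
    using c(1) by (intro sum_nonneg) (auto intro: less_imp_le)
  then have C: "0 < C" using \<alpha> by (simp add: C_def add_nonneg_pos)
  have bound: "(1 + real k)\<^sup>2 * \<bar>G k g y\<bar> <= C * B"
    if g: "cont01 g" and B: "!!y. y \<in> {0..1} ==> \<bar>g y\<bar> <= B" and y: "y \<in> {0..1}" for k g B y
  proof -
    have B0: "0 <= B" using B[OF y] by auto
    show ?thesis
    proof (cases "k <= k0 + 1")
      case True
      have "(1 + real k)\<^sup>2 * c k <= (\<Sum>k\<le>k0 + 1. (1 + real k)\<^sup>2 * c k)"
        using c(1) True by (intro member_le_sum) (auto intro: less_imp_le)
      also have "\<dots> <= C" by (simp add: C_def)
      finally have *: "(1 + real k)\<^sup>2 * c k <= C" .
      have "(1 + real k)\<^sup>2 * \<bar>G k g y\<bar> <= (1 + real k)\<^sup>2 * (c k * B)"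
        using G(2)[OF g B y] by (intro mult_left_mono) auto
      also have "\<dots> <= C * B" using mult_right_mono[OF * B0] by (simp add: mult.assoc)
      finally show ?thesis .
    next
      case False
      then have k: "1 < k" "real k0 <= real k" by auto
      have "real k <= (real k)\<^sup>2" using k by (simp add: power2_eq_square)
      then have "2 * K / \<alpha>\<^sup>2 <= (real k)\<^sup>2" using k0 k by linarith
      then have kk: "2 * K <= \<alpha>\<^sup>2 * (real k)\<^sup>2" using \<alpha> by (simp add: field_simps)
      define m where "m = \<alpha>\<^sup>2 * (real k)\<^sup>2 / 2"
      have m: "0 < m" using \<alpha> k by (simp add: m_def)
      have mq: "m <= q k z" if "z \<in> {0..1}" for z using K(2)[OF that] kk by (auto simp: m_def q_def)
      have bvp: "dirichlet_bvp (q k) g (G k g)"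
        using G(1)[OF g, of k] k unfolding ok_def pr_def [abs_def] by simp
      have "\<bar>G k g y\<bar> <= B / m" by (rule maximum_principle[OF bvp m mq B y])
      then have "(1 + real k)\<^sup>2 * \<bar>G k g y\<bar> <= (2 * real k)\<^sup>2 * (B / m)"
        using k by (intro mult_mono power_mono) auto
      also have "\<dots> = 8 / \<alpha>\<^sup>2 * B" using k \<alpha> by (simp add: m_def field_simps)
      also have "\<dots> <= C * B" using sum_nn B0 by (intro mult_right_mono) (auto simp: C_def)
      finally show ?thesis .
    qed
  qed
  show ?thesis
  proof (rule that[OF C, of G])
    show "dirichlet_bvp (\<lambda>y. Q y + \<alpha>\<^sup>2 * (real k)\<^sup>2) g (G k g)" if "k \<noteq> 1" "cont01 g" for k g
      using G(1)[OF that(2), of k] that(1) unfolding ok_def pr_def [abs_def] q_def [abs_def] by simp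
    show "dirichlet_bvp (\<lambda>y. Q y + \<alpha>\<^sup>2) (\<lambda>y. g y - ip g \<phi> / ip \<phi> \<phi> * \<phi> y) (G 1 g)"
      if "cont01 g" for g
      using G(1)[OF that, of 1] unfolding ok_def pr_def [abs_def] q1 I_def by simp
    show "ip (G 1 g) \<phi> = 0" if "cont01 g" for g
      using G(1)[OF that, of 1] unfolding ok_def by simp
    show "(1 + real k)\<^sup>2 * \<bar>G k g y\<bar> <= C * B"
      if "cont01 g" "!!y. y \<in> {0..1} ==> \<bar>g y\<bar> <= B" "y \<in> {0..1}" for k g B y
      by (rule bound[OF that])
    show "G k (\<lambda>y. g y + h y) y = G k g y + G k h y"
      if g: "cont01 g" and h: "cont01 h" and y: "y \<in> {0..1}" for k g h y
    proof (rule uniq[OF G(1) _ refl y])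
      show "cont01 (\<lambda>y. g y + h y)" by (intro continuous_intros g h)
      have prs: "(\<lambda>y. pr k g y + pr k h y) = pr k (\<lambda>y. g y + h y)"
        using ip_add[OF g h \<phi>c] by (auto simp: pr_def fun_eq_iff add_divide_distrib algebra_simps)
      have "dirichlet_bvp (q k) (pr k (\<lambda>y. g y + h y)) (\<lambda>y. G k g y + G k h y)"
        unfolding prs[symmetric] using G(1)[OF g, of k] G(1)[OF h, of k]
        by (intro dirichlet_bvp_add) (auto simp: ok_def)
      moreover have "ip (\<lambda>y. G k g y + G k h y) \<phi> = ip (G k g) \<phi> + ip (G k h) \<phi>"
        by (rule ip_add[OF okc[OF G(1)[OF g]] okc[OF G(1)[OF h]] \<phi>c])
      ultimately show "ok k (\<lambda>y. g y + h y) (\<lambda>y. G k g y + G k h y)"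
        using G(1)[OF g, of k] G(1)[OF h, of k] unfolding ok_def by auto
    qed
    show "G k (\<lambda>y. c * g y) y = c * G k g y" if g: "cont01 g" and y: "y \<in> {0..1}" for k g c y
    proof (rule uniq[OF G(1) _ refl y])
      show "cont01 (\<lambda>y. c * g y)" by (intro continuous_intros g)
      have "(\<lambda>y. c * pr k g y) = pr k (\<lambda>y. c * g y)"
        by (auto simp: pr_def fun_eq_iff ip_scale algebra_simps)
      then show "ok k (\<lambda>y. c * g y) (\<lambda>y. c * G k g y)"
        using G(1)[OF g, of k] dirichlet_bvp_scale[of "q k" "pr k g" "G k g" c]
        unfolding ok_def by (simp add: ip_scale)
    qed
    show "G k g (1 - y) = G k g y"
      if g: "cont01 g" and s: "!!y. y \<in> {0..1} ==> g (1 - y) = g y" and y: "y \<in> {0..1}" for k g y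
    proof -
      have "dirichlet_bvp (q k) (pr k g) (\<lambda>y. G k g (1 - y))"
      proof (rule dirichlet_bvp_cong[OF dirichlet_bvp_reflect])
        show "dirichlet_bvp (q k) (pr k g) (G k g)" using G(1)[OF g] unfolding ok_def by blast
        fix y :: real assume "y \<in> {0..1}"
        then show "q k (1 - y) * G k g (1 - y) + pr k g (1 - y) = q k y * G k g (1 - y) + pr k g y"
          using qs s facts(3) by (simp add: pr_def)
      qed
      moreover have "ip (\<lambda>y. G k g (1 - y)) \<phi> = ip (G k g) \<phi>"
      proof -
        have gc: "cont01 (G k g)" by (rule okc[OF G(1)[OF g]])
        have "((\<lambda>y. G k g y * \<phi> y) has_integral ip (G k g) \<phi>) {0..1}"
          unfolding ip_def by (rule integrable_integral[OF ip_integrable[OF gc \<phi>c]])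
        from has_integral_affinity[OF this[folded cbox_interval], of "-1" 1]
        have "((\<lambda>y. G k g (1 - y) * \<phi> (1 - y)) has_integral ip (G k g) \<phi>) {0..1}" by (simp add: image_affinity_cbox)
        then have "integral {0..1} (\<lambda>y. G k g (1 - y) * \<phi> (1 - y)) = ip (G k g) \<phi>" by (rule integral_unique)
        moreover have "integral {0..1} (\<lambda>y. G k g (1 - y) * \<phi> (1 - y)) = ip (\<lambda>y. G k g (1 - y)) \<phi>"
          unfolding ip_def by (rule integral_cong) (simp only: facts(3))
        ultimately show ?thesis by simp
      qed
      ultimately have "ok k g (\<lambda>y. G k g (1 - y))" using G(1)[OF g, of k] unfolding ok_def by auto
      from uniq[OF this G(1)[OF g] refl y] show ?thesis .
    qed
  qed
qed

section \<open>Weighted cosine series\<close>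

text \<open>The exponent 6 is spent as follows: two powers on differentiating twice in \<xi>, two on
  reading a \<open>y\<close>-derivative off the equation of the mode, and two on summability. The
  \<open>y\<close>-derivative of the second \<xi>-derivative, needed for its Lipschitz bound, uses
  them all.\<close>

definition wt :: "int => real" where
  "wt k = (1 + real_of_int \<bar>k\<bar>) ^ 6"

lemma wt_ge_1: "1 <= wt k" unfolding wt_def by (rule one_le_power) auto

lemma wt_pos [simp]: "0 < wt k" using wt_ge_1[of k] by linarith

lemma wt_nonneg [simp]: "0 <= wt k" and wt_nonzero [simp]: "wt k \<noteq> 0"
  using wt_ge_1[of k] by linarith+

lemma wt_minus [simp]: "wt (- k) = wt k" by (simp add: wt_def)

lemma summable_on_int_nat:
  fixes f :: "int => real"
  assumes "(\<lambda>n. f (int n)) summable_on UNIV" "(\<lambda>n. f (- int n)) summable_on UNIV"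
  shows "f summable_on UNIV"
proof -
  have "f summable_on (range int)"
    using assms(1) by (subst summable_on_reindex) (auto simp: o_def)
  moreover have "f summable_on (range (\<lambda>n. - int n))"
    using assms(2) by (subst summable_on_reindex) (auto simp: o_def inj_def)
  ultimately have "f summable_on (range int \<union> range (\<lambda>n. - int n))" by (rule summable_on_union)
  moreover have "range int \<union> range (\<lambda>n. - int n) = UNIV"
  proof -
    have "k \<in> range int \<union> range (\<lambda>n. - int n)" for k :: int
      by (cases k rule: int_cases2) auto
    then show ?thesis by blast
  qed
  ultimately show ?thesis by simp
qed

lemma summable_inverse_wt: "(\<lambda>k. 1 / wt k) summable_on UNIV"
proof -
  have "summable (\<lambda>n. 1 / (1 + real n) ^ 6)"
  proof (rule summable_comparison_test_ev)
    show "summable (\<lambda>n. inverse (real (Suc n) ^ 2))"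
      using inverse_power_summable[of 2, where 'a = real] summable_Suc_iff[of "\<lambda>n. inverse (real n ^ 2)"] by simp
    have "norm (1 / (1 + real n) ^ 6) <= inverse (real (Suc n) ^ 2)" for n
      using power_increasing[of 2 6 "1 + real n"] by (simp add: field_simps)
    then show "\<forall>\<^sub>F n in sequentially. norm (1 / (1 + real n) ^ 6) <= inverse (real (Suc n) ^ 2)" by simp
  qed
  then have "(\<lambda>n. 1 / wt (int n)) summable_on UNIV"
    by (intro norm_summable_imp_summable_on) (simp add: wt_def)
  then show ?thesis by (intro summable_on_int_nat) auto
qed

definition wt_sum :: real where "wt_sum = (\<Sum>\<^sub>\<infinity>k. 1 / wt k)"

lemma wt_sum_pos: "0 < wt_sum"
proof -
  have "(\<Sum>\<^sub>\<infinity>k\<in>{0}. 1 / wt k) <= wt_sum"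
    unfolding wt_sum_def by (rule infsum_mono2) (auto intro: summable_inverse_wt)
  then show ?thesis by (simp add: wt_def)
qed

text \<open>By the triangle inequality the larger of the two base factors is at least half of
  \<open>1 + \<bar>k\<bar>\<close>; the constant is \<open>2 ^ 6\<close>.\<close>

lemma wt_split: "1 / (wt j * wt (k - j)) <= 64 / wt k * (1 / wt j + 1 / wt (k - j))"
proof -
  define a where "a = 1 + real_of_int \<bar>j\<bar>"
  define b where "b = 1 + real_of_int \<bar>k - j\<bar>"
  define c where "c = 1 + real_of_int \<bar>k\<bar>"
  have p: "1 <= a" "1 <= b" "1 <= c" by (auto simp: a_def b_def c_def)
  have "c <= a + b" by (simp add: a_def b_def c_def)
  then have "c <= 2 * max a b" by linarith
  then have "c ^ 6 <= (2 * max a b) ^ 6" using p by (intro power_mono) auto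
  also have "\<dots> = 64 * (max a b) ^ 6" by (simp add: power_mult_distrib)
  also have "\<dots> <= 64 * (a ^ 6 + b ^ 6)" using p by (simp add: max_def)
  finally have "c ^ 6 <= 64 * (a ^ 6 + b ^ 6)" .
  then have "c ^ 6 / (a ^ 6 * b ^ 6 * c ^ 6) <= 64 * (a ^ 6 + b ^ 6) / (a ^ 6 * b ^ 6 * c ^ 6)"
    using p by (intro divide_right_mono) auto
  moreover have "c ^ 6 / (a ^ 6 * b ^ 6 * c ^ 6) = 1 / (a ^ 6 * b ^ 6)" using p by auto
  moreover have "64 * (a ^ 6 + b ^ 6) / (a ^ 6 * b ^ 6 * c ^ 6) = 64 / c ^ 6 * (1 / a ^ 6 + 1 / b ^ 6)"
    using p by (simp add: add_divide_distrib distrib_left mult.commute)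
  ultimately show ?thesis unfolding wt_def a_def b_def c_def by simp
qed

lemma summable_inverse_wt_shift: "(\<lambda>j. 1 / wt (k - j)) summable_on UNIV"
  and infsum_inverse_wt_shift: "(\<Sum>\<^sub>\<infinity>j. 1 / wt (k - j)) = wt_sum"
proof -
  have b: "bij_betw (\<lambda>j. k - j) (UNIV :: int set) UNIV"
    by (rule bij_betw_byWitness[where f' = "\<lambda>j. k - j"]) auto
  show "(\<lambda>j. 1 / wt (k - j)) summable_on UNIV"
    using summable_on_reindex_bij_betw[OF b, of "\<lambda>j. 1 / wt j"] summable_inverse_wt by simp
  show "(\<Sum>\<^sub>\<infinity>j. 1 / wt (k - j)) = wt_sum"
    using infsum_reindex_bij_betw[OF b, of "\<lambda>j. 1 / wt j"] by (simp add: wt_sum_def)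
qed

text \<open>The inverse weights are closed under convolution up to a constant, which is what makes
  the product of two series bounded.\<close>

lemma convolution_wt:
  shows "(\<lambda>j. 1 / (wt j * wt (k - j))) summable_on UNIV"
    and "(\<Sum>\<^sub>\<infinity>j. 1 / (wt j * wt (k - j))) <= 128 * wt_sum / wt k"
proof -
  have s: "(\<lambda>j. 64 / wt k * (1 / wt j + 1 / wt (k - j))) summable_on UNIV"
    by (intro summable_on_cmult_right summable_on_add summable_inverse_wt summable_inverse_wt_shift)
  show "(\<lambda>j. 1 / (wt j * wt (k - j))) summable_on UNIV"
    by (rule summable_on_comparison_test[OF s]) (use wt_split in auto)
  then have "(\<Sum>\<^sub>\<infinity>j. 1 / (wt j * wt (k - j))) <= (\<Sum>\<^sub>\<infinity>j. 64 / wt k * (1 / wt j + 1 / wt (k - j)))"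
    by (intro infsum_mono s wt_split)
  also have "\<dots> = 64 / wt k * (wt_sum + wt_sum)"
    by (subst infsum_cmult_right', subst infsum_add)
       (auto simp: summable_inverse_wt summable_inverse_wt_shift infsum_inverse_wt_shift wt_sum_def[symmetric])
  finally show "(\<Sum>\<^sub>\<infinity>j. 1 / (wt j * wt (k - j))) <= 128 * wt_sum / wt k" by simp
qed

text \<open>A cosine series \<open>\<Sum>k u\<^sub>k(y) cos (k \<xi>)\<close> over all integers \<open>k\<close> is stored through the weighted
  coefficients \<open>wt k * u\<^sub>k(y)\<close>, so that the space is complete for the supremum norm.\<close>

type_synonym cosine_series = "(int \<times> real) \<Rightarrow>\<^sub>C real"

definition cf :: "cosine_series => int => real => real" where
  "cf f k y = apply_bcontfun f (k, y) / wt k"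

definition series_of :: "(int => real => real) => cosine_series" where
  "series_of c = Bcontfun (\<lambda>(k, y). wt k * c k (unit_clamp y))"

definition wt_bounded :: "real => (int => real => real) => bool" where
  "wt_bounded B c \<longleftrightarrow> (\<forall>k. cont01 (c k) & (\<forall>y\<in>{0..1}. wt k * \<bar>c k y\<bar> <= B))"

lemma wt_boundedI:
  assumes "!!k. cont01 (c k)" "!!k y. y \<in> {0..1} ==> wt k * \<bar>c k y\<bar> <= B"
  shows "wt_bounded B c"
  using assms unfolding wt_bounded_def by blast

text \<open>The integers are discrete, so near any point the first coordinate is frozen.\<close>

lemma continuous_on_discrete_fst:
  fixes g :: "int => real => real"
  assumes "!!k. continuous_on UNIV (g k)"
  shows "continuous_on UNIV (\<lambda>p. g (fst p) (snd p))"
proof (intro continuous_at_imp_continuous_on ballI)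
  fix p :: "int \<times> real"
  have "isCont (g (fst p)) (snd p)" using assms by (simp add: continuous_on_eq_continuous_at)
  then have "((\<lambda>q. g (fst p) (snd q)) \<longlongrightarrow> g (fst p) (snd p)) (at p)"
    by (rule isCont_tendsto_compose[OF _ tendsto_snd[OF tendsto_ident_at]])
  moreover have "\<forall>\<^sub>F q in at p. g (fst p) (snd q) = g (fst q) (snd q)"
  proof -
    have "open ({fst p} \<times> (UNIV :: real set))" by (intro open_Times open_discrete open_UNIV)
    then have "\<forall>\<^sub>F q in nhds p. q \<in> {fst p} \<times> UNIV"
      by (rule eventually_nhds_in_open) (auto simp: mem_Times_iff)
    then show ?thesis unfolding eventually_at_filter by eventually_elim auto
  qed
  ultimately show "isCont (\<lambda>q. g (fst q) (snd q)) p"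
    unfolding isCont_def by (rule Lim_transform_eventually)
qed

lemma series_of_bcontfun:
  assumes "wt_bounded B c"
  shows "(\<lambda>(k, y). wt k * c k (unit_clamp y)) \<in> bcontfun"
proof -
  have "continuous_on UNIV (\<lambda>p. wt (fst p) * c (fst p) (unit_clamp (snd p)))"
    using assms unfolding wt_bounded_def
    by (intro continuous_on_discrete_fst continuous_on_mult continuous_on_const continuous_on_compose_unit_clamp) auto
  moreover have "bounded (range (\<lambda>p. wt (fst p) * c (fst p) (unit_clamp (snd p))))"
    using assms unfolding wt_bounded_def by (intro boundedI[of _ B]) (auto simp: abs_mult)
  ultimately show ?thesis by (simp add: bcontfun_def case_prod_beta)
qed

lemma cf_series_of:
  assumes "wt_bounded B c"
  shows "cf (series_of c) k y = c k (unit_clamp y)"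
  unfolding cf_def series_of_def by (subst Bcontfun_inverse[OF series_of_bcontfun[OF assms]]) simp

lemma wt_cf_le_norm: "wt k * \<bar>cf f k y\<bar> <= norm f"
  using norm_bounded[of f "(k, y)"] by (simp add: cf_def)

lemma cf_le_norm: "\<bar>cf f k y\<bar> <= norm f * (1 / wt k)"
  using wt_cf_le_norm[of k f y] by (simp add: field_simps)

lemma norm_series_of:
  assumes "wt_bounded B c"
  shows "norm (series_of c) <= B"
proof (rule norm_bound)
  fix x :: "int \<times> real"
  show "norm (apply_bcontfun (series_of c) x) <= B"
    unfolding series_of_def Bcontfun_inverse[OF series_of_bcontfun[OF assms]]
    using assms by (auto simp: case_prod_beta abs_mult wt_bounded_def)
qed

lemma continuous_on_cf: "continuous_on S (cf f k)"
proof -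
  have "continuous_on S (\<lambda>y. apply_bcontfun f (k, y))"
    by (rule continuous_on_compose2[of UNIV "apply_bcontfun f"]) (auto intro!: continuous_intros)
  then show ?thesis unfolding cf_def [abs_def] by (intro continuous_intros) auto
qed

lemma cf_0 [simp]: "cf 0 k y = 0" by (simp add: cf_def)
lemma cf_add: "cf (f + g) k y = cf f k y + cf g k y" by (simp add: cf_def add_divide_distrib)
lemma cf_diff: "cf (f - g) k y = cf f k y - cf g k y" by (simp add: cf_def diff_divide_distrib)
lemma cf_scaleR: "cf (c *\<^sub>R f) k y = c * cf f k y" by (simp add: cf_def)

lemma series_eqI:
  assumes "!!k y. cf f k y = cf g k y"
  shows "f = g"
proof (rule bcontfun_eqI)
  fix x :: "int \<times> real"
  show "apply_bcontfun f x = apply_bcontfun g x"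
    using assms[of "fst x" "snd x"] by (simp add: cf_def)
qed

lemma bounded_linear_cf: "bounded_linear (\<lambda>f. cf f k y)"
proof (rule bounded_linear_intro[where K = "1 / wt k"])
  show "norm (cf x k y) <= norm x * (1 / wt k)" for x using cf_le_norm by simp
qed (auto simp: cf_add cf_scaleR)

lemma bounded_linear_series_of:
  assumes b: "!!f. wt_bounded (C * norm f) (\<Theta> f)"
    and add: "!!f g k y. y \<in> {0..1} ==> \<Theta> (f + g) k y = \<Theta> f k y + \<Theta> g k y"
    and scale: "!!r f k y. y \<in> {0..1} ==> \<Theta> (r *\<^sub>R f) k y = r * \<Theta> f k y"
  shows "bounded_linear (\<lambda>f. series_of (\<Theta> f))"
proof (rule bounded_linear_intro[where K = C])
  show "series_of (\<Theta> (f + g)) = series_of (\<Theta> f) + series_of (\<Theta> g)" for f g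
    by (rule series_eqI) (simp add: cf_add cf_series_of[OF b] add)
  show "series_of (\<Theta> (r *\<^sub>R f)) = r *\<^sub>R series_of (\<Theta> f)" for r f
    by (rule series_eqI) (simp add: cf_scaleR cf_series_of[OF b] scale)
  show "norm (series_of (\<Theta> f)) <= norm f * C" for f
    using norm_series_of[OF b, of f] by (simp add: mult.commute)
qed

subsection \<open>Evaluation and product of cosine series\<close>

definition ev :: "cosine_series => real => real => real" where
  "ev f \<xi> y = (\<Sum>\<^sub>\<infinity>k. cf f k y * cos (real_of_int k * \<xi>))"

lemma summable_norm_wt:
  assumes "!!k. \<bar>a k\<bar> <= B * (1 / wt k)"
  shows "(\<lambda>k. a k :: real) summable_on UNIV" "(\<lambda>k. \<bar>a k\<bar>) summable_on UNIV"
proof -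
  show "(\<lambda>k. \<bar>a k\<bar>) summable_on UNIV"
    by (rule summable_on_comparison_test[OF summable_on_cmult_right[OF summable_inverse_wt, of B]]) (use assms in auto)
  then show "a summable_on UNIV" by (rule abs_summable_summable[of a UNIV, unfolded real_norm_def])
qed

lemma ev_term_bound: "\<bar>cf f k y * cos (real_of_int k * \<xi>)\<bar> <= norm f * (1 / wt k)"
  using mult_mono[OF cf_le_norm[of f k y] abs_cos_le_one[of "real_of_int k * \<xi>"]] by (simp add: abs_mult)

lemma summable_ev: "(\<lambda>k. cf f k y * cos (real_of_int k * \<xi>)) summable_on UNIV"
  and summable_abs_ev: "(\<lambda>k. \<bar>cf f k y * cos (real_of_int k * \<xi>)\<bar>) summable_on UNIV"
  by (rule summable_norm_wt, rule ev_term_bound)+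

lemma ev_bound: "\<bar>ev f \<xi> y\<bar> <= wt_sum * norm f"
proof -
  have "norm (ev f \<xi> y) <= (\<Sum>\<^sub>\<infinity>k. norm (cf f k y * cos (real_of_int k * \<xi>)))"
    unfolding ev_def by (rule norm_infsum_bound) (use summable_abs_ev in simp)
  also have "\<dots> <= (\<Sum>\<^sub>\<infinity>k. norm f * (1 / wt k))"
    using ev_term_bound[of f _ y \<xi>] summable_abs_ev[of f y \<xi>]
    by (intro infsum_mono summable_on_cmult_right summable_inverse_wt) auto
  also have "\<dots> = wt_sum * norm f" by (subst infsum_cmult_right') (simp add: wt_sum_def)
  finally show ?thesis by simp
qed

lemma bounded_linear_ev: "bounded_linear (\<lambda>f. ev f \<xi> y)"
proof (rule bounded_linear_intro[where K = wt_sum])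
  show "ev (f + g) \<xi> y = ev f \<xi> y + ev g \<xi> y" for f g
    unfolding ev_def by (subst infsum_add[symmetric]) (auto simp: cf_add distrib_right summable_ev)
  show "ev (r *\<^sub>R f) \<xi> y = r *\<^sub>R ev f \<xi> y" for r f
    unfolding ev_def by (simp add: cf_scaleR mult.assoc infsum_cmult_right')
  show "norm (ev f \<xi> y) <= norm f * wt_sum" for f using ev_bound[of f \<xi> y] by (simp add: mult.commute)
qed

text \<open>With \<open>cos (j \<xi>) cos (l \<xi>) = (cos ((j + l) \<xi>) + cos ((l - j) \<xi>)) / 2\<close> this convolution represents
  the product also when the coefficients are not even in \<open>k\<close>.\<close>

definition conv_cf :: "cosine_series => cosine_series => int => real => real" where
  "conv_cf u v k y = 1 / 2 * ((\<Sum>\<^sub>\<infinity>j. cf u j y * cf v (k - j) y) + (\<Sum>\<^sub>\<infinity>j. cf u j y * cf v (k + j) y))"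

definition conv :: "cosine_series => cosine_series => cosine_series" where
  "conv u v = series_of (conv_cf u v)"

lemma conv_term_bound:
  "\<bar>cf u j y * cf v (k - j) y\<bar> <= norm u * norm v * (1 / (wt j * wt (k - j)))"
  using mult_mono[OF cf_le_norm[of u j y] cf_le_norm[of v "k - j" y]] by (simp add: abs_mult mult_ac)

lemma conv_term_bound':
  "\<bar>cf u j y * cf v (k + j) y\<bar> <= norm u * norm v * (1 / (wt j * wt (- k - j)))"
proof -
  have "wt (- k - j) = wt (k + j)" using wt_minus[of "k + j"] by simp
  then show ?thesis
    using mult_mono[OF cf_le_norm[of u j y] cf_le_norm[of v "k + j" y]] by (simp add: abs_mult mult_ac)
qed

lemma convolution_summable:
  assumes "!!j. \<bar>a j\<bar> <= B * (1 / (wt j * wt (k - j)))"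
  shows "(\<lambda>j. a j :: real) summable_on UNIV" "(\<lambda>j. \<bar>a j\<bar>) summable_on UNIV"
    "\<bar>\<Sum>\<^sub>\<infinity>j. a j\<bar> <= B * (128 * wt_sum / wt k)"
proof -
  have s: "(\<lambda>j. B * (1 / (wt j * wt (k - j)))) summable_on UNIV"
    by (rule summable_on_cmult_right[OF convolution_wt(1)])
  show a: "(\<lambda>j. \<bar>a j\<bar>) summable_on UNIV"
    by (rule summable_on_comparison_test[OF s]) (use assms in auto)
  then show "a summable_on UNIV" by (rule abs_summable_summable[of a UNIV, unfolded real_norm_def])
  have B: "0 <= B"
  proof (rule ccontr)
    assume "\<not> 0 <= B"
    then have "B * (1 / (wt 0 * wt (k - 0))) < 0" by (intro mult_neg_pos divide_pos_pos mult_pos_pos wt_pos) auto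
    then show False using assms[of 0] by linarith
  qed
  have "norm (\<Sum>\<^sub>\<infinity>j. a j) <= (\<Sum>\<^sub>\<infinity>j. norm (a j))" by (rule norm_infsum_bound) (use a in simp)
  also have "\<dots> <= (\<Sum>\<^sub>\<infinity>j. B * (1 / (wt j * wt (k - j))))"
    using a assms by (intro infsum_mono s) auto
  also have "\<dots> = B * (\<Sum>\<^sub>\<infinity>j. 1 / (wt j * wt (k - j)))" by (rule infsum_cmult_right')
  also have "\<dots> <= B * (128 * wt_sum / wt k)" by (intro mult_left_mono convolution_wt B)
  finally show "\<bar>\<Sum>\<^sub>\<infinity>j. a j\<bar> <= B * (128 * wt_sum / wt k)" by simp
qed

lemma conv_summable:
  "(\<lambda>j. cf u j y * cf v (k - j) y) summable_on UNIV" "(\<lambda>j. cf u j y * cf v (k + j) y) summable_on UNIV"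
  by (rule convolution_summable(1), rule conv_term_bound, rule convolution_summable(1), rule conv_term_bound')

lemma conv_sum_bound:
  "\<bar>\<Sum>\<^sub>\<infinity>j. cf u j y * cf v (k - j) y\<bar> <= norm u * norm v * (128 * wt_sum / wt k)"
  "\<bar>\<Sum>\<^sub>\<infinity>j. cf u j y * cf v (k + j) y\<bar> <= norm u * norm v * (128 * wt_sum / wt k)"
proof -
  show "\<bar>\<Sum>\<^sub>\<infinity>j. cf u j y * cf v (k - j) y\<bar> <= norm u * norm v * (128 * wt_sum / wt k)"
    by (rule convolution_summable(3), rule conv_term_bound)
  have "\<bar>\<Sum>\<^sub>\<infinity>j. cf u j y * cf v (k + j) y\<bar> <= norm u * norm v * (128 * wt_sum / wt (- k))"
    by (rule convolution_summable(3), rule conv_term_bound')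
  then show "\<bar>\<Sum>\<^sub>\<infinity>j. cf u j y * cf v (k + j) y\<bar> <= norm u * norm v * (128 * wt_sum / wt k)"
    by (simp only: wt_minus)
qed

lemma continuous_on_infsum:
  fixes f :: "'i => 'a::topological_space => real"
  assumes "!!i. continuous_on S (f i)" "!!i x. x \<in> S ==> \<bar>f i x\<bar> <= M i" "M summable_on UNIV"
  shows "continuous_on S (\<lambda>x. \<Sum>\<^sub>\<infinity>i. f i x)"
proof (rule uniform_limit_theorem)
  show "uniform_limit S (\<lambda>X x. \<Sum>i\<in>X. f i x) (\<lambda>x. \<Sum>\<^sub>\<infinity>i. f i x) (finite_subsets_at_top UNIV)"
    by (rule Weierstrass_m_test_general) (use assms in auto)
qed (use assms in \<open>auto intro!: continuous_intros always_eventually\<close>)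

lemma wt_bounded_conv: "wt_bounded (128 * wt_sum * (norm u * norm v)) (conv_cf u v)"
proof (rule wt_boundedI)
  fix k
  show "cont01 (conv_cf u v k)"
  proof -
    have "cont01 (\<lambda>y. \<Sum>\<^sub>\<infinity>j. cf u j y * cf v (k - j) y)"
      by (rule continuous_on_infsum[where M = "\<lambda>j. norm u * norm v * (1 / (wt j * wt (k - j)))"])
         (intro continuous_intros continuous_on_cf conv_term_bound summable_on_cmult_right convolution_wt)+
    moreover have "cont01 (\<lambda>y. \<Sum>\<^sub>\<infinity>j. cf u j y * cf v (k + j) y)"
      by (rule continuous_on_infsum[where M = "\<lambda>j. norm u * norm v * (1 / (wt j * wt (- k - j)))"])
         (intro continuous_intros continuous_on_cf conv_term_bound' summable_on_cmult_right convolution_wt)+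
    ultimately show ?thesis unfolding conv_cf_def [abs_def] by (intro continuous_intros)
  qed
  fix y :: real
  have "\<bar>conv_cf u v k y\<bar> <= 1 / 2 * (norm u * norm v * (128 * wt_sum / wt k) + norm u * norm v * (128 * wt_sum / wt k))"
    unfolding conv_cf_def abs_mult
    by (intro mult_mono order_trans[OF abs_triangle_ineq] add_mono conv_sum_bound) auto
  then have "\<bar>conv_cf u v k y\<bar> <= norm u * norm v * (128 * wt_sum / wt k)" by (simp add: mult_ac)
  then have "wt k * \<bar>conv_cf u v k y\<bar> <= wt k * (norm u * norm v * (128 * wt_sum / wt k))"
    by (intro mult_left_mono) auto
  then show "wt k * \<bar>conv_cf u v k y\<bar> <= 128 * wt_sum * (norm u * norm v)" by (simp add: mult_ac)
qed

lemma cf_conv: "y \<in> {0..1} ==> cf (conv u v) k y = conv_cf u v k y"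
  by (simp add: conv_def cf_series_of[OF wt_bounded_conv])

definition conv_const :: real where "conv_const = 128 * wt_sum"

lemma conv_const_pos: "0 < conv_const" using wt_sum_pos by (simp add: conv_const_def)

lemma norm_conv: "norm (conv u v) <= conv_const * norm u * norm v"
  using norm_series_of[OF wt_bounded_conv, of u v] by (simp add: conv_def conv_const_def mult_ac)

lemma infsum_diff_real:
  fixes f g :: "'i => real"
  assumes "f summable_on A" "g summable_on A"
  shows "(\<Sum>\<^sub>\<infinity>x\<in>A. f x - g x) = infsum f A - infsum g A"
  using infsum_add[OF assms(1) summable_on_uminus[THEN iffD2, OF assms(2)]] by (simp add: infsum_uminus)

lemma conv_cf_diff:
  "conv_cf (u - u') v k y = conv_cf u v k y - conv_cf u' v k y"
  "conv_cf u (v - v') k y = conv_cf u v k y - conv_cf u v' k y"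
proof -
  have 1: "(\<Sum>\<^sub>\<infinity>j. cf (u - u') j y * cf v (k - j) y) = (\<Sum>\<^sub>\<infinity>j. cf u j y * cf v (k - j) y) - (\<Sum>\<^sub>\<infinity>j. cf u' j y * cf v (k - j) y)"
    by (subst infsum_diff_real[symmetric]) (simp_all only: conv_summable cf_diff left_diff_distrib right_diff_distrib)
  have 2: "(\<Sum>\<^sub>\<infinity>j. cf (u - u') j y * cf v (k + j) y) = (\<Sum>\<^sub>\<infinity>j. cf u j y * cf v (k + j) y) - (\<Sum>\<^sub>\<infinity>j. cf u' j y * cf v (k + j) y)"
    by (subst infsum_diff_real[symmetric]) (simp_all only: conv_summable cf_diff left_diff_distrib right_diff_distrib)
  show "conv_cf (u - u') v k y = conv_cf u v k y - conv_cf u' v k y"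
    unfolding conv_cf_def 1 2 by (simp add: field_simps)
  have 3: "(\<Sum>\<^sub>\<infinity>j. cf u j y * cf (v - v') (k - j) y) = (\<Sum>\<^sub>\<infinity>j. cf u j y * cf v (k - j) y) - (\<Sum>\<^sub>\<infinity>j. cf u j y * cf v' (k - j) y)"
    by (subst infsum_diff_real[symmetric]) (simp_all only: conv_summable cf_diff left_diff_distrib right_diff_distrib)
  have 4: "(\<Sum>\<^sub>\<infinity>j. cf u j y * cf (v - v') (k + j) y) = (\<Sum>\<^sub>\<infinity>j. cf u j y * cf v (k + j) y) - (\<Sum>\<^sub>\<infinity>j. cf u j y * cf v' (k + j) y)"
    by (subst infsum_diff_real[symmetric]) (simp_all only: conv_summable cf_diff left_diff_distrib right_diff_distrib)
  show "conv_cf u (v - v') k y = conv_cf u v k y - conv_cf u v' k y"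
    unfolding conv_cf_def 3 4 by (simp add: field_simps)
qed

lemma conv_diff: "conv (u - u') v = conv u v - conv u' v" "conv u (v - v') = conv u v - conv u v'"
  by (rule series_eqI, simp add: conv_def cf_diff cf_series_of[OF wt_bounded_conv] conv_cf_diff)+

text \<open>Absolute summability over pairs of frequencies permits every reordering; what remains is
  the product-to-sum formula for cosines.\<close>

lemma ev_conv:
  assumes y: "y \<in> {0..1}"
  shows "ev (conv u v) \<xi> y = ev u \<xi> y * ev v \<xi> y"
proof -
  define a where "a j = cf u j y" for j
  define b where "b j = cf v j y" for j
  have ab: "\<bar>a j\<bar> <= norm u * (1 / wt j)" "\<bar>b j\<bar> <= norm v * (1 / wt j)" for j
    unfolding a_def b_def by (rule cf_le_norm)+
  have abs: "(\<lambda>j. \<bar>a j\<bar>) summable_on UNIV" "(\<lambda>j. \<bar>b j\<bar>) summable_on UNIV"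
    by (rule summable_norm_wt(2), rule ab)+
  have "(\<lambda>x. norm ((\<lambda>(j, l). a j * b l) x)) summable_on UNIV \<times> UNIV"
    unfolding Infinite_Sum.abs_summable_on_Sigma_iff
    using abs by (auto simp: abs_mult infsum_cmult_right' infsum_nonneg
        intro!: summable_on_cmult_right summable_on_cmult_left)
  then have prod: "(\<lambda>(j, l). \<bar>a j\<bar> * \<bar>b l\<bar>) summable_on UNIV \<times> UNIV"
    by (simp add: abs_mult case_prod_unfold)
  \<comment> \<open>Both index shifts of \<open>conv_cf\<close> reindex the same absolutely summable
    family of pairs. \<open>g l j\<close> is the frequency attached to a pair, and \<open>h\<close>
    inverts it for fixed \<open>j\<close>.\<close>
  have swap: "(\<Sum>\<^sub>\<infinity>k. (\<Sum>\<^sub>\<infinity>j. a j * b (h k j)) * cos (real_of_int k * \<xi>)) =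
      (\<Sum>\<^sub>\<infinity>j. a j * (\<Sum>\<^sub>\<infinity>l. b l * cos (real_of_int (g l j) * \<xi>)))"
    and summ: "(\<lambda>k. (\<Sum>\<^sub>\<infinity>j. a j * b (h k j)) * cos (real_of_int k * \<xi>)) summable_on UNIV"
    if hg: "!!l j. h (g l j) j = l" "!!k j. g (h k j) j = k" for h g :: "int => int => int"
  proof -
    have bij: "bij_betw (\<lambda>(k, j). (j, h k j)) (UNIV \<times> UNIV) (UNIV \<times> UNIV)"
      by (rule bij_betw_byWitness[where f' = "\<lambda>(j, l). (g l j, j)"]) (auto simp: hg)
    have "(\<lambda>(k, j). \<bar>a j\<bar> * \<bar>b (h k j)\<bar>) summable_on UNIV \<times> UNIV"
      using summable_on_reindex_bij_betw[OF bij, of "\<lambda>(j, l). \<bar>a j\<bar> * \<bar>b l\<bar>"] prod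
      by (simp add: case_prod_unfold)
    then have "(\<lambda>x. norm (case x of (k, j) => a j * b (h k j) * cos (real_of_int k * \<xi>))) summable_on UNIV \<times> UNIV"
    proof (rule summable_on_comparison_test)
      fix x :: "int \<times> int"
      show "norm (case x of (k, j) => a j * b (h k j) * cos (real_of_int k * \<xi>)) <= (case x of (k, j) => \<bar>a j\<bar> * \<bar>b (h k j)\<bar>)"
        by (auto simp: case_prod_unfold abs_mult intro!: mult_left_le)
    qed simp
    from Infinite_Sum.abs_summable_summable[OF this] have S: "(\<lambda>(k, j). a j * b (h k j) * cos (real_of_int k * \<xi>)) summable_on UNIV \<times> UNIV"
      by simp
    have "(\<lambda>k. \<Sum>\<^sub>\<infinity>j. a j * b (h k j) * cos (real_of_int k * \<xi>)) summable_on UNIV"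
      using summable_on_Sigma_banach[of "\<lambda>k j. a j * b (h k j) * cos (real_of_int k * \<xi>)" UNIV "\<lambda>_. UNIV"] S by simp
    then show "(\<lambda>k. (\<Sum>\<^sub>\<infinity>j. a j * b (h k j)) * cos (real_of_int k * \<xi>)) summable_on UNIV"
      by (simp add: infsum_cmult_left')
    have "(\<Sum>\<^sub>\<infinity>k. \<Sum>\<^sub>\<infinity>j. a j * b (h k j) * cos (real_of_int k * \<xi>)) =
        (\<Sum>\<^sub>\<infinity>j. \<Sum>\<^sub>\<infinity>k. a j * b (h k j) * cos (real_of_int k * \<xi>))"
      by (rule infsum_swap_banach[OF S])
    also have "(\<lambda>j. \<Sum>\<^sub>\<infinity>k. a j * b (h k j) * cos (real_of_int k * \<xi>)) =
        (\<lambda>j. a j * (\<Sum>\<^sub>\<infinity>l. b l * cos (real_of_int (g l j) * \<xi>)))"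
    proof
      fix j
      have bij: "bij_betw (\<lambda>l. g l j) UNIV UNIV"
        by (rule bij_betw_byWitness[where f' = "\<lambda>k. h k j"]) (auto simp: hg)
      have "(\<Sum>\<^sub>\<infinity>k. a j * b (h k j) * cos (real_of_int k * \<xi>)) = a j * (\<Sum>\<^sub>\<infinity>k. b (h k j) * cos (real_of_int k * \<xi>))"
        by (simp add: infsum_cmult_right' mult.assoc)
      also have "(\<Sum>\<^sub>\<infinity>k. b (h k j) * cos (real_of_int k * \<xi>)) = (\<Sum>\<^sub>\<infinity>l. b l * cos (real_of_int (g l j) * \<xi>))"
        using infsum_reindex_bij_betw[OF bij, of "\<lambda>k. b (h k j) * cos (real_of_int k * \<xi>)"] by (simp add: hg)
      finally show "(\<Sum>\<^sub>\<infinity>k. a j * b (h k j) * cos (real_of_int k * \<xi>)) =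
        a j * (\<Sum>\<^sub>\<infinity>l. b l * cos (real_of_int (g l j) * \<xi>))" .
    qed
    finally show "(\<Sum>\<^sub>\<infinity>k. (\<Sum>\<^sub>\<infinity>j. a j * b (h k j)) * cos (real_of_int k * \<xi>)) =
      (\<Sum>\<^sub>\<infinity>j. a j * (\<Sum>\<^sub>\<infinity>l. b l * cos (real_of_int (g l j) * \<xi>)))"
      by (simp add: infsum_cmult_left')
  qed
  have hg1: "(l + j) - j = l" "(k - j) + j = k" "(l - j) + j = l" "(k + j) - j = k" for l j k :: int by auto
  have bc: "(\<lambda>l. b l * cos (real_of_int (g l) * \<xi>)) summable_on UNIV" for g
  proof (rule summable_norm_wt(1)[of _ "norm v"])
    fix k
    show "\<bar>b k * cos (real_of_int (g k) * \<xi>)\<bar> <= norm v * (1 / wt k)"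
      using mult_mono[OF ab(2)[of k] abs_cos_le_one] by (simp add: abs_mult)
  qed
  have bcb: "\<bar>\<Sum>\<^sub>\<infinity>l. b l * cos (real_of_int (g l) * \<xi>)\<bar> <= norm v * wt_sum" for g
  proof -
    have *: "\<bar>b k * cos (real_of_int (g k) * \<xi>)\<bar> <= norm v * (1 / wt k)" for k
      using mult_mono[OF ab(2)[of k] abs_cos_le_one] by (simp add: abs_mult)
    have "norm (\<Sum>\<^sub>\<infinity>l. b l * cos (real_of_int (g l) * \<xi>)) <= (\<Sum>\<^sub>\<infinity>l. norm (b l * cos (real_of_int (g l) * \<xi>)))"
      by (rule norm_infsum_bound) (use summable_norm_wt(2)[OF *] in simp)
    also have "\<dots> <= (\<Sum>\<^sub>\<infinity>k. norm v * (1 / wt k))"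
      using * summable_norm_wt(2)[OF *] by (intro infsum_mono summable_on_cmult_right summable_inverse_wt) auto
    also have "\<dots> = norm v * wt_sum" by (subst infsum_cmult_right') (simp add: wt_sum_def)
    finally show ?thesis by simp
  qed
  have sa: "(\<lambda>j. a j * (\<Sum>\<^sub>\<infinity>l. b l * cos (real_of_int (g l j) * \<xi>))) summable_on UNIV" for g :: "int => int => int"
  proof (rule summable_norm_wt(1)[of _ "norm u * (norm v * wt_sum)"])
    fix j
    show "\<bar>a j * (\<Sum>\<^sub>\<infinity>l. b l * cos (real_of_int (g l j) * \<xi>))\<bar> <= norm u * (norm v * wt_sum) * (1 / wt j)"
      using mult_mono[OF ab(1)[of j] bcb[of "\<lambda>l. g l j"]] by (simp add: abs_mult mult_ac)
  qed
  have "ev (conv u v) \<xi> y = (\<Sum>\<^sub>\<infinity>k. 1 / 2 * ((\<Sum>\<^sub>\<infinity>j. a j * b (k - j)) * cos (real_of_int k * \<xi>)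
      + (\<Sum>\<^sub>\<infinity>j. a j * b (k + j)) * cos (real_of_int k * \<xi>)))"
    unfolding ev_def cf_conv[OF y] conv_cf_def a_def b_def by (simp add: algebra_simps)
  also have "\<dots> = 1 / 2 * ((\<Sum>\<^sub>\<infinity>k. (\<Sum>\<^sub>\<infinity>j. a j * b (k - j)) * cos (real_of_int k * \<xi>)) +
      (\<Sum>\<^sub>\<infinity>k. (\<Sum>\<^sub>\<infinity>j. a j * b (k + j)) * cos (real_of_int k * \<xi>)))"
    by (subst infsum_cmult_right', subst infsum_add)
       (auto intro!: summ[of "\<lambda>l j. l + j" "\<lambda>k j. k - j"] summ[of "\<lambda>l j. l - j" "\<lambda>k j. k + j"])
  also have "\<dots> = 1 / 2 * ((\<Sum>\<^sub>\<infinity>j. a j * (\<Sum>\<^sub>\<infinity>l. b l * cos (real_of_int (l + j) * \<xi>))) +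
      (\<Sum>\<^sub>\<infinity>j. a j * (\<Sum>\<^sub>\<infinity>l. b l * cos (real_of_int (l - j) * \<xi>))))"
    by (subst swap[of "\<lambda>l j. l + j" "\<lambda>k j. k - j"], simp, simp, subst swap[of "\<lambda>l j. l - j" "\<lambda>k j. k + j"], simp_all)
  also have "\<dots> = 1 / 2 * (\<Sum>\<^sub>\<infinity>j. a j * (\<Sum>\<^sub>\<infinity>l. b l * cos (real_of_int (l + j) * \<xi>)) +
      a j * (\<Sum>\<^sub>\<infinity>l. b l * cos (real_of_int (l - j) * \<xi>)))"
    by (subst infsum_add[OF sa sa]) simp
  also have "(\<lambda>j. a j * (\<Sum>\<^sub>\<infinity>l. b l * cos (real_of_int (l + j) * \<xi>)) +
      a j * (\<Sum>\<^sub>\<infinity>l. b l * cos (real_of_int (l - j) * \<xi>))) =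
      (\<lambda>j. 2 * (a j * cos (real_of_int j * \<xi>) * (\<Sum>\<^sub>\<infinity>l. b l * cos (real_of_int l * \<xi>))))"
  proof
    fix j
    have "(\<Sum>\<^sub>\<infinity>l. b l * cos (real_of_int (l + j) * \<xi>)) + (\<Sum>\<^sub>\<infinity>l. b l * cos (real_of_int (l - j) * \<xi>)) =
        (\<Sum>\<^sub>\<infinity>l. 2 * cos (real_of_int j * \<xi>) * (b l * cos (real_of_int l * \<xi>)))"
      by (subst infsum_add[OF bc bc, symmetric]) (simp add: cos_add cos_diff algebra_simps)
    also have "\<dots> = 2 * cos (real_of_int j * \<xi>) * (\<Sum>\<^sub>\<infinity>l. b l * cos (real_of_int l * \<xi>))"
      by (rule infsum_cmult_right')
    finally show "a j * (\<Sum>\<^sub>\<infinity>l. b l * cos (real_of_int (l + j) * \<xi>)) +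
        a j * (\<Sum>\<^sub>\<infinity>l. b l * cos (real_of_int (l - j) * \<xi>)) =
      2 * (a j * cos (real_of_int j * \<xi>) * (\<Sum>\<^sub>\<infinity>l. b l * cos (real_of_int l * \<xi>)))"
      by (simp add: distrib_left[symmetric])
  qed
  also have "1 / 2 * (\<Sum>\<^sub>\<infinity>j. 2 * (a j * cos (real_of_int j * \<xi>) * (\<Sum>\<^sub>\<infinity>l. b l * cos (real_of_int l * \<xi>))))
      = ev u \<xi> y * ev v \<xi> y"
    unfolding ev_def a_def b_def by (simp add: infsum_cmult_right' infsum_cmult_left')
  finally show ?thesis .
qed

text \<open>The domain \<open>int \<times> real\<close> of a stored series has to be a metric space
  for the series to form a Banach space. The distance is the usual one and induces the discrete
  topology.\<close>

instantiation int :: metric_space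
begin

definition dist_int :: "int => int => real" where
  "dist_int x y = real_of_int \<bar>x - y\<bar>"

definition uniformity_int :: "(int \<times> int) filter" where
  "uniformity_int = (INF e\<in>{0 <..}. principal {(x, y). dist x y < e})"

instance
proof
  fix U :: "int set"
  have "\<forall>\<^sub>F (x', y) in uniformity. x' = x --> y \<in> U" if "x \<in> U" for x
  proof -
    have "{(x, y). dist x y < 1} \<subseteq> {(x', y). x' = x --> y \<in> U}"
      using that by (auto simp: dist_int_def simp del: of_int_abs of_int_diff)
    then have "uniformity <= principal {(x', y). x' = x --> y \<in> U}"
      unfolding uniformity_int_def by (intro INF_lower2[of 1]) auto
    then show ?thesis by (simp only: le_principal mem_Collect_eq)
  qed
  then show "open U = (\<forall>x\<in>U. \<forall>\<^sub>F (x', y) in uniformity. x' = x --> y \<in> U)"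
    by (auto intro: open_discrete)
qed (auto simp: dist_int_def uniformity_int_def)

end

instance bcontfun :: (metric_space, banach) banach ..

section \<open>Symmetric series and the nonlinear remainder\<close>

text \<open>Evenness in \<open>k\<close> lets the modes \<open>k\<close> and \<open>- k\<close>
  share one equation. Symmetry under \<open>y \<mapsto> 1 - y\<close> will keep the stagnation
  points on the centre line.\<close>

definition even_sym :: "cosine_series set" where
  "even_sym = {f. \<forall>k. \<forall>y\<in>{0..1}. cf f (- k) y = cf f k y & cf f k (1 - y) = cf f k y}"

lemma even_symI:
  assumes "!!k y. y \<in> {0..1} ==> cf f (- k) y = cf f k y"
    "!!k y. y \<in> {0..1} ==> cf f k (1 - y) = cf f k y"
  shows "f \<in> even_sym"
  using assms by (auto simp: even_sym_def)

lemma even_symD: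
  assumes "f \<in> even_sym" "y \<in> {0..1}"
  shows "cf f (- k) y = cf f k y" "cf f k (1 - y) = cf f k y"
  using assms by (auto simp: even_sym_def)

lemma subspace_even_sym: "subspace even_sym"
  by (rule subspaceI) (auto simp: even_sym_def cf_add cf_scaleR)

lemma closed_even_sym: "closed even_sym"
proof -
  have eq: "even_sym = (\<Inter>k. \<Inter>y\<in>{0..1}. {f. cf f (- k) y = cf f k y} \<inter> {f. cf f k (1 - y) = cf f k y})"
    by (auto simp: even_sym_def)
  have cl: "closed {f. cf f k y = cf f l z}" for k l y z
    by (intro closed_Collect_eq linear_continuous_on bounded_linear_cf)
  show ?thesis unfolding eq by (intro closed_INT ballI closed_Int cl)
qed

definition zmul :: "(real => real) => cosine_series => cosine_series" where
  "zmul c f = series_of (\<lambda>k y. c y * cf f k y)"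

lemma wt_bounded_zmul:
  assumes "cont01 c" "!!y. y \<in> {0..1} ==> \<bar>c y\<bar> <= B"
  shows "wt_bounded (B * norm f) (\<lambda>k y. c y * cf f k y)"
proof (rule wt_boundedI)
  show "cont01 (\<lambda>y. c y * cf f k y)" for k
    by (intro continuous_intros assms continuous_on_cf)
  fix k and y :: real assume "y \<in> {0..1}"
  then have "\<bar>c y\<bar> * (wt k * \<bar>cf f k y\<bar>) <= B * norm f"
    using assms(2)[of y] by (intro mult_mono wt_cf_le_norm) auto
  then show "wt k * \<bar>c y * cf f k y\<bar> <= B * norm f" by (simp add: abs_mult mult_ac)
qed

text \<open>The exponent is shifted: \<open>zpow u i\<close> represents the power
  \<open>i + 1\<close>, so that no constant series is needed to start.\<close>

primrec zpow :: "cosine_series => nat => cosine_series" where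
  "zpow u 0 = u"
| "zpow u (Suc i) = conv u (zpow u i)"

lemma conv_0 [simp]: "conv 0 v = 0" "conv u 0 = 0"
  using conv_diff(1)[of 0 0 v] conv_diff(2)[of u 0 0] by simp_all

lemma zpow_0 [simp]: "zpow 0 i = 0" by (induction i) auto

lemma ev_zpow: "y \<in> {0..1} ==> ev (zpow u i) \<xi> y = ev u \<xi> y ^ Suc i"
  by (induction i) (simp_all add: ev_conv)

lemma norm_zpow:
  assumes "norm u <= R"
  shows "norm (zpow u i) <= (conv_const * R) ^ i * R"
proof (induction i)
  case (Suc i)
  have R: "0 <= R" using assms norm_ge_zero[of u] by linarith
  have "norm (zpow u (Suc i)) <= conv_const * norm u * norm (zpow u i)" using norm_conv by simp
  also have "\<dots> <= conv_const * R * ((conv_const * R) ^ i * R)"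
    using conv_const_pos assms R Suc by (intro mult_mono) auto
  finally show ?case by (simp add: mult_ac)
qed (use assms in simp)

text \<open>Telescoping one factor at a time; the factor \<open>real i + 1\<close> is that of the
  derivative of a power.\<close>

lemma norm_zpow_diff:
  assumes "norm u <= R" "norm v <= R"
  shows "norm (zpow u i - zpow v i) <= (real i + 1) * (conv_const * R) ^ i * norm (u - v)"
proof (induction i)
  case (Suc i)
  have R: "0 <= R" using assms norm_ge_zero[of u] by linarith
  have "zpow u (Suc i) - zpow v (Suc i) = conv (u - v) (zpow u i) + conv v (zpow u i - zpow v i)"
    by (simp add: conv_diff)
  also have "norm \<dots> <= conv_const * norm (u - v) * norm (zpow u i) + conv_const * norm v * norm (zpow u i - zpow v i)"
    by (intro order_trans[OF norm_triangle_ineq] add_mono norm_conv)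
  also have "\<dots> <= conv_const * norm (u - v) * ((conv_const * R) ^ i * R)
      + conv_const * R * ((real i + 1) * (conv_const * R) ^ i * norm (u - v))"
    using conv_const_pos assms R Suc norm_zpow[OF assms(1), of i] by (intro add_mono mult_mono) auto
  also have "\<dots> = (real (Suc i) + 1) * (conv_const * R) ^ Suc i * norm (u - v)"
    by (simp add: algebra_simps)
  finally show ?case .
qed simp

lemma cf_zmul:
  assumes "cont01 c" "y \<in> {0..1}"
  shows "cf (zmul c f) k y = c y * cf f k y"
proof -
  obtain B where "!!y. y \<in> {0..1} ==> \<bar>c y\<bar> <= B" using bounded_abs_on_unit_interval[OF assms(1)] by blast
  from cf_series_of[OF wt_bounded_zmul[OF assms(1) this]] show ?thesis
    using assms(2) by (simp add: zmul_def)
qed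

lemma ev_zmul:
  assumes "cont01 c" "y \<in> {0..1}"
  shows "ev (zmul c f) \<xi> y = c y * ev f \<xi> y"
  unfolding ev_def cf_zmul[OF assms] by (simp add: mult.assoc infsum_cmult_right')

lemma norm_zmul:
  assumes "cont01 c" "!!y. y \<in> {0..1} ==> \<bar>c y\<bar> <= B"
  shows "norm (zmul c f) <= B * norm f"
  unfolding zmul_def by (rule norm_series_of[OF wt_bounded_zmul[OF assms]])

lemma zmul_diff:
  assumes "cont01 c"
  shows "zmul c f - zmul c g = zmul c (f - g)"
proof -
  obtain B where B: "!!y. y \<in> {0..1} ==> \<bar>c y\<bar> <= B" using bounded_abs_on_unit_interval[OF assms] by blast
  have "cf (zmul c h) k y = c (unit_clamp y) * cf h k (unit_clamp y)" for h k y
    unfolding zmul_def by (rule cf_series_of[OF wt_bounded_zmul[OF assms B]])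
  then show ?thesis by (intro series_eqI) (simp add: cf_diff algebra_simps)
qed

lemma even_sym_conv:
  assumes "u \<in> even_sym" "v \<in> even_sym"
  shows "conv u v \<in> even_sym"
proof (rule even_symI)
  fix k y assume y: "y \<in> {0..1::real}"
  then have y': "1 - y \<in> {0..1}" by auto
  have "cf v (- k - j) y = cf v (k + j) y" "cf v (- k + j) y = cf v (k - j) y" for j
  proof -
    have "- k - j = - (k + j)" "- k + j = - (k - j)" by simp_all
    then show "cf v (- k - j) y = cf v (k + j) y" "cf v (- k + j) y = cf v (k - j) y"
      by (simp_all only: even_symD(1)[OF assms(2) y])
  qed
  then show "cf (conv u v) (- k) y = cf (conv u v) k y"
    by (simp add: cf_conv[OF y] conv_cf_def add.commute)
  show "cf (conv u v) k (1 - y) = cf (conv u v) k y"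
    by (simp add: cf_conv[OF y] cf_conv[OF y'] conv_cf_def even_symD(2)[OF assms(1) y] even_symD(2)[OF assms(2) y])
qed

lemma even_sym_zpow: "u \<in> even_sym ==> zpow u i \<in> even_sym"
  by (induction i) (auto intro: even_sym_conv)

text \<open>The linear factor from differences of powers is absorbed by weakening the ratio 1/2 to
  3/4.\<close>

lemma bernoulli_geometric: "(real i + 2) * (1 / 2) ^ i <= 2 * (3 / 4) ^ i"
proof -
  have "1 + real i * (1 / 2) <= (1 + 1 / 2) ^ i" by (rule Bernoulli_inequality) simp
  then have "(2 + real i) * (1 / 2) ^ i <= (2 * (3 / 2) ^ i) * (1 / 2) ^ i"
    by (intro mult_right_mono) auto
  also have "\<dots> = 2 * (3 / 4) ^ i" by (simp add: power_mult_distrib[symmetric] mult.assoc)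
  finally show ?thesis by (simp add: add.commute)
qed

text \<open>\<open>N\<close> is the Taylor remainder of second order of the vorticity function along
  the shear, realised as a series of convolution powers. Since it starts quadratically, its
  Lipschitz constant on a ball is proportional to the radius.\<close>

theorem nonlinear_operator:
  fixes c :: "nat => real => real"
  assumes cc: "!!i. cont01 (c i)" and r: "0 < r" and M: "0 < M"
    and cb: "!!i y. y \<in> {0..1} ==> \<bar>c i y\<bar> <= M / r ^ i"
  obtains N \<rho> C where "0 < \<rho>" "0 < C" "N 0 = 0"
    "!!u v R. norm u <= R ==> norm v <= R ==> R <= \<rho> ==> norm (N u - N v) <= C * R * norm (u - v)"
    "!!u \<xi> y. norm u <= \<rho> ==> \<bar>ev u \<xi> y\<bar> <= r / 2"
    "!!u \<xi> y. norm u <= \<rho> ==> y \<in> {0..1} ==> (\<lambda>i. c (i + 2) y * ev u \<xi> y ^ (i + 2)) sums ev (N u) \<xi> y"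
    "!!u. (!!i y. y \<in> {0..1} ==> c i (1 - y) = c i y) ==> u \<in> even_sym ==> norm u <= \<rho> ==> N u \<in> even_sym"
proof -
  define K where "K = conv_const"
  have K: "0 < K" using conv_const_pos by (simp add: K_def)
  define t where "t i u = zmul (c (i + 2)) (zpow u (Suc i))" for i u
  define N where "N u = (\<Sum>i. t i u)" for u
  \<comment> \<open>The first bound makes the convolution powers converge like powers of one half,
    the second keeps the pointwise values inside half the radius of the Taylor series.\<close>
  define \<rho> where "\<rho> = min (r / (2 * K)) (r / (2 * wt_sum))"
  have \<rho>: "0 < \<rho>" using r K wt_sum_pos by (simp add: \<rho>_def)
  define C where "C = 8 * M * K / r\<^sup>2"
  have C: "0 < C" using M K r by (simp add: C_def)
  have t0 [simp]: "t i 0 = 0" for i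
    using zmul_diff[OF cc, of _ 0 0] by (simp add: t_def)
  have td: "norm (t i u - t i v) <= C / 4 * R * norm (u - v) * (3 / 4) ^ i"
    if "norm u <= R" "norm v <= R" "R <= \<rho>" for i u v R
  proof -
    have R: "0 <= R" using that norm_ge_zero[of u] by linarith
    have "R <= r / (2 * K)" using that by (simp add: \<rho>_def)
    then have KR: "K * R <= r / 2" using K by (simp add: field_simps)
    have "norm (t i u - t i v) <= M / r ^ (i + 2) * norm (zpow u (Suc i) - zpow v (Suc i))"
      unfolding t_def zmul_diff[OF cc] by (intro norm_zmul cc cb)
    also have "\<dots> <= M / r ^ (i + 2) * ((real (Suc i) + 1) * (K * R) ^ Suc i * norm (u - v))"
      using norm_zpow_diff[OF that(1,2), of "Suc i"] M r unfolding K_def by (intro mult_left_mono) auto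
    also have "\<dots> = M / r ^ (i + 2) * (K * R) * norm (u - v) * ((real i + 2) * (K * R) ^ i)" by (simp add: mult_ac)
    also have "\<dots> <= M / r ^ (i + 2) * (K * R) * norm (u - v) * ((real i + 2) * (r / 2) ^ i)"
      using M r K R KR by (intro mult_left_mono power_mono) auto
    also have "\<dots> = M * K / r\<^sup>2 * R * norm (u - v) * ((real i + 2) * (1 / 2) ^ i)"
      using r by (simp add: power_divide power_add power2_eq_square field_simps)
    also have "\<dots> <= M * K / r\<^sup>2 * R * norm (u - v) * (2 * (3 / 4) ^ i)"
      using M K R by (intro mult_left_mono bernoulli_geometric) auto
    finally show ?thesis by (simp add: C_def mult_ac)
  qed
  have geo: "(\<lambda>i. B * (3 / 4) ^ i) sums (B * 4)" for B :: real
    using sums_mult[OF geometric_sums[of "3 / 4 :: real"], of B] by simp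
  have sd: "summable (\<lambda>i. t i u - t i v)" "norm (\<Sum>i. t i u - t i v) <= C * R * norm (u - v)"
    if "norm u <= R" "norm v <= R" "R <= \<rho>" for u v R
  proof -
    note g = geo[of "C / 4 * R * norm (u - v)"]
    have n: "summable (\<lambda>i. norm (t i u - t i v))"
      by (rule summable_comparison_test'[OF sums_summable[OF g], of 0]) (use td[OF that] in simp)
    then show "summable (\<lambda>i. t i u - t i v)" by (rule summable_norm_cancel)
    have "norm (\<Sum>i. t i u - t i v) <= (\<Sum>i. norm (t i u - t i v))" by (rule summable_norm[OF n])
    also have "\<dots> <= (\<Sum>i. C / 4 * R * norm (u - v) * (3 / 4) ^ i)"
      by (rule suminf_le[OF _ n sums_summable[OF g]]) (rule td[OF that])
    also have "\<dots> = C * R * norm (u - v)" using sums_unique[OF g] by simp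
    finally show "norm (\<Sum>i. t i u - t i v) <= C * R * norm (u - v)" .
  qed
  have st: "summable (\<lambda>i. t i u)" if "norm u <= \<rho>" for u
    using sd(1)[of u \<rho> 0] that \<rho> by simp
  have tz: "(\<lambda>i. t i u) sums N u" if "norm u <= \<rho>" for u
    unfolding N_def using st[OF that] by (rule summable_sums)
  show ?thesis
  proof (rule that[OF \<rho> C, of N])
    show "N 0 = 0" by (simp add: N_def)
    show "norm (N u - N v) <= C * R * norm (u - v)" if "norm u <= R" "norm v <= R" "R <= \<rho>" for u v R
      using sd(2)[OF that] st[of u] st[of v] that by (simp add: N_def suminf_diff)
    show "\<bar>ev u \<xi> y\<bar> <= r / 2" if "norm u <= \<rho>" for u \<xi> y
    proof -
      have "wt_sum * norm u <= wt_sum * (r / (2 * wt_sum))"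
        using that wt_sum_pos by (intro mult_left_mono) (auto simp: \<rho>_def)
      then show ?thesis using ev_bound[of u \<xi> y] wt_sum_pos by simp
    qed
    show "(\<lambda>i. c (i + 2) y * ev u \<xi> y ^ (i + 2)) sums ev (N u) \<xi> y" if "norm u <= \<rho>" "y \<in> {0..1}" for u \<xi> y
      using bounded_linear.sums[OF bounded_linear_ev tz[OF that(1)], of \<xi> y]
      by (simp add: t_def ev_zmul[OF cc that(2)] ev_conv[OF that(2)] ev_zpow[OF that(2)])
    show "N u \<in> even_sym"
      if ce: "!!i y. y \<in> {0..1} ==> c i (1 - y) = c i y" and u: "u \<in> even_sym" and nu: "norm u <= \<rho>" for u
    proof (rule even_symI)
      fix k and y :: real assume y: "y \<in> {0..1}"
      then have y': "1 - y \<in> {0..1}" by auto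
      have s: "(\<lambda>i. cf (t i u) l z) sums cf (N u) l z" for l z
        using bounded_linear.sums[OF bounded_linear_cf tz[OF nu]] .
      have "cf (t i u) (- k) y = cf (t i u) k y" "cf (t i u) k (1 - y) = cf (t i u) k y" for i
        using even_symD[OF even_sym_zpow[OF u] y, where i1 = "Suc i"]
        unfolding t_def cf_zmul[OF cc y] cf_zmul[OF cc y'] ce[OF y] by simp_all
      then show "cf (N u) (- k) y = cf (N u) k y" "cf (N u) k (1 - y) = cf (N u) k y"
        using s[of "- k" y] s[of k y] s[of k "1 - y"] by (simp_all add: sums_unique2)
    qed
  qed
qed

section \<open>The vorticity function of the shear\<close>

definition psi0 :: "real => nat => real => real" where
  "psi0 A n y = 1 / 2 * (y - 1 / 2)\<^sup>2 + phi_star A n y"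

lemma cos_csqrt_square: "cos (csqrt (z\<^sup>2)) = cos z"
proof -
  have "(csqrt (z\<^sup>2))\<^sup>2 = z\<^sup>2" by simp
  then have "csqrt (z\<^sup>2) = z \<or> csqrt (z\<^sup>2) = - z" by (simp only: power2_eq_iff)
  then show ?thesis by auto
qed

text \<open>The square root has a branch cut, but cosine is even: its series in
  \<open>csqrt w\<close> contains only even powers and is therefore a power series in
  \<open>w\<close>.\<close>

lemma cos_csqrt_holomorphic: "(\<lambda>w. cos (csqrt w)) holomorphic_on UNIV"
proof -
  have *: "(\<lambda>j. of_real (cos_coeff (2 * j)) * (w - 0) ^ j) sums cos (csqrt w)" for w :: complex
  proof -
    have "(\<lambda>j. cos_coeff (2 * j) *\<^sub>R csqrt w ^ (2 * j)) sums cos (csqrt w)"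
    proof (subst sums_mono_reindex[of "\<lambda>j. 2 * j" "\<lambda>j. cos_coeff j *\<^sub>R csqrt w ^ j"])
      show "strict_mono (\<lambda>j::nat. 2 * j)" by (auto simp: strict_mono_def)
      show "cos_coeff j *\<^sub>R csqrt w ^ j = 0" if "j \<notin> range (\<lambda>j. 2 * j)" for j
        using that by (auto simp: cos_coeff_def dvd_def)
    qed (rule cos_converges)
    then show ?thesis by (simp add: power_mult scaleR_conv_of_real)
  qed
  have "(\<lambda>w. cos (csqrt w)) holomorphic_on ball 0 R" for R
    by (rule power_series_holomorphic) (rule *)
  then have "(\<lambda>w. cos (csqrt w)) field_differentiable (at w)" for w
    using holomorphic_on_imp_differentiable_at[of "\<lambda>w. cos (csqrt w)" "ball 0 (norm w + 1)" w] by simp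
  then show ?thesis by (simp add: holomorphic_on_open field_differentiable_def)
qed

text \<open>The Noshiro-Warschawski theorem.\<close>

lemma inj_on_Re_deriv_pos:
  assumes f: "f holomorphic_on S" "open S" and S: "convex S" and pos: "!!z. z \<in> S ==> 0 < Re (deriv f z)"
  shows "inj_on f S"
proof (rule inj_onI, rule ccontr)
  fix w z assume w: "w \<in> S" and z: "z \<in> S" and eq: "f w = f z" and ne: "w \<noteq> z"
  define d where "d = z - w"
  have d: "d \<noteq> 0" using ne by (simp add: d_def)
  define g where "g t = Re (f (w + of_real t * d) / d)" for t
  have "g 0 < g 1"
  proof (rule DERIV_pos_imp_increasing[of 0 1 g])
    fix t :: real assume t: "0 <= t" "t <= 1"
    have "(1 - t) *\<^sub>R w + t *\<^sub>R z \<in> S" using S w z t by (intro convexD) auto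
    also have "(1 - t) *\<^sub>R w + t *\<^sub>R z = w + of_real t * d" by (simp add: d_def scaleR_conv_of_real algebra_simps)
    finally have p: "w + of_real t * d \<in> S" .
    have "(f has_field_derivative deriv f (w + of_real t * d)) (at (w + of_real t * d))"
      using holomorphic_derivI[OF f p] .
    moreover have "((\<lambda>t. w + of_real t * d) has_vector_derivative d) (at t)"
      by (auto intro!: derivative_eq_intros simp: has_vector_derivative_def fun_eq_iff scaleR_conv_of_real)
    ultimately have "((\<lambda>t. f (w + of_real t * d)) has_vector_derivative d * deriv f (w + of_real t * d)) (at t)"
      using field_vector_diff_chain_at[of "\<lambda>t. w + of_real t * d" d t f] by (simp add: o_def)
    then have "((\<lambda>t. f (w + of_real t * d) / d) has_vector_derivative d * deriv f (w + of_real t * d) / d) (at t)"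
      by (rule has_vector_derivative_divide)
    then have "(g has_real_derivative Re (deriv f (w + of_real t * d))) (at t)"
      unfolding g_def has_real_derivative_iff_has_vector_derivative
      using bounded_linear.has_vector_derivative[OF bounded_linear_Re] d by fastforce
    then show "\<exists>y. DERIV g t :> y & 0 < y" using pos[OF p] by blast
  qed simp
  then show False using eq by (simp add: g_def d_def)
qed

text \<open>The sum of a convex compact set and a small ball stays convex. Convexity is wanted
  because injectivity is derived by integrating a derivative along segments.\<close>

lemma convex_open_neighbourhood:
  fixes T :: "'a::euclidean_space set"
  assumes "compact T" "convex T" "open U" "T \<subseteq> U"
  obtains S where "open S" "convex S" "T \<subseteq> S" "S \<subseteq> U"
proof -
  obtain e where e: "0 < e" "(\<Union>x\<in>T. ball x e) \<subseteq> U"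
    using compact_subset_open_imp_ball_epsilon_subset[OF assms(1,3,4)] by blast
  define S where "S = (\<Union>x\<in>T. \<Union>y\<in>ball 0 e. {x + y})"
  have eq: "S = (\<Union>x\<in>T. ball x e)"
  proof (intro equalityI subsetI)
    fix z assume "z \<in> (\<Union>x\<in>T. ball x e)"
    then obtain x where "x \<in> T" "dist x z < e" by auto
    then show "z \<in> S" unfolding S_def
      by (intro UN_I[of x] UN_I[of "z - x"]) (auto simp: dist_norm norm_minus_commute)
  next
    fix z assume "z \<in> S"
    then obtain x b where "x \<in> T" "norm b < e" "z = x + b" unfolding S_def by auto
    then show "z \<in> (\<Union>x\<in>T. ball x e)" by (intro UN_I[of x]) (auto simp: dist_norm)
  qed
  show ?thesis
  proof (rule that[of S])
    show "open S" unfolding eq by auto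
    show "convex S" unfolding S_def by (intro convex_sums assms convex_ball)
    show "T \<subseteq> S" unfolding eq using e by auto
    show "S \<subseteq> U" unfolding eq by (rule e)
  qed
qed

lemma derivative_shear:
  "(shear A n has_real_derivative 1 + A / real n * (cos (4 * real n * pi * y) * (4 * real n * pi))) (at y)"
  "((\<lambda>y. 1 + A / real n * (cos (4 * real n * pi * y) * (4 * real n * pi))) has_real_derivative
     - (A / real n * (sin (4 * real n * pi * y) * (4 * real n * pi) * (4 * real n * pi)))) (at y)"
  unfolding shear_def [abs_def] by (auto intro!: derivative_eq_intros)

lemma deriv2_shear:
  "(deriv ^^ 2) (shear A n) y = - (A / real n * (sin (4 * real n * pi * y) * (4 * real n * pi) * (4 * real n * pi)))"
proof -
  have eq: "deriv (shear A n) = (\<lambda>y. 1 + A / real n * (cos (4 * real n * pi * y) * (4 * real n * pi)))"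
    by (intro ext DERIV_imp_deriv derivative_shear)
  have "(deriv ^^ 2) (shear A n) y = deriv (deriv (shear A n)) y" by (simp add: numeral_2_eq_2)
  then show ?thesis by (simp only: eq DERIV_imp_deriv[OF derivative_shear(2)])
qed

lemma derivative_psi0:
  assumes "1 <= n"
  shows "(psi0 A n has_real_derivative shear A n y - 1 / 2) (at y)"
  unfolding psi0_def [abs_def] phi_star_def shear_def using assms
  by (auto intro!: derivative_eq_intros simp: field_simps power2_eq_square)

lemma sin_shift: "sin (4 * real n * pi * (y - 1 / 2)) = sin (4 * real n * pi * y)"
  and cos_shift: "cos (4 * real n * pi * (y - 1 / 2)) = cos (4 * real n * pi * y)"
proof -
  have *: "4 * real n * pi * (y - 1 / 2) = 4 * real n * pi * y - 2 * real n * pi" by (simp add: algebra_simps)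
  show "sin (4 * real n * pi * (y - 1 / 2)) = sin (4 * real n * pi * y)"
    and "cos (4 * real n * pi * (y - 1 / 2)) = cos (4 * real n * pi * y)"
    unfolding * sin_diff cos_diff by simp_all
qed

text \<open>The oscillating part is at most \<open>4 * pi * A * \<bar>y - 1 / 2\<bar>\<close>, hence
  strictly smaller than the linear part away from the centre.\<close>

lemma shear_centre:
  assumes "0 < A" "A < 1 / (4 * pi)" "1 <= n" "y \<noteq> 1 / 2"
  shows "shear A n y \<noteq> 1 / 2"
proof
  assume eq: "shear A n y = 1 / 2"
  define x where "x = y - 1 / 2"
  have "\<bar>A / real n * sin (4 * real n * pi * x)\<bar> <= A / real n * \<bar>4 * real n * pi * x\<bar>"
    unfolding abs_mult[of "A / real n"] using assms abs_sin_x_le_abs_x[of "4 * real n * pi * x"]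
    by (intro mult_mono) auto
  also have "\<dots> = 4 * pi * A * \<bar>x\<bar>" using assms by (simp add: abs_mult)
  also have "\<dots> < 1 * \<bar>x\<bar>"
    using assms by (intro mult_strict_right_mono) (auto simp: x_def field_simps)
  finally have "\<bar>A / real n * sin (4 * real n * pi * y)\<bar> < \<bar>x\<bar>" by (simp add: x_def sin_shift)
  moreover have "A / real n * sin (4 * real n * pi * y) = - x" using eq unfolding shear_def x_def by linarith
  ultimately show False by (metis abs_minus_cancel less_irrefl)
qed

lemma psi0_reflect: "psi0 A n (1 - y) = psi0 A n y"
proof -
  have "cos (4 * real n * pi * (1 - y)) = cos (4 * real n * pi * ((1 - y) - 1 / 2))" by (simp only: cos_shift)
  also have "4 * real n * pi * ((1 - y) - 1 / 2) = - (4 * real n * pi * (y - 1 / 2))" by (simp add: algebra_simps)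
  also have "cos \<dots> = cos (4 * real n * pi * y)" by (simp only: cos_minus cos_shift)
  finally show ?thesis by (simp add: psi0_def phi_star_def power2_eq_square algebra_simps)
qed

text \<open>In the variable \<open>w = (y - 1/2)\<^sup>2\<close> both the relative stream function of the shear and its vorticity are
  entire, and the derivative of the former does not vanish for \<open>w \<ge> 0\<close>. Eliminating \<open>w\<close> gives a vorticity
  function that is holomorphic near the range of the stream function, including the value at the
  centre line.\<close>

lemma vorticity_function_holomorphic:
  assumes A: "0 < A" "A < 1 / (4 * pi)" and n: "1 <= n"
  obtains f :: "complex => complex" and U where "open U" "f holomorphic_on U"
    "!!y. y \<in> {-1/2..3/2} ==> of_real (psi0 A n y) \<in> U"
    "!!y. y \<in> {-1/2..3/2} ==> f (of_real (psi0 A n y)) = of_real (1 + 4 * pi * A * cos (4 * real n * pi * y))"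
proof -
  define k where "k = 4 * real n * pi"
  have k: "0 < k" using n by (simp add: k_def)
  define a where "a = A / (4 * (real n)\<^sup>2 * pi)"
  have a: "0 < a" using A n by (simp add: a_def)
  have ak: "a * k * k = 4 * pi * A" using n by (simp add: a_def k_def field_simps power2_eq_square)
  define E where "E w = cos (csqrt (of_real (k * k) * w))" for w
  have E_hol: "E holomorphic_on UNIV"
    unfolding E_def using holomorphic_on_compose[of "\<lambda>w. of_real (k * k) * w" UNIV "\<lambda>w. cos (csqrt w)"]
      holomorphic_on_subset[OF cos_csqrt_holomorphic] by (simp add: o_def holomorphic_intros)
  have E_sq: "E (z\<^sup>2) = cos (of_real k * z)" for z
    using cos_csqrt_square[of "of_real k * z"] by (simp add: E_def power2_eq_square mult_ac)
  have E_real: "E (of_real (x\<^sup>2)) = of_real (cos (k * x))" for x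
    using E_sq[of "of_real x", unfolded of_real_power[symmetric] of_real_mult[symmetric] cos_of_real] .
  define P where "P w = w / 2 + of_real a - of_real a * E w" for w
  have P_hol: "P holomorphic_on UNIV" unfolding P_def by (intro holomorphic_intros E_hol) auto
  have P_der: "(P has_field_derivative deriv P w) (at w)" for w
    using holomorphic_derivI[OF P_hol open_UNIV] by simp
  \<comment> \<open>The function \<open>P (z\<^sup>2)\<close> is differentiated in two ways: by the
    chain rule, and after rewriting \<open>E (z\<^sup>2)\<close> as a cosine.\<close>
  have P': "deriv P (z\<^sup>2) * (2 * z) = z + of_real (a * k) * sin (of_real k * z)" for z
  proof -
    have "((\<lambda>z. P (z\<^sup>2)) has_field_derivative deriv P (z\<^sup>2) * (2 * z)) (at z)"
      by (rule DERIV_chain2[OF P_der]) (auto intro!: derivative_eq_intros)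
    moreover have "((\<lambda>z. P (z\<^sup>2)) has_field_derivative z + of_real (a * k) * sin (of_real k * z)) (at z)"
      unfolding P_def E_sq by (auto intro!: derivative_eq_intros)
    ultimately show ?thesis by (rule DERIV_unique)
  qed
  \<comment> \<open>For \<open>t = x\<^sup>2 > 0\<close> the derivative is
    \<open>1 / 2 + a * k * sin (k * x) / (2 * x)\<close>. The inequality
    \<open>\<bar>sin (k * x)\<bar> \<le> k * x\<close> together with
    \<open>a * k * k = 4 * pi * A\<close> yields this lower bound.\<close>
  define m where "m = 1 / 2 - 2 * pi * A"
  have m: "0 < m" using A by (simp add: m_def field_simps)
  have Re_pos0: "m <= Re (deriv P (of_real t))" if t: "0 < t" for t :: real
  proof -
    define x where "x = sqrt t"
    have x: "0 < x" "t = x\<^sup>2" using t by (auto simp: x_def)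
    have "deriv P (of_real t) * of_real (2 * x) = of_real (x + a * k * sin (k * x))"
      using P'[of "of_real x", unfolded of_real_mult[symmetric] of_real_power[symmetric] sin_of_real] x by simp
    then have "deriv P (of_real t) = of_real (x + a * k * sin (k * x)) / of_real (2 * x)"
      using x by (metis nonzero_mult_div_cancel_right of_real_eq_0_iff mult_eq_0_iff less_irrefl zero_neq_numeral)
    also have "\<dots> = of_real ((x + a * k * sin (k * x)) / (2 * x))" by simp
    also have "(x + a * k * sin (k * x)) / (2 * x) = 1 / 2 + a * k * sin (k * x) / (2 * x)"
      using x by (simp add: add_divide_distrib)
    finally have "deriv P (of_real t) = of_real (1 / 2 + a * k * sin (k * x) / (2 * x))" .
    then have "Re (deriv P (of_real t)) = 1 / 2 + a * k * sin (k * x) / (2 * x)" by (simp only: Re_complex_of_real)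
    moreover have "\<bar>a * k * sin (k * x) / (2 * x)\<bar> <= a * k * (k * x) / (2 * x)"
    proof -
      have "\<bar>a * k * sin (k * x) / (2 * x)\<bar> = a * k * \<bar>sin (k * x)\<bar> / (2 * x)"
        using a k x by (simp add: abs_mult)
      also have "\<dots> <= a * k * (k * x) / (2 * x)"
        using abs_sin_x_le_abs_x[of "k * x"] a k x by (intro divide_right_mono mult_left_mono) auto
      finally show ?thesis .
    qed
    moreover have "a * k * (k * x) / (2 * x) = 2 * pi * A" using ak x by simp
    ultimately show ?thesis unfolding m_def by linarith
  qed
  \<comment> \<open>At \<open>t = 0\<close> the quotient formula breaks down, and the bound is
    carried over by continuity of the derivative.\<close>
  have Re_pos: "0 < Re (deriv P (of_real t))" if "0 <= t" for t :: real
  proof (cases "t = 0")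
    case True
    have "continuous_on UNIV (deriv P)"
      by (intro holomorphic_on_imp_continuous_on holomorphic_deriv P_hol) auto
    then have "isCont (\<lambda>t. Re (deriv P (of_real t))) (0 :: real)"
      by (intro continuous_Re continuous_at_compose[of 0 of_real "deriv P", unfolded o_def])
         (auto simp: continuous_on_eq_continuous_at)
    then have "((\<lambda>t. Re (deriv P (of_real t))) \<longlongrightarrow> Re (deriv P (of_real 0))) (at_right (0::real))"
      unfolding isCont_def by (rule tendsto_within_subset) simp
    then have "m <= Re (deriv P (of_real 0))"
      by (rule tendsto_lowerbound) (auto simp: eventually_at_right_field Re_pos0 intro!: exI[of _ 1])
    then show ?thesis using m True by simp
  next
    case False
    then show ?thesis using Re_pos0[of t] that m by simp
  qed
  \<comment> \<open>This segment contains all values \<open>(y - 1 / 2)\<^sup>2\<close> for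
    \<open>y\<close> from -1/2 to 3/2. That range is larger than \<open>{0..1}\<close> so that the
    walls are interior points, where derivatives in \<open>y\<close> are two-sided.\<close>
  define T where "T = complex_of_real ` {0..1}"
  have T: "compact T" "convex T"
    unfolding T_def by (auto intro!: compact_continuous_image continuous_intros convex_linear_image linear_of_real)
  have "open {w. 0 < Re (deriv P w)}"
    by (intro open_Collect_less continuous_on_Re continuous_on_const holomorphic_on_imp_continuous_on
        holomorphic_deriv P_hol) auto
  moreover have "T \<subseteq> {w. 0 < Re (deriv P w)}" using Re_pos by (auto simp: T_def)
  ultimately obtain S where S: "open S" "convex S" "T \<subseteq> S" "S \<subseteq> {w. 0 < Re (deriv P w)}"
    using convex_open_neighbourhood[OF T] by metis
  have PS: "P holomorphic_on S" using P_hol by (rule holomorphic_on_subset) simp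
  have inj: "inj_on P S" using S by (intro inj_on_Re_deriv_pos PS) auto
  obtain g where g: "g holomorphic_on (P ` S)" "!!z. z \<in> S ==> g (P z) = z"
    using holomorphic_has_inverse[OF PS S(1) inj] by metis
  \<comment> \<open>The inverse \<open>g\<close> recovers \<open>(y - 1 / 2)\<^sup>2\<close> from
    the stream function, and the vorticity is entire in that variable.\<close>
  define f where "f z = 1 + of_real (4 * pi * A) * E (g z)" for z
  have point: "of_real (psi0 A n y) = P (of_real ((y - 1 / 2)\<^sup>2)) & of_real ((y - 1 / 2)\<^sup>2) \<in> S"
    if y: "y \<in> {-1/2..3/2}" for y
  proof
    have "P (of_real ((y - 1 / 2)\<^sup>2)) = of_real ((y - 1 / 2)\<^sup>2 / 2 + a - a * cos (k * (y - 1 / 2)))"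
      unfolding P_def E_real by simp
    then show "of_real (psi0 A n y) = P (of_real ((y - 1 / 2)\<^sup>2))"
      by (simp add: psi0_def phi_star_def k_def cos_shift a_def)
    have "\<bar>y - 1 / 2\<bar> <= 1" using y by auto
    then have "(y - 1 / 2)\<^sup>2 <= 1" by (simp add: abs_square_le_1)
    then have "of_real ((y - 1 / 2)\<^sup>2) \<in> T" unfolding T_def by (intro imageI) auto
    then show "of_real ((y - 1 / 2)\<^sup>2) \<in> S" using S by blast
  qed
  show ?thesis
  proof (rule that[of "P ` S" f])
    show "open (P ` S)" by (rule open_mapping_thm3[OF PS S(1) inj])
    show "f holomorphic_on P ` S" unfolding f_def
      using holomorphic_on_compose[OF g(1), of E] holomorphic_on_subset[OF E_hol]
      by (auto simp: o_def intro!: holomorphic_intros)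
    fix y :: real assume y: "y \<in> {-1/2..3/2}"
    show "of_real (psi0 A n y) \<in> P ` S" using point[OF y] by auto
    have "f (of_real (psi0 A n y)) = 1 + of_real (4 * pi * A) * E (of_real ((y - 1 / 2)\<^sup>2))"
      using point[OF y] g(2) by (simp add: f_def)
    also have "\<dots> = of_real (1 + 4 * pi * A * cos (4 * real n * pi * y))"
      unfolding E_real k_def cos_shift by simp
    finally show "f (of_real (psi0 A n y)) = of_real (1 + 4 * pi * A * cos (4 * real n * pi * y))" .
  qed
qed

text \<open>The quotient is 0/0 at the centre. A function that satisfies the identity in product
  form and is continuous there supplies the limit by which \<open>Qpot\<close> is completed.\<close>

lemma Qpot_eq:
  assumes "0 < A" "A < 1 / (4 * pi)" "1 <= n"
    and c: "!!y. y \<in> {-1/2<..<3/2} ==> c y * (shear A n y - 1 / 2) = (deriv ^^ 2) (shear A n) y"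
    and cc: "isCont c (1 / 2)" and y: "y \<in> {0..1}"
  shows "Qpot A n y = c y"
proof -
  define q where "q z = (deriv ^^ 2) (shear A n) z / (shear A n z - 1 / 2)" for z
  have q: "q z = c z" if "z \<in> {-1/2<..<3/2}" "z \<noteq> 1 / 2" for z
    using c[OF that(1)] shear_centre[OF assms(1-3) that(2)] by (simp add: q_def field_simps)
  have "(c \<longlongrightarrow> c (1 / 2)) (at (1 / 2))" using cc by (simp add: isCont_def)
  then have "(q \<longlongrightarrow> c (1 / 2)) (at (1 / 2))"
  proof (rule Lim_transform_eventually)
    have "\<forall>\<^sub>F z in nhds (1 / 2). z \<in> {-1/2<..<3/2::real}" by (rule eventually_nhds_in_open) auto
    then show "\<forall>\<^sub>F z in at (1 / 2). c z = q z"
      unfolding eventually_at_filter by eventually_elim (simp add: q)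
  qed
  then have lim: "Lim (at (1 / 2)) q = c (1 / 2)" by (intro tendsto_Lim) auto
  show ?thesis
  proof (cases "y = 1 / 2")
    case True
    show ?thesis unfolding True Qpot_def Let_def q_def [abs_def, symmetric] lim by simp
  next
    case False
    then show ?thesis using q[of y] y unfolding Qpot_def Let_def q_def [abs_def, symmetric] by auto
  qed
qed

text \<open>\<open>c i y\<close> is the \<open>i\<close>-th Taylor coefficient of the vorticity
  function at \<open>psi0 A n y\<close>. Cauchy's inequality on discs of one common radius,
  available because the range of \<open>psi0\<close> is compact, gives the geometric bounds. The
  derivatives \<open>c'\<close> serve the Lipschitz estimates of the nonlinearity, and the
  antiderivative \<open>H\<close> serves the pressure.\<close>

theorem vorticity_function:
  assumes A: "0 < A" "A < 1 / (4 * pi)" and n: "1 <= n"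
  obtains F H :: "real => real" and c c' :: "nat => real => real" and r M :: real
  where "0 < r" "0 < M"
    "!!i y. y \<in> {0..1} ==> (c i has_real_derivative c' i y) (at y within {0..1})"
    "!!i y. y \<in> {0..1} ==> \<bar>c i y\<bar> <= M / r ^ i"
    "!!i y. y \<in> {0..1} ==> \<bar>c' i y\<bar> <= M / r ^ i"
    "!!i y. c i (1 - y) = c i y"
    "!!y. y \<in> {0..1} ==> c 0 y = 1 + 4 * pi * A * cos (4 * real n * pi * y)"
    "!!y. y \<in> {0..1} ==> c 1 y = Qpot A n y"
    "!!y h. y \<in> {0..1} ==> \<bar>h\<bar> < r ==> (\<lambda>i. c i y * h ^ i) sums F (psi0 A n y + h)"
    "!!y h. y \<in> {0..1} ==> \<bar>h\<bar> < r ==> (H has_real_derivative F (psi0 A n y + h)) (at (psi0 A n y + h))"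
    "!!y h. y \<in> {0..1} ==> \<bar>h\<bar> < r ==> isCont F (psi0 A n y + h)"
proof -
  obtain f U where U: "open U" "f holomorphic_on U"
    and inU: "!!y. y \<in> {-1/2..3/2} ==> of_real (psi0 A n y) \<in> U"
    and fval: "!!y. y \<in> {-1/2..3/2} ==> f (of_real (psi0 A n y)) = of_real (1 + 4 * pi * A * cos (4 * real n * pi * y))"
    by (rule vorticity_function_holomorphic[OF A n]) (rule that)
  define \<Psi> where "\<Psi> = psi0 A n"
  define \<Psi>' where "\<Psi>' y = shear A n y - 1 / 2" for y
  have \<Psi>d: "(\<Psi> has_real_derivative \<Psi>' y) (at y)" for y
    unfolding \<Psi>_def \<Psi>'_def by (rule derivative_psi0[OF n])
  have \<Psi>c: "continuous_on S \<Psi>" for S by (rule DERIV_continuous_on[OF has_field_derivative_at_within[OF \<Psi>d]])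
  define K where "K = (\<lambda>y. complex_of_real (\<Psi> y)) ` {0..1}"
  have K: "compact K" unfolding K_def by (intro compact_continuous_image continuous_intros \<Psi>c) auto
  have KU: "K \<subseteq> U" using inU by (auto simp: K_def \<Psi>_def)
  obtain e where e: "0 < e" "(\<Union>x\<in>K. ball x e) \<subseteq> U"
    using compact_subset_open_imp_ball_epsilon_subset[OF K U(1) KU] by blast
  define \<rho> where "\<rho> = e / 2"
  have \<rho>: "0 < \<rho>" using e by (simp add: \<rho>_def)
  have "compact {x + b |x b. x \<in> K & b \<in> cball 0 \<rho>}" by (intro compact_sums K compact_cball)
  moreover have sub: "{x + b |x b. x \<in> K & b \<in> cball 0 \<rho>} \<subseteq> U"
  proof
    fix z assume "z \<in> {x + b |x b. x \<in> K & b \<in> cball 0 \<rho>}"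
    then obtain x b where "x \<in> K" "norm b <= \<rho>" "z = x + b" by auto
    then have "z \<in> ball x e" using e by (simp add: \<rho>_def dist_norm)
    then show "z \<in> U" using e(2) \<open>x \<in> K\<close> by blast
  qed
  ultimately have "bounded (f ` {x + b |x b. x \<in> K & b \<in> cball 0 \<rho>})"
    using U(2) by (intro compact_imp_bounded compact_continuous_image)
      (auto intro: continuous_on_subset holomorphic_on_imp_continuous_on)
  then obtain M0 where M0: "0 < M0" "!!z. z \<in> f ` {x + b |x b. x \<in> K & b \<in> cball 0 \<rho>} ==> norm z <= M0"
    unfolding bounded_pos by blast
  have mem: "z \<in> {x + b |x b. x \<in> K & b \<in> cball 0 \<rho>}" if "x \<in> K" "norm (z - x) <= \<rho>" for x z
    unfolding mem_Collect_eq by (rule exI[of _ x], rule exI[of _ "z - x"]) (use that in auto)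
  have fb: "norm (f z) <= M0" if "x \<in> K" "norm (z - x) <= \<rho>" for x z
    by (rule M0(2), rule imageI, rule mem[OF that])
  have xU: "z \<in> U" if "x \<in> K" "norm (z - x) <= \<rho>" for x z
    by (rule subsetD[OF sub mem[OF that]])
  have holo: "f holomorphic_on ball x \<rho>" "continuous_on (cball x \<rho>) f" if "x \<in> K" for x
  proof -
    have "cball x \<rho> \<subseteq> U" using xU[OF that] by (auto simp: dist_norm norm_minus_commute)
    then show "f holomorphic_on ball x \<rho>" "continuous_on (cball x \<rho>) f"
      using holomorphic_on_subset[OF U(2)] ball_subset_cball
        continuous_on_subset[OF holomorphic_on_imp_continuous_on[OF U(2)]] by blast+
  qed
  have cauchy: "norm ((deriv ^^ i) f x) <= fact i * M0 / \<rho> ^ i" if "x \<in> K" for i x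
    by (rule Cauchy_inequality[OF holo[OF that] \<rho>]) (use fb[OF that] in \<open>simp add: norm_minus_commute\<close>)
  define c where "c i y = Re ((deriv ^^ i) f (of_real (\<Psi> y))) / fact i" for i y
  define c' where "c' i y = Re ((deriv ^^ Suc i) f (of_real (\<Psi> y))) / fact i * \<Psi>' y" for i y
  have cd: "(c i has_real_derivative c' i y) (at y)" if y: "y \<in> {-1/2..3/2}" for i y
  proof -
    have "(deriv ^^ i) f holomorphic_on U" by (rule holomorphic_higher_deriv[OF U(2,1)])
    then have "((deriv ^^ i) f has_field_derivative (deriv ^^ Suc i) f (of_real (\<Psi> y))) (at (of_real (\<Psi> y)))"
      using holomorphic_derivI[OF _ U(1) inU[OF y, folded \<Psi>_def]] by simp
    moreover have "((\<lambda>t. complex_of_real (\<Psi> t)) has_vector_derivative of_real (\<Psi>' y)) (at y)"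
      using \<Psi>d[of y] by (intro has_vector_derivative_of_real) (simp add: has_real_derivative_iff_has_vector_derivative)
    ultimately have "((\<lambda>t. (deriv ^^ i) f (of_real (\<Psi> t))) has_vector_derivative
        of_real (\<Psi>' y) * (deriv ^^ Suc i) f (of_real (\<Psi> y))) (at y)"
      using field_vector_diff_chain_at[of "\<lambda>t. complex_of_real (\<Psi> t)"] by (fastforce simp: o_def)
    then have "((\<lambda>t. Re ((deriv ^^ i) f (of_real (\<Psi> t)))) has_vector_derivative
        Re (of_real (\<Psi>' y) * (deriv ^^ Suc i) f (of_real (\<Psi> y)))) (at y)"
      by (rule bounded_linear.has_vector_derivative[OF bounded_linear_Re])
    then have "((\<lambda>t. Re ((deriv ^^ i) f (of_real (\<Psi> t)))) has_real_derivative
        \<Psi>' y * Re ((deriv ^^ Suc i) f (of_real (\<Psi> y)))) (at y)"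
      by (simp add: has_real_derivative_iff_has_vector_derivative)
    from DERIV_cdivide[OF this, of "fact i"] show ?thesis
      unfolding c_def [abs_def] c'_def by (simp add: mult.commute)
  qed
  have yK: "of_real (\<Psi> y) \<in> K" if "y \<in> {0..1}" for y using that by (auto simp: K_def)
  obtain D where D: "0 < D" "!!y. y \<in> {0..1} ==> \<bar>\<Psi>' y\<bar> <= D"
  proof (rule bounded_abs_on_unit_interval[of \<Psi>'])
    show "cont01 \<Psi>'" unfolding \<Psi>'_def shear_def by (intro continuous_intros)
  qed blast
  \<comment> \<open>Halving the radius pays for the factor \<open>i + 1\<close> in
    \<open>c' i\<close>, since \<open>(i + 1) / 2 ^ (i + 1) \<le> 1\<close>.\<close>
  define r where "r = \<rho> / 2"
  have r: "0 < r" "r < \<rho>" using \<rho> by (auto simp: r_def)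
  define M where "M = M0 + M0 * D / r"
  have M: "0 < M" "M0 <= M" "M0 * D / r <= M" using M0 D r by (simp_all add: M_def add_pos_pos)
  have fact_abs: "\<bar>fact i :: real\<bar> = fact i" for i by simp
  have cb: "\<bar>c i y\<bar> <= M / r ^ i" if y: "y \<in> {0..1}" for i y
  proof -
    have "\<bar>Re ((deriv ^^ i) f (of_real (\<Psi> y)))\<bar> <= fact i * M0 / \<rho> ^ i"
      using abs_Re_le_cmod cauchy[OF yK[OF y], of i] order_trans by blast
    then have "\<bar>c i y\<bar> <= fact i * M0 / \<rho> ^ i / fact i"
      unfolding c_def abs_divide fact_abs by (rule divide_right_mono) simp
    also have "\<dots> = M0 / \<rho> ^ i" by simp
    also have "\<dots> <= M / r ^ i" using M r M0 \<rho> by (intro frac_le power_mono) auto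
    finally show ?thesis .
  qed
  have cb': "\<bar>c' i y\<bar> <= M / r ^ i" if y: "y \<in> {0..1}" for i y
  proof -
    have "\<bar>Re ((deriv ^^ Suc i) f (of_real (\<Psi> y)))\<bar> <= fact (Suc i) * M0 / \<rho> ^ Suc i"
      using abs_Re_le_cmod cauchy[OF yK[OF y], of "Suc i"] order_trans by blast
    then have "\<bar>c' i y\<bar> <= fact (Suc i) * M0 / \<rho> ^ Suc i / fact i * D"
      unfolding c'_def abs_divide abs_mult fact_abs using D(2)[OF y] M0 \<rho>
      by (intro mult_mono divide_right_mono) auto
    also have "\<dots> = (real i + 1) / 2 ^ Suc i * (M0 * D / r / r ^ i)"
    proof -
      have pw: "\<rho> ^ Suc i = 2 ^ Suc i * (r * r ^ i)" by (simp add: r_def power_divide)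
      show ?thesis unfolding pw fact_Suc by (simp add: mult_ac add.commute)
    qed
    also have "\<dots> <= 1 * (M0 * D / r / r ^ i)"
    proof (rule mult_right_mono)
      have "real (Suc i) <= 2 ^ Suc i" using less_exp[of "Suc i"] by (metis less_imp_le of_nat_le_numeral_power_cancel_iff)
      then show "(real i + 1) / 2 ^ Suc i <= 1" by (simp add: field_simps)
    qed (use M0 D r in auto)
    also have "\<dots> <= M / r ^ i" unfolding mult_1 by (rule divide_right_mono[OF M(3)]) (use r in simp)
    finally show ?thesis .
  qed
  define F where "F t = Re (f (of_real t))" for t
  have c0: "c 0 y = 1 + 4 * pi * A * cos (4 * real n * pi * y)" if "y \<in> {-1/2..3/2}" for y
    using fval[OF that] by (simp add: c_def \<Psi>_def)
  \<comment> \<open>The chain rule on \<open>c 0 y = F (psi0 A n y)\<close>: the vorticity has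
    derivative \<open>(deriv ^^ 2) (shear A n) y\<close>, the stream function has derivative
    \<open>shear A n y - 1 / 2\<close>.\<close>
  have c1: "c 1 y * \<Psi>' y = (deriv ^^ 2) (shear A n) y" if y: "y \<in> {-1/2<..<3/2}" for y
  proof -
    have "(c 0 has_real_derivative c' 0 y) (at y)" using cd y by simp
    then have "((\<lambda>y. 1 + 4 * pi * A * cos (4 * real n * pi * y)) has_real_derivative c' 0 y) (at y)"
      by (rule DERIV_cong_ev[OF refl _ refl, THEN iffD1, rotated])
         (use eventually_nhds_in_open[of "{-1/2<..<3/2}" y] y in \<open>auto elim!: eventually_mono intro!: c0\<close>)
    moreover have "((\<lambda>y. 1 + 4 * pi * A * cos (4 * real n * pi * y)) has_real_derivative (deriv ^^ 2) (shear A n) y) (at y)"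
      unfolding deriv2_shear using n by (auto intro!: derivative_eq_intros simp: field_simps)
    ultimately have "c' 0 y = (deriv ^^ 2) (shear A n) y" by (rule DERIV_unique)
    then show ?thesis by (simp add: c_def c'_def)
  qed
  have Fc: "isCont F t" if "x \<in> K" "norm (of_real t - x) < \<rho>" for x t
  proof -
    have "of_real t \<in> U" using xU[of x "of_real t"] that by simp
    then have "isCont f (of_real t)"
      using U holomorphic_on_imp_continuous_on continuous_on_eq_continuous_at by blast
    then show ?thesis unfolding F_def
      by (intro continuous_Re continuous_at_compose[of t of_real f, unfolded o_def]) auto
  qed
  have near: "norm (of_real (\<Psi> y + h) - of_real (\<Psi> y) :: complex) = \<bar>h\<bar>" for y h
    by (simp flip: of_real_diff)
  obtain lo hi where img: "\<Psi> ` {0..1} = {lo..hi}" "lo <= hi"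
    using continuous_image_closed_interval[of 0 1 \<Psi>] \<Psi>c by auto
  \<comment> \<open>One real interval containing all arguments of \<open>F\<close> that will occur,
    so that a single antiderivative can be used.\<close>
  have J: "\<exists>x\<in>K. norm (of_real t - x) < \<rho>" if "t \<in> {lo - r..hi + r}" for t
  proof -
    define s where "s = max lo (min hi t)"
    have "s \<in> \<Psi> ` {0..1}" "\<bar>t - s\<bar> <= r" unfolding img using that img(2) r by (auto simp: s_def)
    then show ?thesis using r yK by (auto intro!: bexI[of _ "of_real s"] simp flip: of_real_diff)
  qed
  have "continuous_on {lo - r..hi + r} F"
    using J Fc by (intro continuous_at_imp_continuous_on) blast
  then obtain H where H: "!!t. t \<in> {lo - r..hi + r} ==> (H has_vector_derivative F t) (at t within {lo - r..hi + r})"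
    using antiderivative_continuous by blast
  show ?thesis
  proof (rule that[of r M c c' F H])
    show "(c i has_real_derivative c' i y) (at y within {0..1})" if "y \<in> {0..1}" for i y
      by (rule has_field_derivative_at_within[OF cd]) (use that in auto)
    show "c i (1 - y) = c i y" for i y by (simp add: c_def \<Psi>_def psi0_reflect)
    show "c 0 y = 1 + 4 * pi * A * cos (4 * real n * pi * y)" if "y \<in> {0..1}" for y using c0[of y] that by simp
    show "c 1 y = Qpot A n y" if "y \<in> {0..1}" for y
    proof (rule Qpot_eq[OF A n _ _ that, symmetric])
      show "isCont (c 1) (1 / 2)" by (rule DERIV_isCont[OF cd]) auto
    qed (use c1 in \<open>simp add: \<Psi>'_def\<close>)
    fix y h :: real assume y: "y \<in> {0..1}" and h: "\<bar>h\<bar> < r"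
    have "(\<lambda>i. (deriv ^^ i) f (of_real (\<Psi> y)) / fact i * (of_real (\<Psi> y + h) - of_real (\<Psi> y)) ^ i) sums f (of_real (\<Psi> y + h))"
      by (rule holomorphic_power_series[OF holo(1)[OF yK[OF y]]]) (use h r in \<open>simp add: dist_norm norm_minus_commute\<close>)
    moreover have "Re ((deriv ^^ i) f (of_real (\<Psi> y)) / fact i * (of_real (\<Psi> y + h) - of_real (\<Psi> y)) ^ i) = c i y * h ^ i" for i
    proof -
      have 1: "(of_real (\<Psi> y + h) - of_real (\<Psi> y)) ^ i = complex_of_real (h ^ i)" by simp
      have 2: "(fact i :: complex) = of_real (fact i)" by simp
      have 3: "Re (a / of_real b * of_real d) = Re a / b * d" for a b d by simp
      show ?thesis unfolding 1 2 3 c_def ..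
    qed
    ultimately have "(\<lambda>i. c i y * h ^ i) sums F (\<Psi> y + h)"
      unfolding F_def using sums_Re by fastforce
    then show "(\<lambda>i. c i y * h ^ i) sums F (psi0 A n y + h)" by (simp add: \<Psi>_def)
    show "isCont F (psi0 A n y + h)"
      using Fc[OF yK[OF y], of "\<Psi> y + h"] near[of y h] h r by (simp add: \<Psi>_def)
    have "\<Psi> y \<in> {lo..hi}" using y img by blast
    then have i: "\<Psi> y + h \<in> {lo - r<..<hi + r}" using h by auto
    then have "\<Psi> y + h \<in> {lo - r..hi + r}" by auto
    from H[OF this] have "(H has_real_derivative F (\<Psi> y + h)) (at (\<Psi> y + h) within {lo - r..hi + r})"
      by (simp add: has_real_derivative_iff_has_vector_derivative)
    moreover have "at (\<Psi> y + h) within {lo - r..hi + r} = at (\<Psi> y + h)"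
      by (rule at_within_interior) (use i in simp)
    ultimately show "(H has_real_derivative F (psi0 A n y + h)) (at (psi0 A n y + h))" by (simp add: \<Psi>_def)
  qed (use r M cb cb' in auto)
qed

section \<open>Negative energy in the central cell\<close>

lemma sin_taylor_lower:
  assumes "0 <= x"
  shows "x - x ^ 3 / 6 + x ^ 5 / 120 - x ^ 7 / 5040 <= sin (x :: real)"
proof -
  have "\<bar>sin x - (\<Sum>m<7. sin_coeff m * x ^ m)\<bar> <= inverse (fact 7) * \<bar>x\<bar> ^ 7"
    by (rule Maclaurin_sin_bound)
  moreover have "(\<Sum>m<7. sin_coeff m * x ^ m) = x - x ^ 3 / 6 + x ^ 5 / 120"
  proof -
    have "{..<7} = {0, 1, 2, 3, 4, 5, 6::nat}" by auto
    then show ?thesis by (simp add: sin_coeff_def fact_numeral)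
  qed
  moreover have "inverse (fact 7) * \<bar>x\<bar> ^ 7 = x ^ 7 / 5040"
  proof -
    have "(fact 7 :: real) = 5040" by (simp add: fact_numeral)
    then show ?thesis using assms by (simp only: abs_of_nonneg) simp
  qed
  ultimately show ?thesis by linarith
qed

text \<open>A Taylor polynomial lying below \<open>sin t / t\<close>; being a polynomial, it lets
  the energy of the trial function be integrated in closed form.\<close>

definition sinc_poly :: "real => real" where
  "sinc_poly t = 1 - t\<^sup>2 / 6 + t ^ 4 / 120 - t ^ 6 / 5040"

lemma sinc_poly_le:
  assumes "t \<noteq> 0"
  shows "sinc_poly t <= sin t / t"
proof -
  have *: "sinc_poly t <= sin t / t" if "0 < t" for t
  proof -
    have "t * sinc_poly t <= sin t"
      using sin_taylor_lower[of t] that by (simp add: sinc_poly_def algebra_simps eval_nat_numeral)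
    then show ?thesis using that by (simp add: field_simps)
  qed
  show ?thesis
  proof (cases "0 < t")
    case False
    then have "sinc_poly (- t) <= sin (- t) / (- t)" using assms by (intro *) auto
    then show ?thesis by (simp add: sinc_poly_def)
  qed (rule *)
qed

text \<open>With \<open>x = sin t / t\<close> and \<open>B = 4 * pi * A\<close> the potential equals
  \<open>- (k\<^sup>2 * (B * x / (1 + B * x)))\<close>. The lower bound on \<open>A\<close> means
  \<open>B > 1 / 2\<close>, whence \<open>1 + B * x \<le> 3 * B\<close> for
  \<open>x \<le> 1\<close>, and the fraction is at least \<open>x / 3\<close>.\<close>

lemma Qpot_upper_bound:
  assumes A: "1 / 2 * (1 / (4 * pi)) < A" "A < 1 / (4 * pi)" and n: "1 <= n"
    and t: "\<bar>4 * real n * pi * (y - 1 / 2)\<bar> <= pi" and y: "y \<noteq> 1 / 2"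
  shows "Qpot A n y <= - ((4 * real n * pi)\<^sup>2 * sinc_poly (4 * real n * pi * (y - 1 / 2)) / 3)"
proof -
  define k where "k = 4 * real n * pi"
  define t where "t = k * (y - 1 / 2)"
  define B where "B = 4 * pi * A"
  have k: "0 < k" using n by (simp add: k_def)
  have B: "1 / 2 < B" "B < 1" using A by (simp_all add: B_def field_simps)
  have "0 < 1 / 2 * (1 / (4 * pi))" by simp
  then have A0: "0 < A" using A(1) by linarith
  have tn: "t \<noteq> 0" using y k by (simp add: t_def)
  have An: "A / real n = B / k" using n by (simp add: B_def k_def)
  define x where "x = sin t / t"
  have x0: "0 <= x"
  proof (cases "0 < t")
    case True
    then show ?thesis using assms(4) sin_ge_zero[of t] by (simp add: x_def t_def k_def)
  next
    case False
    then have "0 <= sin (- t)" using assms(4) by (intro sin_ge_zero) (auto simp: t_def k_def)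
    then show ?thesis using False tn by (auto simp: x_def divide_nonpos_neg)
  qed
  have x1: "x <= 1"
  proof -
    have "\<bar>sin t\<bar> <= \<bar>t\<bar>" by (rule abs_sin_x_le_abs_x)
    then have "\<bar>x\<bar> <= 1" using tn by (simp add: x_def abs_divide divide_le_eq)
    then show ?thesis by simp
  qed
  have s: "sin (4 * real n * pi * y) = sin t" using sin_shift[of n y] by (simp add: t_def k_def)
  have sx: "sin t = t * x" using tn by (simp add: x_def)
  have "Qpot A n y = - (B / k * (sin t * k * k)) / (y + B / k * sin t - 1 / 2)"
    using y unfolding Qpot_def Let_def deriv2_shear shear_def unfolding s An unfolding k_def[symmetric] by simp
  also have "y + B / k * sin t - 1 / 2 = t / k * (1 + B * x)"
  proof -
    have yt: "y = 1 / 2 + t / k" using k by (simp add: t_def)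
    show ?thesis by (subst yt) (simp add: sx algebra_simps)
  qed
  also have "- (B / k * (sin t * k * k)) / (t / k * (1 + B * x)) = - (k\<^sup>2 * (B * x / (1 + B * x)))"
    using tn k by (simp add: sx power2_eq_square)
  finally have Q: "Qpot A n y = - (k\<^sup>2 * (B * x / (1 + B * x)))" .
  have pos: "0 < 1 + B * x" using B x0 by (simp add: add_pos_nonneg)
  have "x * (1 + B * x) <= 3 * (B * x)"
  proof -
    have "B * x <= B" using B x1 by simp
    then have "1 + B * x <= 3 * B" using B by linarith
    then have "x * (1 + B * x) <= x * (3 * B)" using x0 by (rule mult_left_mono)
    then show ?thesis by (simp add: mult_ac)
  qed
  then have "x / 3 <= B * x / (1 + B * x)" using pos by (simp add: field_simps)
  moreover have "sinc_poly t <= x" unfolding x_def by (rule sinc_poly_le[OF tn])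
  ultimately have "sinc_poly t / 3 <= B * x / (1 + B * x)" by linarith
  then have "k\<^sup>2 * (sinc_poly t / 3) <= k\<^sup>2 * (B * x / (1 + B * x))" by (intro mult_left_mono) auto
  then show ?thesis unfolding Q by (simp add: t_def k_def)
qed

text \<open>The test function is \<open>1 - x\<^sup>2\<close> in the variable \<open>x = 4 n (y - 1/2)\<close>, supported in the innermost cell
  where the potential is negative; \<open>energy_poly\<close> is the antiderivative of the resulting energy density,
  with \<open>s = \<pi>\<^sup>2\<close>.\<close>

definition energy_poly :: "real => real => real" where
  "energy_poly s x = 4 * x ^ 3 / 3 + s * x / 1000 - s / 3 * (x + (- 2 - s / 6) * x ^ 3 / 3
     + (1 + s / 3 + s ^ 2 / 120) * x ^ 5 / 5 + (- s / 6 - s ^ 2 / 60 - s ^ 3 / 5040) * x ^ 7 / 7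
     + (s ^ 2 / 120 + s ^ 3 / 2520) * x ^ 9 / 9 - s ^ 3 / 5040 * x ^ 11 / 11)"

text \<open>The energy density of the trial function in units of \<open>(4 * n)\<^sup>2\<close>: the
  square of its slope, the small admissible increase of the potential with the factor
  \<open>(1 - x\<^sup>2)\<^sup>2\<close> bounded by 1, and the bound for the potential times that
  factor.\<close>

lemma energy_poly_deriv:
  "(energy_poly (pi\<^sup>2) has_real_derivative 4 * x\<^sup>2 + pi\<^sup>2 / 1000 - pi\<^sup>2 / 3 * sinc_poly (pi * x) * (1 - x\<^sup>2)\<^sup>2) (at x)"
proof -
  have poly: "((\<lambda>x. p * x ^ 3 + q * x - r * (x + a * x ^ 3 + b * x ^ 5 + c * x ^ 7 + d * x ^ 9 + e * x ^ 11))
      has_real_derivative 3 * p * x\<^sup>2 + q - r * (1 + 3 * a * x\<^sup>2 + 5 * b * x ^ 4 + 7 * c * x ^ 6 + 9 * d * x ^ 8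
        + 11 * e * x ^ 10)) (at x)" for a b c d e p q r :: real
    by (auto intro!: derivative_eq_intros simp: algebra_simps)
  have "(energy_poly s has_real_derivative 4 * x\<^sup>2 + s / 1000 - s / 3 *
      (1 - s * x\<^sup>2 / 6 + s\<^sup>2 * x ^ 4 / 120 - s ^ 3 * x ^ 6 / 5040) * (1 - x\<^sup>2)\<^sup>2) (at x)" for s
  proof -
    define a b c d e where "a = (- 2 - s / 6) / 3" and "b = (1 + s / 3 + s ^ 2 / 120) / 5"
      and "c = (- s / 6 - s ^ 2 / 60 - s ^ 3 / 5040) / 7" and "d = (s ^ 2 / 120 + s ^ 3 / 2520) / 9"
      and "e = - (s ^ 3) / 5040 / 11"
    have f: "energy_poly s =
        (\<lambda>x. 4 / 3 * x ^ 3 + s / 1000 * x - s / 3 * (x + a * x ^ 3 + b * x ^ 5 + c * x ^ 7 + d * x ^ 9 + e * x ^ 11))"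
      by (rule ext) (simp add: energy_poly_def a_def b_def c_def d_def e_def)
    have g: "1 + 3 * a * x\<^sup>2 + 5 * b * x ^ 4 + 7 * c * x ^ 6 + 9 * d * x ^ 8 + 11 * e * x ^ 10 =
        (1 - s * x\<^sup>2 / 6 + s\<^sup>2 * x ^ 4 / 120 - s ^ 3 * x ^ 6 / 5040) * (1 - x\<^sup>2)\<^sup>2"
    proof -
      have gen: "(1 - p * q + p2 * q ^ 2 - p3 * q ^ 3) * (1 - q) ^ 2 = 1 + (- 2 - p) * q + (1 + 2 * p + p2) * q ^ 2
          + (- p - 2 * p2 - p3) * q ^ 3 + (p2 + 2 * p3) * q ^ 4 + (- p3) * q ^ 5" for p p2 p3 q :: real
        by (simp add: algebra_simps power2_eq_square eval_nat_numeral)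
      have co: "3 * a = - 2 - s / 6" "5 * b = 1 + 2 * (s / 6) + s\<^sup>2 / 120" "7 * c = - (s / 6) - 2 * (s\<^sup>2 / 120) - s ^ 3 / 5040"
        "9 * d = s\<^sup>2 / 120 + 2 * (s ^ 3 / 5040)" "11 * e = - (s ^ 3 / 5040)"
        by (simp_all add: a_def b_def c_def d_def e_def)
      have xp: "(x\<^sup>2)\<^sup>2 = x ^ 4" "(x\<^sup>2) ^ 3 = x ^ 6" "(x\<^sup>2) ^ 4 = x ^ 8" "(x\<^sup>2) ^ 5 = x ^ 10"
        by (simp_all flip: power_mult)
      have "1 - s * x\<^sup>2 / 6 + s\<^sup>2 * x ^ 4 / 120 - s ^ 3 * x ^ 6 / 5040 =
          1 - s / 6 * x\<^sup>2 + s\<^sup>2 / 120 * x ^ 4 - s ^ 3 / 5040 * x ^ 6" by simp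
      then show ?thesis
        using gen[of "s / 6" "x\<^sup>2" "s\<^sup>2 / 120" "s ^ 3 / 5040"] unfolding co xp by (simp only:)
    qed
    have "4 * x\<^sup>2 + s / 1000 - s / 3 *
        (1 - s * x\<^sup>2 / 6 + s\<^sup>2 * x ^ 4 / 120 - s ^ 3 * x ^ 6 / 5040) * (1 - x\<^sup>2)\<^sup>2 =
        3 * (4 / 3) * x\<^sup>2 + s / 1000 - s / 3 *
        (1 + 3 * a * x\<^sup>2 + 5 * b * x ^ 4 + 7 * c * x ^ 6 + 9 * d * x ^ 8 + 11 * e * x ^ 10)"
      unfolding g by simp
    then show ?thesis unfolding f using poly[of "4 / 3" "s / 1000" "s / 3" a b c d e] by metis
  qed
  moreover have "1 - pi\<^sup>2 * x\<^sup>2 / 6 + (pi\<^sup>2)\<^sup>2 * x ^ 4 / 120 - (pi\<^sup>2) ^ 3 * x ^ 6 / 5040 = sinc_poly (pi * x)"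
    by (simp add: sinc_poly_def power_mult_distrib flip: power_mult)
  ultimately show ?thesis by metis
qed

text \<open>The value at 1 is \<open>4 / 3 + s / 1000 - s / 3 * P\<close> with \<open>P\<close> at
  least 0.42 and \<open>s\<close> between 9.85 and 9.93, so the last term exceeds 1.37 while the
  others stay below 1.35. This narrow margin pays for \<open>s / 1000\<close>. Oddness reduces the
  integral over the cell to this single value.\<close>

lemma energy_poly_negative: "energy_poly (pi\<^sup>2) 1 < 0" "energy_poly (pi\<^sup>2) (- 1) = - energy_poly (pi\<^sup>2) 1"
proof -
  define s where "s = pi\<^sup>2"
  have pi_b: "3.14 <= pi" "pi <= 3.15" using pi_approx by simp_all
  have s: "985 / 100 <= s" "s <= 993 / 100"
  proof -
    have "3.14\<^sup>2 <= pi\<^sup>2" "pi\<^sup>2 <= 3.15\<^sup>2" using pi_b by (intro power_mono; simp)+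
    then show "985 / 100 <= s" "s <= 993 / 100" by (simp_all add: s_def power2_eq_square)
  qed
  define P where "P = 8 / 15 - 4 * s / 315 + s\<^sup>2 / 4725 - s ^ 3 / 436590"
  have e: "energy_poly s 1 = 4 / 3 + s / 1000 - s / 3 * P"
    by (simp add: P_def energy_poly_def field_simps eval_nat_numeral)
  have "(985 / 100)\<^sup>2 <= s\<^sup>2" using s by (intro power_mono) auto
  moreover have "s ^ 3 <= (993 / 100) ^ 3" using s by (intro power_mono) auto
  ultimately have "42 / 100 <= P" unfolding P_def
    using s by (simp add: eval_nat_numeral)
  then have "s / 3 * (42 / 100) <= s / 3 * P"
    using s by (intro mult_left_mono) auto
  then show "energy_poly (pi\<^sup>2) 1 < 0" unfolding s_def[symmetric] e using s by linarith
  show "energy_poly (pi\<^sup>2) (- 1) = - energy_poly (pi\<^sup>2) 1"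
    by (simp add: energy_poly_def algebra_simps add_divide_distrib diff_divide_distrib)
qed

text \<open>The zero condition required for the ground state, at a level of order
  \<open>n\<^sup>2\<close>. The cell has half-width \<open>1 / (4 * n)\<close>, and both the slope
  energy and the potential scale with \<open>n\<^sup>2\<close>, so one numerical inequality settles
  every \<open>n\<close>.\<close>

lemma shear_negative_energy:
  assumes A: "1 / 2 * (1 / (4 * pi)) < A" "A < 1 / (4 * pi)" and n: "1 <= n"
    and Qc: "cont01 (Qpot A n)"
    and ode: "linear_ode (\<lambda>y. Qpot A n y + (4 * pi * real n)\<^sup>2 / 1000) (\<lambda>y. 0) f f'" "f 0 = 0" "f' 0 = 1"
  shows "\<exists>z\<in>{0<..1}. f z = 0"
proof -
  define k where "k = 4 * real n"
  have k: "4 <= k" using n by (simp add: k_def)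
  define y1 where "y1 = 1 / 2 - 1 / k"
  define y2 where "y2 = 1 / 2 + 1 / k"
  have k4: "1 / k <= 1 / 4" "0 < 1 / k" using k by (auto simp: field_simps)
  have y12: "0 < y1" "y1 < y2" "y2 < 1" unfolding y1_def y2_def using k4 by linarith+
  define x where "x y = k * (y - 1 / 2)" for y
  have xb: "\<bar>x y\<bar> <= 1" if "\<bar>y - 1 / 2\<bar> <= 1 / k" for y
  proof -
    have 1: "\<bar>k\<bar> = k" "k * (1 / k) = 1" using k by auto
    have "k * \<bar>y - 1 / 2\<bar> <= k * (1 / k)" using that k by (intro mult_left_mono) auto
    then show ?thesis unfolding x_def abs_mult 1 .
  qed
  have x: "x y1 = - 1" "x y2 = 1" using k by (auto simp: x_def y1_def y2_def)
  have Qb: "Qpot A n y <= - (k\<^sup>2 * pi\<^sup>2 * sinc_poly (pi * x y) / 3)" if y: "y1 <= y" "y <= y2" for y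
  proof -
    have b: "Qpot A n z <= - (k\<^sup>2 * pi\<^sup>2 * sinc_poly (pi * x z) / 3)" if z: "y1 <= z" "z <= y2" "z \<noteq> 1 / 2" for z
    proof -
      have "\<bar>z - 1 / 2\<bar> <= 1 / k" using z by (auto simp: y1_def y2_def abs_le_iff)
      then have "\<bar>x z\<bar> <= 1" by (rule xb)
      then have "pi * \<bar>x z\<bar> <= pi * 1" by (intro mult_left_mono) auto
      then have "\<bar>4 * real n * pi * (z - 1 / 2)\<bar> <= pi" by (simp add: x_def k_def abs_mult mult_ac)
      from Qpot_upper_bound[OF A n this z(3)] show ?thesis
        by (simp add: x_def k_def power_mult_distrib mult_ac)
    qed
    show ?thesis
    proof (cases "y = 1 / 2")
      case True
      \<comment> \<open>The bound on the potential was derived off the centre; both sides are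
        continuous, so it extends to the centre.\<close>
      define g where "g z = - (k\<^sup>2 * pi\<^sup>2 * sinc_poly (pi * x z) / 3) - Qpot A n z" for z
      have "cont01 g" unfolding g_def sinc_poly_def x_def by (intro continuous_intros Qc) auto
      then have "isCont g (1 / 2)" by (rule continuous_on_interior) simp
      then have "(g \<longlongrightarrow> g (1 / 2)) (at (1 / 2))" by (simp add: isCont_def)
      moreover have "\<forall>\<^sub>F z in at (1 / 2). 0 <= g z"
      proof -
        have "\<forall>\<^sub>F z in nhds (1 / 2). z \<in> {y1<..<y2}"
          by (rule eventually_nhds_in_open) (use k4 in \<open>auto simp: y1_def y2_def\<close>)
        then show ?thesis unfolding eventually_at_filter
          by eventually_elim (use b in \<open>auto simp: g_def\<close>)
      qed
      ultimately have "0 <= g (1 / 2)" by (rule tendsto_lowerbound) auto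
      then show ?thesis unfolding True g_def by simp
    qed (rule b[OF y])
  qed
  have "\<exists>y\<in>{y1..y2}. f y <= 0"
  proof (rule negative_energy_forces_zero[OF ode(1) y12, of "\<lambda>y. 1 - (x y)\<^sup>2" "\<lambda>y. - (2 * x y * k)"
        "\<lambda>y. k * energy_poly (pi\<^sup>2) (x y)"
        "\<lambda>y. k * ((4 * (x y)\<^sup>2 + pi\<^sup>2 / 1000 - pi\<^sup>2 / 3 * sinc_poly (pi * x y) * (1 - (x y)\<^sup>2)\<^sup>2) * k)"])
    have xd: "(x has_real_derivative k) (at y)" for y unfolding x_def [abs_def] by (auto intro!: derivative_eq_intros)
    show "((\<lambda>y. 1 - (x y)\<^sup>2) has_real_derivative - (2 * x y * k)) (at y)" for y
      by (auto intro!: derivative_eq_intros xd)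
    show "((\<lambda>y. k * energy_poly (pi\<^sup>2) (x y)) has_real_derivative
        k * ((4 * (x y)\<^sup>2 + pi\<^sup>2 / 1000 - pi\<^sup>2 / 3 * sinc_poly (pi * x y) * (1 - (x y)\<^sup>2)\<^sup>2) * k)) (at y)" for y
      by (rule DERIV_cmult[OF DERIV_chain2[OF energy_poly_deriv xd]])
    show "k * energy_poly (pi\<^sup>2) (x y2) < k * energy_poly (pi\<^sup>2) (x y1)"
      unfolding x using energy_poly_negative k by (simp add: mult_pos_neg)
    fix y assume y: "y1 <= y" "y <= y2"
    have "\<bar>y - 1 / 2\<bar> <= 1 / k" using y by (auto simp: y1_def y2_def abs_le_iff)
    then have "\<bar>x y\<bar> <= 1" by (rule xb)
    then have x2: "(x y)\<^sup>2 <= 1" by (simp add: abs_square_le_1)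
    define w where "w = (1 - (x y)\<^sup>2)\<^sup>2"
    have "1 - (x y)\<^sup>2 <= 1" "0 <= 1 - (x y)\<^sup>2" using x2 by auto
    then have w: "0 <= w" "w <= 1" unfolding w_def by (auto simp: power_le_one)
    have "(- (2 * x y * k))\<^sup>2 + (Qpot A n y + (4 * pi * real n)\<^sup>2 / 1000) * w
        <= 4 * (x y)\<^sup>2 * k\<^sup>2 + (- (k\<^sup>2 * pi\<^sup>2 * sinc_poly (pi * x y) / 3) * w + k\<^sup>2 * pi\<^sup>2 / 1000 * 1)"
    proof -
      have "Qpot A n y * w <= - (k\<^sup>2 * pi\<^sup>2 * sinc_poly (pi * x y) / 3) * w"
        using Qb[OF y] w by (intro mult_right_mono)
      moreover have "k\<^sup>2 * pi\<^sup>2 / 1000 * w <= k\<^sup>2 * pi\<^sup>2 / 1000 * 1"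
        using w by (intro mult_left_mono) auto
      moreover have "(4 * pi * real n)\<^sup>2 = k\<^sup>2 * pi\<^sup>2" by (simp add: k_def power_mult_distrib)
      moreover have "(- (2 * x y * k))\<^sup>2 = 4 * (x y)\<^sup>2 * k\<^sup>2" by (simp add: power_mult_distrib)
      ultimately show ?thesis by (simp only: distrib_right)
    qed
    also have "\<dots> = k * ((4 * (x y)\<^sup>2 + pi\<^sup>2 / 1000 - pi\<^sup>2 / 3 * sinc_poly (pi * x y) * w) * k)"
      by (simp add: algebra_simps power2_eq_square)
    finally show "(- (2 * x y * k))\<^sup>2 + (Qpot A n y + (4 * pi * real n)\<^sup>2 / 1000) * (1 - (x y)\<^sup>2)\<^sup>2
        <= k * ((4 * (x y)\<^sup>2 + pi\<^sup>2 / 1000 - pi\<^sup>2 / 3 * sinc_poly (pi * x y) * (1 - (x y)\<^sup>2)\<^sup>2) * k)"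
      unfolding w_def .
  qed (simp_all add: x)
  then obtain y where y: "y1 <= y" "y <= y2" "f y <= 0" by auto
  \<comment> \<open>Near the left end the slope keeps \<open>f\<close> positive, so a nonpositive
    value further right forces a zero in between.\<close>
  obtain e where e: "0 < e" "e < 1" "!!t. 0 <= t ==> t <= e ==> 1 / 2 <= f' t"
    using ode_derivative_positive_near_0[OF ode(1,3)] by blast
  define e' where "e' = min e y"
  have e': "0 < e'" "e' <= e" "e' <= y" using e y y12 by (auto simp: e'_def)
  have "1 / 2 * e' <= f e'"
    by (rule ode_linear_lower_bound[OF ode(1,2), of e]) (use e e' in auto)
  then have "0 <= f e'" using e' by linarith
  then obtain z where "e' <= z" "z <= y" "f z = 0"
    using IVT2'[of f y 0 e'] continuous_on_subset[OF linear_ode_continuous(1)[OF ode(1)], of "{e'..y}"] y e' y12 by auto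
  then show ?thesis using e' y y12 by (intro bexI[of _ z]) auto
qed

section \<open>Bifurcation from a simple kernel by contraction\<close>

text \<open>Away from \<open>s = 0\<close> the second equation gives \<open>lam = L (N (s b + v)) / s\<close>, which is of size \<open>s\<close>
  although it is not small in \<open>v\<close>; inserted in the first equation it multiplies \<open>S v = O(s\<^sup>2)\<close>, so the
  resulting map of \<open>v\<close> alone contracts the ball of radius of order \<open>s\<^sup>2\<close>.\<close>

theorem bifurcation_from_simple_kernel:
  fixes V :: "'z::banach set" and S T N :: "'z => 'z" and L :: "'z => real" and b :: 'z
  assumes V: "closed V" "subspace V"
    and S: "bounded_linear S" "!!x. x \<in> V ==> S x \<in> V"
    and T: "bounded_linear T" "!!x. x \<in> V ==> T x \<in> V"
    and L: "bounded_linear L"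
    and r: "0 < r"
    and NV: "!!x. x \<in> V ==> norm x <= r ==> N x \<in> V"
    and N0: "N 0 = 0"
    and NC: "0 < C" "!!x y R. norm x <= R ==> norm y <= R ==> R <= r ==> norm (N x - N y) <= C * R * norm (x - y)"
    and b: "b \<in> V"
  obtains s0 K :: real and v :: "real => 'z" and lam :: "real => real"
  where "0 < s0" "0 < K"
    "!!s. \<bar>s\<bar> < s0 ==> v s \<in> V"
    "!!s. \<bar>s\<bar> < s0 ==> norm (s *\<^sub>R b + v s) <= r"
    "!!s. \<bar>s\<bar> < s0 ==> norm (v s) <= K * s\<^sup>2"
    "!!s. \<bar>s\<bar> < s0 ==> norm (N (s *\<^sub>R b + v s)) <= K * s\<^sup>2"
    "!!s. \<bar>s\<bar> < s0 ==> \<bar>lam s\<bar> <= K * \<bar>s\<bar>"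
    "!!s. \<bar>s\<bar> < s0 ==> s * lam s = L (N (s *\<^sub>R b + v s))"
    "!!s. \<bar>s\<bar> < s0 ==> v s = lam s *\<^sub>R S (v s) + T (N (s *\<^sub>R b + v s))"
    "!!s t. \<bar>s\<bar> < s0 ==> \<bar>t\<bar> < s0 ==> norm (v s - v t) <= K * \<bar>s - t\<bar>"
    "!!s t. \<bar>s\<bar> < s0 ==> \<bar>t\<bar> < s0 ==> \<bar>lam s - lam t\<bar> <= K * \<bar>s - t\<bar>"
    "!!s t. \<bar>s\<bar> < s0 ==> \<bar>t\<bar> < s0 ==>
       norm (N (s *\<^sub>R b + v s) - N (t *\<^sub>R b + v t)) <= K * \<bar>s - t\<bar>"
proof -
  interpret S: bounded_linear S by (rule S(1))
  interpret T: bounded_linear T by (rule T(1))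
  interpret L: bounded_linear L by (rule L)
  obtain k where k: "0 < k" "!!x. norm (S x) <= norm x * k" using S.pos_bounded by blast
  obtain t where t: "0 < t" "!!x. norm (T x) <= norm x * t" using T.pos_bounded by blast
  obtain l where l: "0 < l" "!!x. norm (L x) <= norm x * l" using L.pos_bounded by blast
  define B where "B = norm b + 1"
  have B: "1 <= B" "norm b <= B" by (auto simp: B_def)
  define M where "M = C * B * B"
  have M: "0 < M" using NC B by (simp add: M_def)
  \<comment> \<open>The ball has radius \<open>K * s\<^sup>2\<close>: the nonlinear term, through
    \<open>T\<close>, fills at most half of it, and the term with \<open>S\<close> at most the other
    half.\<close>
  define K where "K = 2 * t * M + 1"
  have K: "1 <= K" using t M by (simp add: K_def)
  \<comment> \<open>The summands are the Lipschitz contributions of \<open>S v\<close> with its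
    factor frozen, of that factor, and of the nonlinear term. The whole map has constant
    \<open>D * \<bar>s\<bar>\<close>.\<close>
  define D where "D = l * M * k + l * C * B * k * K + t * C * B"
  have D: "0 <= D" using l M k NC B K t by (simp add: D_def)
  define s0 where "s0 = Min {1, 1 / K, r / B, 1 / (2 * (l * M * k + 1)), 1 / (2 * (D + 1))}"
  have s0: "0 < s0" using K r B l M k D by (simp add: s0_def add_nonneg_pos)
  have s0_le: "s0 <= 1" "s0 <= 1 / K" "s0 <= r / B" "s0 <= 1 / (2 * (l * M * k + 1))" "s0 <= 1 / (2 * (D + 1))"
    by (auto simp: s0_def)
  have Ks: "K * s\<^sup>2 <= \<bar>s\<bar>" "B * \<bar>s\<bar> <= r" "l * M * k * \<bar>s\<bar> <= 1 / 2" "D * \<bar>s\<bar> <= 1 / 2" "\<bar>s\<bar> <= 1"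
    if "\<bar>s\<bar> < s0" for s
  proof -
    have "K * \<bar>s\<bar> <= K * (1 / K)" using K s0_le that by (intro mult_left_mono) auto
    then have 1: "K * \<bar>s\<bar> <= 1" using K by simp
    have "K * s\<^sup>2 = (K * \<bar>s\<bar>) * \<bar>s\<bar>" by (simp add: power2_eq_square abs_mult_self_eq mult.assoc)
    also have "\<dots> <= 1 * \<bar>s\<bar>" using 1 by (intro mult_right_mono) auto
    finally show "K * s\<^sup>2 <= \<bar>s\<bar>" by simp
    have "B * \<bar>s\<bar> <= B * (r / B)" using B s0_le that by (intro mult_left_mono) auto
    then show "B * \<bar>s\<bar> <= r" using B by simp
    have *: "x * \<bar>s\<bar> <= 1 / 2" if x: "0 <= x" "s0 <= 1 / (2 * (x + 1))" for x
    proof -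
      have "x * \<bar>s\<bar> <= (x + 1) * (1 / (2 * (x + 1)))"
        using x \<open>\<bar>s\<bar> < s0\<close> by (intro mult_mono) auto
      also have "\<dots> = 1 / 2" using x by simp
      finally show ?thesis .
    qed
    show "l * M * k * \<bar>s\<bar> <= 1 / 2" using l M k s0_le by (intro *) auto
    show "D * \<bar>s\<bar> <= 1 / 2" using D s0_le by (intro *) auto
    show "\<bar>s\<bar> <= 1" using s0_le that by simp
  qed
  have u: "norm (s *\<^sub>R b + v) <= B * \<bar>s\<bar>" if "\<bar>s\<bar> < s0" "norm v <= K * s\<^sup>2" for s v
  proof -
    have "norm (s *\<^sub>R b + v) <= \<bar>s\<bar> * norm b + norm v"
      using norm_triangle_ineq[of "s *\<^sub>R b" v] by simp
    also have "\<dots> <= \<bar>s\<bar> * norm b + \<bar>s\<bar>" using Ks[OF that(1)] that(2) by linarith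
    finally show ?thesis by (simp add: B_def algebra_simps)
  qed
  have Nb: "norm (N (s *\<^sub>R b + v)) <= M * s\<^sup>2" if "\<bar>s\<bar> < s0" "norm v <= K * s\<^sup>2" for s v
  proof -
    have "norm (N (s *\<^sub>R b + v) - N 0) <= C * (B * \<bar>s\<bar>) * norm (s *\<^sub>R b + v - 0)"
      using u[OF that] Ks[OF that(1)] B by (intro NC(2)) auto
    also have "\<dots> <= C * (B * \<bar>s\<bar>) * (B * \<bar>s\<bar>)"
      using u[OF that] NC B by (intro mult_left_mono) auto
    also have "\<dots> = M * s\<^sup>2" by (simp add: M_def power2_eq_square mult_ac)
    finally show ?thesis by (simp add: N0)
  qed
  \<comment> \<open>The candidate for \<open>lam\<close>. At \<open>s = 0\<close> division yields 0,
    in agreement with the bound \<open>\<bar>mu s v\<bar> \<le> l * M * \<bar>s\<bar>\<close>; the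
    ball is then reduced to the origin.\<close>
  define mu where "mu s v = L (N (s *\<^sub>R b + v)) / s" for s v
  have s_mu: "s * mu s v = L (N (s *\<^sub>R b + v))" if "\<bar>s\<bar> < s0" "norm v <= K * s\<^sup>2" for s v
  proof (cases "s = 0")
    case True
    then show ?thesis using that by (simp add: N0 L.zero)
  qed (simp add: mu_def)
  have mu_b: "\<bar>mu s v\<bar> <= l * M * \<bar>s\<bar>" if "\<bar>s\<bar> < s0" "norm v <= K * s\<^sup>2" for s v
  proof (cases "s = 0")
    case False
    have "\<bar>L (N (s *\<^sub>R b + v))\<bar> <= norm (N (s *\<^sub>R b + v)) * l" using l(2) by (metis real_norm_def)
    also have "\<dots> <= M * s\<^sup>2 * l" using Nb[OF that] l by (intro mult_right_mono) auto
    finally have "\<bar>mu s v\<bar> <= M * s\<^sup>2 * l / \<bar>s\<bar>" by (simp add: mu_def divide_right_mono)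
    also have "\<dots> = l * M * \<bar>s\<bar>" using False by (simp add: power2_eq_square field_simps flip: abs_mult)
    finally show ?thesis .
  qed (simp add: mu_def)
  define \<Phi> where "\<Phi> s v = mu s v *\<^sub>R S v + T (N (s *\<^sub>R b + v))" for s v
  have ND: "norm (N (s *\<^sub>R b + v) - N (s' *\<^sub>R b + w)) <= C * (B * m) * (\<bar>s - s'\<bar> * B + norm (v - w))"
    if "\<bar>s\<bar> < s0" "norm v <= K * s\<^sup>2" "\<bar>s'\<bar> < s0" "norm w <= K * s'\<^sup>2" "\<bar>s\<bar> <= m" "\<bar>s'\<bar> <= m" "m < s0"
    for s v s' w m
  proof -
    have m: "0 <= m" using that by linarith
    have "norm (s *\<^sub>R b + v) <= B * m" "norm (s' *\<^sub>R b + w) <= B * m"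
      using u[OF that(1,2)] u[OF that(3,4)] mult_left_mono[OF that(5), of B]
        mult_left_mono[OF that(6), of B] B by linarith+
    then have "norm (N (s *\<^sub>R b + v) - N (s' *\<^sub>R b + w)) <= C * (B * m) * norm (s *\<^sub>R b + v - (s' *\<^sub>R b + w))"
      using Ks(2)[of m] m that by (intro NC(2)) auto
    also have "\<dots> <= C * (B * m) * (\<bar>s - s'\<bar> * B + norm (v - w))"
    proof (rule mult_left_mono)
      have "s *\<^sub>R b + v - (s' *\<^sub>R b + w) = (s - s') *\<^sub>R b + (v - w)" by (simp add: algebra_simps)
      then have "norm (s *\<^sub>R b + v - (s' *\<^sub>R b + w)) <= norm ((s - s') *\<^sub>R b) + norm (v - w)"
        by (simp only: norm_triangle_ineq)
      then have "norm (s *\<^sub>R b + v - (s' *\<^sub>R b + w)) <= \<bar>s - s'\<bar> * norm b + norm (v - w)"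
        by simp
      also have "\<dots> <= \<bar>s - s'\<bar> * B + norm (v - w)" using B by (intro add_right_mono mult_left_mono) auto
      finally show "norm (s *\<^sub>R b + v - (s' *\<^sub>R b + w)) <= \<bar>s - s'\<bar> * B + norm (v - w)" .
    qed (use NC B m in auto)
    finally show ?thesis .
  qed
  have Lb: "\<bar>L x\<bar> <= norm x * l" for x using l(2)[of x] by simp
  have ex: "\<exists>v. v \<in> V & norm v <= K * s\<^sup>2 & \<Phi> s v = v" if s: "\<bar>s\<bar> < s0" for s
  proof -
    define A where "A = V \<inter> cball 0 (K * s\<^sup>2)"
    have A: "v \<in> V" "norm v <= K * s\<^sup>2" if "v \<in> A" for v using that by (auto simp: A_def)
    have "\<exists>!v\<in>A. \<Phi> s v = v"
    proof (rule Banach_fix[where c = "1/2"])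
      show "complete A" unfolding A_def using V by (simp add: complete_eq_closed closed_Int)  
      have "0 \<in> A" using V(2) K by (auto simp: A_def subspace_0)
      then show "A \<noteq> {}" by blast
      show "\<Phi> s ` A \<subseteq> A"
      proof
        fix w assume "w \<in> \<Phi> s ` A"
        then obtain v where v: "v \<in> A" "w = \<Phi> s v" by blast
        note v' = A[OF v(1)]
        have "norm (s *\<^sub>R b + v) <= r" using u[OF s v'(2)] Ks(2)[OF s] by linarith
        then have "w \<in> V" unfolding v(2) \<Phi>_def using v' V(2) b
          by (intro subspace_add subspace_scale S T NV) auto
        have "norm w <= \<bar>mu s v\<bar> * norm (S v) + norm (T (N (s *\<^sub>R b + v)))"
          unfolding v(2) \<Phi>_def using norm_triangle_ineq[of "mu s v *\<^sub>R S v"] by simp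
        also have "\<dots> <= (l * M * \<bar>s\<bar>) * (K * s\<^sup>2 * k) + M * s\<^sup>2 * t"
          using k t mu_b[OF s v'(2)] Nb[OF s v'(2)] l M
          by (intro add_mono mult_mono order_trans[OF k(2)] order_trans[OF t(2)] mult_right_mono v') auto
        also have "\<dots> = (l * M * k * \<bar>s\<bar>) * (K * s\<^sup>2) + t * M * s\<^sup>2" by (simp add: mult_ac)
        also have "\<dots> <= 1 / 2 * (K * s\<^sup>2) + t * M * s\<^sup>2"
          using Ks(3)[OF s] K by (intro add_right_mono mult_right_mono) auto
        also have "\<dots> <= K * s\<^sup>2" by (simp add: K_def algebra_simps)
        finally show "w \<in> A" using \<open>w \<in> V\<close> by (simp add: A_def)
      qed
      fix v w assume vw: "v \<in> A" "w \<in> A"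
      note v = A[OF vw(1)] and w = A[OF vw(2)]
      have n: "norm (N (s *\<^sub>R b + v) - N (s *\<^sub>R b + w)) <= C * B * \<bar>s\<bar> * norm (v - w)"
        using ND[OF s v(2) s w(2), of "\<bar>s\<bar>"] s by (simp add: mult_ac)
      have mu_d: "\<bar>mu s v - mu s w\<bar> <= l * C * B * norm (v - w)"
      proof (cases "s = 0")
        case False
        have "mu s v - mu s w = L (N (s *\<^sub>R b + v) - N (s *\<^sub>R b + w)) / s"
          by (simp add: mu_def L.diff diff_divide_distrib)
        then have "\<bar>mu s v - mu s w\<bar> <= norm (N (s *\<^sub>R b + v) - N (s *\<^sub>R b + w)) * l / \<bar>s\<bar>"
          using Lb by (simp add: divide_right_mono)
        also have "\<dots> <= C * B * \<bar>s\<bar> * norm (v - w) * l / \<bar>s\<bar>"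
          using n l by (intro divide_right_mono mult_right_mono) auto
        also have "\<dots> = l * C * B * norm (v - w)" using False by simp
        finally show ?thesis .
      qed (use l NC B in \<open>simp add: mu_def\<close>)
      have "\<Phi> s v - \<Phi> s w = mu s v *\<^sub>R S (v - w) + (mu s v - mu s w) *\<^sub>R S w
          + T (N (s *\<^sub>R b + v) - N (s *\<^sub>R b + w))"
        by (simp add: \<Phi>_def S.diff T.diff algebra_simps)
      then have "dist (\<Phi> s v) (\<Phi> s w) <= \<bar>mu s v\<bar> * norm (S (v - w)) + \<bar>mu s v - mu s w\<bar> * norm (S w)
          + norm (T (N (s *\<^sub>R b + v) - N (s *\<^sub>R b + w)))"
        unfolding dist_norm
        by (metis (no_types, lifting) norm_triangle_le add_mono norm_scaleR order_refl)
      also have "\<dots> <= (l * M * \<bar>s\<bar>) * (norm (v - w) * k) + (l * C * B * norm (v - w)) * (K * s\<^sup>2 * k)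
          + C * B * \<bar>s\<bar> * norm (v - w) * t"
        using k t mu_b[OF s v(2)] mu_d n l M NC B K
        by (intro add_mono mult_mono order_trans[OF k(2)] order_trans[OF t(2)] mult_right_mono w) auto
      also have "\<dots> <= (l * M * \<bar>s\<bar>) * (norm (v - w) * k) + (l * C * B * norm (v - w)) * (K * \<bar>s\<bar> * k)
          + C * B * \<bar>s\<bar> * norm (v - w) * t"
      proof -
        have "s\<^sup>2 <= \<bar>s\<bar>"
          using Ks(5)[OF s] mult_left_mono[of "\<bar>s\<bar>" 1 "\<bar>s\<bar>"] by (simp add: power2_eq_square flip: abs_mult)
        then show ?thesis using l NC B K k by (intro add_mono order_refl mult_left_mono mult_right_mono) auto
      qed
      also have "\<dots> = D * \<bar>s\<bar> * norm (v - w)" by (simp add: D_def algebra_simps)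
      also have "\<dots> <= 1 / 2 * dist v w" unfolding dist_norm using Ks(4)[OF s] by (intro mult_right_mono) auto
      finally show "dist (\<Phi> s v) (\<Phi> s w) <= 1 / 2 * dist v w" .
    qed auto
    then show ?thesis using A by blast
  qed
  define v where "v s = (SOME v. v \<in> V & norm v <= K * s\<^sup>2 & \<Phi> s v = v)" for s
  have v: "v s \<in> V" "norm (v s) <= K * s\<^sup>2" "\<Phi> s (v s) = v s" if "\<bar>s\<bar> < s0" for s
    using someI_ex[OF ex[OF that]] by (auto simp: v_def)
  define lam where "lam s = mu s (v s)" for s
  define E where "E = 2 * ((l * C * B * B + l * M) * K * k + C * B * B * t)"
  have E: "0 <= E" using l NC B M k K t by (simp add: E_def)
  define F where "F = l * C * B * B + l * M"
  have F: "0 <= F" using l NC B M by (simp add: F_def)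
  \<comment> \<open>Division by the parameter is harmless only for the larger of the two in absolute
    value, hence the ordering; it is removed afterwards by symmetry.\<close>
  have lip: "norm (v s - v q) <= E * \<bar>s - q\<bar> & \<bar>lam s - lam q\<bar> <= (l * C * B * B + l * M) * \<bar>s - q\<bar> + l * C * B * norm (v s - v q)
    & norm (N (s *\<^sub>R b + v s) - N (q *\<^sub>R b + v q)) <= C * B * (B * \<bar>s - q\<bar> + norm (v s - v q))"
    if s: "\<bar>s\<bar> < s0" and q: "\<bar>q\<bar> < s0" and qs: "\<bar>q\<bar> <= \<bar>s\<bar>" for s q
  proof -
    define d where "d = norm (v s - v q)"
    note vs = v[OF s] and vq = v[OF q]
    have n: "norm (N (s *\<^sub>R b + v s) - N (q *\<^sub>R b + v q)) <= C * (B * \<bar>s\<bar>) * (\<bar>s - q\<bar> * B + d)"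
      unfolding d_def by (rule ND) (use s q vs vq qs in auto)
    have mu_d: "\<bar>lam s - lam q\<bar> <= (l * C * B * B + l * M) * \<bar>s - q\<bar> + l * C * B * d"
    proof (cases "s = 0")
      case True
      then show ?thesis using qs l NC B by (simp add: d_def)
    next
      case False
      \<comment> \<open>Subtracting the two bifurcation equations leaves the extra term
        \<open>(s - q) * lam q\<close>, which is affordable because \<open>lam q\<close> is of order
        \<open>q\<close>.\<close>
      have "s * (lam s - lam q) = L (N (s *\<^sub>R b + v s) - N (q *\<^sub>R b + v q)) - (s - q) * lam q"
        using s_mu[OF s vs(2)] s_mu[OF q vq(2)] by (simp add: lam_def L.diff algebra_simps)
      then have "\<bar>s\<bar> * \<bar>lam s - lam q\<bar> <= \<bar>L (N (s *\<^sub>R b + v s) - N (q *\<^sub>R b + v q))\<bar> + \<bar>s - q\<bar> * \<bar>lam q\<bar>"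
        by (metis abs_mult abs_triangle_ineq4)
      also have "\<dots> <= C * (B * \<bar>s\<bar>) * (\<bar>s - q\<bar> * B + d) * l + \<bar>s - q\<bar> * (l * M * \<bar>s\<bar>)"
      proof (intro add_mono mult_left_mono)
        show "\<bar>L (N (s *\<^sub>R b + v s) - N (q *\<^sub>R b + v q))\<bar> <= C * (B * \<bar>s\<bar>) * (\<bar>s - q\<bar> * B + d) * l"
          by (rule order_trans[OF Lb]) (use n l in \<open>auto intro: mult_right_mono\<close>)
        have "\<bar>lam q\<bar> <= l * M * \<bar>q\<bar>" unfolding lam_def by (rule mu_b[OF q vq(2)])
        also have "\<dots> <= l * M * \<bar>s\<bar>" using qs l M by (intro mult_left_mono) auto
        finally show "\<bar>lam q\<bar> <= l * M * \<bar>s\<bar>" .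
      qed auto
      also have "\<dots> = \<bar>s\<bar> * ((l * C * B * B + l * M) * \<bar>s - q\<bar> + l * C * B * d)" by (simp add: algebra_simps)
      finally show ?thesis using False by simp
    qed
    have "v s - v q = \<Phi> s (v s) - \<Phi> q (v q)" using vs vq by simp
    also have "\<dots> = lam s *\<^sub>R S (v s - v q) + (lam s - lam q) *\<^sub>R S (v q)
        + T (N (s *\<^sub>R b + v s) - N (q *\<^sub>R b + v q))"
      by (simp add: \<Phi>_def lam_def S.diff T.diff algebra_simps)
    finally have "d <= \<bar>lam s\<bar> * norm (S (v s - v q)) + \<bar>lam s - lam q\<bar> * norm (S (v q))
        + norm (T (N (s *\<^sub>R b + v s) - N (q *\<^sub>R b + v q)))"
      unfolding d_def by (metis (no_types, lifting) norm_triangle_le add_mono norm_scaleR order_refl)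
    also have "\<dots> <= (l * M * \<bar>s\<bar>) * (d * k) + ((l * C * B * B + l * M) * \<bar>s - q\<bar> + l * C * B * d) * (K * \<bar>s\<bar> * k)
        + C * (B * \<bar>s\<bar>) * (\<bar>s - q\<bar> * B + d) * t"
    proof -
      have 1: "\<bar>lam s\<bar> <= l * M * \<bar>s\<bar>" unfolding lam_def by (rule mu_b[OF s vs(2)])
      have 2: "norm (S (v s - v q)) <= d * k" unfolding d_def by (rule k)
      have "q\<^sup>2 <= \<bar>s\<bar>"
      proof -
        have "q\<^sup>2 = \<bar>q\<bar> * \<bar>q\<bar>" by (simp add: power2_eq_square)
        also have "\<dots> <= 1 * \<bar>s\<bar>" using Ks(5)[OF q] qs by (intro mult_mono) auto
        finally show ?thesis by simp
      qed
      then have "norm (v q) <= K * \<bar>s\<bar>" using K by (intro order_trans[OF vq(2)] mult_left_mono) auto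
      then have 3: "norm (S (v q)) <= K * \<bar>s\<bar> * k"
        using k by (intro order_trans[OF k(2)] mult_right_mono) auto
      have 4: "norm (T (N (s *\<^sub>R b + v s) - N (q *\<^sub>R b + v q))) <= C * (B * \<bar>s\<bar>) * (\<bar>s - q\<bar> * B + d) * t"
        using n t by (intro order_trans[OF t(2)] mult_right_mono) auto
      have "0 <= d" by (simp add: d_def)
      then show ?thesis using 1 2 3 4 mu_d l M k NC B K
        by (intro add_mono mult_mono) auto
    qed
    also have "\<dots> = D * \<bar>s\<bar> * d + ((l * C * B * B + l * M) * K * k + C * B * B * t) * \<bar>s - q\<bar> * \<bar>s\<bar>"
      by (simp add: D_def algebra_simps)
    also have "\<dots> <= 1 / 2 * d + ((l * C * B * B + l * M) * K * k + C * B * B * t) * \<bar>s - q\<bar> * 1"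
    proof (intro add_mono mult_right_mono mult_left_mono)
      show "D * \<bar>s\<bar> <= 1 / 2" by (rule Ks[OF s])
      show "0 <= d" by (simp add: d_def)
      show "\<bar>s\<bar> <= 1" by (rule Ks[OF s])
    qed (use l M k NC B K t in auto)
    finally have "d <= 2 * (((l * C * B * B + l * M) * K * k + C * B * B * t) * \<bar>s - q\<bar>)" by simp
    also have "\<dots> = E * \<bar>s - q\<bar>" by (simp add: E_def)
    finally have "d <= E * \<bar>s - q\<bar>" .
    moreover have "C * (B * \<bar>s\<bar>) * (\<bar>s - q\<bar> * B + d) <= C * (B * 1) * (\<bar>s - q\<bar> * B + d)"
      using Ks(5)[OF s] NC B by (intro mult_right_mono mult_left_mono) (auto simp: d_def)
    then have "norm (N (s *\<^sub>R b + v s) - N (q *\<^sub>R b + v q)) <= C * B * (B * \<bar>s - q\<bar> + d)"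
      using n by (simp only: mult_1_right mult.commute[of "\<bar>s - q\<bar>" B])
    ultimately show ?thesis using mu_d unfolding d_def by blast
  qed
  define H where "H = K + M + l * M + E + (F + l * C * B * E) + C * B * (B + E)"
  have H: "K <= H" "M <= H" "l * M <= H" "E <= H" "F + l * C * B * E <= H" "C * B * (B + E) <= H" "0 < H"
  proof -
    have "0 <= l * M" "0 <= F + l * C * B * E" "0 <= C * B * (B + E)" using l M F NC B E by auto
    then show "K <= H" "M <= H" "l * M <= H" "E <= H" "F + l * C * B * E <= H" "C * B * (B + E) <= H" "0 < H"
      using K M E unfolding H_def by linarith+
  qed
  have all: "norm (v s - v q) <= H * \<bar>s - q\<bar> & \<bar>lam s - lam q\<bar> <= H * \<bar>s - q\<bar>
    & norm (N (s *\<^sub>R b + v s) - N (q *\<^sub>R b + v q)) <= H * \<bar>s - q\<bar>"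
    if s: "\<bar>s\<bar> < s0" and q: "\<bar>q\<bar> < s0" and qs: "\<bar>q\<bar> <= \<bar>s\<bar>" for s q
  proof -
    note 1 = lip[OF that, folded F_def]
    have "\<bar>lam s - lam q\<bar> <= F * \<bar>s - q\<bar> + l * C * B * (E * \<bar>s - q\<bar>)"
    proof -
      have "l * C * B * norm (v s - v q) <= l * C * B * (E * \<bar>s - q\<bar>)"
        by (rule mult_left_mono) (use 1 l NC B in auto)
      then show ?thesis using 1 by linarith
    qed
    also have "\<dots> = (F + l * C * B * E) * \<bar>s - q\<bar>" by (simp add: algebra_simps)
    also have "\<dots> <= H * \<bar>s - q\<bar>" by (intro mult_right_mono H) auto
    finally have 2: "\<bar>lam s - lam q\<bar> <= H * \<bar>s - q\<bar>" .
    have "norm (N (s *\<^sub>R b + v s) - N (q *\<^sub>R b + v q)) <= C * B * (B * \<bar>s - q\<bar> + E * \<bar>s - q\<bar>)"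
    proof -
      have "C * B * (B * \<bar>s - q\<bar> + norm (v s - v q)) <= C * B * (B * \<bar>s - q\<bar> + E * \<bar>s - q\<bar>)"
        by (rule mult_left_mono) (use 1 NC B in auto)
      then show ?thesis using 1 by linarith
    qed
    also have "\<dots> = C * B * (B + E) * \<bar>s - q\<bar>" by (simp add: algebra_simps)
    also have "\<dots> <= H * \<bar>s - q\<bar>" by (intro mult_right_mono H) auto
    finally have 3: "norm (N (s *\<^sub>R b + v s) - N (q *\<^sub>R b + v q)) <= H * \<bar>s - q\<bar>" .
    have "norm (v s - v q) <= H * \<bar>s - q\<bar>"
      using 1 mult_right_mono[OF H(4), of "\<bar>s - q\<bar>"] by linarith
    then show ?thesis using 2 3 by blast
  qed
  have all: "norm (v s - v q) <= H * \<bar>s - q\<bar> & \<bar>lam s - lam q\<bar> <= H * \<bar>s - q\<bar>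
    & norm (N (s *\<^sub>R b + v s) - N (q *\<^sub>R b + v q)) <= H * \<bar>s - q\<bar>"
    if s: "\<bar>s\<bar> < s0" and q: "\<bar>q\<bar> < s0" for s q
  proof (cases "\<bar>q\<bar> <= \<bar>s\<bar>")
    case False
    then show ?thesis using all[OF q s] by (simp add: norm_minus_commute abs_minus_commute)
  qed (use all[OF s q] in blast)
  have mono: "a <= H * x" if "a <= c * x" "c <= H" "0 <= x" for a c x :: real
    using that mult_right_mono[of c H x] by linarith
  show ?thesis
  proof (rule that[of s0 H v lam])
    fix s assume s: "\<bar>s\<bar> < s0"
    note vs = v[OF s]
    show "v s \<in> V" by (rule vs)
    show "norm (s *\<^sub>R b + v s) <= r" using u[OF s vs(2)] Ks(2)[OF s] by linarith
    show "norm (v s) <= H * s\<^sup>2" by (rule mono[OF vs(2) H(1)]) auto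
    show "norm (N (s *\<^sub>R b + v s)) <= H * s\<^sup>2" by (rule mono[OF Nb[OF s vs(2)] H(2)]) auto
    show "\<bar>lam s\<bar> <= H * \<bar>s\<bar>" unfolding lam_def by (rule mono[OF mu_b[OF s vs(2)] H(3)]) auto
    show "s * lam s = L (N (s *\<^sub>R b + v s))" unfolding lam_def by (rule s_mu[OF s vs(2)])
    show "v s = lam s *\<^sub>R S (v s) + T (N (s *\<^sub>R b + v s))"
      using vs(3) unfolding lam_def \<Phi>_def by simp
  qed (use s0 H all in auto)
qed

section \<open>Cat's eyes from convexity and symmetry\<close>

text \<open>Partial derivatives with names, in the sense of \<open>D1\<close> and \<open>D2\<close>:
  two-sided in the first variable, one-sided at the walls in the second.\<close>

definition has_partials ::
  "(real \<times> real => real) => (real \<times> real => real) => (real \<times> real => real) => bool" where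
  "has_partials f fx fy \<longleftrightarrow> (\<forall>x. \<forall>y\<in>{0..1}.
     ((\<lambda>t. f (t, y)) has_real_derivative fx (x, y)) (at x) &
     ((\<lambda>t. f (x, t)) has_real_derivative fy (x, y)) (at y within {0..1}))"

lemma has_partialsD:
  assumes "has_partials f fx fy" "y \<in> {0..1}"
  shows "((\<lambda>t. f (t, y)) has_real_derivative fx (x, y)) (at x)"
    "((\<lambda>t. f (x, t)) has_real_derivative fy (x, y)) (at y within {0..1})"
  using assms unfolding has_partials_def by auto

lemma has_partials_D1_D2:
  assumes "has_partials f fx fy" "z \<in> strip"
  shows "D1 f z = fx z" "D2 f z = fy z"
proof -
  obtain x y where z: "z = (x, y)" "y \<in> {0..1}" using assms(2) by (auto simp: strip_def)
  note d = has_partialsD[OF assms(1) z(2), of x]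
  show "D1 f z = fx z" unfolding z D1_def
    using d(1) by (simp add: has_real_derivative_iff_has_vector_derivative vector_derivative_at)
  show "D2 f z = fy z" unfolding z D2_def
    using vector_derivative_within_cbox[of 0 1 y "\<lambda>t. f (x, t)" "fy (x, y)"] d(2) z(2)
    by (simp add: has_real_derivative_iff_has_vector_derivative)
qed

text \<open>Comparing \<open>g\<close> with the level at a fixed height \<open>b\<close> shows on
  which side of \<open>b\<close> the solution lies, and this comparison is stable in
  \<open>x\<close>. Monotonicity replaces a nonzero derivative, which matters at the saddles, where
  the derivative in \<open>y\<close> vanishes.\<close>

lemma implicit_height_continuous:
  fixes g :: "real => real => real" and h \<tau> :: "real => real"
  assumes g: "!!y. 0 <= y ==> y <= d ==> continuous_on UNIV (\<lambda>x. g x y)"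
    and mono: "!!x y z. 0 <= y ==> y < z ==> z <= d ==> g x y < g x z"
    and \<tau>: "continuous_on UNIV \<tau>"
    and h: "!!x. 0 <= h x" "!!x. h x <= d" "!!x. g x (h x) = \<tau> x"
  shows "continuous_on UNIV h"
proof -
  have up: "\<forall>\<^sub>F x in at a. h x < b" if b: "h a < b" for a b
  proof (cases "b <= d")
    case True
    have "0 <= b" using b h(1)[of a] by linarith
    have "\<tau> a < g a b" using mono[of "h a" b a] b True h(1,3)[of a] by simp
    moreover have "((\<lambda>x. g x b - \<tau> x) \<longlongrightarrow> g a b - \<tau> a) (at a)"
      using g[OF \<open>0 <= b\<close> True] \<tau> by (intro tendsto_diff) (auto simp: continuous_on_def)
    ultimately have "\<forall>\<^sub>F x in at a. 0 < g x b - \<tau> x" by (intro order_tendstoD(1)) auto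
    then show ?thesis
    proof eventually_elim
      case (elim x)
      show ?case
      proof (rule ccontr)
        assume "\<not> h x < b"
        then have "g x b <= g x (h x)" using mono[of b "h x" x] \<open>0 <= b\<close> h(2)[of x] by (cases "b = h x") auto
        then show False using elim h(3)[of x] by simp
      qed
    qed
  next
    case False
    then have "h x < b" for x using h(2)[of x] by linarith
    then show ?thesis by simp
  qed
  have lo: "\<forall>\<^sub>F x in at a. b < h x" if b: "b < h a" for a b
  proof (cases "0 <= b")
    case True
    have "b <= d" using b h(2)[of a] by linarith
    have "g a b < \<tau> a" using mono[of b "h a" a] True b h(2,3)[of a] by simp
    moreover have "((\<lambda>x. \<tau> x - g x b) \<longlongrightarrow> \<tau> a - g a b) (at a)"
      using g[OF True \<open>b <= d\<close>] \<tau> by (intro tendsto_diff) (auto simp: continuous_on_def)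
    ultimately have "\<forall>\<^sub>F x in at a. 0 < \<tau> x - g x b" by (intro order_tendstoD(1)) auto
    then show ?thesis
    proof eventually_elim
      case (elim x)
      show ?case
      proof (rule ccontr)
        assume "\<not> b < h x"
        then have "g x (h x) <= g x b" using mono[of "h x" b x] h(1)[of x] \<open>b <= d\<close> by (cases "b = h x") auto
        then show False using elim h(3)[of x] by simp
      qed
    qed
  next
    case False
    then have "b < h x" for x using h(1)[of x] by linarith
    then show ?thesis by simp
  qed
  show ?thesis
    unfolding continuous_on_def by (auto intro!: order_tendstoI up lo)
qed

lemma shift_into_period:
  fixes x c :: real
  obtains k :: int where "\<bar>x - 2 * pi * of_int k - c\<bar> <= pi"
proof -
  define k where "k = round ((x - c) / (2 * pi))"
  have "\<bar>of_int k - (x - c) / (2 * pi)\<bar> <= 1 / 2" unfolding k_def by (rule of_int_round_abs_le)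
  then have "2 * pi * \<bar>of_int k - (x - c) / (2 * pi)\<bar> <= 2 * pi * (1 / 2)" by (intro mult_left_mono) auto
  moreover have "2 * pi * \<bar>of_int k - (x - c) / (2 * pi)\<bar> = \<bar>2 * pi * (of_int k - (x - c) / (2 * pi))\<bar>"
    by (simp add: abs_mult)
  moreover have "2 * pi * (of_int k - (x - c) / (2 * pi)) = - (x - 2 * pi * of_int k - c)"
    by (simp add: field_simps)
  ultimately have "\<bar>x - 2 * pi * of_int k - c\<bar> <= pi" by simp
  then show ?thesis by (rule that)
qed

text \<open>Convexity and reflection make \<open>\<Psi>\<close> strictly increasing in
  \<open>\<bar>y - 1 / 2\<bar>\<close>, so over each \<open>x\<close> a level is attained at most at
  two mirror points. By \<open>sgn\<close> the values on the axis fall strictly from the saddle at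
  \<open>p\<close> to the centre at \<open>p + pi\<close> and rise symmetrically to the next saddle.
  A level between the two extremes therefore bounds a lens around the centre, and \<open>lev\<close>
  keeps the separatrices inside the band.\<close>

theorem cats_eyes_criterion:
  fixes \<Psi> \<Psi>x \<Psi>y \<Psi>yy :: "real \<times> real => real" and p \<delta> d :: real
  assumes \<delta>: "\<delta> <= 1 / 2" and d: "0 < d" "d < \<delta>"
    and cont: "continuous_on strip \<Psi>"
    and partials: "has_partials \<Psi> \<Psi>x \<Psi>y"
    and dyy: "!!x y. y \<in> {0..1} ==> ((\<lambda>t. \<Psi>y (x, t)) has_real_derivative \<Psi>yy (x, y)) (at y within {0..1})"
    and convex: "!!x y. y \<in> {0..1} ==> 0 < \<Psi>yy (x, y)"
    and sym: "!!x y. y \<in> {0..1} ==> \<Psi> (x, 1 - y) = \<Psi> (x, y)"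
    and per: "!!x y. y \<in> {0..1} ==> \<Psi> (x + 2 * pi, y) = \<Psi> (x, y)"
    and even: "!!x y. y \<in> {0..1} ==> \<Psi> (2 * p - x, y) = \<Psi> (x, y)"
    and sgn: "!!x. 0 < sin (x - p) ==> \<Psi>x (x, 1 / 2) < 0" "!!x. sin (x - p) < 0 ==> 0 < \<Psi>x (x, 1 / 2)"
      "!!x. sin (x - p) = 0 ==> \<Psi>x (x, 1 / 2) = 0"
    and sad: "!!k :: int. D1 (D1 \<Psi>) (p + 2 * pi * of_int k, 1 / 2) < 0"
      "!!k :: int. 0 < D2 (D2 \<Psi>) (p + 2 * pi * of_int k, 1 / 2)"
    and lev: "!!x. \<Psi> (p, 1 / 2) < \<Psi> (x, 1 / 2 + d)"
  shows "cats_eyes \<delta> \<Psi>"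
proof -
  define c where "c = p + pi"
  define G where "G x h = \<Psi> (x, 1 / 2 + h)" for x h
  define m where "m x = \<Psi> (x, 1 / 2)" for x
  define m0 where "m0 = m p"
  have d2: "d < 1 / 2" using d \<delta> by simp
  have half_bound: "\<bar>y - 1 / 2\<bar> <= 1 / 2" if "y \<in> {0..1}" for y :: real
    using that unfolding abs_le_iff by auto
  have G0: "G x 0 = m x" for x by (simp add: G_def m_def)
  have Gabs: "\<Psi> (x, y) = G x \<bar>y - 1 / 2\<bar>" if "y \<in> {0..1}" for x y
    using sym[OF that, of x] by (auto simp: G_def abs_if algebra_simps)
  have half: "\<Psi>y (x, 1 / 2) = 0" for x
  proof -
    have int: "(1 / 2 :: real) \<in> interior {0..1}" by simp
    have 1: "((\<lambda>t. \<Psi> (x, t)) has_real_derivative \<Psi>y (x, 1 / 2)) (at (1 / 2))"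
      using has_partialsD(2)[OF partials, of "1 / 2" x] at_within_interior[OF int] by simp
    have "((\<lambda>t. \<Psi> (x, 1 - t)) has_real_derivative \<Psi>y (x, 1 / 2) * (- 1)) (at (1 / 2))"
    proof (rule DERIV_chain2[of "\<lambda>t. \<Psi> (x, t)" _ "\<lambda>t. 1 - t"])
      show "((\<lambda>t. \<Psi> (x, t)) has_real_derivative \<Psi>y (x, 1 / 2)) (at (1 - 1 / 2))" using 1 by simp
    qed (auto intro!: derivative_eq_intros)
    moreover have "\<forall>\<^sub>F t in nhds (1 / 2). \<Psi> (x, 1 - t) = \<Psi> (x, t)"
      using eventually_nhds_in_open[of "{0<..<1}" "1 / 2 :: real"] by (auto elim!: eventually_mono intro!: sym)
    ultimately have "((\<lambda>t. \<Psi> (x, t)) has_real_derivative \<Psi>y (x, 1 / 2) * (- 1)) (at (1 / 2))"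
      by (subst (asm) DERIV_cong_ev[OF refl _ refl]) auto
    from DERIV_unique[OF 1 this] show ?thesis by simp
  qed
  have ypos: "0 < \<Psi>y (x, y)" if y: "1 / 2 < y" "y <= 1" for x y
  proof -
    obtain z where "1 / 2 < z" "z < y" "\<Psi>y (x, y) - \<Psi>y (x, 1 / 2) = (y - 1 / 2) * \<Psi>yy (x, z)"
      using mvt_unit_interval[of "\<lambda>t. \<Psi>y (x, t)" "\<lambda>t. \<Psi>yy (x, t)" "1 / 2" y] dyy y by auto
    then show ?thesis using convex[of z x] y half by simp
  qed
  have yneg: "\<Psi>y (x, y) < 0" if y: "0 <= y" "y < 1 / 2" for x y
  proof -
    obtain z where "y < z" "z < 1 / 2" "\<Psi>y (x, 1 / 2) - \<Psi>y (x, y) = (1 / 2 - y) * \<Psi>yy (x, z)"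
      using mvt_unit_interval[of "\<lambda>t. \<Psi>y (x, t)" "\<lambda>t. \<Psi>yy (x, t)" y "1 / 2"] dyy y by auto
    then show ?thesis using mult_pos_pos[OF _ convex[of z x], of "1 / 2 - y"] y half[of x] by simp
  qed
  have Gmono: "G x h < G x k" if hk: "0 <= h" "h < k" "k <= 1 / 2" for x h k
  proof -
    obtain z where z: "1 / 2 + h < z" "z < 1 / 2 + k"
      "\<Psi> (x, 1 / 2 + k) - \<Psi> (x, 1 / 2 + h) = (1 / 2 + k - (1 / 2 + h)) * \<Psi>y (x, z)"
      using mvt_unit_interval[of "\<lambda>t. \<Psi> (x, t)" "\<lambda>t. \<Psi>y (x, t)" "1 / 2 + h" "1 / 2 + k"]
        has_partialsD(2)[OF partials] hk by auto
    have "0 < (1 / 2 + k - (1 / 2 + h)) * \<Psi>y (x, z)"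
      using ypos[of z x] hk z by (intro mult_pos_pos) auto
    then show ?thesis using z(3) unfolding G_def by linarith
  qed
  have Gle: "G x h <= G x k" if "0 <= h" "h <= k" "k <= 1 / 2" for x h k
    using Gmono[of h k x] that by (cases "h = k") auto
  have Ginj: "h = k" if "G x h = G x k" "0 <= h" "h <= 1 / 2" "0 <= k" "k <= 1 / 2" for x h k
    using Gmono[of h k x] Gmono[of k h x] that by (cases h k rule: linorder_cases) auto
  have Gc: "continuous_on UNIV (\<lambda>x. G x h)" if "0 <= h" "h <= 1 / 2" for h
    unfolding G_def by (rule continuous_on_compose2[OF cont]) (use that in \<open>auto simp: strip_def intro!: continuous_intros\<close>)
  have Gcy: "continuous_on {0..1/2} (G x)" for x
    unfolding G_def by (rule continuous_on_compose2[OF cont]) (auto simp: strip_def intro!: continuous_intros)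
  have mc: "continuous_on UNIV m" using Gc[of 0] by (simp add: G0)
  have perk: "\<Psi> (x + 2 * pi * of_int k, y) = \<Psi> (x, y)" if y: "y \<in> {0..1}" for x y and k :: int
  proof -
    have nat: "\<Psi> (x + 2 * pi * real n, y) = \<Psi> (x, y)" for x n
    proof (induction n)
      case (Suc n)
      have "x + 2 * pi * real (Suc n) = (x + 2 * pi * real n) + 2 * pi" by (simp add: algebra_simps)
      then show ?case using per[OF y, of "x + 2 * pi * real n"] Suc by (simp only:)
    qed simp
    show ?thesis
    proof (cases "0 <= k")
      case True
      then show ?thesis using nat[of x "nat k"] by simp
    next
      case False
      then show ?thesis using nat[of "x + 2 * pi * of_int k" "nat (- k)"] by (simp add: algebra_simps)
    qed
  qed
  have mper: "m (x + 2 * pi * of_int k) = m x" for x and k :: int unfolding m_def by (rule perk) auto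
  have meven: "m (c - t) = m (c + t)" for t
  proof -
    have "m (c + t) = m (2 * p - (c + t))" unfolding m_def by (rule even[symmetric]) auto
    also have "\<dots> = m (2 * p - (c + t) + 2 * pi * of_int 1)" by (simp only: mper)
    finally show ?thesis by (simp add: c_def algebra_simps)
  qed
  have mmono: "m (c + s) < m (c + t)" if st: "0 <= s" "s < t" "t <= pi" for s t
  proof (rule DERIV_pos_imp_increasing_open[of "c + s" "c + t" m])
    fix x assume x: "c + s < x" "x < c + t"
    have "sin (x - p) = - sin (x - c)" by (simp add: c_def algebra_simps sin_diff)
    moreover have "0 < sin (x - c)" using x st by (intro sin_gt_zero) auto
    ultimately have "0 < \<Psi>x (x, 1 / 2)" using sgn(2) by simp
    moreover have "(m has_real_derivative \<Psi>x (x, 1 / 2)) (at x)"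
      using has_partialsD(1)[OF partials, of "1 / 2" x] by (simp add: m_def [abs_def])
    ultimately show "\<exists>y. (m has_real_derivative y) (at x) & 0 < y" by blast
  qed (use st mc continuous_on_subset in auto)
  have mabs: "m x = m (c + \<bar>x - c\<bar>)" for x using meven[of "c - x"] by (simp add: abs_if algebra_simps)
  have m0: "m0 = m (c + pi)" using mper[of p 1] by (simp add: m0_def c_def algebra_simps)
  have mle: "m x <= m0" and meq: "m x = m0 ==> \<exists>k :: int. x = p + 2 * pi * of_int k" for x
  proof -
    obtain k :: int where k: "\<bar>x - 2 * pi * of_int k - c\<bar> <= pi" using shift_into_period .
    define t where "t = \<bar>x - 2 * pi * of_int k - c\<bar>"
    have "m x = m (x - 2 * pi * of_int k)" using mper[of "x - 2 * pi * of_int k" k] by simp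
    then have mt: "m x = m (c + t)" using mabs[of "x - 2 * pi * of_int k"] by (simp add: t_def)
    have t: "0 <= t" "t <= pi" using k by (auto simp: t_def)
    show "m x <= m0" using mmono[of t pi] t unfolding mt m0 by (cases "t = pi") auto
    assume "m x = m0"
    then have "t = pi" using mmono[of t pi] t unfolding mt m0 by (cases "t = pi") auto
    then have "x - 2 * pi * of_int k - c = pi \<or> x - 2 * pi * of_int k - c = - pi" by (auto simp: t_def abs_if split: if_splits)
    then have "x = p + 2 * pi * of_int (k + 1) \<or> x = p + 2 * pi * of_int k" by (auto simp: c_def algebra_simps)
    then show "\<exists>k :: int. x = p + 2 * pi * of_int k" by blast
  qed
  have mlt: "m x < m0" if "\<bar>x - c\<bar> < pi" for x
    using mmono[of "\<bar>x - c\<bar>" pi] that unfolding m0 mabs[of x] by simp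
  have lev': "m0 < G x d" for x using lev[of x] by (simp add: m0_def m_def G_def)
  have hex: "\<exists>h. 0 <= h & h < d & G x h = max e (m x)" if "e <= m0" for e x
  proof -
    have "G x 0 <= max e (m x)" by (simp add: G0)
    moreover have lt: "max e (m x) < G x d" using lev'[of x] mle[of x] that by auto
    ultimately obtain h where h: "0 <= h" "h <= d" "G x h = max e (m x)"
      using IVT'[of "G x" 0 "max e (m x)" d] continuous_on_subset[OF Gcy, of "{0..d}" x] d d2 by auto
    then show ?thesis using lt by (intro exI[of _ h]) (cases "h = d", auto)
  qed
  \<comment> \<open>Half the height of the level line \<open>e\<close> over \<open>x\<close>. Where
    the axis value already exceeds \<open>e\<close>, the maximum makes it 0, so that
    \<open>H e\<close> is defined and continuous on the whole line.\<close>
  define H where "H e x = (SOME h. 0 <= h & h < d & G x h = max e (m x))" for e x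
  have H: "0 <= H e x" "H e x < d" "G x (H e x) = max e (m x)" if "e <= m0" for e x
    using someI_ex[OF hex[OF that]] unfolding H_def by blast+
  have Hc: "continuous_on UNIV (H e)" if e: "e <= m0" for e
  proof (rule implicit_height_continuous[of "1/2" G "\<lambda>x. max e (m x)"])
    show "H e x <= 1 / 2" for x using H(2)[OF e, of x] d2 by simp
  qed (use H[OF e] Gc Gmono mc in \<open>auto intro!: continuous_intros\<close>)
  have Heq: "H e x = \<bar>y - 1 / 2\<bar>" if "e <= m0" "y \<in> {0..1}" "\<Psi> (x, y) = e" for e x y
  proof (rule Ginj[of x])
    have y: "0 <= \<bar>y - 1 / 2\<bar>" "\<bar>y - 1 / 2\<bar> <= 1 / 2" using half_bound[OF that(2)] by auto
    have "m x <= e" using Gle[OF order_refl y, of x] Gabs[OF that(2)] that(3) G0 by simp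
    then show "G x (H e x) = G x \<bar>y - 1 / 2\<bar>" using H(3)[OF that(1)] Gabs[OF that(2)] that(3) by simp
  qed (use H(1,2)[OF that(1), of x] d2 half_bound[OF that(2)] in auto)
  have Hval: "\<Psi> (x, 1 / 2 + H e x) = max e (m x)" "\<Psi> (x, 1 / 2 - H e x) = max e (m x)"
    "1 / 2 + H e x \<in> {0..1}" "1 / 2 - H e x \<in> {0..1}" if "e <= m0" for e x
  proof -
    have i: "1 / 2 + H e x \<in> {0..1}" "1 / 2 - H e x \<in> {0..1}" using H(1,2)[OF that, of x] d2 by auto
    then show "1 / 2 + H e x \<in> {0..1}" "1 / 2 - H e x \<in> {0..1}" by auto
    show "\<Psi> (x, 1 / 2 + H e x) = max e (m x)" "\<Psi> (x, 1 / 2 - H e x) = max e (m x)"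
      using Gabs[OF i(1)] Gabs[OF i(2)] H[OF that, of x] by auto
  qed
  have Hlt: "\<bar>y - 1 / 2\<bar> < H m0 x \<longleftrightarrow> \<Psi> (x, y) < m0" if y: "y \<in> {0..1}" for x y
  proof -
    have y': "\<bar>y - 1 / 2\<bar> <= 1 / 2" by (rule half_bound[OF y])
    have Hm: "G x (H m0 x) = m0" using H(3)[of m0 x] mle[of x] by simp
    show ?thesis unfolding Gabs[OF y]
      using Gmono[of "\<bar>y - 1 / 2\<bar>" "H m0 x" x] Gle[of "H m0 x" "\<bar>y - 1 / 2\<bar>" x] H(1,2)[of m0 x] Hm y' d2
      by (cases "\<bar>y - 1 / 2\<bar> < H m0 x") auto
  qed
  define u where "u x = 1 / 2 + H m0 x" for x
  define l where "l x = 1 / 2 - H m0 x" for x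
  define eye where "eye = {(x, y). p < x & x < p + 2 * pi & l x < y & y < u x}"
  have eye_iff: "(x, y) \<in> eye \<longleftrightarrow> \<bar>x - c\<bar> < pi & y \<in> {0..1} & \<Psi> (x, y) < m0" for x y
  proof -
    have 1: "p < x & x < p + 2 * pi \<longleftrightarrow> \<bar>x - c\<bar> < pi" by (auto simp: c_def abs_less_iff)
    have 2: "l x < y & y < u x \<longleftrightarrow> \<bar>y - 1 / 2\<bar> < H m0 x" by (auto simp: l_def u_def abs_less_iff)
    have 3: "y \<in> {0..1}" if "\<bar>y - 1 / 2\<bar> < H m0 x" using that H(2)[of m0 x] d2 by (auto simp: abs_less_iff)
    show ?thesis unfolding eye_def mem_Collect_eq case_prod_conv using 1 2 3 Hlt[of y x] by blast
  qed
  have closed_lines: "streamline \<Psi> z \<subseteq> eye & closed_streamline_around (c, 1 / 2) \<Psi> z"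
    if z: "z \<in> eye" "z \<noteq> (c, 1 / 2)" for z
  proof -
    obtain zx zy where zz: "z = (zx, zy)" by (cases z)
    define e where "e = \<Psi> z"
    have zi: "\<bar>zx - c\<bar> < pi" "zy \<in> {0..1}" "e < m0" using z(1) eye_iff unfolding zz e_def by auto
    have em: "e <= m0" using zi by simp
    have ce: "m c < e"
    proof -
      have zy': "0 <= \<bar>zy - 1 / 2\<bar>" "\<bar>zy - 1 / 2\<bar> <= 1 / 2" using half_bound[OF zi(2)] by auto
      have "m zx <= e" using Gle[OF order_refl zy', of zx] Gabs[OF zi(2), of zx] G0 by (simp add: e_def zz)
      moreover have "m c <= m zx" using mmono[of 0 "\<bar>zx - c\<bar>"] mabs[of zx] zi(1) by (cases "zx = c") auto
      moreover have "m c < m zx \<or> m zx < e"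
      proof (cases "zx = c")
        case True
        then have "zy \<noteq> 1 / 2" using z(2) zz by auto
        then have "G zx 0 < G zx \<bar>zy - 1 / 2\<bar>" using zy' by (intro Gmono) auto
        then show ?thesis using Gabs[OF zi(2), of zx] G0 by (simp add: e_def zz)
      next
        case False
        then show ?thesis using mmono[of 0 "\<bar>zx - c\<bar>"] mabs[of zx] zi(1) by auto
      qed
      ultimately show ?thesis by linarith
    qed
    have mcc: "continuous_on {0..pi} (\<lambda>t. m (c + t))"
      by (rule continuous_on_compose2[OF mc]) (auto intro!: continuous_intros)
    \<comment> \<open>The level line meets the axis of its cell at \<open>c - a\<close> and
      \<open>c + a\<close>.\<close>
    obtain a where a: "0 <= a" "a <= pi" "m (c + a) = e"
      using IVT'[of "\<lambda>t. m (c + t)" 0 e pi] ce em m0 mcc by auto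
    have a': "0 < a" "a < pi" using a ce zi(3) m0 by (cases "a = 0"; cases "a = pi"; auto)+
    have m_le: "m x <= e \<longleftrightarrow> \<bar>x - c\<bar> <= a" "m x < e \<longleftrightarrow> \<bar>x - c\<bar> < a" if "\<bar>x - c\<bar> <= pi" for x
      using mmono[of "\<bar>x - c\<bar>" a] mmono[of a "\<bar>x - c\<bar>"] a that unfolding mabs[of x] a(3)[symmetric]
      by (cases "\<bar>x - c\<bar>" a rule: linorder_cases; auto)+
    define C where "C = {w \<in> strip. \<bar>fst w - c\<bar> < pi & \<Psi> w = e}"
    have C_iff: "(x, y) \<in> C \<longleftrightarrow> \<bar>x - c\<bar> <= a & (y = 1 / 2 + H e x \<or> y = 1 / 2 - H e x)" for x y
    proof
      assume "(x, y) \<in> C"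
      then have w: "y \<in> {0..1}" "\<bar>x - c\<bar> < pi" "\<Psi> (x, y) = e" by (auto simp: C_def strip_def)
      have "0 <= \<bar>y - 1 / 2\<bar>" "\<bar>y - 1 / 2\<bar> <= 1 / 2" using half_bound[OF w(1)] by auto
      then have "m x <= e" using Gle[of 0 "\<bar>y - 1 / 2\<bar>" x] Gabs[OF w(1), of x] w(3) G0 by simp
      then show "\<bar>x - c\<bar> <= a & (y = 1 / 2 + H e x \<or> y = 1 / 2 - H e x)"
        using m_le(1)[of x] w Heq[OF em w(1,3)] by (auto simp: abs_if split: if_splits)
    next
      assume w: "\<bar>x - c\<bar> <= a & (y = 1 / 2 + H e x \<or> y = 1 / 2 - H e x)"
      then have "m x <= e" using m_le(1)[of x] a' by auto
      then show "(x, y) \<in> C" using w a' Hval[OF em, of x] by (auto simp: C_def strip_def)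
    qed
    \<comment> \<open>The upper arc runs from left to right, the lower one back; they share exactly
      the two points on the axis.\<close>
    define g1 where "g1 t = (c - a + 2 * a * t, 1 / 2 + H e (c - a + 2 * a * t))" for t :: real
    define g2 where "g2 t = (c + a - 2 * a * t, 1 / 2 - H e (c + a - 2 * a * t))" for t :: real
    have Hce: "continuous_on S (\<lambda>t. H e (f t))" if "continuous_on S f" for f :: "real => real" and S
      by (rule continuous_on_compose2[OF Hc[OF em] that]) auto
    have H0: "H e x = 0 \<longleftrightarrow> \<bar>x - c\<bar> = a" if "\<bar>x - c\<bar> <= a" for x
    proof -
      have "m x <= e" using m_le(1)[of x] that a' by simp
      then have Ge: "G x (H e x) = e" using H(3)[OF em, of x] by simp
      have "H e x = 0 \<longleftrightarrow> m x = e"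
        using Ginj[of x "H e x" 0] Ge G0 H(1,2)[OF em, of x] d2 by auto
      also have "\<dots> \<longleftrightarrow> \<bar>x - c\<bar> = a" using m_le[of x] that a' by auto
      finally show ?thesis .
    qed
    have arc: "arc g1" "arc g2"
      unfolding arc_def path_def g1_def g2_def using a'
      by (auto intro!: continuous_intros Hce inj_onI)
    have img1: "path_image g1 = {(x, y). \<bar>x - c\<bar> <= a & y = 1 / 2 + H e x}"
    proof (intro equalityI subsetI)
      fix w assume "w \<in> {(x, y). \<bar>x - c\<bar> <= a & y = 1 / 2 + H e x}"
      then obtain x where w: "w = (x, 1 / 2 + H e x)" "\<bar>x - c\<bar> <= a" by auto
      then have "w = g1 ((x - c + a) / (2 * a))" "(x - c + a) / (2 * a) \<in> {0..1}"
        using a' by (auto simp: g1_def field_simps abs_le_iff)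
      then show "w \<in> path_image g1" unfolding path_image_def by blast
    next
      fix w assume "w \<in> path_image g1"
      then obtain t where t: "0 <= t" "t <= 1" "w = g1 t" by (auto simp: path_image_def)
      have "2 * a * t <= 2 * a" "0 <= 2 * a * t" using t a' by (auto intro: mult_left_le)
      then show "w \<in> {(x, y). \<bar>x - c\<bar> <= a & y = 1 / 2 + H e x}" using t by (auto simp: g1_def abs_le_iff)
    qed
    have img2: "path_image g2 = {(x, y). \<bar>x - c\<bar> <= a & y = 1 / 2 - H e x}"
    proof (intro equalityI subsetI)
      fix w assume "w \<in> {(x, y). \<bar>x - c\<bar> <= a & y = 1 / 2 - H e x}"
      then obtain x where w: "w = (x, 1 / 2 - H e x)" "\<bar>x - c\<bar> <= a" by auto
      then have "w = g2 ((c + a - x) / (2 * a))" "(c + a - x) / (2 * a) \<in> {0..1}"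
        using a' by (auto simp: g2_def field_simps abs_le_iff)
      then show "w \<in> path_image g2" unfolding path_image_def by blast
    next
      fix w assume "w \<in> path_image g2"
      then obtain t where t: "0 <= t" "t <= 1" "w = g2 t" by (auto simp: path_image_def)
      have "2 * a * t <= 2 * a" "0 <= 2 * a * t" using t a' by (auto intro: mult_left_le)
      then show "w \<in> {(x, y). \<bar>x - c\<bar> <= a & y = 1 / 2 - H e x}" using t by (auto simp: g2_def abs_le_iff)
    qed
    have ends: "pathstart g1 = (c - a, 1 / 2)" "pathfinish g1 = (c + a, 1 / 2)"
      "pathstart g2 = (c + a, 1 / 2)" "pathfinish g2 = (c - a, 1 / 2)"
      using H0[of "c - a"] H0[of "c + a"] a' by (auto simp: g1_def g2_def pathstart_def pathfinish_def add.commute)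
    define g where "g = g1 +++ g2"
    have simple: "simple_path g" unfolding g_def
    proof (rule simple_path_join_loop[OF arc])
      show "path_image g1 \<inter> path_image g2 \<subseteq> {pathstart g1, pathstart g2}"
      proof
        fix w assume "w \<in> path_image g1 \<inter> path_image g2"
        then obtain x where x: "w = (x, 1 / 2 + H e x)" "\<bar>x - c\<bar> <= a" "H e x = 0"
          unfolding img1 img2 by auto
        then have "\<bar>x - c\<bar> = a" using H0 by simp
        then show "w \<in> {pathstart g1, pathstart g2}" using x ends by (auto simp: abs_if split: if_splits)
      qed
    qed (simp_all add: ends)
    have img: "path_image g = C"
    proof -
      have "path_image g = path_image g1 \<union> path_image g2"
        unfolding g_def by (rule path_image_join) (simp add: ends)
      also have "\<dots> = C" unfolding img1 img2 using C_iff by auto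
      finally show ?thesis .
    qed
    have zC: "z \<in> C" using zi by (auto simp: C_def zz strip_def e_def)
    have loop: "pathfinish g = pathstart g" by (simp add: g_def ends)
    have connC: "connected C" using simple unfolding img[symmetric] by (intro connected_path_image simple_path_imp_path)
    define L where "L = {w \<in> strip. \<Psi> w = \<Psi> z}"
    \<comment> \<open>On the vertical lines through the saddles the smallest value is the saddle
      level, so a level below it cannot cross them.\<close>
    have no_edge: "\<Psi> w > e" if ws: "w \<in> strip" "\<bar>fst w - c\<bar> = pi" for w
    proof -
      obtain x y where w: "w = (x, y)" "y \<in> {0..1}" using ws(1) by (auto simp: strip_def)
      have "m x = m0" using mabs[of x] ws(2) w m0 by simp
      moreover have "m x <= \<Psi> w" unfolding w Gabs[OF w(2)] G0[symmetric]
        using half_bound[OF w(2)] by (intro Gle) auto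
      ultimately show ?thesis using zi by simp
    qed
    have stream: "streamline \<Psi> z = C"
    proof
      show "C \<subseteq> streamline \<Psi> z" unfolding streamline_def L_def[symmetric]
        by (rule connected_component_maximal[OF zC connC]) (auto simp: C_def L_def e_def)
      \<comment> \<open>The projection of the streamline to the first coordinate is an interval, so
        leaving the cell would mean meeting one of the lines through the saddles.\<close>
      define K where "K = streamline \<Psi> z"
      have K: "connected K" "z \<in> K" "K \<subseteq> L"
        unfolding K_def streamline_def L_def[symmetric]
        using zC connected_component_refl_eq[of L z] by (auto simp: C_def L_def connected_component_subset connected_component_refl_eq intro: connected_component_in)
      have "connected (fst ` K)" by (intro connected_continuous_image K continuous_intros)
      then have iv: "is_interval (fst ` K)" by (simp add: is_interval_connected_1)
      have "\<bar>fst w - c\<bar> < pi" if w: "w \<in> K" for w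
      proof (rule ccontr)
        assume far: "\<not> \<bar>fst w - c\<bar> < pi"
        have "\<exists>b\<in>fst ` K. \<bar>b - c\<bar> = pi"
        proof (cases "c <= fst w")
          case True
          have "c + pi \<in> fst ` K"
            by (rule mem_is_interval_1_I[OF iv, of zx "fst w"]) (use K(2) zz w far True zi in \<open>auto simp: abs_less_iff intro: rev_image_eqI\<close>)
          then show ?thesis by (intro bexI[of _ "c + pi"]) auto
        next
          case False
          have "c - pi \<in> fst ` K"
            by (rule mem_is_interval_1_I[OF iv, of "fst w" zx]) (use K(2) zz w far False zi in \<open>auto simp: abs_less_iff intro: rev_image_eqI\<close>)
          then show ?thesis by (intro bexI[of _ "c - pi"]) auto
        qed
        then obtain v where "v \<in> K" "\<bar>fst v - c\<bar> = pi" by auto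
        then show False using no_edge[of v] K(3) by (auto simp: L_def e_def)
      qed
      then show "streamline \<Psi> z \<subseteq> C" using K(3) unfolding K_def[symmetric] by (auto simp: C_def L_def e_def)
    qed
    have inside: "(c, 1 / 2) \<in> inside C"
    proof -
      define K where "K = connected_component_set (- C) (c, 1 / 2)"
      have cC: "(c, 1 / 2) \<notin> C" using ce by (auto simp: C_def m_def)
      have K: "connected K" "(c, 1 / 2) \<in> K" "K \<inter> C = {}"
        unfolding K_def using cC by (auto simp: connected_component_refl_eq dest: connected_component_in)
      define S0 where "S0 = {c - pi<..<c + pi} \<times> {0<..<1::real}"
      define S1 where "S1 = {c - pi..c + pi} \<times> {0..1::real}"
      \<comment> \<open>\<open>U\<close> is open, \<open>D\<close> is closed and contains it, and
        the two differ only by points of \<open>C\<close>. A connected set avoiding \<open>C\<close>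
        lies in \<open>U\<close> or outside \<open>D\<close>, so the component of the centre stays
        in a bounded cell.\<close>
      define U where "U = S0 \<inter> \<Psi> -` {..<e}"
      define D where "D = S1 \<inter> \<Psi> -` {..e}"
      have "open U" unfolding U_def
        by (rule continuous_open_preimage[OF continuous_on_subset[OF cont]])
           (auto simp: S0_def strip_def intro!: open_Times)
      have "closed D" unfolding D_def
        by (rule continuous_closed_preimage[OF continuous_on_subset[OF cont]])
           (auto simp: S1_def strip_def intro!: closed_Times)
      have UD: "U \<subseteq> D" by (auto simp: U_def D_def S0_def S1_def)
      have DC: "w \<in> U \<or> w \<in> C" if w: "w \<in> D" for w
      proof -
        obtain x y where xy: "w = (x, y)" by (cases w)
        have w': "y \<in> {0..1}" "\<bar>x - c\<bar> <= pi" "\<Psi> w <= e" using w by (auto simp: D_def S1_def xy abs_le_iff)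
        have ws: "w \<in> strip" using w' by (auto simp: xy strip_def)
        have "\<bar>x - c\<bar> \<noteq> pi" using no_edge[OF ws] w' xy by auto
        then have x: "\<bar>x - c\<bar> < pi" using w' by simp
        have "y \<noteq> 0 & y \<noteq> 1"
        proof -
          have "m0 < G x (1 / 2)" using lev'[of x] Gmono[of d "1 / 2" x] d d2 by simp
          moreover have "G x \<bar>y - 1 / 2\<bar> <= e" using w'(3) Gabs[OF w'(1), of x] xy by simp
          ultimately have "G x \<bar>y - 1 / 2\<bar> \<noteq> G x (1 / 2)" using zi(3) by linarith
          then have "\<bar>y - 1 / 2\<bar> \<noteq> 1 / 2" by metis
          then show ?thesis by auto
        qed
        then have y: "0 < y" "y < 1" using w'(1) by auto
        show ?thesis
        proof (cases "\<Psi> w = e")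
          case True
          then show ?thesis using x ws xy by (auto simp: C_def)
        next
          case False
          then show ?thesis using x y w' xy by (auto simp: U_def S0_def abs_less_iff)
        qed
      qed
      have "(c, 1 / 2) \<in> U" using ce by (auto simp: U_def S0_def m_def)
      have "K \<subseteq> U"
      proof (rule ccontr)
        assume "\<not> K \<subseteq> U"
        then have "- D \<inter> K \<noteq> {}" using DC K(3) by blast
        moreover have "U \<inter> K \<noteq> {}" using K(2) \<open>(c, 1 / 2) \<in> U\<close> by blast
        moreover have "K \<subseteq> U \<union> - D" using DC K(3) by blast
        moreover have "U \<inter> - D \<inter> K = {}" using UD by blast
        ultimately show False
          using connectedD[OF K(1) \<open>open U\<close> open_Compl[OF \<open>closed D\<close>]] by blast
      qed
      then have "K \<subseteq> S1" by (auto simp: U_def S0_def S1_def)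
      moreover have "bounded S1" unfolding S1_def by (intro bounded_Times) auto
      ultimately have "bounded K" by (rule bounded_subset[rotated])
      then show ?thesis unfolding inside_def K_def using cC by blast
    qed
    have "C \<subseteq> eye"
    proof
      fix w assume w: "w \<in> C"
      then show "w \<in> eye" using eye_iff[of "fst w" "snd w"] zi by (auto simp: C_def strip_def mem_Times_iff)
    qed
    then show ?thesis unfolding closed_streamline_around_def stream
      using simple loop img inside by blast
  qed
  define band where "band = {(x, y) \<in> strip. \<bar>y - 1 / 2\<bar> < \<delta>}"
  define saddles where "saddles = {(p + 2 * pi * of_int k, 1 / 2 :: real) | k :: int. True}"
  define centres where "centres = {(c + 2 * pi * of_int k, 1 / 2 :: real) | k :: int. True}"
  have stag: "stagnation \<Psi> (x, y) \<longleftrightarrow> y = 1 / 2 & sin (x - p) = 0" if y: "y \<in> {0..1}" for x y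
  proof -
    have s: "(x, y) \<in> strip" using y by (auto simp: strip_def)
    have "stagnation \<Psi> (x, y) \<longleftrightarrow> \<Psi>x (x, y) = 0 & \<Psi>y (x, y) = 0"
      unfolding stagnation_def has_partials_D1_D2[OF partials s] ..
    also have "\<Psi>y (x, y) = 0 \<longleftrightarrow> y = 1 / 2"
    proof
      assume "\<Psi>y (x, y) = 0"
      then show "y = 1 / 2"
        using ypos[of y x] yneg[of y x] y by (cases y "1 / 2 :: real" rule: linorder_cases) auto
    next
      assume eq: "y = 1 / 2"
      show "\<Psi>y (x, y) = 0" unfolding eq by (rule half)
    qed
    also have "\<Psi>x (x, y) = 0 & y = 1 / 2 \<longleftrightarrow> y = 1 / 2 & \<Psi>x (x, 1 / 2) = 0" by metis
    also have "\<Psi>x (x, 1 / 2) = 0 \<longleftrightarrow> sin (x - p) = 0"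
      using sgn[of x] by (cases "sin (x - p)" "0 :: real" rule: linorder_cases) auto
    finally show ?thesis .
  qed
  have sin_zero: "sin (x - p) = 0 \<longleftrightarrow> (\<exists>k :: int. x = p + 2 * pi * of_int k \<or> x = c + 2 * pi * of_int k)" for x
  proof
    assume "sin (x - p) = 0"
    then obtain i :: int where i: "x - p = of_int i * pi" by (auto simp: sin_zero_iff_int2)
    show "\<exists>k :: int. x = p + 2 * pi * of_int k \<or> x = c + 2 * pi * of_int k"
    proof (cases "even i")
      case True
      then obtain k where "i = 2 * k" by (elim evenE)
      then show ?thesis using i by (intro exI[of _ k]) (simp add: algebra_simps)
    next
      case False
      then obtain k where "i = 2 * k + 1" by (elim oddE)
      then show ?thesis using i by (intro exI[of _ k]) (simp add: c_def algebra_simps)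
    qed
  next
    assume "\<exists>k :: int. x = p + 2 * pi * of_int k \<or> x = c + 2 * pi * of_int k"
    then obtain k :: int where "x - p = of_int (2 * k) * pi \<or> x - p = of_int (2 * k + 1) * pi"
      by (auto simp: c_def algebra_simps)
    then show "sin (x - p) = 0" unfolding sin_zero_iff_int2 by blast
  qed
  have Hm0: "H m0 x = 0 \<longleftrightarrow> m x = m0" for x
    using Ginj[of x "H m0 x" 0] H[of m0 x] G0[of x] mle[of x] d2 by auto
  have Hper: "H m0 (x + 2 * pi) = H m0 x" for x
  proof -
    have "\<Psi> (x + 2 * pi, 1 / 2 + H m0 x) = m0"
      using per[OF Hval(3), of m0 x] Hval(1)[of m0 x] mle[of x] by simp
    then have "H m0 (x + 2 * pi) = \<bar>1 / 2 + H m0 x - 1 / 2\<bar>" using Hval(3)[of m0 x] by (intro Heq) auto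
    then show ?thesis using H(1)[of m0 x] by simp
  qed
  show ?thesis
    unfolding cats_eyes_def Let_def
  proof (rule exI[of _ p], rule exI[of _ "1 / 2"], rule exI[of _ c], rule exI[of _ "1 / 2"], rule exI[of _ l], rule exI[of _ u],
      fold band_def saddles_def centres_def eye_def, intro conjI)
    show "\<forall>z\<in>saddles. saddle \<Psi> z"
    proof
      fix z assume "z \<in> saddles"
      then obtain k :: int where z: "z = (p + 2 * pi * of_int k, 1 / 2)" by (auto simp: saddles_def)
      have "stagnation \<Psi> z" unfolding z using sin_zero by (subst stag) auto
      moreover have "D1 (D1 \<Psi>) z * D2 (D2 \<Psi>) z < 0" unfolding z by (intro mult_neg_pos sad)
      ultimately show "saddle \<Psi> z" unfolding saddle_def using zero_le_power2[of "D1 (D2 \<Psi>) z"] by linarith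
    qed
    show "{z \<in> band. stagnation \<Psi> z} = saddles \<union> centres"
    proof (intro equalityI subsetI)
      fix z assume "z \<in> {z \<in> band. stagnation \<Psi> z}"
      then obtain x y where z: "z = (x, y)" "y \<in> {0..1}" "stagnation \<Psi> (x, y)" by (auto simp: band_def strip_def)
      then show "z \<in> saddles \<union> centres" using stag[OF z(2)] sin_zero[of x] by (auto simp: saddles_def centres_def)
    next
      fix z assume "z \<in> saddles \<union> centres"
      then obtain x where z: "z = (x, 1 / 2)" "sin (x - p) = 0"
        using sin_zero unfolding saddles_def centres_def by auto
      then show "z \<in> {z \<in> band. stagnation \<Psi> z}" using stag[of "1 / 2" x] d by (auto simp: band_def strip_def)
    qed
    show "continuous_on UNIV l" "continuous_on UNIV u"
      unfolding l_def u_def by (intro continuous_intros Hc order_refl)+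
    show "\<forall>x. l (x + 2 * pi) = l x & u (x + 2 * pi) = u x & l x <= u x"
      using Hper H(1)[of m0] by (auto simp: l_def u_def)
    show "\<forall>x. (l x = u x) = (\<exists>k :: int. x = p + 2 * pi * of_int k)"
    proof
      fix x
      have "l x = u x \<longleftrightarrow> m x = m0" using Hm0[of x] by (auto simp: l_def u_def)
      also have "\<dots> \<longleftrightarrow> (\<exists>k :: int. x = p + 2 * pi * of_int k)"
        using meq[of x] mper[of p] by (auto simp: m0_def)
      finally show "(l x = u x) = (\<exists>k :: int. x = p + 2 * pi * of_int k)" .
    qed
    show "l p = 1 / 2" using Hm0[of p] by (simp add: l_def m0_def)
    show "{z \<in> band. \<Psi> z = \<Psi> (p, 1 / 2)} = range (\<lambda>x. (x, l x)) \<union> range (\<lambda>x. (x, u x))"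
    proof (intro equalityI subsetI)
      fix z assume "z \<in> {z \<in> band. \<Psi> z = \<Psi> (p, 1 / 2)}"
      then obtain x y where z: "z = (x, y)" "y \<in> {0..1}" "\<Psi> (x, y) = m0"
        by (auto simp: band_def strip_def m0_def m_def)
      have "H m0 x = \<bar>y - 1 / 2\<bar>" by (rule Heq[OF order_refl z(2,3)])
      then have "y = l x \<or> y = u x" by (auto simp: l_def u_def abs_if split: if_splits)
      then show "z \<in> range (\<lambda>x. (x, l x)) \<union> range (\<lambda>x. (x, u x))" using z(1) by auto
    next
      fix z assume "z \<in> range (\<lambda>x. (x, l x)) \<union> range (\<lambda>x. (x, u x))"
      then obtain x where "z = (x, l x) \<or> z = (x, u x)" by auto
      then show "z \<in> {z \<in> band. \<Psi> z = \<Psi> (p, 1 / 2)}"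
        using Hval[of m0 x] H(1,2)[of m0 x] mle[of x] d
        by (auto simp: l_def u_def band_def strip_def m0_def[unfolded m_def, symmetric])
    qed
    show "(c, 1 / 2) \<in> eye" unfolding eye_iff using mlt[of c] by (simp add: m_def)
    show "\<forall>z\<in>eye - {(c, 1 / 2)}. streamline \<Psi> z \<subseteq> eye & closed_streamline_around (c, 1 / 2) \<Psi> z"
      using closed_lines by blast
  qed
qed

section \<open>Differentiability and Hoelder norms on the strip\<close>

lemma strip_iff [simp]: "(x, y) \<in> strip \<longleftrightarrow> y \<in> {0..1}" by (simp add: strip_def)

lemma has_real_derivative_cong_within:
  fixes f g :: "real => real"
  assumes "(f has_real_derivative d) (at y within S)" "y \<in> S" "!!t. t \<in> S ==> f t = g t"
  shows "(g has_real_derivative d) (at y within S)"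
  by (rule has_field_derivative_transform_within[OF assms(1), of 1]) (use assms in auto)

lemma has_partials_cong:
  assumes "has_partials f fx fy" "!!z. z \<in> strip ==> f z = g z" "!!z. z \<in> strip ==> fx z = gx z"
    "!!z. z \<in> strip ==> fy z = gy z"
  shows "has_partials g gx gy"
  unfolding has_partials_def
proof (intro allI ballI conjI)
  fix x y :: real assume y: "y \<in> {0..1}"
  have "(\<lambda>t. g (t, y)) = (\<lambda>t. f (t, y))" using assms(2) y by auto
  then show "((\<lambda>t. g (t, y)) has_real_derivative gx (x, y)) (at x)"
    using has_partialsD(1)[OF assms(1) y, of x] assms(3) y by simp
  show "((\<lambda>t. g (x, t)) has_real_derivative gy (x, y)) (at y within {0..1})"
    using has_real_derivative_cong_within[OF has_partialsD(2)[OF assms(1) y, of x] y, of "\<lambda>t. g (x, t)"]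
      assms(2,4) y by auto
qed

lemma has_partials_add:
  assumes "has_partials f fx fy" "has_partials g gx gy"
  shows "has_partials (\<lambda>z. f z + g z) (\<lambda>z. fx z + gx z) (\<lambda>z. fy z + gy z)"
  using assms unfolding has_partials_def by (auto intro!: derivative_intros)

lemma has_partials_snd:
  assumes "!!y. y \<in> {0..1} ==> (h has_real_derivative h' y) (at y within {0..1})"
  shows "has_partials (\<lambda>z. h (snd z)) (\<lambda>z. 0) (\<lambda>z. h' (snd z))"
  using assms unfolding has_partials_def by auto

text \<open>Values off the strip never enter, because the second variable is differentiated within
  \<open>{0..1}\<close>; hence \<open>D1\<close> and \<open>D2\<close> again agree on the strip and
  the induction proceeds.\<close>

lemma Ck_strip_cong:
  assumes "!!z. z \<in> strip ==> f z = g z"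
  shows "Ck_strip k f \<longleftrightarrow> Ck_strip k g"
  using assms
proof (induction k arbitrary: f g)
  case 0
  then show ?case by (auto intro: continuous_on_cong[THEN iffD1])
next
  case (Suc k)
  have 1: "(\<lambda>t. f (t, y)) = (\<lambda>t. g (t, y))" if "y \<in> {0..1}" for y using Suc.prems that by auto
  have D1: "D1 f z = D1 g z" if "z \<in> strip" for z
    using that 1 by (cases z) (simp add: D1_def)
  have 2: "((\<lambda>t. f (x, t)) has_vector_derivative d) (at y within {0..1}) \<longleftrightarrow>
      ((\<lambda>t. g (x, t)) has_vector_derivative d) (at y within {0..1})" if "y \<in> {0..1}" for x y d
    using Suc.prems that by (intro has_vector_derivative_cong_ev)
      (auto simp: eventually_nhds intro!: exI[of _ UNIV])
  have D2: "D2 f z = D2 g z" if "z \<in> strip" for z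
    using that 2 by (cases z) (simp add: D2_def vector_derivative_def)
  have 3: "(\<lambda>t. f (x, t)) differentiable (at y within {0..1}) \<longleftrightarrow> (\<lambda>t. g (x, t)) differentiable (at y within {0..1})"
    if "y \<in> {0..1}" for x y
    using 2[OF that] by (simp add: differentiable_def has_vector_derivative_def[symmetric]
        vector_derivative_works) (metis vector_derivative_works differentiableI_vector differentiable_def)
  have "continuous_on strip f \<longleftrightarrow> continuous_on strip g" by (rule continuous_on_cong) (use Suc.prems in auto)
  moreover have "Ck_strip k (D1 f) \<longleftrightarrow> Ck_strip k (D1 g)" "Ck_strip k (D2 f) \<longleftrightarrow> Ck_strip k (D2 g)"
    using Suc.IH[of "D1 f" "D1 g"] Suc.IH[of "D2 f" "D2 g"] D1 D2 by blast+
  ultimately show ?case using 1 3 by simp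
qed

lemma has_partials_differentiable:
  assumes "has_partials f fx fy" "y \<in> {0..1}"
  shows "(\<lambda>t. f (t, y)) differentiable (at x)" "(\<lambda>t. f (x, t)) differentiable (at y within {0..1})"
  using has_partialsD[OF assms, of x] by (auto simp: real_differentiable_def)

lemma Ck_strip_SucI:
  assumes "has_partials f fx fy" "continuous_on strip f" "Ck_strip k fx" "Ck_strip k fy"
  shows "Ck_strip (Suc k) f"
  using assms has_partials_differentiable[OF assms(1)]
    Ck_strip_cong[of "D1 f" fx k] Ck_strip_cong[of "D2 f" fy k] has_partials_D1_D2[OF assms(1)]
  by simp

lemma second_partials:
  assumes "has_partials f fx fy" "has_partials fx fxx fxy" "has_partials fy fyx fyy" "z \<in> strip"
  shows "D1 (D1 f) z = fxx z" "D1 (D2 f) z = fyx z" "D2 (D2 f) z = fyy z" "D2 (D1 f) z = fxy z"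
proof -
  have "has_partials (D1 f) fxx fxy"
    by (rule has_partials_cong[OF assms(2)]) (simp_all add: has_partials_D1_D2[OF assms(1)])
  moreover have "has_partials (D2 f) fyx fyy"
    by (rule has_partials_cong[OF assms(3)]) (simp_all add: has_partials_D1_D2[OF assms(1)])
  ultimately show "D1 (D1 f) z = fxx z" "D1 (D2 f) z = fyx z" "D2 (D2 f) z = fyy z" "D2 (D1 f) z = fxy z"
    using has_partials_D1_D2 assms(4) by blast+
qed

text \<open>One constant for the supremum and the Lipschitz quotient. It dominates the Hoelder
  quantities for all exponents below 1 and behaves well under products.\<close>

definition bounded_lipschitz :: "real => (real \<times> real => real) => bool" where
  "bounded_lipschitz K f \<longleftrightarrow> (\<forall>z\<in>strip. \<bar>f z\<bar> <= K & (\<forall>w\<in>strip. \<bar>f z - f w\<bar> <= K * dist z w))"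

lemma bounded_lipschitzI:
  assumes "!!z. z \<in> strip ==> \<bar>f z\<bar> <= K" "!!z w. z \<in> strip ==> w \<in> strip ==> \<bar>f z - f w\<bar> <= K * dist z w"
  shows "bounded_lipschitz K f"
  using assms unfolding bounded_lipschitz_def by blast

lemma bounded_lipschitzD:
  assumes "bounded_lipschitz K f" "z \<in> strip"
  shows "\<bar>f z\<bar> <= K" "w \<in> strip ==> \<bar>f z - f w\<bar> <= K * dist z w"
  using assms unfolding bounded_lipschitz_def by blast+

lemma bounded_lipschitz_nonneg: "bounded_lipschitz K f ==> 0 <= K"
  using bounded_lipschitzD(1)[of K f "(0, 0)"] by auto

lemma bounded_lipschitz_mono:
  assumes "bounded_lipschitz K f" "K <= L"
  shows "bounded_lipschitz L f"
proof (rule bounded_lipschitzI)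
  show "\<bar>f z\<bar> <= L" if "z \<in> strip" for z using bounded_lipschitzD(1)[OF assms(1) that] assms(2) by simp
  show "\<bar>f z - f w\<bar> <= L * dist z w" if "z \<in> strip" "w \<in> strip" for z w
    using bounded_lipschitzD(2)[OF assms(1) that] mult_right_mono[OF assms(2), of "dist z w"] by simp
qed

lemma bounded_lipschitz_add:
  assumes "bounded_lipschitz K f" "bounded_lipschitz L g"
  shows "bounded_lipschitz (K + L) (\<lambda>z. f z + g z)"
proof (rule bounded_lipschitzI)
  show "\<bar>f z + g z\<bar> <= K + L" if "z \<in> strip" for z
    using bounded_lipschitzD(1)[OF assms(1) that] bounded_lipschitzD(1)[OF assms(2) that] by linarith
  show "\<bar>f z + g z - (f w + g w)\<bar> <= (K + L) * dist z w" if "z \<in> strip" "w \<in> strip" for z w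
    using bounded_lipschitzD(2)[OF assms(1) that] bounded_lipschitzD(2)[OF assms(2) that]
    unfolding distrib_right by linarith
qed

lemma bounded_lipschitz_mult:
  assumes f: "bounded_lipschitz K f" and g: "bounded_lipschitz L g"
  shows "bounded_lipschitz (2 * K * L) (\<lambda>z. f z * g z)"
proof (rule bounded_lipschitzI)
  have K: "0 <= K" "0 <= L" using bounded_lipschitz_nonneg assms by auto
  have KL: "0 <= K * L" using K by simp
  show "\<bar>f z * g z\<bar> <= 2 * K * L" if "z \<in> strip" for z
  proof -
    have "\<bar>f z * g z\<bar> <= K * L" unfolding abs_mult
      using bounded_lipschitzD(1)[OF f that] bounded_lipschitzD(1)[OF g that] K by (intro mult_mono) auto
    then show ?thesis using KL by simp
  qed
  show "\<bar>f z * g z - f w * g w\<bar> <= 2 * K * L * dist z w" if "z \<in> strip" "w \<in> strip" for z w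
  proof -
    have "f z * g z - f w * g w = (f z - f w) * g z + f w * (g z - g w)" by (simp add: algebra_simps)
    then have "\<bar>f z * g z - f w * g w\<bar> <= \<bar>f z - f w\<bar> * \<bar>g z\<bar> + \<bar>f w\<bar> * \<bar>g z - g w\<bar>"
      by (metis abs_mult abs_triangle_ineq)
    also have "\<dots> <= (K * dist z w) * L + K * (L * dist z w)"
      using bounded_lipschitzD[OF f] bounded_lipschitzD[OF g] that K
      by (intro add_mono mult_mono) auto
    finally show ?thesis by (simp add: algebra_simps)
  qed
qed

lemma bounded_lipschitz_scale:
  assumes "bounded_lipschitz K f"
  shows "bounded_lipschitz (\<bar>c\<bar> * K) (\<lambda>z. c * f z)"
proof (rule bounded_lipschitzI)
  show "\<bar>c * f z\<bar> <= \<bar>c\<bar> * K" if "z \<in> strip" for z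
    unfolding abs_mult using bounded_lipschitzD(1)[OF assms that] by (intro mult_left_mono) auto
  show "\<bar>c * f z - c * f w\<bar> <= \<bar>c\<bar> * K * dist z w" if "z \<in> strip" "w \<in> strip" for z w
    unfolding right_diff_distrib[symmetric] abs_mult mult.assoc
    using bounded_lipschitzD(2)[OF assms that] by (intro mult_left_mono) auto
qed

lemma bounded_lipschitz_cong:
  assumes "bounded_lipschitz K f" "!!z. z \<in> strip ==> f z = g z"
  shows "bounded_lipschitz K g"
  using assms unfolding bounded_lipschitz_def by simp

lemma bounded_lipschitz_snd:
  assumes h: "!!y. y \<in> {0..1} ==> (h has_real_derivative h' y) (at y within {0..1})"
    and "!!y. y \<in> {0..1} ==> \<bar>h y\<bar> <= K" "!!y. y \<in> {0..1} ==> \<bar>h' y\<bar> <= K"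
  shows "bounded_lipschitz K (\<lambda>z. h (snd z))"
proof (rule bounded_lipschitzI)
  have K: "0 <= K" using assms(2)[of 0] by auto
  show "\<bar>h (snd z)\<bar> <= K" if "z \<in> strip" for z using that assms(2) by (auto simp: strip_def)
  have *: "\<bar>h y - h x\<bar> <= K * \<bar>y - x\<bar>" if xy: "x < y" "x \<in> {0..1}" "y \<in> {0..1}" for x y
  proof -
    obtain t where t: "x < t" "t < y" "h y - h x = (y - x) * h' t"
      using mvt_unit_interval[of h h' x y] h xy by auto
    have "\<bar>h' t\<bar> <= K" using assms(3)[of t] t xy by auto
    then show ?thesis unfolding t(3) abs_mult using mult_left_mono[of "\<bar>h' t\<bar>" K "\<bar>y - x\<bar>"] by (simp add: mult.commute)
  qed
  show "\<bar>h (snd z) - h (snd w)\<bar> <= K * dist z w" if "z \<in> strip" "w \<in> strip" for z w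
  proof -
    have "\<bar>h (snd z) - h (snd w)\<bar> <= K * \<bar>snd z - snd w\<bar>"
      using *[of "snd z" "snd w"] *[of "snd w" "snd z"] that
      by (cases "snd z" "snd w" rule: linorder_cases) (auto simp: strip_def abs_minus_commute)
    also have "\<dots> <= K * dist z w"
      using K dist_snd_le[of z w] by (intro mult_left_mono) (auto simp: dist_real_def)
    finally show ?thesis .
  qed
qed

text \<open>Two points are joined by a path parallel to the axes; its two pieces account for the
  factor 2.\<close>

lemma bounded_lipschitz_partials:
  assumes f: "has_partials f fx fy" and L: "!!z. z \<in> strip ==> \<bar>fx z\<bar> <= L" "!!z. z \<in> strip ==> \<bar>fy z\<bar> <= L"
    and b: "!!z. z \<in> strip ==> \<bar>f z\<bar> <= L"
  shows "bounded_lipschitz (2 * L) f"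
proof (rule bounded_lipschitzI)
  have L0: "0 <= L" using L(1)[of "(0, 0)"] by auto
  show "\<bar>f z\<bar> <= 2 * L" if "z \<in> strip" for z using b[OF that] L0 by simp
  have x: "\<bar>f (a, y) - f (b, y)\<bar> <= L * \<bar>a - b\<bar>" if y: "y \<in> {0..1}" for a b y
  proof -
    have "norm ((\<lambda>t. f (t, y)) a - (\<lambda>t. f (t, y)) b) <= L * norm (a - b)"
      by (rule field_differentiable_bound[of UNIV _ "\<lambda>t. fx (t, y)"])
         (use has_partialsD(1)[OF f y] L(1) y in auto)
    then show ?thesis by simp
  qed
  have yy: "\<bar>f (a, y) - f (a, y')\<bar> <= L * \<bar>y - y'\<bar>" if y: "y \<in> {0..1}" "y' \<in> {0..1}" for a y y'
  proof -
    have "norm ((\<lambda>t. f (a, t)) y - (\<lambda>t. f (a, t)) y') <= L * norm (y - y')"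
      by (rule field_differentiable_bound[of "{0..1}" _ "\<lambda>t. fy (a, t)"])
         (use has_partialsD(2)[OF f] L(2) y in auto)
    then show ?thesis by simp
  qed
  fix z w assume "z \<in> strip" "w \<in> strip"
  then obtain a y b y' where zw: "z = (a, y)" "w = (b, y')" "y \<in> {0..1}" "y' \<in> {0..1}" by (auto simp: strip_def)
  have "\<bar>f z - f w\<bar> <= \<bar>f (a, y) - f (b, y)\<bar> + \<bar>f (b, y) - f (b, y')\<bar>" unfolding zw by simp
  also have "\<dots> <= L * \<bar>a - b\<bar> + L * \<bar>y - y'\<bar>" by (intro add_mono x yy zw)
  also have "\<dots> <= L * dist z w + L * dist z w"
    using dist_fst_le[of z w] dist_snd_le[of z w] L0
    by (intro add_mono mult_left_mono) (auto simp: zw dist_real_def)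
  finally show "\<bar>f z - f w\<bar> <= 2 * L * dist z w" by simp
qed

lemma sup_norm_le: "(!!z. z \<in> strip ==> \<bar>f z\<bar> <= K) ==> sup_norm f <= ennreal K"
  unfolding sup_norm_def by (intro SUP_least ennreal_leI) auto

text \<open>For distances up to 1 the Lipschitz bound suffices, since
  \<open>d \<le> d powr \<beta>\<close>; for larger ones the supremum bound does, since
  \<open>d powr \<beta> \<ge> 1\<close>.\<close>

lemma holder_seminorm_le:
  assumes f: "bounded_lipschitz K f" and \<beta>: "0 < \<beta>" "\<beta> < 1"
  shows "holder_seminorm \<beta> f <= ennreal (2 * K)"
  unfolding holder_seminorm_def
proof (rule SUP_least)
  fix x :: "(real \<times> real) \<times> (real \<times> real)"
  assume x: "x \<in> {(p, q). p \<in> strip & q \<in> strip & p \<noteq> q}"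
  define z where "z = fst x"
  define w where "w = snd x"
  have zw: "x = (z, w)" by (simp add: z_def w_def)
  have z: "z \<in> strip" "w \<in> strip" "z \<noteq> w" using x unfolding zw by auto
  have K: "0 <= K" by (rule bounded_lipschitz_nonneg[OF f])
  define d where "d = dist z w"
  have d: "0 < d" using z by (simp add: d_def)
  have "\<bar>f z - f w\<bar> <= 2 * K * d powr \<beta>"
  proof (cases "d <= 1")
    case True
    have "d powr 1 <= d powr \<beta>" using True d \<beta> by (intro powr_mono') auto
    then have "K * d <= K * d powr \<beta>" using K d by (intro mult_left_mono) auto
    moreover have "\<bar>f z - f w\<bar> <= K * d" unfolding d_def by (rule bounded_lipschitzD(2)[OF f z(1,2)])
    moreover have "0 <= K * d powr \<beta>" using K by simp
    ultimately show ?thesis by linarith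
  next
    case False
    then have "1 <= d powr \<beta>" using \<beta> by (intro ge_one_powr_ge_zero) auto
    then have "2 * K * 1 <= 2 * K * d powr \<beta>" using K by (intro mult_left_mono) auto
    then show ?thesis using bounded_lipschitzD(1)[OF f z(1)] bounded_lipschitzD(1)[OF f z(2)] by linarith
  qed
  then have "\<bar>f z - f w\<bar> / d powr \<beta> <= 2 * K" using d by (simp add: divide_le_eq)
  then show "(case x of (p, q) => ennreal (\<bar>f p - f q\<bar> / dist p q powr \<beta>)) <= ennreal (2 * K)"
    unfolding zw d_def prod.case by (rule ennreal_leI)
qed

text \<open>The number 12 counts three supremum norms of lower order and, for each of the three
  second derivatives, a supremum norm plus a seminorm of at most \<open>2 * K\<close>.\<close>

lemma C2_holder_norm_le:
  assumes p: "has_partials f fx fy" "has_partials fx fxx fxy" "has_partials fy fyx fyy"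
    and b: "!!z. z \<in> strip ==> \<bar>f z\<bar> <= K" "!!z. z \<in> strip ==> \<bar>fx z\<bar> <= K" "!!z. z \<in> strip ==> \<bar>fy z\<bar> <= K"
    and l: "bounded_lipschitz K fxx" "bounded_lipschitz K fyx" "bounded_lipschitz K fyy"
    and \<beta>: "0 < \<beta>" "\<beta> < 1"
  shows "C2_holder_norm \<beta> f <= ennreal (12 * K)"
proof -
  have K: "0 <= K" by (rule bounded_lipschitz_nonneg[OF l(1)])
  have l': "bounded_lipschitz K (D1 (D1 f))" "bounded_lipschitz K (D1 (D2 f))" "bounded_lipschitz K (D2 (D2 f))"
    by (rule bounded_lipschitz_cong[OF l(1)], simp add: second_partials[OF p],
        rule bounded_lipschitz_cong[OF l(2)], simp add: second_partials[OF p],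
        rule bounded_lipschitz_cong[OF l(3)], simp add: second_partials[OF p])
  have s: "sup_norm g + holder_seminorm \<beta> g <= ennreal (3 * K)" if g: "bounded_lipschitz K g" for g
  proof -
    have "sup_norm g + holder_seminorm \<beta> g <= ennreal K + ennreal (2 * K)"
      by (intro add_mono sup_norm_le holder_seminorm_le[OF g \<beta>] bounded_lipschitzD(1)[OF g])
    then show ?thesis using K by (simp flip: ennreal_plus)
  qed
  have "C2_holder_norm \<beta> f <= ennreal K + ennreal K + ennreal K + (ennreal (3 * K) + (ennreal (3 * K) + (ennreal (3 * K) + 0)))"
    unfolding C2_holder_norm_def list.map sum_list.Cons sum_list.Nil
    by (intro add_mono s l' sup_norm_le order_refl) (simp_all add: b has_partials_D1_D2[OF p(1)])
  also have "\<dots> = ennreal (12 * K)" using K by (simp flip: ennreal_plus)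
  finally show ?thesis .
qed

subsection \<open>Trigonometric series\<close>

text \<open>The phase closes the class under differentiation in the first variable: minus sine is
  cosine advanced by \<open>pi / 2\<close>, so each derivative adds \<open>pi / 2\<close> to the
  phase and a factor \<open>k\<close> to the coefficients.\<close>

definition tser :: "real => (nat => real => real) => real \<times> real => real" where
  "tser \<theta> c z = (\<Sum>k. c k (snd z) * cos (real k * fst z + \<theta>))"

definition decay :: "nat => real => (nat => real => real) => bool" where
  "decay m B c \<longleftrightarrow> (\<forall>k. \<forall>y\<in>{0..1}. (1 + real k) ^ m * \<bar>c k y\<bar> <= B)"

definition zeta2 :: real where "zeta2 = (\<Sum>k. 1 / (1 + real k)\<^sup>2)"

lemma summable_zeta2: "summable (\<lambda>k. 1 / (1 + real k)\<^sup>2)"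
  using inverse_power_summable[of 2, where 'a = real] summable_Suc_iff[of "\<lambda>n. inverse (real n ^ 2)"]
  by (simp add: inverse_eq_divide add.commute)

lemma zeta2_ge_1: "1 <= zeta2"
  using sum_le_suminf[OF summable_zeta2, of "{0}"] by (simp add: zeta2_def)

lemma decayD: "decay m B c ==> y \<in> {0..1} ==> (1 + real k) ^ m * \<bar>c k y\<bar> <= B"
  unfolding decay_def by blast

lemma decayI: "(!!k y. y \<in> {0..1} ==> (1 + real k) ^ m * \<bar>c k y\<bar> <= B) ==> decay m B c"
  unfolding decay_def by blast

lemma decay_nonneg: "decay m B c ==> 0 <= B"
  using decayD[of m B c 0 0] abs_ge_zero[of "c 0 0"] by simp

lemma decay_le: "decay m B c ==> B <= C ==> decay m C c"
  unfolding decay_def by (meson order_trans)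

lemma decay_times_k:
  assumes "decay m B c" "j + i <= m"
  shows "decay j B (\<lambda>k y. real k ^ i * c k y)"
proof (rule decayI)
  fix k and y :: real assume y: "y \<in> {0..1}"
  have "real k ^ i <= (1 + real k) ^ i" by (intro power_mono) auto
  then have "(1 + real k) ^ j * (real k ^ i * \<bar>c k y\<bar>) <= (1 + real k) ^ j * ((1 + real k) ^ i * \<bar>c k y\<bar>)"
    by (intro mult_left_mono mult_right_mono) auto
  also have "\<dots> = (1 + real k) ^ (j + i) * \<bar>c k y\<bar>" by (simp add: power_add)
  also have "\<dots> <= (1 + real k) ^ m * \<bar>c k y\<bar>" using assms(2) by (intro mult_right_mono power_increasing) auto
  also have "\<dots> <= B" by (rule decayD[OF assms(1) y])
  finally show "(1 + real k) ^ j * \<bar>real k ^ i * c k y\<bar> <= B" by (simp add: abs_mult)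
qed

lemma decay_mono: "decay m B c ==> j <= m ==> decay j B c"
  using decay_times_k[of m B c j 0] by simp

lemma tser_term_bound:
  assumes "decay 2 B c" "snd z \<in> {0..1}"
  shows "\<bar>c k (snd z) * cos (real k * fst z + \<theta>)\<bar> <= B * (1 / (1 + real k)\<^sup>2)"
proof -
  have "\<bar>c k (snd z) * cos (real k * fst z + \<theta>)\<bar> <= \<bar>c k (snd z)\<bar> * 1"
    unfolding abs_mult by (intro mult_left_mono abs_cos_le_one) auto
  also have "\<dots> <= B * (1 / (1 + real k)\<^sup>2)"
    using decayD[OF assms, of k] by (simp add: field_simps)
  finally show ?thesis .
qed

lemma tser_summable:
  assumes "decay 2 B c" "snd z \<in> {0..1}"
  shows "summable (\<lambda>k. c k (snd z) * cos (real k * fst z + \<theta>))"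
  by (rule summable_comparison_test'[OF summable_mult[OF summable_zeta2, of B], of 0])
     (use tser_term_bound[OF assms] in simp)

lemma tser_bound:
  assumes "decay 2 B c" "z \<in> strip"
  shows "\<bar>tser \<theta> c z\<bar> <= B * zeta2"
proof -
  have z: "snd z \<in> {0..1}" using assms(2) by (auto simp: strip_def)
  note t = tser_term_bound[OF assms(1) z, of _ \<theta>]
  have n: "summable (\<lambda>k. norm (c k (snd z) * cos (real k * fst z + \<theta>)))"
    by (rule summable_comparison_test'[OF summable_mult[OF summable_zeta2, of B], of 0]) (use t in simp)
  have "\<bar>tser \<theta> c z\<bar> <= (\<Sum>k. norm (c k (snd z) * cos (real k * fst z + \<theta>)))"
    unfolding tser_def using summable_norm[OF n] by simp
  also have "\<dots> <= (\<Sum>k. B * (1 / (1 + real k)\<^sup>2))"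
    by (rule suminf_le[OF _ n summable_mult[OF summable_zeta2]]) (use t in simp)
  also have "\<dots> = B * zeta2" unfolding zeta2_def by (rule suminf_mult[OF summable_zeta2])
  finally show ?thesis .
qed

lemma tser_continuous:
  assumes "decay 2 B c" "!!k. cont01 (c k)"
  shows "continuous_on strip (tser \<theta> c)"
proof -
  have "uniform_limit strip (\<lambda>n z. \<Sum>k<n. c k (snd z) * cos (real k * fst z + \<theta>))
      (\<lambda>z. \<Sum>k. c k (snd z) * cos (real k * fst z + \<theta>)) sequentially"
    by (rule Weierstrass_m_test[OF _ summable_mult[OF summable_zeta2, of B]])
       (use tser_term_bound[OF assms(1)] in \<open>auto simp: strip_def\<close>)
  then show ?thesis unfolding tser_def [abs_def]
  proof (rule uniform_limit_theorem[rotated])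
    show "\<forall>\<^sub>F n in sequentially. continuous_on strip (\<lambda>z. \<Sum>k<n. c k (snd z) * cos (real k * fst z + \<theta>))"
      by (intro always_eventually allI continuous_intros continuous_on_compose2[OF assms(2)]) (auto simp: strip_def)
  qed simp
qed

lemma tser_partials:
  assumes c: "decay 3 B c" "decay 2 B c'"
    and d: "!!k y. y \<in> {0..1} ==> (c k has_real_derivative c' k y) (at y within {0..1})"
  shows "has_partials (tser \<theta> c) (tser (\<theta> + pi / 2) (\<lambda>k y. real k * c k y)) (tser \<theta> c')"
  unfolding has_partials_def
proof (intro allI ballI conjI)
  fix x y :: real assume y: "y \<in> {0..1}"
  have c2: "decay 2 B c" using decay_mono[OF c(1)] by simp
  have kc: "decay 2 B (\<lambda>k y. real k * c k y)" using decay_times_k[OF c(1), of 2 1] by simp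
  have "\<exists>g. \<forall>t\<in>UNIV. (\<lambda>k. c k y * cos (real k * t + \<theta>)) sums g t &
      (g has_real_derivative tser (\<theta> + pi / 2) (\<lambda>k y. real k * c k y) (t, y)) (at t within UNIV)"
  proof (rule has_field_derivative_series)
    show "((\<lambda>t. c k y * cos (real k * t + \<theta>)) has_real_derivative real k * c k y * cos (real k * t + (\<theta> + pi / 2)))
        (at t within UNIV)" for k t
      by (auto intro!: derivative_eq_intros simp: cos_add sin_add algebra_simps)
    show "uniform_limit UNIV (\<lambda>n t. \<Sum>k<n. real k * c k y * cos (real k * t + (\<theta> + pi / 2)))
        (\<lambda>t. tser (\<theta> + pi / 2) (\<lambda>k y. real k * c k y) (t, y)) sequentially"
      unfolding tser_def fst_conv snd_conv
      by (rule Weierstrass_m_test[OF _ summable_mult[OF summable_zeta2, of B]])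
         (use tser_term_bound[OF kc, of "(_, y)"] y in auto)
    show "summable (\<lambda>k. c k y * cos (real k * x + \<theta>))" using tser_summable[OF c2, of "(x, y)" \<theta>] y by simp
  qed auto
  then obtain g where g: "!!t. (\<lambda>k. c k y * cos (real k * t + \<theta>)) sums g t"
    "!!t. (g has_real_derivative tser (\<theta> + pi / 2) (\<lambda>k y. real k * c k y) (t, y)) (at t)" by auto
  have "(\<lambda>t. tser \<theta> c (t, y)) = g" using g(1) by (auto simp: tser_def fun_eq_iff sums_iff)
  then show "((\<lambda>t. tser \<theta> c (t, y)) has_real_derivative tser (\<theta> + pi / 2) (\<lambda>k y. real k * c k y) (x, y)) (at x)"
    using g(2) by simp
  have "\<exists>g. \<forall>t\<in>{0..1}. (\<lambda>k. c k t * cos (real k * x + \<theta>)) sums g t &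
      (g has_real_derivative tser \<theta> c' (x, t)) (at t within {0..1})"
  proof (rule has_field_derivative_series[of _ _ "\<lambda>k t. c' k t * cos (real k * x + \<theta>)"])
    show "((\<lambda>t. c k t * cos (real k * x + \<theta>)) has_real_derivative c' k t * cos (real k * x + \<theta>)) (at t within {0..1})"
      if "t \<in> {0..1}" for k t
      using d[OF that] by (auto intro!: derivative_eq_intros)
    show "uniform_limit {0..1} (\<lambda>n t. \<Sum>k<n. c' k t * cos (real k * x + \<theta>)) (\<lambda>t. tser \<theta> c' (x, t)) sequentially"
      unfolding tser_def fst_conv snd_conv
      by (rule Weierstrass_m_test[OF _ summable_mult[OF summable_zeta2, of B]])
         (use tser_term_bound[OF c(2), of "(x, _)"] in auto)
    show "summable (\<lambda>k. c k y * cos (real k * x + \<theta>))" using tser_summable[OF c2, of "(x, y)" \<theta>] y by simp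
  qed (use y in auto)
  then obtain g where g: "!!t. t \<in> {0..1} ==> (\<lambda>k. c k t * cos (real k * x + \<theta>)) sums g t"
    "!!t. t \<in> {0..1} ==> (g has_real_derivative tser \<theta> c' (x, t)) (at t within {0..1})" by blast
  show "((\<lambda>t. tser \<theta> c (x, t)) has_real_derivative tser \<theta> c' (x, y)) (at y within {0..1})"
    by (rule has_real_derivative_cong_within[OF g(2)[OF y] y]) (use g(1) in \<open>auto simp: tser_def sums_iff\<close>)
qed

lemma tser_lipschitz:
  assumes c: "decay 3 B c" "decay 2 B c'"
    and d: "!!k y. y \<in> {0..1} ==> (c k has_real_derivative c' k y) (at y within {0..1})"
  shows "bounded_lipschitz (2 * (B * zeta2)) (tser \<theta> c)"
proof (rule bounded_lipschitz_partials[OF tser_partials[OF assms]])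
  have "decay 2 B (\<lambda>k y. real k * c k y)" using decay_times_k[OF c(1), of 2 1] by simp
  then show "\<bar>tser (\<theta> + pi / 2) (\<lambda>k y. real k * c k y) z\<bar> <= B * zeta2" if "z \<in> strip" for z
    using tser_bound that by blast
  show "\<bar>tser \<theta> c' z\<bar> <= B * zeta2" if "z \<in> strip" for z by (rule tser_bound[OF c(2) that])
  show "\<bar>tser \<theta> c z\<bar> <= B * zeta2" if "z \<in> strip" for z
    by (rule tser_bound[OF decay_mono[OF c(1)] that]) simp
qed

text \<open>\<open>\<psi> - y/2\<close> solves \<open>a\<^sup>2 \<Psi>\<^sub>\<xi>\<^sub>\<xi> + \<Psi>\<^sub>y\<^sub>y = F(\<Psi>)\<close>; with \<open>H' = F\<close>, the pressure is
  \<open>H(\<Psi>) - a\<^sup>2 \<Psi>\<^sub>\<xi>\<^sup>2 / 2 - \<Psi>\<^sub>y\<^sup>2 / 2\<close>.\<close>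

theorem euler_stream_travelling:
  fixes \<psi> \<psi>x \<psi>y \<psi>xx \<psi>xy \<psi>yy :: "real \<times> real => real" and a :: real and F H :: "real => real"
  assumes p: "has_partials \<psi> \<psi>x \<psi>y" "has_partials \<psi>x \<psi>xx \<psi>xy" "has_partials \<psi>y \<psi>xy \<psi>yy"
    and c: "continuous_on strip \<psi>" "continuous_on strip \<psi>x" "continuous_on strip \<psi>y" "continuous_on strip \<psi>xx"
      "continuous_on strip \<psi>xy" "continuous_on strip \<psi>yy"
    and H: "!!z. z \<in> strip ==> (H has_real_derivative F (\<psi> z - snd z / 2)) (at (\<psi> z - snd z / 2))"
    and eq: "!!z. z \<in> strip ==> a\<^sup>2 * \<psi>xx z + \<psi>yy z = F (\<psi> z - snd z / 2)"
    and bc: "!!x. \<psi>x (x, 0) = 0" "!!x. \<psi>x (x, 1) = 0"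
  shows "euler_stream (travelling a \<psi>)"
proof -
  define sh where "sh t z = (a * (fst z - t / 2), snd z)" for t :: real and z :: "real \<times> real"
  have sh: "sh t z \<in> strip \<longleftrightarrow> z \<in> strip" for t z by (cases z) (simp add: sh_def)
  have shc: "continuous_on strip (\<lambda>z. f (sh t z))" if "continuous_on strip f" for f :: "real \<times> real => real" and t
    by (rule continuous_on_compose2[OF that]) (auto simp: sh_def strip_def intro!: continuous_intros)
  have shp: "has_partials (\<lambda>z. f (sh t z)) (\<lambda>z. a * fx (sh t z)) (\<lambda>z. fy (sh t z))" if "has_partials f fx fy" for f fx fy t
    unfolding has_partials_def
  proof (intro allI ballI conjI)
    fix x y :: real assume y: "y \<in> {0..1}"
    have "((\<lambda>s. f (a * (s - t / 2), y)) has_real_derivative fx (a * (x - t / 2), y) * a) (at x)"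
      by (rule DERIV_chain2[OF has_partialsD(1)[OF that y]]) (auto intro!: derivative_eq_intros)
    then show "((\<lambda>s. f (sh t (s, y))) has_real_derivative a * fx (sh t (x, y))) (at x)"
      by (simp add: sh_def mult.commute)
    show "((\<lambda>s. f (sh t (x, s))) has_real_derivative fy (sh t (x, y))) (at y within {0..1})"
      using has_partialsD(2)[OF that y] by (simp add: sh_def)
  qed
  have sht: "((\<lambda>s. f (sh s z)) has_real_derivative - (a / 2) * fx (sh t z)) (at t)"
    if "has_partials f fx fy" "z \<in> strip" for f fx fy t z
  proof -
    obtain x y where z: "z = (x, y)" "y \<in> {0..1}" using \<open>z \<in> strip\<close> by (cases z) auto
    have "((\<lambda>s. f (a * (x - s / 2), y)) has_real_derivative fx (a * (x - t / 2), y) * (- (a / 2))) (at t)"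
      by (rule DERIV_chain2[OF has_partialsD(1)[OF that(1) z(2)]]) (auto intro!: derivative_eq_intros)
    then show ?thesis by (simp add: z sh_def mult.commute)
  qed
  have scale: "has_partials (\<lambda>z. k * f z) (\<lambda>z. k * fx z) (\<lambda>z. k * fy z)" if "has_partials f fx fy" for f fx fy and k :: real
    using that unfolding has_partials_def by (auto intro!: derivative_eq_intros)
  define P where "P z = H (\<psi> z - snd z / 2) - (a\<^sup>2 * (\<psi>x z)\<^sup>2 + (\<psi>y z - 1 / 2)\<^sup>2) / 2" for z
  define Px where "Px z = F (\<psi> z - snd z / 2) * \<psi>x z - (a\<^sup>2 * (\<psi>x z * \<psi>xx z) + (\<psi>y z - 1 / 2) * \<psi>xy z)" for z
  define Py where "Py z = F (\<psi> z - snd z / 2) * (\<psi>y z - 1 / 2) - (a\<^sup>2 * (\<psi>x z * \<psi>xy z) + (\<psi>y z - 1 / 2) * \<psi>yy z)" for z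
  \<comment> \<open>Continuity of the vorticity comes from the equation, whose other side is
    continuous.\<close>
  have Fc: "continuous_on strip (\<lambda>z. F (\<psi> z - snd z / 2))"
  proof (rule continuous_on_eq)
    show "continuous_on strip (\<lambda>z. a\<^sup>2 * \<psi>xx z + \<psi>yy z)" by (intro continuous_intros c)
  qed (simp add: eq)
  have Pp: "has_partials P Px Py"
    unfolding has_partials_def
  proof (intro allI ballI conjI)
    fix x y :: real assume y: "y \<in> {0..1}"
    have Hd: "(H has_real_derivative F (\<psi> (x, y) - y / 2)) (at (\<psi> (x, y) - y / 2))" using H[of "(x, y)"] y by simp
    note d = has_partialsD(1)[OF p(1) y, of x] has_partialsD(1)[OF p(2) y, of x] has_partialsD(1)[OF p(3) y, of x]
    have "((\<lambda>t. H (\<psi> (t, y) - y / 2)) has_real_derivative F (\<psi> (x, y) - y / 2) * \<psi>x (x, y)) (at x)"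
      by (rule DERIV_chain2[of H _ "\<lambda>t. \<psi> (t, y) - y / 2", OF Hd]) (auto intro!: derivative_eq_intros d)
    then show "((\<lambda>t. P (t, y)) has_real_derivative Px (x, y)) (at x)"
      unfolding P_def Px_def fst_conv snd_conv
      by (auto intro!: derivative_eq_intros d simp: power2_eq_square field_simps)
    note d = has_partialsD(2)[OF p(1) y, of x] has_partialsD(2)[OF p(2) y, of x] has_partialsD(2)[OF p(3) y, of x]
    have "((\<lambda>t. H (\<psi> (x, t) - t / 2)) has_real_derivative F (\<psi> (x, y) - y / 2) * (\<psi>y (x, y) - 1 / 2)) (at y within {0..1})"
      by (rule DERIV_chain2[of H _ "\<lambda>t. \<psi> (x, t) - t / 2", OF Hd]) (auto intro!: derivative_eq_intros d)
    then show "((\<lambda>t. P (x, t)) has_real_derivative Py (x, y)) (at y within {0..1})"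
      unfolding P_def Py_def fst_conv snd_conv
      by (auto intro!: derivative_eq_intros d simp: power2_eq_square field_simps)
  qed
  have Pc: "continuous_on strip P"
  proof -
    have "continuous_on strip (\<lambda>z. H (\<psi> z - snd z / 2))"
    proof (rule continuous_on_compose2[of "(\<lambda>z. \<psi> z - snd z / 2) ` strip" H])
      show "continuous_on ((\<lambda>z. \<psi> z - snd z / 2) ` strip) H"
      proof (intro continuous_at_imp_continuous_on ballI)
        fix x assume "x \<in> (\<lambda>z. \<psi> z - snd z / 2) ` strip"
        then obtain z where z: "z \<in> strip" "x = \<psi> z - snd z / 2" by blast
        show "isCont H x" unfolding z(2) by (rule DERIV_isCont[OF H[OF z(1)]])
      qed
    qed (auto intro!: continuous_intros c)
    then show ?thesis unfolding P_def [abs_def] by (auto intro!: continuous_intros c)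
  qed
  define \<Phi> where "\<Phi> = travelling a \<psi>"
  have \<Phi>: "\<Phi> t = (\<lambda>z. \<psi> (sh t z))" for t by (simp add: \<Phi>_def travelling_def sh_def case_prod_beta fun_eq_iff)
  define u1 where "u1 t = D2 (\<Phi> t)" for t
  define u2 where "u2 t z = - D1 (\<Phi> t) z" for t z
  define pr where "pr t z = P (sh t z)" for t z
  have u1: "u1 t z = \<psi>y (sh t z)" and u2: "u2 t z = - a * \<psi>x (sh t z)" if "z \<in> strip" for t z
    using has_partials_D1_D2[OF shp[OF p(1)] that, of t] by (simp_all add: u1_def u2_def \<Phi>)
  have q1: "has_partials (u1 t) (\<lambda>z. a * \<psi>xy (sh t z)) (\<lambda>z. \<psi>yy (sh t z))" for t
    by (rule has_partials_cong[OF shp[OF p(3), of t]]) (simp_all add: u1)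
  have q2: "has_partials (u2 t) (\<lambda>z. - a * (a * \<psi>xx (sh t z))) (\<lambda>z. - a * \<psi>xy (sh t z))" for t
    by (rule has_partials_cong[OF scale[OF shp[OF p(2), of t], of "- a"]]) (simp_all add: u2)
  have q3: "has_partials (pr t) (\<lambda>z. a * Px (sh t z)) (\<lambda>z. Py (sh t z))" for t
    by (rule has_partials_cong[OF shp[OF Pp, of t]]) (simp_all add: pr_def)
  have u1c: "continuous_on strip (u1 t)" for t
    by (rule continuous_on_cong[THEN iffD2, OF refl _ shc[OF c(3), of t]]) (simp add: u1)
  have u2c: "continuous_on strip (u2 t)" for t
    by (rule continuous_on_cong[THEN iffD2, OF refl _ continuous_on_mult[OF continuous_on_const shc[OF c(2), of t], of "- a"]])
       (simp add: u2)
  have Pxc: "continuous_on strip Px" "continuous_on strip Py"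
    unfolding Px_def [abs_def] Py_def [abs_def] by (intro continuous_intros Fc c)+
  have ck: "Ck_strip 1 (u1 t)" "Ck_strip 1 (u2 t)" "Ck_strip 1 (pr t)" for t
    unfolding One_nat_def
    by (rule Ck_strip_SucI[OF q1 u1c], simp, intro continuous_intros shc c, simp, intro shc c,
        rule Ck_strip_SucI[OF q2 u2c], simp, intro continuous_intros shc c, simp, intro continuous_intros shc c,
        rule Ck_strip_SucI[OF q3], simp add: pr_def [abs_def], intro shc Pc, simp, intro continuous_intros shc Pxc,
        simp, intro shc Pxc)
  have "euler_channel u1 u2 pr"
    unfolding euler_channel_def
  proof (intro conjI allI ballI)
    fix t :: real and z :: "real \<times> real" assume z: "z \<in> strip"
    have sz: "sh t z \<in> strip" using sh z by simp
    have e1: "(\<lambda>s. u1 s z) = (\<lambda>s. \<psi>y (sh s z))" "(\<lambda>s. u2 s z) = (\<lambda>s. - a * \<psi>x (sh s z))"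
      using u1[OF z] u2[OF z] by auto
    have t1: "((\<lambda>s. u1 s z) has_real_derivative - (a / 2) * \<psi>xy (sh t z)) (at t)"
      unfolding e1 by (rule sht[OF p(3) z])
    have t2: "((\<lambda>s. u2 s z) has_real_derivative - a * (- (a / 2) * \<psi>xx (sh t z))) (at t)"
      unfolding e1 by (rule DERIV_cmult[OF sht[OF p(2) z]])
    show "(\<lambda>s. u1 s z) differentiable (at t)" "(\<lambda>s. u2 s z) differentiable (at t)"
      using t1 t2 by (auto simp: real_differentiable_def)
    have v: "vector_derivative (\<lambda>s. u1 s z) (at t) = - (a / 2) * \<psi>xy (sh t z)"
      "vector_derivative (\<lambda>s. u2 s z) (at t) = - a * (- (a / 2) * \<psi>xx (sh t z))"
      by (rule vector_derivative_at[OF t1[unfolded has_real_derivative_iff_has_vector_derivative]],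
          rule vector_derivative_at[OF t2[unfolded has_real_derivative_iff_has_vector_derivative]])
    note D = has_partials_D1_D2[OF q1 z] has_partials_D1_D2[OF q2 z] has_partials_D1_D2[OF q3 z]
    note yy = eq[OF sz]
    show "vector_derivative (\<lambda>s. u1 s z) (at t) + u1 t z * D1 (u1 t) z + u2 t z * D2 (u1 t) z = - D1 (pr t) z"
      unfolding v unfolding D u1[OF z] u2[OF z] Px_def yy[symmetric] by (simp add: algebra_simps power2_eq_square)
    show "vector_derivative (\<lambda>s. u2 s z) (at t) + u1 t z * D1 (u2 t) z + u2 t z * D2 (u2 t) z = - D2 (pr t) z"
      unfolding v unfolding D u1[OF z] u2[OF z] Py_def yy[symmetric] by (simp add: algebra_simps power2_eq_square)
    show "D1 (u1 t) z + D2 (u2 t) z = 0" unfolding D by simp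
  next
    fix t x
    show "u2 t (x, 0) = 0" "u2 t (x, 1) = 0" by (simp_all add: u2 sh_def bc)
  qed (rule ck)+
  then show ?thesis unfolding euler_stream_def \<Phi>_def[symmetric] u1_def [abs_def] u2_def [abs_def] by blast
qed

section \<open>Bifurcating coefficients of the shear\<close>

text \<open>Passes from integer to natural frequencies. The zero mode is counted once, so for even
  series every other coefficient doubles.\<close>

definition fold_series :: "cosine_series => nat => real => real" where
  "fold_series f k y = cf f (int k) y + (if k = 0 then 0 else cf f (- int k) y)"

lemma fold_series_diff: "fold_series (f - g) k y = fold_series f k y - fold_series g k y"
  by (simp add: fold_series_def cf_diff)

lemma fold_series_even:
  assumes "f \<in> even_sym" "y \<in> {0..1}"
  shows "fold_series f k y = (if k = 0 then 1 else 2) * cf f (int k) y"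
  using even_symD(1)[OF assms, of "int k"] by (simp add: fold_series_def)

lemma decay_fold_series: "decay 6 (2 * norm f) (fold_series f)"
proof (rule decayI)
  fix k and y :: real
  have w: "(1 + real k) ^ 6 = wt (int k)" by (simp add: wt_def)
  have "(1 + real k) ^ 6 * \<bar>fold_series f k y\<bar> <= wt (int k) * (\<bar>cf f (int k) y\<bar> + \<bar>cf f (- int k) y\<bar>)"
    unfolding w fold_series_def by (intro mult_left_mono) auto
  also have "\<dots> = wt (int k) * \<bar>cf f (int k) y\<bar> + wt (- int k) * \<bar>cf f (- int k) y\<bar>"
    by (simp add: distrib_left)
  also have "\<dots> <= 2 * norm f" using wt_cf_le_norm[of "int k" f y] wt_cf_le_norm[of "- int k" f y] by linarith
  finally show "(1 + real k) ^ 6 * \<bar>fold_series f k y\<bar> <= 2 * norm f" .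
qed

lemma infsum_int_sums:
  fixes g :: "int => real"
  assumes "g summable_on UNIV"
  shows "(\<lambda>k. g (int k) + (if k = 0 then 0 else g (- int k))) sums infsum g UNIV"
proof -
  define P where "P = range int"
  define M where "M = range (\<lambda>k. - int (Suc k))"
  have U: "UNIV = P \<union> M"
  proof -
    have "i \<in> P \<union> M" for i :: int
    proof (cases "0 <= i")
      case True
      then have "i = int (nat i)" by simp
      then show ?thesis unfolding P_def by blast
    next
      case False
      then have "i = - int (Suc (nat (- i - 1)))" by simp
      then show ?thesis unfolding M_def by blast
    qed
    then show ?thesis by blast
  qed
  have D: "P \<inter> M = {}" unfolding P_def M_def by auto
  have sP: "g summable_on P" and sM: "g summable_on M" using summable_on_subset_banach[OF assms] by auto
  have iM: "inj (\<lambda>k. - int (Suc k))" by (rule injI) simp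
  have "(g has_sum infsum g P) P" using sP by simp
  then have "((g \<circ> int) has_sum infsum g P) UNIV" unfolding P_def by (subst (asm) has_sum_reindex) auto
  then have p: "(\<lambda>k. g (int k)) sums infsum g P" using has_sum_imp_sums by (fastforce simp: o_def)
  have "(g has_sum infsum g M) M" using sM by simp
  then have "((g \<circ> (\<lambda>k. - int (Suc k))) has_sum infsum g M) UNIV" unfolding M_def using iM by (subst (asm) has_sum_reindex) auto
  then have m: "(\<lambda>k. g (- int (Suc k))) sums infsum g M" using has_sum_imp_sums by (fastforce simp: o_def)
  have m': "(\<lambda>k. if k = 0 then 0 else g (- int k)) sums infsum g M"
    using sums_Suc[of "\<lambda>k. if k = 0 then 0 else g (- int k)" "infsum g M"] m by simp
  have "infsum g UNIV = infsum g P + infsum g M" unfolding U by (rule infsum_Un_disjoint[OF sP sM D])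
  then show ?thesis using sums_add[OF p m'] by simp
qed

lemma ev_eq_tser: "ev f \<xi> y = tser 0 (fold_series f) (\<xi>, y)"
proof -
  have e: "cf f (int k) y * cos (real_of_int (int k) * \<xi>) +
      (if k = 0 then 0 else cf f (- int k) y * cos (real_of_int (- int k) * \<xi>)) =
      fold_series f k y * cos (real k * \<xi>)" for k
    by (simp add: fold_series_def distrib_right)
  show ?thesis using sums_unique[OF infsum_int_sums[OF summable_ev[of f y \<xi>], unfolded e]]
    by (simp add: ev_def tser_def)
qed

lemma dirichlet_bvp_cong_fun:
  assumes "dirichlet_bvp q g a" "!!y. y \<in> {0..1} ==> a y = b y"
  shows "dirichlet_bvp q g b"
proof -
  obtain a' where a: "linear_ode q g a a'" "a 0 = 0" "a 1 = 0" using assms(1) unfolding dirichlet_bvp_def by blast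
  have "linear_ode q g b a'"
    unfolding linear_ode_def
  proof (intro ballI conjI)
    fix y :: real assume y: "y \<in> {0..1}"
    show "(b has_real_derivative a' y) (at y within {0..1})"
      using has_real_derivative_cong_within[OF linear_odeD(1)[OF a(1) y] y] assms(2) by blast
    show "(a' has_real_derivative q y * b y + g y) (at y within {0..1})"
      using linear_odeD(2)[OF a(1) y] assms(2)[OF y] by simp
  qed
  then show ?thesis using a assms(2)[of 0] assms(2)[of 1] unfolding dirichlet_bvp_def by auto
qed

text \<open>The abstract bifurcation result with \<open>T\<close> the Green operators,
  \<open>S\<close> the Green operators times \<open>k\<^sup>2\<close>, and \<open>L\<close> the
  solvability functional of the resonant mode; \<open>lam\<close> is the shift of
  \<open>\<alpha>\<^sup>2\<close>. The fixed point equation says that each coefficient solves the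
  equation of its mode with the shifted wave number.\<close>

theorem bifurcation_coefficients:
  fixes c :: "nat => real => real" and Q \<phi> \<phi>' :: "real => real" and \<alpha> r M :: real
  assumes cc: "!!i. cont01 (c i)" and r: "0 < r" and M: "0 < M"
    and cb: "!!i y. y \<in> {0..1} ==> \<bar>c i y\<bar> <= M / r ^ i"
    and csym: "!!i y. c i (1 - y) = c i y"
    and Q: "cont01 Q" and sym: "!!y. y \<in> {0..1} ==> Q (1 - y) = Q y" and \<alpha>: "0 < \<alpha>"
    and \<phi>: "linear_ode (\<lambda>y. Q y + \<alpha>\<^sup>2) (\<lambda>y. 0) \<phi> \<phi>'" "\<phi> 0 = 0" "\<phi> 1 = 0" "!!y. y \<in> {0<..<1} ==> 0 < \<phi> y"
    and nr0: "!!a. dirichlet_bvp Q (\<lambda>y. 0) a ==> \<forall>y\<in>{0..1}. a y = 0"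
    and nr: "!!m a. \<alpha>\<^sup>2 < m ==> dirichlet_bvp (\<lambda>y. Q y + m) (\<lambda>y. 0) a ==> \<forall>y\<in>{0..1}. a y = 0"
  obtains s0 K :: real and u n :: "real => nat => real => real" and lam :: "real => real"
  where "0 < s0" "0 < K"
    "!!s k. \<bar>s\<bar> < s0 ==> dirichlet_bvp (\<lambda>y. Q y + (\<alpha>\<^sup>2 + lam s) * (real k)\<^sup>2) (n s k) (u s k)"
    "!!s k. \<bar>s\<bar> < s0 ==> cont01 (n s k)"
    "!!s k y. \<bar>s\<bar> < s0 ==> y \<in> {0..1} ==> u s k (1 - y) = u s k y"
    "!!s t. \<bar>s\<bar> < s0 ==> \<bar>t\<bar> < s0 ==> decay 6 (K * \<bar>s - t\<bar>) (\<lambda>k y. u s k y - u t k y)"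
    "!!s t. \<bar>s\<bar> < s0 ==> \<bar>t\<bar> < s0 ==> decay 6 (K * \<bar>s - t\<bar>) (\<lambda>k y. n s k y - n t k y)"
    "!!s t. \<bar>s\<bar> < s0 ==> \<bar>t\<bar> < s0 ==> \<bar>lam s - lam t\<bar> <= K * \<bar>s - t\<bar>"
    "!!s. \<bar>s\<bar> < s0 ==> \<bar>lam s\<bar> <= K * \<bar>s\<bar>"
    "!!s. \<bar>s\<bar> < s0 ==> decay 6 (K * s\<^sup>2) (\<lambda>k y. u s k y - (if k = 1 then s * \<phi> y else 0))"
    "!!s. \<bar>s\<bar> < s0 ==> decay 6 (K * s\<^sup>2) (n s)"
    "!!s \<xi> y. \<bar>s\<bar> < s0 ==> y \<in> {0..1} ==> \<bar>tser 0 (u s) (\<xi>, y)\<bar> <= r / 2"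
    "!!s \<xi> y. \<bar>s\<bar> < s0 ==> y \<in> {0..1} ==>
       (\<lambda>i. c (i + 2) y * tser 0 (u s) (\<xi>, y) ^ (i + 2)) sums tser 0 (n s) (\<xi>, y)"
proof -
  note thesis0 = that
  have symq: "Q (1 - y) + \<alpha>\<^sup>2 = Q y + \<alpha>\<^sup>2" if "y \<in> {0..1}" for y using sym[OF that] by simp
  have Qc: "cont01 (\<lambda>y. Q y + \<alpha>\<^sup>2)" by (intro continuous_intros Q)
  have \<phi>sym: "\<phi> (1 - y) = \<phi> y" if "y \<in> {0..1}" for y
    by (rule positive_eigenfunction_facts(3)[where q = "\<lambda>y. Q y + \<alpha>\<^sup>2" and \<phi>' = \<phi>', OF Qc symq \<phi>]) (assumption | rule that)+
  have ip0: "0 < ip \<phi> \<phi>"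
    by (rule positive_eigenfunction_facts(4)[where q = "\<lambda>y. Q y + \<alpha>\<^sup>2" and \<phi>' = \<phi>', OF Qc symq \<phi>])
  have \<phi>c: "cont01 \<phi>" by (rule linear_ode_continuous(1)[OF \<phi>(1)])
  have \<phi>b: "dirichlet_bvp (\<lambda>y. Q y + \<alpha>\<^sup>2) (\<lambda>y. 0) \<phi>" unfolding dirichlet_bvp_def using \<phi> by blast
  obtain \<Phi> where \<Phi>: "0 < \<Phi>" "!!y. y \<in> {0..1} ==> \<bar>\<phi> y\<bar> <= \<Phi>" by (rule bounded_abs_on_unit_interval[OF \<phi>c]) (rule that)
  obtain G C where C: "0 < C"
    and G1: "!!k g. k \<noteq> 1 ==> cont01 g ==> dirichlet_bvp (\<lambda>y. Q y + \<alpha>\<^sup>2 * (real k)\<^sup>2) g (G k g)"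
    and G2: "!!g. cont01 g ==> dirichlet_bvp (\<lambda>y. Q y + \<alpha>\<^sup>2) (\<lambda>y. g y - ip g \<phi> / ip \<phi> \<phi> * \<phi> y) (G 1 g)"
    and G3: "!!g. cont01 g ==> ip (G 1 g) \<phi> = 0"
    and G4: "!!k g B y. cont01 g ==> (!!y. y \<in> {0..1} ==> \<bar>g y\<bar> <= B) ==> y \<in> {0..1} ==>
       (1 + real k)\<^sup>2 * \<bar>G k g y\<bar> <= C * B"
    and G5: "!!k g h y. cont01 g ==> cont01 h ==> y \<in> {0..1} ==>
       G k (\<lambda>y. g y + h y) y = G k g y + G k h y"
    and G6: "!!k g c y. cont01 g ==> y \<in> {0..1} ==> G k (\<lambda>y. c * g y) y = c * G k g y"
    and G7: "!!k g y. cont01 g ==> (!!y. y \<in> {0..1} ==> g (1 - y) = g y) ==> y \<in> {0..1} ==>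
       G k g (1 - y) = G k g y"
  proof (rule green_operators[where Q = Q and \<alpha> = \<alpha> and \<phi> = \<phi> and \<phi>' = \<phi>', OF Q sym \<alpha> \<phi>],
      assumption, assumption, goal_cases)
    case (1 a y) then show ?case using nr0 by blast
  next
    case (2 m a y) then show ?case using nr by blast
  next
    case (3 G C)
    show ?case by (rule that[where G = G and C = C]) (fact 3)+
  qed
  have Gc: "cont01 (G k g)" if "cont01 g" for k g
    using dirichlet_bvp_continuous[OF G1[OF _ that]] dirichlet_bvp_continuous[OF G2[OF that]] by (cases "k = 1") auto
  \<comment> \<open>The Green operators take functions on the whole line, so independence of the
    values outside the interval has to be derived; it follows from the bound applied to the
    difference.\<close>
  have Gcong: "G k g y = G k h y" if "cont01 g" "cont01 h" "y \<in> {0..1}"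
    "!!y. y \<in> {0..1} ==> g y = h y" for k g h y
  proof -
    have c': "cont01 (\<lambda>y. (- 1) * h y)" by (intro continuous_intros that(2))
    have "(1 + real k)\<^sup>2 * \<bar>G k (\<lambda>y. g y + (- 1) * h y) y\<bar> <= C * 0"
      by (rule G4) (use that c' in \<open>auto intro!: continuous_intros\<close>)
    then have "\<bar>G k (\<lambda>y. g y + (- 1) * h y) y\<bar> <= 0" by (simp add: mult_le_0_iff)
    then show ?thesis using G5[OF that(1) c' that(3), of k] G6[OF that(2,3), of k "- 1"] by simp
  qed
  obtain N \<rho> CN where \<rho>: "0 < \<rho>" "0 < CN" and N0: "N 0 = 0"
    and NL: "!!u v R. norm u <= R ==> norm v <= R ==> R <= \<rho> ==> norm (N u - N v) <= CN * R * norm (u - v)"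
    and evb: "!!u \<xi> y. norm u <= \<rho> ==> \<bar>ev u \<xi> y\<bar> <= r / 2"
    and evs: "!!u \<xi> y. norm u <= \<rho> ==> y \<in> {0..1} ==> (\<lambda>i. c (i + 2) y * ev u \<xi> y ^ (i + 2)) sums ev (N u) \<xi> y"
    and NV0: "!!u. (!!i y. y \<in> {0..1} ==> c i (1 - y) = c i y) ==> u \<in> even_sym ==> norm u <= \<rho> ==> N u \<in> even_sym"
  proof (rule nonlinear_operator[where c = c and r = r and M = M, OF cc r M cb], assumption, goal_cases)
    case (1 N \<rho> CN)
    show ?case by (rule that[where N = N and \<rho> = \<rho> and CN = CN]) (fact 1)+
  qed
  have NV: "N u \<in> even_sym" if "u \<in> even_sym" "norm u <= \<rho>" for u by (rule NV0[OF csym that])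
  \<comment> \<open>Negative frequencies use the operator of their absolute value, which preserves
    evenness in \<open>k\<close>.\<close>
  define \<Theta> where "\<Theta> f k y = G (nat \<bar>k\<bar>) (cf f k) y" for f :: cosine_series and k y
  have cfc: "cont01 (cf f k)" for f k by (rule continuous_on_cf)
  have \<Theta>b: "wt k * ((1 + real_of_int \<bar>k\<bar>)\<^sup>2 * \<bar>\<Theta> f k y\<bar>) <= C * norm f" if "y \<in> {0..1}" for f k y
  proof -
    have "(1 + real (nat \<bar>k\<bar>))\<^sup>2 * \<bar>G (nat \<bar>k\<bar>) (cf f k) y\<bar> <= C * (norm f * (1 / wt k))"
      by (rule G4[OF cfc cf_le_norm that])
    then have "(1 + real_of_int \<bar>k\<bar>)\<^sup>2 * \<bar>\<Theta> f k y\<bar> <= C * (norm f * (1 / wt k))" by (simp add: \<Theta>_def)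
    then have "wt k * ((1 + real_of_int \<bar>k\<bar>)\<^sup>2 * \<bar>\<Theta> f k y\<bar>) <= wt k * (C * (norm f * (1 / wt k)))"
      by (intro mult_left_mono) auto
    then show ?thesis by simp
  qed
  have \<Theta>w: "wt_bounded (C * norm f) (\<lambda>k y. p k * \<Theta> f k y)"
    if p: "!!k. \<bar>p k\<bar> <= (1 + real_of_int \<bar>k\<bar>)\<^sup>2" for p f
  proof (rule wt_boundedI)
    show "cont01 (\<lambda>y. p k * \<Theta> f k y)" for k
      unfolding \<Theta>_def by (intro continuous_intros Gc cfc)
    show "wt k * \<bar>p k * \<Theta> f k y\<bar> <= C * norm f" if "y \<in> {0..1}" for k y
    proof -
      have "wt k * \<bar>p k * \<Theta> f k y\<bar> <= wt k * ((1 + real_of_int \<bar>k\<bar>)\<^sup>2 * \<bar>\<Theta> f k y\<bar>)"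
        unfolding abs_mult by (intro mult_left_mono mult_right_mono p) auto
      then show ?thesis using \<Theta>b[OF that, of k f] by linarith
    qed
  qed
  have \<Theta>add: "\<Theta> (f + g) k y = \<Theta> f k y + \<Theta> g k y" if "y \<in> {0..1}" for f g k y
  proof -
    have "cf (f + g) k = (\<lambda>y. cf f k y + cf g k y)" by (rule ext) (rule cf_add)
    then show ?thesis unfolding \<Theta>_def using G5[OF cfc cfc that] by simp
  qed
  have \<Theta>scale: "\<Theta> (a *\<^sub>R f) k y = a * \<Theta> f k y" if "y \<in> {0..1}" for a f k y
  proof -
    have "cf (a *\<^sub>R f) k = (\<lambda>y. a * cf f k y)" by (rule ext) (rule cf_scaleR)
    then show ?thesis unfolding \<Theta>_def using G6[OF cfc that] by simp
  qed
  have \<Theta>V: "\<Theta> f (- k) y = \<Theta> f k y" "\<Theta> f k (1 - y) = \<Theta> f k y" if "f \<in> even_sym" "y \<in> {0..1}" for f k y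
  proof -
    show "\<Theta> f (- k) y = \<Theta> f k y" unfolding \<Theta>_def abs_minus_cancel
      by (rule Gcong[OF cfc cfc that(2)]) (rule even_symD(1)[OF that(1)])
    show "\<Theta> f k (1 - y) = \<Theta> f k y" unfolding \<Theta>_def
      by (rule G7[OF cfc _ that(2)]) (rule even_symD(2)[OF that(1)])
  qed
  define W where "W p f = series_of (\<lambda>k y. p k * \<Theta> f k y)" for p :: "int => real" and f
  have Wlin: "bounded_linear (W p)" if p: "!!k. \<bar>p k\<bar> <= (1 + real_of_int \<bar>k\<bar>)\<^sup>2" for p
    unfolding W_def [abs_def]
    by (rule bounded_linear_series_of[where C = C]) (auto simp: \<Theta>w[OF p] \<Theta>add \<Theta>scale distrib_left)
  have Wcf: "cf (W p f) k y = p k * \<Theta> f k y" if p: "!!k. \<bar>p k\<bar> <= (1 + real_of_int \<bar>k\<bar>)\<^sup>2" and "y \<in> {0..1}" for p f k y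
    unfolding W_def cf_series_of[OF \<Theta>w[OF p]] using that(2) by simp
  have WV: "W p f \<in> even_sym" if p: "!!k. \<bar>p k\<bar> <= (1 + real_of_int \<bar>k\<bar>)\<^sup>2" "!!k. p (- k) = p k" and f: "f \<in> even_sym" for p f
  proof (rule even_symI)
    fix k and y :: real assume y: "y \<in> {0..1}"
    then have y': "1 - y \<in> {0..1}" by auto
    show "cf (W p f) (- k) y = cf (W p f) k y" "cf (W p f) k (1 - y) = cf (W p f) k y"
      unfolding Wcf[OF p(1) y] Wcf[OF p(1) y'] p(2) \<Theta>V[OF f y] by simp_all
  qed
  \<comment> \<open>The multipliers of \<open>T\<close> and of \<open>S\<close>. Both are dominated
    by the gain of the Green operators, so even the one that differentiates twice in \<xi> is
    bounded.\<close>
  define p1 :: "int => real" where "p1 k = 1" for k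
  define p2 :: "int => real" where "p2 k = (real_of_int k)\<^sup>2" for k
  have p1: "\<bar>p1 k\<bar> <= (1 + real_of_int \<bar>k\<bar>)\<^sup>2" for k unfolding p1_def by (simp add: one_le_power)
  have p2: "\<bar>p2 k\<bar> <= (1 + real_of_int \<bar>k\<bar>)\<^sup>2" for k
  proof -
    have "\<bar>real_of_int k\<bar>\<^sup>2 <= (1 + real_of_int \<bar>k\<bar>)\<^sup>2" by (intro power_mono) auto
    then show ?thesis by (simp add: p2_def)
  qed
  have pm: "p1 (- k) = p1 k" "p2 (- k) = p2 k" for k by (simp_all add: p1_def p2_def)
  \<comment> \<open>The factor 2 stems from the kernel part, whose coefficient at frequency 1 is
    \<open>s / 2 * \<phi>\<close>; the sign comes from moving the nonlinear term to the other side
    of the solvability condition.\<close>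
  define L where "L f = - 2 * ip (cf f 1) \<phi> / ip \<phi> \<phi>" for f
  have L: "bounded_linear L"
  proof (rule bounded_linear_intro)
    show "L (f + g) = L f + L g" for f g
    proof -
      have "cf (f + g) 1 = (\<lambda>y. cf f 1 y + cf g 1 y)" by (rule ext) (rule cf_add)
      then show ?thesis unfolding L_def using ip_add[OF cfc cfc \<phi>c, of f 1 g 1] ip0
        by (simp add: add_divide_distrib diff_divide_distrib distrib_left)
    qed
    show "L (a *\<^sub>R f) = a *\<^sub>R L f" for a f
    proof -
      have "cf (a *\<^sub>R f) 1 = (\<lambda>y. a * cf f 1 y)" by (rule ext) (rule cf_scaleR)
      then show ?thesis unfolding L_def using ip_scale[of a "cf f 1" \<phi>] by simp
    qed
    show "norm (L f) <= norm f * (2 * \<Phi> / ip \<phi> \<phi>)" for f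
    proof -
      have b: "\<bar>cf f 1 y\<bar> <= norm f" for y
      proof -
        have "1 * \<bar>cf f 1 y\<bar> <= wt 1 * \<bar>cf f 1 y\<bar>" by (intro mult_right_mono wt_ge_1) auto
        then show ?thesis using wt_cf_le_norm[of 1 f y] by linarith
      qed
      have "\<bar>ip (cf f 1) \<phi>\<bar> <= norm f * \<Phi>" by (rule ip_bound[OF cfc \<phi>c b \<Phi>(2)])
      then have "2 * \<bar>ip (cf f 1) \<phi>\<bar> / ip \<phi> \<phi> <= 2 * (norm f * \<Phi>) / ip \<phi> \<phi>"
        using ip0 by (intro divide_right_mono) auto
      then show ?thesis using ip0 by (simp add: L_def abs_mult field_simps)
    qed
  qed
  \<comment> \<open>Half of \<open>\<phi>\<close> at each of the frequencies 1 and -1 represents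
    \<open>\<phi> y * cos \<xi>\<close>.\<close>
  define bc where "bc k y = (if \<bar>k\<bar> = 1 then \<phi> y / 2 else 0)" for k :: int and y
  have bw: "wt_bounded (wt 1 * \<Phi>) bc"
  proof (rule wt_boundedI)
    show "cont01 (bc k)" for k
      using \<phi>c by (cases "\<bar>k\<bar> = 1") (auto simp: bc_def [abs_def] intro!: continuous_intros)
    show "wt k * \<bar>bc k y\<bar> <= wt 1 * \<Phi>" if "y \<in> {0..1}" for k y
    proof (cases "\<bar>k\<bar> = 1")
      case True
      then have "wt k = wt 1" by (simp add: wt_def)
      then show ?thesis using \<Phi>(2)[OF that] True \<Phi>(1)
        by (simp add: bc_def)
    qed (use \<Phi>(1) in \<open>simp add: bc_def\<close>)
  qed
  define b where "b = series_of bc"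
  have bcf: "cf b k y = bc k y" if "y \<in> {0..1}" for k y unfolding b_def cf_series_of[OF bw] using that by simp
  have bV: "b \<in> even_sym"
  proof (rule even_symI)
    fix k and y :: real assume y: "y \<in> {0..1}"
    then have y': "1 - y \<in> {0..1}" by auto
    show "cf b (- k) y = cf b k y" "cf b k (1 - y) = cf b k y"
      unfolding bcf[OF y] bcf[OF y'] using \<phi>sym[OF y] by (simp_all add: bc_def)
  qed
  obtain s0 K v lam where s0: "0 < s0" "0 < K"
    and vV: "!!s. \<bar>s\<bar> < s0 ==> v s \<in> even_sym"
    and vr: "!!s. \<bar>s\<bar> < s0 ==> norm (s *\<^sub>R b + v s) <= \<rho>"
    and vs: "!!s. \<bar>s\<bar> < s0 ==> norm (v s) <= K * s\<^sup>2"
    and Ns: "!!s. \<bar>s\<bar> < s0 ==> norm (N (s *\<^sub>R b + v s)) <= K * s\<^sup>2"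
    and ls: "!!s. \<bar>s\<bar> < s0 ==> \<bar>lam s\<bar> <= K * \<bar>s\<bar>"
    and leq: "!!s. \<bar>s\<bar> < s0 ==> s * lam s = L (N (s *\<^sub>R b + v s))"
    and veq: "!!s. \<bar>s\<bar> < s0 ==> v s = lam s *\<^sub>R W p2 (v s) + W p1 (N (s *\<^sub>R b + v s))"
    and vl: "!!s t. \<bar>s\<bar> < s0 ==> \<bar>t\<bar> < s0 ==> norm (v s - v t) <= K * \<bar>s - t\<bar>"
    and ll: "!!s t. \<bar>s\<bar> < s0 ==> \<bar>t\<bar> < s0 ==> \<bar>lam s - lam t\<bar> <= K * \<bar>s - t\<bar>"
    and Nl: "!!s t. \<bar>s\<bar> < s0 ==> \<bar>t\<bar> < s0 ==>
       norm (N (s *\<^sub>R b + v s) - N (t *\<^sub>R b + v t)) <= K * \<bar>s - t\<bar>"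
  proof (rule bifurcation_from_simple_kernel[where V = even_sym and S = "W p2" and T = "W p1" and L = L and N = N and r = \<rho>
        and C = CN and b = b, OF closed_even_sym subspace_even_sym Wlin[of p2, OF p2] WV[of p2, OF p2 pm(2)]
        Wlin[of p1, OF p1] WV[of p1, OF p1 pm(1)] L \<rho>(1) NV N0 \<rho>(2) NL bV], (assumption+)?, goal_cases)
    case (1 s0 K v lam)
    show ?case by (rule that[where ?s0.0 = s0 and K = K and v = v and lam = lam]) (fact 1)+
  qed
  define U where "U s = s *\<^sub>R b + v s" for s
  have UV: "U s \<in> even_sym" and NUV: "N (U s) \<in> even_sym" if "\<bar>s\<bar> < s0" for s
  proof -
    show "U s \<in> even_sym" unfolding U_def
      by (intro subspace_add subspace_scale subspace_even_sym bV vV[OF that])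
    then show "N (U s) \<in> even_sym" by (rule NV) (use vr[OF that] in \<open>simp add: U_def\<close>)
  qed
  have vcf: "cf (v s) k y = lam s * ((real_of_int k)\<^sup>2 * \<Theta> (v s) k y) + \<Theta> (N (U s)) k y"
    if "\<bar>s\<bar> < s0" "y \<in> {0..1}" for s k y
    using arg_cong[OF veq[OF that(1)], of "\<lambda>f. cf f k y"] Wcf[of p2, OF p2 that(2)] Wcf[of p1, OF p1 that(2)]
    by (simp add: cf_add cf_scaleR p1_def p2_def U_def)
  \<comment> \<open>Folding doubles the bounds, and \<open>norm b\<close> accounts for the explicit
    part \<open>s *\<^sub>R b\<close>.\<close>
  define K' where "K' = 2 * (K + norm b)"
  have K': "K <= K'" "2 * K <= K'" "0 < K'" using s0 by (auto simp: K'_def add_pos_nonneg)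
  show ?thesis
  proof (rule thesis0[of s0 K' lam "\<lambda>s. fold_series (N (U s))" "\<lambda>s. fold_series (U s)"])
    show "0 < s0" "0 < K'" by fact+
    fix s :: real assume s: "\<bar>s\<bar> < s0"
    show "cont01 (fold_series (N (U s)) k)" for k
      unfolding fold_series_def [abs_def] by (cases "k = 0") (auto intro!: continuous_intros cfc)
    show "fold_series (U s) k (1 - y) = fold_series (U s) k y" if "y \<in> {0..1}" for k y
    proof -
      have "1 - y \<in> {0..1}" using that by auto
      then show ?thesis using that UV[OF s] by (simp add: fold_series_even even_symD)
    qed
    show "\<bar>lam s\<bar> <= K' * \<bar>s\<bar>" using ls[OF s] mult_right_mono[OF K'(1), of "\<bar>s\<bar>"] by simp
    have s2: "2 * (K * s\<^sup>2) <= K' * s\<^sup>2" using mult_right_mono[OF K'(2), of "s\<^sup>2"] by (simp add: mult.assoc)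
    show "decay 6 (K' * s\<^sup>2) (fold_series (N (U s)))"
      by (rule decay_le[OF decay_fold_series]) (use Ns[OF s] s2 in \<open>simp add: U_def\<close>)
    show "decay 6 (K' * s\<^sup>2) (\<lambda>k y. fold_series (U s) k y - (if k = 1 then s * \<phi> y else 0))"
    proof (rule decayI)
      fix k and y :: real assume y: "y \<in> {0..1}"
      have "fold_series (U s) k y - (if k = 1 then s * \<phi> y else 0) = fold_series (v s) k y"
        using bcf[OF y] by (auto simp: fold_series_def U_def cf_add cf_scaleR bc_def)
      moreover have "(1 + real k) ^ 6 * \<bar>fold_series (v s) k y\<bar> <= 2 * norm (v s)"
        by (rule decayD[OF decay_fold_series y])
      ultimately show "(1 + real k) ^ 6 * \<bar>fold_series (U s) k y - (if k = 1 then s * \<phi> y else 0)\<bar> <= K' * s\<^sup>2"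
        using vs[OF s] s2 by simp
    qed
    show "\<bar>tser 0 (fold_series (U s)) (\<xi>, y)\<bar> <= r / 2" if "y \<in> {0..1}" for \<xi> y
      using evb[of "U s" \<xi> y] vr[OF s] by (simp add: ev_eq_tser U_def)
    show "(\<lambda>i. c (i + 2) y * tser 0 (fold_series (U s)) (\<xi>, y) ^ (i + 2)) sums tser 0 (fold_series (N (U s))) (\<xi>, y)"
      if "y \<in> {0..1}" for \<xi> y
      using evs[of "U s" y \<xi>] vr[OF s] that unfolding ev_eq_tser by (simp add: U_def)
    show "dirichlet_bvp (\<lambda>y. Q y + (\<alpha>\<^sup>2 + lam s) * (real k)\<^sup>2) (fold_series (N (U s)) k) (fold_series (U s) k)" for k
    proof -
      define e :: real where "e = (if k = 0 then 1 else 2)"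
      define w where "w = cf (v s) (int k)"
      define h where "h = cf (N (U s)) (int k)"
      define g where "g y = lam s * (real k)\<^sup>2 * w y + h y" for y
      have wc: "cont01 w" "cont01 h" unfolding w_def h_def by (rule cfc)+
      have gc: "cont01 g" unfolding g_def [abs_def] by (intro continuous_intros wc)
      have wg: "w y = G k g y" if "y \<in> {0..1}" for y
      proof -
        have "G k g y = G k (\<lambda>y. (lam s * (real k)\<^sup>2) * w y) y + G k h y"
          unfolding g_def [abs_def] by (rule G5[OF _ wc(2) that]) (intro continuous_intros wc)
        also have "G k (\<lambda>y. (lam s * (real k)\<^sup>2) * w y) y = lam s * (real k)\<^sup>2 * G k w y" by (rule G6[OF wc(1) that])
        finally show ?thesis using vcf[OF s that, of "int k"] by (simp add: w_def h_def \<Theta>_def)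
      qed
      have main: "dirichlet_bvp (\<lambda>y. Q y + (\<alpha>\<^sup>2 + lam s) * (real k)\<^sup>2) h (cf (U s) (int k))"
      proof (cases "k = 1")
        case False
        have "dirichlet_bvp (\<lambda>y. Q y + \<alpha>\<^sup>2 * (real k)\<^sup>2) g w"
          by (rule dirichlet_bvp_cong_fun[OF G1[OF False gc]]) (simp add: wg)
        then have "dirichlet_bvp (\<lambda>y. Q y + (\<alpha>\<^sup>2 + lam s) * (real k)\<^sup>2) h w"
          by (rule dirichlet_bvp_cong) (simp add: g_def algebra_simps)
        then show ?thesis
          by (rule dirichlet_bvp_cong_fun)
             (use False bcf in \<open>simp add: w_def U_def cf_add cf_scaleR bc_def\<close>)
      next
        case True
        have w1: "dirichlet_bvp (\<lambda>y. Q y + \<alpha>\<^sup>2) (\<lambda>y. g y - ip g \<phi> / ip \<phi> \<phi> * \<phi> y) w"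
          by (rule dirichlet_bvp_cong_fun[OF G2[OF gc]]) (use True wg in simp)
        have "ip w \<phi> = ip (G 1 g) \<phi>" by (rule ip_cong) (use True wg in simp)
        then have w0: "ip w \<phi> = 0" using G3[OF gc] by simp
        have "ip g \<phi> = ip (\<lambda>y. lam s * w y) \<phi> + ip h \<phi>"
          unfolding g_def [abs_def] using ip_add[OF continuous_on_mult[OF continuous_on_const wc(1)] wc(2) \<phi>c, of "lam s"] True by simp
        then have gh: "ip g \<phi> = ip h \<phi>" using ip_scale[of "lam s" w \<phi>] w0 by simp
        \<comment> \<open>The bifurcation equation says that the component removed from
          \<open>g\<close> by the projection equals minus \<open>s * lam s / 2\<close> times
          \<open>\<phi>\<close>. This is exactly compensated by the shift acting on the kernel part,
          so the sum solves the equation without projection.\<close>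
        have "s * lam s = - 2 * ip h \<phi> / ip \<phi> \<phi>" using leq[OF s] True by (simp add: L_def h_def U_def)
        then have gh': "ip g \<phi> / ip \<phi> \<phi> = - (s * lam s / 2)" unfolding gh by simp
        have "dirichlet_bvp (\<lambda>y. Q y + \<alpha>\<^sup>2)
            (\<lambda>y. (g y - ip g \<phi> / ip \<phi> \<phi> * \<phi> y) + s / 2 * 0) (\<lambda>y. w y + s / 2 * \<phi> y)"
          by (rule dirichlet_bvp_add[OF w1 dirichlet_bvp_scale[OF \<phi>b]])
        then have "dirichlet_bvp (\<lambda>y. Q y + (\<alpha>\<^sup>2 + lam s) * (real k)\<^sup>2) h (\<lambda>y. w y + s / 2 * \<phi> y)"
          by (rule dirichlet_bvp_cong) (simp only: gh', simp add: g_def True field_simps)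
        then show ?thesis
          by (rule dirichlet_bvp_cong_fun)
             (use True bcf in \<open>simp add: w_def U_def cf_add cf_scaleR bc_def\<close>)
      qed
      have "dirichlet_bvp (\<lambda>y. Q y + (\<alpha>\<^sup>2 + lam s) * (real k)\<^sup>2) (\<lambda>y. e * h y) (\<lambda>y. e * cf (U s) (int k) y)"
        by (rule dirichlet_bvp_scale[OF main])
      then have "dirichlet_bvp (\<lambda>y. Q y + (\<alpha>\<^sup>2 + lam s) * (real k)\<^sup>2) (fold_series (N (U s)) k)
          (\<lambda>y. e * cf (U s) (int k) y)"
        by (rule dirichlet_bvp_cong) (simp add: fold_series_even[OF NUV[OF s]] e_def h_def)
      then show ?thesis
        by (rule dirichlet_bvp_cong_fun) (simp add: fold_series_even[OF UV[OF s]] e_def)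
    qed
    fix t :: real assume t: "\<bar>t\<bar> < s0"
    have st: "2 * K * \<bar>s - t\<bar> <= K' * \<bar>s - t\<bar>" by (rule mult_right_mono[OF K'(2)]) simp
    show "\<bar>lam s - lam t\<bar> <= K' * \<bar>s - t\<bar>" using ll[OF s t] mult_right_mono[OF K'(1), of "\<bar>s - t\<bar>"] by simp
    show "decay 6 (K' * \<bar>s - t\<bar>) (\<lambda>k y. fold_series (N (U s)) k y - fold_series (N (U t)) k y)"
      unfolding fold_series_diff[symmetric]
      by (rule decay_le[OF decay_fold_series]) (use Nl[OF s t] st in \<open>simp add: U_def\<close>)
    show "decay 6 (K' * \<bar>s - t\<bar>) (\<lambda>k y. fold_series (U s) k y - fold_series (U t) k y)"
      unfolding fold_series_diff[symmetric]
    proof (rule decay_le[OF decay_fold_series])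
      have "U s - U t = (s - t) *\<^sub>R b + (v s - v t)" by (simp add: U_def scaleR_left_diff_distrib)
      then have "norm (U s - U t) <= \<bar>s - t\<bar> * norm b + K * \<bar>s - t\<bar>"
        using norm_triangle_ineq[of "(s - t) *\<^sub>R b" "v s - v t"] vl[OF s t] by simp
      then show "2 * norm (U s - U t) <= K' * \<bar>s - t\<bar>" by (simp add: K'_def algebra_simps)
    qed
  qed
qed

section \<open>Regularity of the series and of the nonlinearity\<close>

lemma zeta2_pos: "0 < zeta2" using zeta2_ge_1 by linarith

text \<open>Second derivatives are read off the equation, at the cost of two powers of
  \<open>k\<close>. For the first derivative no further loss occurs: the coefficient vanishes at
  both walls, so its derivative has a zero and is bounded by the second derivative.\<close>

lemma C2_series_decay:
  fixes \<mu> K0 \<epsilon> :: real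
  assumes Q: "!!y. y \<in> {0..1} ==> \<bar>Q y\<bar> <= K0" and \<mu>: "\<bar>\<mu>\<bar> <= K0" and K0: "1 <= K0"
    and f: "decay 6 \<epsilon> f" and e: "decay 4 \<epsilon> e"
    and bvp: "!!k. dirichlet_bvp (\<lambda>y. Q y + \<mu> * (real k)\<^sup>2) (e k) (f k)"
  obtains f' f'' where
    "!!k y. y \<in> {0..1} ==> (f k has_real_derivative f' k y) (at y within {0..1})"
    "!!k y. y \<in> {0..1} ==> (f' k has_real_derivative f'' k y) (at y within {0..1})"
    "!!k y. y \<in> {0..1} ==> f'' k y = (Q y + \<mu> * (real k)\<^sup>2) * f k y + e k y"
    "decay 4 (3 * K0 * \<epsilon>) f'" "decay 4 (3 * K0 * \<epsilon>) f''"
proof -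
  have "\<exists>a'. linear_ode (\<lambda>y. Q y + \<mu> * (real k)\<^sup>2) (e k) (f k) a'" for k
    using bvp[of k] unfolding dirichlet_bvp_def by blast
  then obtain f' where f': "!!k. linear_ode (\<lambda>y. Q y + \<mu> * (real k)\<^sup>2) (e k) (f k) (f' k)" by metis
  define f'' where "f'' k y = (Q y + \<mu> * (real k)\<^sup>2) * f k y + e k y" for k y
  have d1: "(f k has_real_derivative f' k y) (at y within {0..1})"
    and d2: "(f' k has_real_derivative f'' k y) (at y within {0..1})" if "y \<in> {0..1}" for k y
    using linear_odeD[OF f' that] unfolding f''_def by blast+
  have \<epsilon>: "0 <= \<epsilon>" by (rule decay_nonneg[OF f])
  have b: "(1 + real k) ^ 4 * \<bar>f'' k y\<bar> <= 3 * K0 * \<epsilon>" if y: "y \<in> {0..1}" for k y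
  proof -
    have 1: "(1 + real k) ^ 4 * \<bar>f k y\<bar> <= \<epsilon>" using decayD[OF decay_mono[OF f, of 4] y] by simp
    have 2: "(1 + real k) ^ 4 * \<bar>(real k)\<^sup>2 * f k y\<bar> <= \<epsilon>" using decayD[OF decay_times_k[OF f, of 4 2] y] by simp
    have "\<bar>f'' k y\<bar> <= \<bar>Q y * f k y\<bar> + \<bar>\<mu> * ((real k)\<^sup>2 * f k y)\<bar> + \<bar>e k y\<bar>"
      unfolding f''_def distrib_right mult.assoc by linarith
    also have "\<dots> <= K0 * \<bar>f k y\<bar> + K0 * \<bar>(real k)\<^sup>2 * f k y\<bar> + \<bar>e k y\<bar>"
      unfolding abs_mult[of "Q y"] abs_mult[of \<mu>] by (intro add_mono mult_right_mono Q y \<mu>) auto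
    finally have "(1 + real k) ^ 4 * \<bar>f'' k y\<bar> \<le>
        (1 + real k) ^ 4 * (K0 * \<bar>f k y\<bar> + K0 * \<bar>(real k)\<^sup>2 * f k y\<bar> + \<bar>e k y\<bar>)" by (rule mult_left_mono) simp
    also have "\<dots> = K0 * ((1 + real k) ^ 4 * \<bar>f k y\<bar>) + K0 * ((1 + real k) ^ 4 * \<bar>(real k)\<^sup>2 * f k y\<bar>)
        + (1 + real k) ^ 4 * \<bar>e k y\<bar>" by (simp only: distrib_left mult_ac)
    also have "\<dots> <= K0 * \<epsilon> + K0 * \<epsilon> + \<epsilon>"
      using K0 by (intro add_mono mult_left_mono 1 2 decayD[OF e y]) auto
    also have "\<dots> <= 3 * K0 * \<epsilon>" using mult_right_mono[OF K0 \<epsilon>] by simp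
    finally show ?thesis .
  qed
  have b': "(1 + real k) ^ 4 * \<bar>f' k y\<bar> <= 3 * K0 * \<epsilon>" if y: "y \<in> {0..1}" for k y
  proof -
    obtain t where t: "0 < t" "t < 1" "f k 1 - f k 0 = (1 - 0) * f' k t"
      using mvt_unit_interval[of "f k" "f' k" 0 1] d1 by auto
    then have t0: "f' k t = 0" using bvp[of k] unfolding dirichlet_bvp_def by simp
    have *: "(1 + real k) ^ 4 * \<bar>f' k v - f' k w\<bar> <= 3 * K0 * \<epsilon>" if vw: "v < w" "v \<in> {0..1}" "w \<in> {0..1}" for v w
    proof -
      obtain x where x: "v < x" "x < w" "f' k w - f' k v = (w - v) * f'' k x"
        using mvt_unit_interval[of "f' k" "f'' k" v w] d2 vw by auto
      have "\<bar>f' k v - f' k w\<bar> = \<bar>w - v\<bar> * \<bar>f'' k x\<bar>" unfolding abs_mult[symmetric] x(3)[symmetric] by simp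
      also have "\<dots> <= 1 * \<bar>f'' k x\<bar>" using vw by (intro mult_right_mono) auto
      finally have "(1 + real k) ^ 4 * \<bar>f' k v - f' k w\<bar> <= (1 + real k) ^ 4 * \<bar>f'' k x\<bar>"
        by (intro mult_left_mono) auto
      moreover have "x \<in> {0..1}" using x vw by auto
      ultimately show ?thesis using b[of x k] by linarith
    qed
    have K\<epsilon>: "0 <= 3 * K0 * \<epsilon>" using K0 \<epsilon> by simp
    consider "y = t" | "y < t" | "t < y" by linarith
    then show ?thesis
    proof cases
      case 1 then show ?thesis using t0 K\<epsilon> by simp
    next
      case 2 then show ?thesis using *[of y t] t t0 y by simp
    next
      case 3 then show ?thesis using *[of t y] t t0 y by simp
    qed
  qed
  show thesis
    by (rule that[of f' f'']) (use d1 d2 b b' in \<open>auto simp: f''_def intro!: decayI\<close>)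
qed

lemma tser_diff:
  assumes "decay 2 B c" "decay 2 B' d" "z \<in> strip"
  shows "tser \<theta> (\<lambda>k y. c k y - d k y) z = tser \<theta> c z - tser \<theta> d z"
proof -
  have z: "snd z \<in> {0..1}" using assms(3) by (auto simp: strip_def)
  show ?thesis unfolding tser_def left_diff_distrib
    by (rule suminf_diff[OF tser_summable[OF assms(1) z] tser_summable[OF assms(2) z], symmetric])
qed

lemma tser_add:
  assumes "decay 2 B c" "decay 2 B' d" "z \<in> strip"
  shows "tser \<theta> (\<lambda>k y. c k y + d k y) z = tser \<theta> c z + tser \<theta> d z"
proof -
  have z: "snd z \<in> {0..1}" using assms(3) by (auto simp: strip_def)
  show ?thesis unfolding tser_def distrib_right
    by (rule suminf_add[OF tser_summable[OF assms(1) z] tser_summable[OF assms(2) z], symmetric])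
qed

lemma tser_scale:
  assumes "decay 2 B c" "z \<in> strip"
  shows "tser \<theta> (\<lambda>k y. a (y) * c k y) z = a (snd z) * tser \<theta> c z"
proof -
  have z: "snd z \<in> {0..1}" using assms(2) by (auto simp: strip_def)
  show ?thesis unfolding tser_def mult.assoc
    by (rule suminf_mult[OF tser_summable[OF assms(1) z]])
qed

lemma tser_single: "tser \<theta> (\<lambda>k y. if k = m then h y else 0) z = h (snd z) * cos (real m * fst z + \<theta>)"
proof -
  have "(\<lambda>k. (if k = m then h (snd z) else 0) * cos (real k * fst z + \<theta>)) sums
      (\<Sum>k\<in>{m}. (if k = m then h (snd z) else 0) * cos (real k * fst z + \<theta>))"
    by (rule sums_finite) auto
  then show ?thesis unfolding tser_def by (simp add: sums_iff)
qed

lemma tser_shift: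
  assumes "decay 2 B c" "z \<in> strip"
  shows "tser (\<theta> + pi) c z = - tser \<theta> c z"
proof -
  have z: "snd z \<in> {0..1}" using assms(2) by (auto simp: strip_def)
  show ?thesis unfolding tser_def suminf_minus[OF tser_summable[OF assms(1) z], symmetric]
    by (simp add: add.assoc[symmetric])
qed

lemma decay_scale:
  assumes c: "decay m B c"
  shows "decay m (\<bar>a\<bar> * B) (\<lambda>k y. a * c k y)"
proof (rule decayI)
  fix k and y :: real assume y: "y \<in> {0..1}"
  have "(1 + real k) ^ m * \<bar>a * c k y\<bar> = \<bar>a\<bar> * ((1 + real k) ^ m * \<bar>c k y\<bar>)" by (simp add: abs_mult)
  also have "\<dots> <= \<bar>a\<bar> * B" by (intro mult_left_mono decayD[OF c y]) simp
  finally show "(1 + real k) ^ m * \<bar>a * c k y\<bar> <= \<bar>a\<bar> * B" .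
qed

lemma decay_add:
  assumes c: "decay m B c" "decay m B' d"
  shows "decay m (B + B') (\<lambda>k y. c k y + d k y)"
proof (rule decayI)
  fix k and y :: real assume y: "y \<in> {0..1}"
  have "(1 + real k) ^ m * \<bar>c k y + d k y\<bar> <= (1 + real k) ^ m * (\<bar>c k y\<bar> + \<bar>d k y\<bar>)"
    by (intro mult_left_mono) auto
  then show "(1 + real k) ^ m * \<bar>c k y + d k y\<bar> <= B + B'"
    using decayD[OF c(1) y, of k] decayD[OF c(2) y, of k] unfolding distrib_left by linarith
qed

text \<open>All bounds are linear in the common size \<open>\<epsilon>\<close> of solution and
  forcing, so the same statement serves a solution, a difference of two solutions, and a remainder.
  The Lipschitz bound of the second \<open>y\<close>-derivative does not come from a further
  differentiation but from the equation, which is why the forcing has to be Lipschitz as a function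
  (\<open>el\<close>).\<close>

theorem C2_series:
  fixes \<mu> K0 \<epsilon> :: real
  assumes Qd: "!!y. y \<in> {0..1} ==> (Q has_real_derivative Q' y) (at y within {0..1})"
    and Q: "!!y. y \<in> {0..1} ==> \<bar>Q y\<bar> <= K0" "!!y. y \<in> {0..1} ==> \<bar>Q' y\<bar> <= K0"
    and \<mu>: "\<bar>\<mu>\<bar> <= K0" and K0: "1 <= K0"
    and f: "decay 6 \<epsilon> f" and e: "decay 4 \<epsilon> e" and ec: "!!k. cont01 (e k)"
    and bvp: "!!k. dirichlet_bvp (\<lambda>y. Q y + \<mu> * (real k)\<^sup>2) (e k) (f k)"
    and el: "bounded_lipschitz \<epsilon> (tser 0 e)"
  obtains g where
    "has_partials (tser 0 f) (tser (pi / 2) (\<lambda>k y. real k * f k y)) (tser 0 g)"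
    "has_partials (tser (pi / 2) (\<lambda>k y. real k * f k y)) (tser pi (\<lambda>k y. real k * (real k * f k y)))
       (tser (pi / 2) (\<lambda>k y. real k * g k y))"
    "!!\<beta> h. 0 < \<beta> ==> \<beta> < 1 ==> (!!z. z \<in> strip ==> h z = tser 0 f z) ==>
       C2_holder_norm \<beta> h <= ennreal (12 * (21 * K0\<^sup>2 * zeta2 * \<epsilon>))"
    "bounded_lipschitz (21 * K0\<^sup>2 * zeta2 * \<epsilon>) (tser 0 f)"
    "bounded_lipschitz (21 * K0\<^sup>2 * zeta2 * \<epsilon>) (tser pi (\<lambda>k y. real k * (real k * f k y)))"
    "bounded_lipschitz (21 * K0\<^sup>2 * zeta2 * \<epsilon>) (tser (pi / 2) (\<lambda>k y. real k * g k y))"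
    "!!z. z \<in> strip ==> \<bar>tser (pi / 2) (\<lambda>k y. real k * f k y) z\<bar> <= 21 * K0\<^sup>2 * zeta2 * \<epsilon>"
    "!!z. z \<in> strip ==> \<bar>tser 0 g z\<bar> <= 21 * K0\<^sup>2 * zeta2 * \<epsilon>"
    "continuous_on strip (tser 0 f)" "continuous_on strip (tser (pi / 2) (\<lambda>k y. real k * f k y))"
    "continuous_on strip (tser 0 g)" "continuous_on strip (tser pi (\<lambda>k y. real k * (real k * f k y)))"
    "continuous_on strip (tser (pi / 2) (\<lambda>k y. real k * g k y))"
    "\<exists>w. has_partials (tser 0 g) (tser (pi / 2) (\<lambda>k y. real k * g k y)) w & continuous_on strip w &
       bounded_lipschitz (21 * K0\<^sup>2 * zeta2 * \<epsilon>) w &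
       (\<forall>z\<in>strip. w z = Q (snd z) * tser 0 f z - \<mu> * tser pi (\<lambda>k y. real k * (real k * f k y)) z + tser 0 e z)"
proof -
  obtain f' f'' where d1: "!!k y. y \<in> {0..1} ==> (f k has_real_derivative f' k y) (at y within {0..1})"
    and d2: "!!k y. y \<in> {0..1} ==> (f' k has_real_derivative f'' k y) (at y within {0..1})"
    and f'': "!!k y. y \<in> {0..1} ==> f'' k y = (Q y + \<mu> * (real k)\<^sup>2) * f k y + e k y"
    and dec: "decay 4 (3 * K0 * \<epsilon>) f'" "decay 4 (3 * K0 * \<epsilon>) f''"
    by (rule C2_series_decay[OF Q(1) \<mu> K0 f e bvp]) (assumption | rule that)+
  define B where "B = 3 * K0 * \<epsilon>"
  have \<epsilon>: "0 <= \<epsilon>" by (rule decay_nonneg[OF f])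
  have \<epsilon>B: "\<epsilon> <= B" "0 <= B" using mult_right_mono[OF K0 \<epsilon>] \<epsilon> by (simp_all add: B_def)
  have fB: "decay 6 B f" by (rule decay_le[OF f \<epsilon>B(1)])
  have Qc: "cont01 Q" by (rule DERIV_continuous_on[OF Qd])
  have fc: "cont01 (f k)" "cont01 (f' k)" for k
    by (rule DERIV_continuous_on[OF d1], assumption, rule DERIV_continuous_on[OF d2])
  have f''c: "cont01 (f'' k)" for k
  proof (rule continuous_on_eq)
    show "cont01 (\<lambda>y. (Q y + \<mu> * (real k)\<^sup>2) * f k y + e k y)" by (intro continuous_intros Qc fc ec)
  qed (simp add: f'')
  define kf where "kf k y = real k * f k y" for k y
  define kkf where "kkf k y = real k * (real k * f k y)" for k y
  define kf' where "kf' k y = real k * f' k y" for k y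
  define kf'' where "kf'' k y = real k * f'' k y" for k y
  define kkf' where "kkf' k y = real k * kf' k y" for k y
  have cs: "cont01 (kf k)" "cont01 (kkf k)" "cont01 (kf' k)" for k
    unfolding kf_def kkf_def kf'_def by (intro continuous_intros fc)+
  have f'B: "decay 4 B f'" "decay 4 B f''" using dec unfolding B_def by auto
  have D1: "decay 3 B f" "decay 2 B f" by (rule decay_mono[OF fB]; simp)+
  have D2: "decay 3 B f'" "decay 2 B f'" "decay 2 B f''" using f'B decay_mono by fastforce+
  have D3: "decay 3 B kf" "decay 2 B kf" using decay_times_k[OF fB, of 3 1] decay_times_k[OF fB, of 2 1] unfolding kf_def by simp_all
  have D4: "decay 3 B kkf" "decay 2 B kkf" using decay_times_k[OF fB, of 3 2] decay_times_k[OF fB, of 2 2]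
    unfolding kf_def kkf_def by (simp_all add: power2_eq_square mult.assoc)
  have D5: "decay 3 B kf'" "decay 2 B kf'" "decay 2 B kf''"
    using decay_times_k[OF f'B(1), of 3 1] decay_times_k[OF f'B(1), of 2 1] decay_times_k[OF f'B(2), of 2 1]
    unfolding kf'_def kf''_def by simp_all
  have D6: "decay 2 B kkf'" using decay_times_k[OF f'B(1), of 2 2]
    unfolding kf'_def kkf'_def by (simp add: power2_eq_square mult.assoc)
  have dk: "(kf k has_real_derivative kf' k y) (at y within {0..1})" "(kf' k has_real_derivative kf'' k y) (at y within {0..1})"
    "(kkf k has_real_derivative kkf' k y) (at y within {0..1})"
    if "y \<in> {0..1}" for k y
    unfolding kkf_def [abs_def] kf_def [abs_def] kf'_def [abs_def] kf''_def [abs_def] kkf'_def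
    by (intro DERIV_cmult d1[OF that] d2[OF that])+
  have h2: "0 + pi / 2 = pi / 2" "pi / 2 + pi / 2 = pi" by simp_all
  have p1: "has_partials (tser 0 f) (tser (pi / 2) kf) (tser 0 f')"
    using tser_partials[OF D1(1) D2(2) d1, of 0] by (simp add: kf_def [abs_def])
  have p2: "has_partials (tser (pi / 2) kf) (tser pi kkf) (tser (pi / 2) kf')"
    using tser_partials[OF D3(1) D5(2) dk(1), of "pi / 2"] by (simp add: kkf_def [abs_def] kf_def [abs_def])
  have p3: "has_partials (tser 0 f') (tser (pi / 2) kf') (tser 0 f'')"
    using tser_partials[OF D2(1) D2(3) d2, of 0] by (simp add: kf'_def [abs_def])
  have c: "continuous_on strip (tser 0 f)" "continuous_on strip (tser (pi / 2) kf)"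
    "continuous_on strip (tser 0 f')" "continuous_on strip (tser pi kkf)"
    "continuous_on strip (tser (pi / 2) kf')" "continuous_on strip (tser 0 f'')"
    by (rule tser_continuous[OF D1(2) fc(1)], rule tser_continuous[OF D3(2) cs(1)],
        rule tser_continuous[OF D2(2) fc(2)], rule tser_continuous[OF D4(2) cs(2)],
        rule tser_continuous[OF D5(2) cs(3)], rule tser_continuous[OF D2(3) f''c])
  have l0: "bounded_lipschitz (2 * (B * zeta2)) (tser 0 f)" by (rule tser_lipschitz[OF D1(1) D2(2) d1])
  have l1: "bounded_lipschitz (2 * (B * zeta2)) (tser pi kkf)" by (rule tser_lipschitz[OF D4(1) D6 dk(3)])
  have l2: "bounded_lipschitz (2 * (B * zeta2)) (tser (pi / 2) kf')" by (rule tser_lipschitz[OF D5(1) D5(3) dk(2)])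
  have e2: "decay 2 \<epsilon> e" by (rule decay_mono[OF e]) simp
  have pde: "tser 0 f'' z = Q (snd z) * tser 0 f z - \<mu> * tser pi kkf z + tser 0 e z" if z: "z \<in> strip" for z
  proof -
    have y: "snd z \<in> {0..1}" using z by (auto simp: strip_def)
    have "tser 0 f'' z = (\<Sum>k. (Q (snd z) * (f k (snd z) * cos (real k * fst z + 0)) -
        \<mu> * (kkf k (snd z) * cos (real k * fst z + pi))) + e k (snd z) * cos (real k * fst z + 0))"
      unfolding tser_def by (intro suminf_cong)
        (simp add: f''[OF y] kkf_def kf_def power2_eq_square algebra_simps)
    also have "\<dots> = (\<Sum>k. Q (snd z) * (f k (snd z) * cos (real k * fst z + 0)) -
        \<mu> * (kkf k (snd z) * cos (real k * fst z + pi))) + tser 0 e z"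
      unfolding tser_def
      by (intro suminf_add[symmetric] summable_diff summable_mult tser_summable[OF D1(2) y] tser_summable[OF D4(2) y]
          tser_summable[OF e2 y])
    also have "(\<Sum>k. Q (snd z) * (f k (snd z) * cos (real k * fst z + 0)) -
        \<mu> * (kkf k (snd z) * cos (real k * fst z + pi))) =
        (\<Sum>k. Q (snd z) * (f k (snd z) * cos (real k * fst z + 0))) - (\<Sum>k. \<mu> * (kkf k (snd z) * cos (real k * fst z + pi)))"
      by (intro suminf_diff[symmetric] summable_mult tser_summable[OF D1(2) y] tser_summable[OF D4(2) y])
    also have "(\<Sum>k. Q (snd z) * (f k (snd z) * cos (real k * fst z + 0))) = Q (snd z) * tser 0 f z"
      unfolding tser_def by (rule suminf_mult[OF tser_summable[OF D1(2) y]])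
    also have "(\<Sum>k. \<mu> * (kkf k (snd z) * cos (real k * fst z + pi))) = \<mu> * tser pi kkf z"
      unfolding tser_def by (rule suminf_mult[OF tser_summable[OF D4(2) y]])
    finally show ?thesis .
  qed
  \<comment> \<open>The number 21 is \<open>7 * 3\<close>: \<open>3 * K0\<close> bounds the
    derivative coefficients, and 7 collects the shares 4, 2 and 1 of the potential, the parameter
    and the forcing in the second \<open>y\<close>-derivative.\<close>
  define K1 where "K1 = 21 * K0\<^sup>2 * zeta2 * \<epsilon>"
  have K1eq: "K1 = 7 * (K0 * (B * zeta2))" by (simp add: K1_def B_def power2_eq_square)
  have Bz: "B <= B * zeta2" "0 <= B * zeta2" using mult_left_mono[OF zeta2_ge_1 \<epsilon>B(2)] \<epsilon>B(2) zeta2_pos by auto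
  have KBz: "B * zeta2 <= K0 * (B * zeta2)" using mult_right_mono[OF K0 Bz(2)] by simp
  have K1B: "2 * (B * zeta2) <= K1" "B * zeta2 <= K1" unfolding K1eq using KBz Bz(2) by linarith+
  have l3: "bounded_lipschitz K1 (tser 0 f'')"
  proof (rule bounded_lipschitz_cong)
    have "bounded_lipschitz (2 * K0 * (2 * (B * zeta2)) + \<bar>- \<mu>\<bar> * (2 * (B * zeta2)) + \<epsilon>)
        (\<lambda>z. (Q (snd z) * tser 0 f z + - \<mu> * tser pi kkf z) + tser 0 e z)"
      by (intro bounded_lipschitz_add bounded_lipschitz_mult bounded_lipschitz_scale bounded_lipschitz_snd[of Q Q'] Qd Q l0 l1 el)
    moreover have "2 * K0 * (2 * (B * zeta2)) + \<bar>- \<mu>\<bar> * (2 * (B * zeta2)) + \<epsilon> <= K1"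
    proof -
      have "\<bar>- \<mu>\<bar> * (2 * (B * zeta2)) <= K0 * (2 * (B * zeta2))" using \<mu> Bz by (intro mult_right_mono) auto
      then show ?thesis unfolding K1eq using \<epsilon>B Bz KBz by linarith
    qed
    ultimately show "bounded_lipschitz K1 (\<lambda>z. (Q (snd z) * tser 0 f z + - \<mu> * tser pi kkf z) + tser 0 e z)"
      by (rule bounded_lipschitz_mono)
  qed (simp add: pde)
  have H: "C2_holder_norm \<beta> h <= ennreal (12 * K1)"
    if "0 < \<beta>" "\<beta> < 1" and h: "!!z. z \<in> strip ==> h z = tser 0 f z" for \<beta> h
  proof (rule C2_holder_norm_le[OF _ p2 p3])
    show "has_partials h (tser (pi / 2) kf) (tser 0 f')" by (rule has_partials_cong[OF p1]) (simp_all add: h)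
    show "\<bar>h z\<bar> <= K1" if "z \<in> strip" for z
      using tser_bound[OF D1(2) that, of 0] K1B h[OF that] by simp
    show "\<bar>tser (pi / 2) kf z\<bar> <= K1" if "z \<in> strip" for z using tser_bound[OF D3(2) that, of "pi / 2"] K1B by simp
    show "\<bar>tser 0 f' z\<bar> <= K1" if "z \<in> strip" for z using tser_bound[OF D2(2) that, of 0] K1B by simp
    show "bounded_lipschitz K1 (tser pi kkf)" "bounded_lipschitz K1 (tser (pi / 2) kf')" "bounded_lipschitz K1 (tser 0 f'')"
      by (rule bounded_lipschitz_mono[OF l1 K1B(1)], rule bounded_lipschitz_mono[OF l2 K1B(1)], rule l3)
  qed fact+
  show thesis
  proof (rule that[of f', folded kf_def [abs_def] kkf_def [abs_def] kf'_def [abs_def] K1_def])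
    show "bounded_lipschitz K1 (tser 0 f)" "bounded_lipschitz K1 (tser pi kkf)" "bounded_lipschitz K1 (tser (pi / 2) kf')"
      by (rule bounded_lipschitz_mono[OF l0 K1B(1)], rule bounded_lipschitz_mono[OF l1 K1B(1)],
          rule bounded_lipschitz_mono[OF l2 K1B(1)])
    show "\<bar>tser (pi / 2) kf z\<bar> <= K1" if "z \<in> strip" for z using tser_bound[OF D3(2) that, of "pi / 2"] K1B by simp
    show "\<bar>tser 0 f' z\<bar> <= K1" if "z \<in> strip" for z using tser_bound[OF D2(2) that, of 0] K1B by simp
    show "\<exists>w. has_partials (tser 0 f') (tser (pi / 2) kf') w & continuous_on strip w & bounded_lipschitz K1 w &
       (\<forall>z\<in>strip. w z = Q (snd z) * tser 0 f z - \<mu> * tser pi kkf z + tser 0 e z)"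
      using p3 c(6) l3 pde by blast
  qed (fact p1 p2 c | (rule H; assumption))+
qed

lemma bounded_lipschitz_1: "bounded_lipschitz 1 (\<lambda>z. 1)"
  by (rule bounded_lipschitzI) auto

lemma bounded_lipschitz_power:
  assumes "bounded_lipschitz \<eta> U"
  shows "bounded_lipschitz ((2 * \<eta>) ^ m) (\<lambda>z. U z ^ m)"
proof (induction m)
  case 0
  then show ?case using bounded_lipschitz_1 by simp
next
  case (Suc m)
  then show ?case using bounded_lipschitz_mult[OF assms Suc] by simp
qed

text \<open>Telescoping; every use of the product rule costs a factor 2, hence the powers of
  \<open>2 * \<eta>\<close>.\<close>

lemma bounded_lipschitz_power_diff:
  assumes U: "bounded_lipschitz \<eta> U" and V: "bounded_lipschitz \<eta> V" and d: "bounded_lipschitz \<epsilon> (\<lambda>z. U z - V z)"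
  shows "bounded_lipschitz (2 * (real m + 1) * \<epsilon> * (2 * \<eta>) ^ m) (\<lambda>z. U z ^ Suc m - V z ^ Suc m)"
proof (induction m)
  case 0
  have "0 <= \<epsilon>" by (rule bounded_lipschitz_nonneg[OF d])
  then show ?case using bounded_lipschitz_mono[OF d, of "2 * \<epsilon>"] by simp
next
  case (Suc m)
  have "bounded_lipschitz (2 * \<eta> * (2 * (real m + 1) * \<epsilon> * (2 * \<eta>) ^ m) + 2 * \<epsilon> * (2 * \<eta>) ^ Suc m)
      (\<lambda>z. U z * (U z ^ Suc m - V z ^ Suc m) + (U z - V z) * V z ^ Suc m)"
    by (intro bounded_lipschitz_add bounded_lipschitz_mult U Suc d bounded_lipschitz_power[OF V])
  moreover have "2 * \<eta> * (2 * (real m + 1) * \<epsilon> * (2 * \<eta>) ^ m) + 2 * \<epsilon> * (2 * \<eta>) ^ Suc m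
      = 2 * (real (Suc m) + 1) * \<epsilon> * (2 * \<eta>) ^ Suc m"
    by (simp add: algebra_simps)
  moreover have "U z * (U z ^ Suc m - V z ^ Suc m) + (U z - V z) * V z ^ Suc m = U z ^ Suc (Suc m) - V z ^ Suc (Suc m)" for z
    by (simp add: algebra_simps)
  ultimately show ?case by simp
qed

lemma bounded_lipschitz_sums:
  assumes t: "!!i. bounded_lipschitz (b i) (f i)" and b: "summable b"
    and s: "!!z. z \<in> strip ==> (\<lambda>i. f i z) sums g z"
  shows "bounded_lipschitz (\<Sum>i. b i) g"
proof (rule bounded_lipschitzI)
  show "\<bar>g z\<bar> <= (\<Sum>i. b i)" if z: "z \<in> strip" for z
  proof -
    have le: "\<bar>f i z\<bar> <= b i" for i by (rule bounded_lipschitzD(1)[OF t z])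
    have n: "summable (\<lambda>i. norm (f i z))" by (rule summable_comparison_test'[OF b, of 0]) (use le in simp)
    have "\<bar>\<Sum>i. f i z\<bar> <= (\<Sum>i. norm (f i z))" using summable_norm[OF n] by simp
    also have "\<dots> <= (\<Sum>i. b i)" by (rule suminf_le[OF _ n b]) (use le in simp)
    finally show ?thesis using sums_unique[OF s[OF z]] by simp
  qed
  show "\<bar>g z - g w\<bar> <= (\<Sum>i. b i) * dist z w" if z: "z \<in> strip" "w \<in> strip" for z w
  proof -
    have le: "\<bar>f i z - f i w\<bar> <= b i * dist z w" for i by (rule bounded_lipschitzD(2)[OF t z])
    have bd: "summable (\<lambda>i. b i * dist z w)" by (rule summable_mult2[OF b])
    have n: "summable (\<lambda>i. norm (f i z - f i w))" by (rule summable_comparison_test'[OF bd, of 0]) (use le in simp)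
    have "\<bar>\<Sum>i. f i z - f i w\<bar> <= (\<Sum>i. norm (f i z - f i w))" using summable_norm[OF n] by simp
    also have "\<dots> <= (\<Sum>i. b i * dist z w)" by (rule suminf_le[OF _ n bd]) (use le in simp)
    also have "\<dots> = (\<Sum>i. b i) * dist z w" by (rule suminf_mult2[OF b, symmetric])
    finally show ?thesis using sums_unique[OF sums_diff[OF s[OF z(1)] s[OF z(2)]]] by simp
  qed
qed

text \<open>A power series without terms of order less than two has a Lipschitz constant proportional to the size of its
  argument, which makes the nonlinearity negligible to first order.\<close>

lemma bounded_lipschitz_power_series:
  assumes c: "!!i y. y \<in> {0..1} ==> (c i has_real_derivative c' i y) (at y within {0..1})"
    and cb: "!!i y. y \<in> {0..1} ==> \<bar>c i y\<bar> <= M / r ^ i" "!!i y. y \<in> {0..1} ==> \<bar>c' i y\<bar> <= M / r ^ i"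
    and r: "0 < r" and M: "0 < M" and \<eta>: "4 * \<eta> <= r"
    and U: "bounded_lipschitz \<eta> U" and V: "bounded_lipschitz \<eta> V" and d: "bounded_lipschitz \<epsilon> (\<lambda>z. U z - V z)"
    and s: "!!z. z \<in> strip ==> (\<lambda>i. c (i + 2) (snd z) * U z ^ (i + 2)) sums F z"
      "!!z. z \<in> strip ==> (\<lambda>i. c (i + 2) (snd z) * V z ^ (i + 2)) sums G z"
  shows "bounded_lipschitz (64 * M * \<epsilon> * \<eta> / r\<^sup>2) (\<lambda>z. F z - G z)"
proof -
  have \<eta>0: "0 <= \<eta>" and \<epsilon>: "0 <= \<epsilon>" using bounded_lipschitz_nonneg U d by auto
  define b where "b i = 16 * M * \<epsilon> * \<eta> / r\<^sup>2 * (3 / 4) ^ i" for i :: nat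
  have "(\<lambda>i. 16 * M * \<epsilon> * \<eta> / r\<^sup>2 * (3 / 4 :: real) ^ i) sums (16 * M * \<epsilon> * \<eta> / r\<^sup>2 * (1 / (1 - 3 / 4)))"
    by (intro sums_mult geometric_sums) simp
  then have bs: "b sums (64 * M * \<epsilon> * \<eta> / r\<^sup>2)" unfolding b_def [abs_def] by (simp add: mult.assoc)
  have bern: "(real i + 2) * (1 / 2) ^ i <= 2 * (3 / 4) ^ i" for i
  proof (induction i)
    case (Suc i)
    have "real (Suc i) + 2 <= 3 / 2 * (real i + 2)" by simp
    then have "(real (Suc i) + 2) * (1 / 2) ^ Suc i <= (3 / 2 * (real i + 2)) * (1 / 2) ^ Suc i"
      by (intro mult_right_mono) auto
    also have "\<dots> = 3 / 4 * ((real i + 2) * (1 / 2) ^ i)" by simp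
    also have "\<dots> <= 3 / 4 * (2 * (3 / 4) ^ i)" by (intro mult_left_mono Suc) auto
    finally show ?case by simp
  qed simp
  have t: "bounded_lipschitz (b i) (\<lambda>z. c (i + 2) (snd z) * (U z ^ Suc (Suc i) - V z ^ Suc (Suc i)))" for i
  proof (rule bounded_lipschitz_mono)
    show "bounded_lipschitz (2 * (M / r ^ (i + 2)) * (2 * (real (Suc i) + 1) * \<epsilon> * (2 * \<eta>) ^ Suc i))
        (\<lambda>z. c (i + 2) (snd z) * (U z ^ Suc (Suc i) - V z ^ Suc (Suc i)))"
      by (rule bounded_lipschitz_mult[OF bounded_lipschitz_snd[OF c cb] bounded_lipschitz_power_diff[OF U V d]])
    define q where "q = 2 * \<eta> / r"
    have q: "0 <= q" "q <= 1 / 2" using \<eta> \<eta>0 r by (auto simp: q_def field_simps)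
    have \<eta>q: "2 * \<eta> = q * r" using r by (simp add: q_def)
    have "2 * (M / r ^ (i + 2)) * (2 * (real (Suc i) + 1) * \<epsilon> * (2 * \<eta>) ^ Suc i) = 4 * M * \<epsilon> / r * q * ((real i + 2) * q ^ i)"
      unfolding \<eta>q power_mult_distrib using r by (simp add: field_simps power_add power2_eq_square)
    also have "\<dots> <= 4 * M * \<epsilon> / r * q * ((real i + 2) * (1 / 2) ^ i)"
      using q M \<epsilon> r by (intro mult_left_mono power_mono) auto
    also have "\<dots> <= 4 * M * \<epsilon> / r * q * (2 * (3 / 4) ^ i)"
      using q M \<epsilon> r by (intro mult_left_mono bern) auto
    also have "\<dots> = b i" using r by (simp add: b_def q_def power2_eq_square)
    finally show "2 * (M / r ^ (i + 2)) * (2 * (real (Suc i) + 1) * \<epsilon> * (2 * \<eta>) ^ Suc i) <= b i" .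
  qed
  have "bounded_lipschitz (\<Sum>i. b i) (\<lambda>z. F z - G z)"
  proof (rule bounded_lipschitz_sums[OF t sums_summable[OF bs]])
    show "(\<lambda>i. c (i + 2) (snd z) * (U z ^ Suc (Suc i) - V z ^ Suc (Suc i))) sums (F z - G z)" if "z \<in> strip" for z
      using sums_diff[OF s(1)[OF that] s(2)[OF that]] by (simp add: right_diff_distrib)
  qed
  then show ?thesis using sums_unique[OF bs] by simp
qed

section \<open>Spectral and geometric facts about the shear\<close>

text \<open>The quotient defining the potential, multiplied out; at the centre both sides vanish. In
  this form it states that \<open>shear A n y - 1 / 2\<close> solves the equation of the zero
  mode.\<close>

lemma shear_rayleigh:
  assumes A: "0 < A" "A < 1 / (4 * pi)" and n: "1 <= n"
  shows "Qpot A n y * (shear A n y - 1 / 2) = (deriv ^^ 2) (shear A n) y"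
proof (cases "y = 1 / 2")
  case True
  have "sin (4 * real n * pi * (1 / 2)) = sin (2 * real n * pi)" by (simp add: algebra_simps)
  then have s: "sin (4 * real n * pi * (1 / 2)) = 0" by (simp add: sin_2npi)
  show ?thesis unfolding True deriv2_shear shear_def s by simp
next
  case False
  then show ?thesis using shear_centre[OF A n False] unfolding Qpot_def Let_def by simp
qed

text \<open>A Dirichlet solution without zeros in the interior would have the sign pattern of the positive eigenfunction; the
  Wronskian with \<open>w\<close>, a solution that changes sign once, excludes interior zeros.\<close>

lemma no_zero_mode:
  assumes Q: "cont01 Q"
    and w: "linear_ode Q (\<lambda>y. 0) w w'" "w (1 / 2) = 0" "!!y. y \<in> {0..1} ==> y \<noteq> 1 / 2 ==> w y \<noteq> 0"
    and \<alpha>: "0 < \<alpha>" and \<phi>: "linear_ode (\<lambda>y. Q y + \<alpha>) (\<lambda>y. 0) \<phi> \<phi>'" "\<phi> 0 = 0" "\<phi> 1 = 0"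
      "!!y. y \<in> {0<..<1} ==> 0 < \<phi> y"
    and a: "dirichlet_bvp Q (\<lambda>y. 0) a"
  shows "\<forall>y\<in>{0..1}. a y = 0"
proof (rule ccontr)
  assume ne: "\<not> (\<forall>y\<in>{0..1}. a y = 0)"
  obtain a' where ode: "linear_ode Q (\<lambda>y. 0) a a'" and a01: "a 0 = 0" "a 1 = 0"
    using a unfolding dirichlet_bvp_def by blast
  have zero: "linear_ode Q (\<lambda>y. 0) (\<lambda>y. 0) (\<lambda>y. 0)" unfolding linear_ode_def by auto
  have a'0: "a' 0 \<noteq> 0"
  proof
    assume "a' 0 = 0"
    then have "a y = 0" if "y \<in> {0..1}" for y using linear_ode_unique(1)[OF ode zero Q a01(1) _ that] by simp
    then show False using ne by blast
  qed
  define \<kappa> where "\<kappa> = a' 0 * w 0"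
  have \<kappa>: "\<kappa> \<noteq> 0" using a'0 w(3)[of 0] by (simp add: \<kappa>_def)
  have W: "a' y * w y - a y * w' y = \<kappa>" if "y \<in> {0..1}" for y
    using wronskian_constant[OF ode w(1) that] a01 by (simp add: \<kappa>_def)
  \<comment> \<open>Between two zeros of \<open>a\<close> the quotient \<open>a / w\<close> would
    have a critical point, but its derivative is \<open>\<kappa> / w\<^sup>2\<close> with
    \<open>\<kappa>\<close> the nonzero constant Wronskian.\<close>
  have rolle: False if x: "0 <= x1" "x1 < x2" "x2 <= 1" "a x1 = 0" "a x2 = 0" and wn: "!!y. x1 <= y ==> y <= x2 ==> w y \<noteq> 0" for x1 x2
  proof -
    have c: "continuous_on {x1..x2} a" "continuous_on {x1..x2} w"
      using linear_ode_continuous(1)[OF ode] linear_ode_continuous(1)[OF w(1)] x continuous_on_subset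
      by (metis atLeastatMost_subset_iff)+
    have d: "((\<lambda>y. a y / w y) has_real_derivative \<kappa> / (w y * w y)) (at y)" if y: "x1 < y" "y < x2" for y
    proof -
      have y': "y \<in> {0..1}" "0 < y" "y < 1" using x y by auto
      have "(a has_real_derivative a' y) (at y)" "(w has_real_derivative w' y) (at y)"
        using linear_odeD(1)[OF ode y'(1)] linear_odeD(1)[OF w(1) y'(1)] at_within_Icc_at[OF y'(2,3)] by auto
      from DERIV_divide[OF this wn] show ?thesis using W[OF y'(1)] y by simp
    qed
    have "\<exists>z. x1 < z & z < x2 & ((\<lambda>y. a y / w y) has_real_derivative 0) (at z)"
    proof (rule Rolle[OF x(2)])
      show "a x1 / w x1 = a x2 / w x2" using x by simp
      show "continuous_on {x1..x2} (\<lambda>y. a y / w y)" using wn by (intro continuous_on_divide c) auto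
      show "(\<lambda>y. a y / w y) differentiable (at y)" if "x1 < y" "y < x2" for y
        using d[OF that] real_differentiable_def by blast
    qed
    then obtain z where z: "x1 < z" "z < x2" "((\<lambda>y. a y / w y) has_real_derivative 0) (at z)" by blast
    have "\<kappa> / (w z * w z) = 0" by (rule DERIV_unique[OF d[OF z(1,2)] z(3)])
    then show False using \<kappa> wn[of z] z by simp
  qed
  have nz: "a z \<noteq> 0" if z: "0 < z" "z < 1" for z
  proof
    assume az: "a z = 0"
    have "w z \<noteq> 0" using W[of z] z az \<kappa> by auto
    then have "z \<noteq> 1 / 2" using w(2) by metis
    then consider "z < 1 / 2" | "1 / 2 < z" by linarith
    then show False
    proof cases
      case 1
      show False by (rule rolle[of 0 z]) (use 1 z az a01 w(3) in auto)
    next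
      case 2
      show False by (rule rolle[of z 1]) (use 2 z az a01 w(3) in auto)
    qed
  qed
  \<comment> \<open>The Wronskian with the positive eigenfunction vanishes at both walls, while its
    derivative \<open>- \<alpha> * a * \<phi>\<close> has no zero inside.\<close>
  define R where "R y = a' y * \<phi> y - a y * \<phi>' y" for y
  have "(R has_real_derivative (Q y - (Q y + \<alpha>)) * a y * \<phi> y + 0 * \<phi> y - a y * 0) (at y within {0..1})"
    if "y \<in> {0..1}" for y
    unfolding R_def [abs_def] by (rule wronskian_derivative[OF ode \<phi>(1) that])
  then obtain z where z: "0 < z" "z < 1" "R 1 - R 0 = (1 - 0) * ((Q z - (Q z + \<alpha>)) * a z * \<phi> z + 0 * \<phi> z - a z * 0)"
    using mvt_unit_interval[of R "\<lambda>y. (Q y - (Q y + \<alpha>)) * a y * \<phi> y + 0 * \<phi> y - a y * 0" 0 1] by auto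
  then have "\<alpha> * a z * \<phi> z = 0" using \<phi>(2,3) a01 by (simp add: R_def)
  then show False using \<alpha> nz[OF z(1,2)] \<phi>(4)[of z] z by auto
qed

lemma dirichlet_eigenfunction_iff:
  "dirichlet_eigenfunction Q \<nu> \<phi> \<longleftrightarrow>
     (\<exists>\<phi>'. linear_ode (\<lambda>y. Q y - \<nu>) (\<lambda>y. 0) \<phi> \<phi>') & \<phi> 0 = 0 & \<phi> 1 = 0 & (\<exists>y\<in>{0..1}. \<phi> y \<noteq> 0)"
proof -
  have "(\<exists>\<phi>' \<phi>''. \<forall>y\<in>{0..1}. (\<phi> has_real_derivative \<phi>' y) (at y within {0..1}) &
        (\<phi>' has_real_derivative \<phi>'' y) (at y within {0..1}) & - \<phi>'' y + Q y * \<phi> y = \<nu> * \<phi> y) \<longleftrightarrow>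
      (\<exists>\<phi>'. linear_ode (\<lambda>y. Q y - \<nu>) (\<lambda>y. 0) \<phi> \<phi>')" (is "?L \<longleftrightarrow> ?R")
  proof
    assume ?L
    then obtain \<phi>' \<phi>'' where h: "!!y. y \<in> {0..1} ==> (\<phi> has_real_derivative \<phi>' y) (at y within {0..1})"
      "!!y. y \<in> {0..1} ==> (\<phi>' has_real_derivative \<phi>'' y) (at y within {0..1})"
      "!!y. y \<in> {0..1} ==> - \<phi>'' y + Q y * \<phi> y = \<nu> * \<phi> y" by blast
    have e: "(Q y - \<nu>) * \<phi> y + 0 = \<phi>'' y" if "y \<in> {0..1}" for y using h(3)[OF that] by (simp add: algebra_simps)
    show ?R unfolding linear_ode_def
      by (rule exI[of _ \<phi>'], intro ballI conjI h(1), assumption) (simp only: e h(2))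
  next
    assume ?R
    then obtain \<phi>' where h: "linear_ode (\<lambda>y. Q y - \<nu>) (\<lambda>y. 0) \<phi> \<phi>'" by blast
    show ?L
    proof (rule exI[of _ \<phi>'], rule exI[of _ "\<lambda>y. (Q y - \<nu>) * \<phi> y"], intro ballI conjI)
      fix y :: real assume y: "y \<in> {0..1}"
      show "(\<phi> has_real_derivative \<phi>' y) (at y within {0..1})" by (rule linear_odeD(1)[OF h y])
      show "(\<phi>' has_real_derivative (Q y - \<nu>) * \<phi> y) (at y within {0..1})" using linear_odeD(2)[OF h y] by simp
      show "- ((Q y - \<nu>) * \<phi> y) + Q y * \<phi> y = \<nu> * \<phi> y" by (simp add: algebra_simps)
    qed
  qed
  then show ?thesis unfolding dirichlet_eigenfunction_def by blast
qed

text \<open>Lets the error in the derivative along the axis be measured against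
  \<open>\<bar>sin x\<bar>\<close> itself, so that its sign is controlled up to the points where the
  sine vanishes.\<close>

lemma abs_sin_mult_le: "\<bar>sin (real k * x)\<bar> <= real k * \<bar>sin x\<bar>"
proof (induction k)
  case (Suc k)
  have e: "sin (real (Suc k) * x) = sin (real k * x) * cos x + cos (real k * x) * sin x"
    using sin_add[of "real k * x" x] by (simp add: distrib_right add.commute)
  have "\<bar>sin (real (Suc k) * x)\<bar> <= \<bar>sin (real k * x)\<bar> * \<bar>cos x\<bar> + \<bar>cos (real k * x)\<bar> * \<bar>sin x\<bar>"
    unfolding e abs_mult[symmetric] by (rule abs_triangle_ineq)
  also have "\<dots> <= \<bar>sin (real k * x)\<bar> * 1 + 1 * \<bar>sin x\<bar>"
    by (intro add_mono mult_left_mono mult_right_mono abs_cos_le_one) auto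
  finally show ?case using Suc by (simp add: distrib_right)
qed simp

text \<open>The oscillating part is a positive multiple of \<open>1 - cos\<close>, so the parabola
  is a lower bound; it places the level at distance \<open>d\<close> from the axis above that of the
  saddles.\<close>

lemma psi0_lower:
  assumes "0 < A" "1 <= n"
  shows "1 / 2 * (y - 1 / 2)\<^sup>2 <= psi0 A n y" "psi0 A n (1 / 2) = 0"
proof -
  have "cos (4 * real n * pi * (1 / 2)) = cos (2 * real n * pi)" by (simp add: algebra_simps)
  then have c: "cos (4 * real n * pi * (1 / 2)) = 1" by (simp add: cos_2npi)
  show "psi0 A n (1 / 2) = 0" unfolding psi0_def phi_star_def c by simp
  have "A / (4 * (real n)\<^sup>2 * pi) * cos (4 * real n * pi * y) <= A / (4 * (real n)\<^sup>2 * pi) * 1"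
    using assms by (intro mult_left_mono) auto
  then show "1 / 2 * (y - 1 / 2)\<^sup>2 <= psi0 A n y" unfolding psi0_def phi_star_def by simp
qed

text \<open>The shear part has second \<open>y\<close>-derivative at least
  \<open>1 - 4 * pi * A\<close>, which small perturbations cannot destroy, and it contributes
  nothing to the \<xi>-derivative, whose sign is thus that of the leading mode.\<close>

lemma cats_eyes_perturbation:
  fixes U Ux Uy Uxx Uxy Uyy :: "real \<times> real => real" and A \<delta> s b K :: real
  assumes A: "0 < A" "A < 1 / (4 * pi)" and n: "1 <= n" and \<delta>: "0 < \<delta>" "\<delta> <= 1 / 2"
    and p: "has_partials U Ux Uy" "has_partials Ux Uxx Uxy" "has_partials Uy Uxy Uyy"
    and cont: "continuous_on strip U"
    and sym: "!!x y. y \<in> {0..1} ==> U (x, 1 - y) = U (x, y)"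
    and per: "!!x y. U (x + 2 * pi, y) = U (x, y)" and even: "!!x y. U (- x, y) = U (x, y)"
    and s: "s \<noteq> 0" "K * \<bar>s\<bar> < b" "K * \<bar>s\<bar> < 1 - 4 * pi * A" "2 * K * \<bar>s\<bar> < 1 / 2 * (\<delta> / 2)\<^sup>2"
    and Ub: "!!z. z \<in> strip ==> \<bar>U z\<bar> <= K * \<bar>s\<bar>" "!!z. z \<in> strip ==> \<bar>Uyy z\<bar> <= K * \<bar>s\<bar>"
    and Uxb: "!!x. \<bar>Ux (x, 1 / 2) + s * b * sin x\<bar> <= K * s\<^sup>2 * \<bar>sin x\<bar>"
    and Uxxb: "!!x. \<bar>Uxx (x, 1 / 2) + s * b * cos x\<bar> <= K * s\<^sup>2"
  shows "cats_eyes \<delta> (\<lambda>z. psi0 A n (snd z) + U z)"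
proof -
  define g2 where "g2 y = 1 + A / real n * (cos (4 * real n * pi * y) * (4 * real n * pi))" for y
  have b1: "has_partials (\<lambda>z. psi0 A n (snd z)) (\<lambda>z. 0) (\<lambda>z. shear A n (snd z) - 1 / 2)"
    by (rule has_partials_snd) (rule DERIV_subset[OF derivative_psi0[OF n]], simp)
  have b2: "has_partials (\<lambda>z. shear A n (snd z) - 1 / 2) (\<lambda>z. 0) (\<lambda>z. g2 (snd z))"
    by (rule has_partials_snd, rule DERIV_subset[of _ _ _ UNIV])
       (use derivative_shear(1)[of A n] in \<open>auto intro!: derivative_eq_intros simp: g2_def\<close>)
  have P1: "has_partials (\<lambda>z. psi0 A n (snd z) + U z) Ux (\<lambda>z. shear A n (snd z) - 1 / 2 + Uy z)"
    using has_partials_add[OF b1 p(1)] by simp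
  have P2: "has_partials (\<lambda>z. shear A n (snd z) - 1 / 2 + Uy z) Uxy (\<lambda>z. g2 (snd z) + Uyy z)"
    using has_partials_add[OF b2 p(3)] by simp
  have g2: "1 - 4 * pi * A <= g2 y" for y
  proof -
    have "g2 y = 1 + 4 * pi * A * cos (4 * real n * pi * y)" using n by (simp add: g2_def)
    moreover have "4 * pi * A * (- 1) <= 4 * pi * A * cos (4 * real n * pi * y)" using A by (intro mult_left_mono) auto
    ultimately show ?thesis by simp
  qed
  have b: "0 < b - K * \<bar>s\<bar>" using s by simp
  have K0: "0 <= K * \<bar>s\<bar>" using Ub(1)[of "(0, 0)"] by simp
  \<comment> \<open>The saddles sit where \<open>s * cos x\<close> is largest: at 0 for positive
    \<open>s\<close>, at \<open>pi\<close> for negative \<open>s\<close>. Measured from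
    \<open>p\<close>, both cases read alike with \<open>\<bar>s\<bar>\<close> in place of
    \<open>s\<close>.\<close>
  define p where "p = (if 0 < s then 0 else pi)"
  have sinp: "s * sin x = \<bar>s\<bar> * sin (x - p)" "s * cos x = \<bar>s\<bar> * cos (x - p)" for x
    using s(1) by (auto simp: p_def sin_diff cos_diff)
  have Uxp: "\<bar>Ux (x, 1 / 2) + \<bar>s\<bar> * b * sin (x - p)\<bar> <= K * \<bar>s\<bar> * (\<bar>s\<bar> * \<bar>sin (x - p)\<bar>)" for x
  proof -
    have 1: "\<bar>s\<bar> * \<bar>sin x\<bar> = \<bar>s\<bar> * \<bar>sin (x - p)\<bar>" using arg_cong[OF sinp(1)[of x], of abs] by (simp add: abs_mult)
    have 2: "K * s\<^sup>2 * \<bar>sin x\<bar> = K * \<bar>s\<bar> * (\<bar>s\<bar> * \<bar>sin x\<bar>)" by (simp add: power2_eq_square)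
    have 3: "s * b * sin x = \<bar>s\<bar> * b * sin (x - p)" using sinp(1)[of x] by (simp add: mult_ac)
    show ?thesis using Uxb[of x] unfolding 2 1 3 .
  qed
  define q where "q = \<bar>s\<bar> * (b - K * \<bar>s\<bar>)"
  have q: "0 < q" using b s(1) by (simp add: q_def)
  have sp: "s * cos (p + 2 * pi * of_int k) = \<bar>s\<bar>" for k :: int
  proof -
    have "cos (p + 2 * pi * of_int k - p) = cos (2 * pi * of_int k)" by simp
    also have "\<dots> = 1" by (rule cos_int_2pin)
    finally show ?thesis using sinp(2)[of "p + 2 * pi * of_int k"] by simp
  qed
  define d where "d = \<delta> / 2"
  show ?thesis
  proof (rule cats_eyes_criterion[of \<delta> d _ Ux "\<lambda>z. shear A n (snd z) - 1 / 2 + Uy z" "\<lambda>z. g2 (snd z) + Uyy z" p])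
    show "\<delta> <= 1 / 2" "0 < d" "d < \<delta>" using \<delta> by (auto simp: d_def)
    have "continuous_on UNIV (psi0 A n)"
      by (rule DERIV_continuous_on[OF DERIV_subset[OF derivative_psi0[OF n]]]) auto
    then have "continuous_on strip (\<lambda>z. psi0 A n (snd z))"
      by (rule continuous_on_compose2) (auto intro!: continuous_intros)
    then show "continuous_on strip (\<lambda>z. psi0 A n (snd z) + U z)" by (intro continuous_intros cont)
    show "has_partials (\<lambda>z. psi0 A n (snd z) + U z) Ux (\<lambda>z. shear A n (snd z) - 1 / 2 + Uy z)" by (rule P1)
    fix x y :: real
    show "((\<lambda>t. shear A n (snd (x, t)) - 1 / 2 + Uy (x, t)) has_real_derivative g2 (snd (x, y)) + Uyy (x, y)) (at y within {0..1})"
      if "y \<in> {0..1}" by (rule has_partialsD(2)[OF P2 that])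
    show pos: "0 < g2 (snd (x, y)) + Uyy (x, y)" if "y \<in> {0..1}" for x y
      using g2[of y] Ub(2)[of "(x, y)"] that s(3) by (simp add: abs_le_iff)
    show "psi0 A n (snd (x, 1 - y)) + U (x, 1 - y) = psi0 A n (snd (x, y)) + U (x, y)" if "y \<in> {0..1}"
      using sym[OF that] psi0_reflect by simp
    show "psi0 A n (snd (x + 2 * pi, y)) + U (x + 2 * pi, y) = psi0 A n (snd (x, y)) + U (x, y)"
      using per by simp
    show "psi0 A n (snd (2 * p - x, y)) + U (2 * p - x, y) = psi0 A n (snd (x, y)) + U (x, y)"
      using per[of "- x" y] even[of x y] by (auto simp: p_def algebra_simps)
    show "Ux (x, 1 / 2) < 0" if "0 < sin (x - p)"
    proof -
      have "0 < q * sin (x - p)" using q that by simp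
      then have "0 < \<bar>s\<bar> * b * sin (x - p) - K * \<bar>s\<bar> * (\<bar>s\<bar> * sin (x - p))" by (simp add: q_def algebra_simps)
      moreover have "Ux (x, 1 / 2) + \<bar>s\<bar> * b * sin (x - p) <= K * \<bar>s\<bar> * (\<bar>s\<bar> * sin (x - p))"
        using abs_le_D1[OF Uxp[of x]] unfolding abs_of_pos[OF that] .
      ultimately show ?thesis by linarith
    qed
    show "0 < Ux (x, 1 / 2)" if "sin (x - p) < 0"
    proof -
      have "q * sin (x - p) < 0" using q that by (simp add: mult_pos_neg)
      then have "\<bar>s\<bar> * b * sin (x - p) - K * \<bar>s\<bar> * (\<bar>s\<bar> * sin (x - p)) < 0" by (simp add: q_def algebra_simps)
      moreover have "- (Ux (x, 1 / 2) + \<bar>s\<bar> * b * sin (x - p)) <= K * \<bar>s\<bar> * (\<bar>s\<bar> * - sin (x - p))"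
        using abs_le_D2[OF Uxp[of x]] unfolding abs_of_neg[OF that] .
      ultimately show ?thesis unfolding mult_minus_right by linarith
    qed
    show "Ux (x, 1 / 2) = 0" if "sin (x - p) = 0" using Uxp[of x] that by simp
    show "D1 (D1 (\<lambda>z. psi0 A n (snd z) + U z)) (p + 2 * pi * of_int k, 1 / 2) < 0" for k :: int
    proof -
      define X where "X = p + 2 * pi * of_int k"
      have st: "(X, 1 / 2) \<in> strip" by simp
      have 1: "s * b * cos X = \<bar>s\<bar> * b" using sp[of k] by (simp add: X_def mult_ac)
      have 2: "K * s\<^sup>2 = \<bar>s\<bar> * (K * \<bar>s\<bar>)" by (simp add: power2_eq_square)
      have "Uxx (X, 1 / 2) + \<bar>s\<bar> * b <= \<bar>s\<bar> * (K * \<bar>s\<bar>)" using abs_le_D1[OF Uxxb[of X]] unfolding 1 2 .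
      then have "Uxx (X, 1 / 2) < 0" using q unfolding q_def right_diff_distrib by linarith
      then show ?thesis using second_partials(1)[OF P1 p(2) P2 st] by (simp add: X_def)
    qed
    show "0 < D2 (D2 (\<lambda>z. psi0 A n (snd z) + U z)) (p + 2 * pi * of_int k, 1 / 2)" for k :: int
      using second_partials(3)[OF P1 p(2) P2, of "(p + 2 * pi * of_int k, 1 / 2)"] pos[of "1 / 2" "p + 2 * pi * of_int k"]
      by simp
    show "psi0 A n (snd (p, 1 / 2)) + U (p, 1 / 2) < psi0 A n (snd (x, 1 / 2 + d)) + U (x, 1 / 2 + d)"
    proof -
      have st: "(x, 1 / 2 + d) \<in> strip" using \<delta> by (simp add: d_def)
      have "- U (x, 1 / 2 + d) <= K * \<bar>s\<bar>" by (rule abs_le_D2[OF Ub(1)[OF st]])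
      then have "- (K * \<bar>s\<bar>) <= U (x, 1 / 2 + d)" by linarith
      moreover have "U (p, 1 / 2) <= K * \<bar>s\<bar>" using Ub(1)[of "(p, 1 / 2)"] by (simp add: abs_le_iff)
      moreover have "1 / 2 * d\<^sup>2 <= psi0 A n (1 / 2 + d)" using psi0_lower(1)[OF A(1) n, of "1 / 2 + d"] by simp
      ultimately show ?thesis using psi0_lower(2)[OF A(1) n] s(4) by (simp add: d_def)
    qed
  qed
qed

section \<open>The bifurcating waves\<close>

text \<open>A family of perturbations \<open>U s\<close>, \<open>\<bar>s\<bar> < s0\<close>, of the relative stream function, with eigenvalue shift \<open>lam s\<close>; the
  coefficients \<open>c i\<close> are those of the Taylor series of the vorticity function at the shear.\<close>

definition wave_family :: "(nat => real => real) => real => real => (real => real) => real => real =>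
  (real => real) => (real => real \<times> real => real) => (real => real \<times> real => real) =>
  (real => real \<times> real => real) => (real => real \<times> real => real) =>
  (real => real \<times> real => real) => (real => real \<times> real => real) => bool" where
  "wave_family c r \<alpha> \<phi> s0 K lam U Ux Uy Uxx Uxy Uyy \<longleftrightarrow> 0 < s0 & 0 < K &
    (\<forall>s t. \<bar>s\<bar> < s0 & \<bar>t\<bar> < s0 --> \<bar>lam s - lam t\<bar> <= K * \<bar>s - t\<bar> &
       (\<forall>\<beta> h. 0 < \<beta> & \<beta> < 1 & (\<forall>z\<in>strip. h z = U s z - U t z) --> C2_holder_norm \<beta> h <= ennreal (K * \<bar>s - t\<bar>))) &
    (\<forall>s. \<bar>s\<bar> < s0 --> \<bar>lam s\<bar> <= K * \<bar>s\<bar> &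
       has_partials (U s) (Ux s) (Uy s) & has_partials (Ux s) (Uxx s) (Uxy s) & has_partials (Uy s) (Uxy s) (Uyy s) &
       continuous_on strip (U s) & continuous_on strip (Ux s) & continuous_on strip (Uy s) &
       continuous_on strip (Uxx s) & continuous_on strip (Uxy s) & continuous_on strip (Uyy s) &
       bounded_lipschitz (K * \<bar>s\<bar>) (Uxx s) & bounded_lipschitz (K * \<bar>s\<bar>) (Uxy s) & bounded_lipschitz (K * \<bar>s\<bar>) (Uyy s) &
       (\<forall>z\<in>strip. \<bar>U s z\<bar> <= K * \<bar>s\<bar> & \<bar>Ux s z\<bar> <= K * \<bar>s\<bar> & \<bar>Uy s z\<bar> <= K * \<bar>s\<bar> & \<bar>U s z\<bar> <= r / 2 &
          (\<lambda>i. c (Suc i) (snd z) * U s z ^ Suc i) sums ((\<alpha>\<^sup>2 + lam s) * Uxx s z + Uyy s z) &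
          \<bar>Ux s z + s * \<phi> (snd z) * sin (fst z)\<bar> <= K * s\<^sup>2 * \<bar>sin (fst z)\<bar> &
          \<bar>Uxx s z + s * \<phi> (snd z) * cos (fst z)\<bar> <= K * s\<^sup>2) &
       (\<forall>x. \<forall>y\<in>{0..1}. U s (x, 1 - y) = U s (x, y)) &
       (\<forall>x y. U s (x + 2 * pi, y) = U s (x, y) & U s (- x, y) = U s (x, y)) &
       (\<forall>x. U s (x, 0) = 0 & U s (x, 1) = 0 & Ux s (x, 0) = 0 & Ux s (x, 1) = 0) &
       (\<forall>\<beta> h. 0 < \<beta> & \<beta> < 1 & (\<forall>z\<in>strip. h z = U s z - s * \<phi> (snd z) * cos (fst z)) -->
          C2_holder_norm \<beta> h <= ennreal (K * s\<^sup>2)))"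

text \<open>The regularity theorem is applied three times: to \<open>u s\<close>, to
  \<open>u s - u t\<close> with size of order \<open>\<bar>s - t\<bar>\<close>, and to the remainder
  after the leading mode with size of order \<open>s\<^sup>2\<close>. This yields regularity,
  continuity of the family in the Hoelder norm, and the leading order.\<close>

theorem bifurcating_series:
  fixes c c' :: "nat => real => real" and \<phi> \<phi>' :: "real => real" and \<alpha> r M :: real
  assumes c: "!!i y. y \<in> {0..1} ==> (c i has_real_derivative c' i y) (at y within {0..1})"
    and r: "0 < r" and M: "0 < M"
    and cb: "!!i y. y \<in> {0..1} ==> \<bar>c i y\<bar> <= M / r ^ i" "!!i y. y \<in> {0..1} ==> \<bar>c' i y\<bar> <= M / r ^ i"
    and csym: "!!i y. c i (1 - y) = c i y" and \<alpha>: "0 < \<alpha>"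
    and \<phi>: "linear_ode (\<lambda>y. c 1 y + \<alpha>\<^sup>2) (\<lambda>y. 0) \<phi> \<phi>'" "\<phi> 0 = 0" "\<phi> 1 = 0" "!!y. y \<in> {0<..<1} ==> 0 < \<phi> y"
    and nr0: "!!a. dirichlet_bvp (c 1) (\<lambda>y. 0) a ==> \<forall>y\<in>{0..1}. a y = 0"
    and nr: "!!m a. \<alpha>\<^sup>2 < m ==> dirichlet_bvp (\<lambda>y. c 1 y + m) (\<lambda>y. 0) a ==> \<forall>y\<in>{0..1}. a y = 0"
  shows "\<exists>s0 K lam U Ux Uy Uxx Uxy Uyy. wave_family c r \<alpha> \<phi> s0 K lam U Ux Uy Uxx Uxy Uyy"
proof -
  define Q where "Q = c 1"
  have Qd: "(Q has_real_derivative c' 1 y) (at y within {0..1})" if "y \<in> {0..1}" for y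
    unfolding Q_def by (rule c[OF that])
  have cc: "cont01 (c i)" for i by (rule DERIV_continuous_on[OF c])
  have Qc: "cont01 Q" unfolding Q_def by (rule cc)
  have Qsym: "Q (1 - y) = Q y" for y unfolding Q_def by (rule csym)
  obtain s1 K1 u n lam where s1: "0 < s1" and K1: "0 < K1"
    and bvp: "!!s k. \<bar>s\<bar> < s1 ==> dirichlet_bvp (\<lambda>y. Q y + (\<alpha>\<^sup>2 + lam s) * (real k)\<^sup>2) (n s k) (u s k)"
    and nc: "!!s k. \<bar>s\<bar> < s1 ==> cont01 (n s k)"
    and usym: "!!s k y. \<bar>s\<bar> < s1 ==> y \<in> {0..1} ==> u s k (1 - y) = u s k y"
    and ul: "!!s t. \<bar>s\<bar> < s1 ==> \<bar>t\<bar> < s1 ==> decay 6 (K1 * \<bar>s - t\<bar>) (\<lambda>k y. u s k y - u t k y)"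
    and nl: "!!s t. \<bar>s\<bar> < s1 ==> \<bar>t\<bar> < s1 ==> decay 6 (K1 * \<bar>s - t\<bar>) (\<lambda>k y. n s k y - n t k y)"
    and ll: "!!s t. \<bar>s\<bar> < s1 ==> \<bar>t\<bar> < s1 ==> \<bar>lam s - lam t\<bar> <= K1 * \<bar>s - t\<bar>"
    and lb: "!!s. \<bar>s\<bar> < s1 ==> \<bar>lam s\<bar> <= K1 * \<bar>s\<bar>"
    and u1: "!!s. \<bar>s\<bar> < s1 ==> decay 6 (K1 * s\<^sup>2) (\<lambda>k y. u s k y - (if k = 1 then s * \<phi> y else 0))"
    and n2: "!!s. \<bar>s\<bar> < s1 ==> decay 6 (K1 * s\<^sup>2) (n s)"
    and ur: "!!s \<xi> y. \<bar>s\<bar> < s1 ==> y \<in> {0..1} ==> \<bar>tser 0 (u s) (\<xi>, y)\<bar> <= r / 2"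
    and ns: "!!s \<xi> y. \<bar>s\<bar> < s1 ==> y \<in> {0..1} ==>
       (\<lambda>i. c (i + 2) y * tser 0 (u s) (\<xi>, y) ^ (i + 2)) sums tser 0 (n s) (\<xi>, y)"
  proof (rule bifurcation_coefficients[where c = c and r = r and M = M and Q = Q and \<alpha> = \<alpha> and \<phi> = \<phi> and \<phi>' = \<phi>',
        OF cc r M cb(1) csym Qc Qsym \<alpha> \<phi>[folded Q_def] nr0[folded Q_def] nr[folded Q_def]], (assumption+)?, goal_cases)
    case (1 s0 K u n lam)
    show ?case by (rule that[where ?s1.0 = s0 and ?K1.0 = K and u = u and n = n and lam = lam]) (fact 1)+
  qed
  have \<phi>c: "cont01 \<phi>" "cont01 \<phi>'" by (rule linear_ode_continuous[OF \<phi>(1)])+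
  obtain \<Phi>1 where \<Phi>1: "0 < \<Phi>1" "!!y. y \<in> {0..1} ==> \<bar>\<phi> y\<bar> <= \<Phi>1" by (rule bounded_abs_on_unit_interval[OF \<phi>c(1)]) (rule that)
  obtain \<Phi>2 where \<Phi>2: "0 < \<Phi>2" "!!y. y \<in> {0..1} ==> \<bar>\<phi>' y\<bar> <= \<Phi>2" by (rule bounded_abs_on_unit_interval[OF \<phi>c(2)]) (rule that)
  define \<Phi> where "\<Phi> = \<Phi>1 + \<Phi>2"
  have \<Phi>: "0 < \<Phi>" "!!y. y \<in> {0..1} ==> \<bar>\<phi> y\<bar> <= \<Phi>" "!!y. y \<in> {0..1} ==> \<bar>\<phi>' y\<bar> <= \<Phi>"
    using \<Phi>1 \<Phi>2 by (fastforce simp: \<Phi>_def)+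
  define ph where "ph k y = (if k = 1 then \<phi> y else 0)" for k :: nat and y
  define ph' where "ph' k y = (if k = 1 then \<phi>' y else 0)" for k :: nat and y
  have phd: "decay 4 (16 * \<Phi>) ph" "decay 4 (16 * \<Phi>) ph'"
    using \<Phi> by (auto intro!: decayI simp: ph_def ph'_def)
  have phD: "(ph k has_real_derivative ph' k y) (at y within {0..1})" if "y \<in> {0..1}" for k y
    using linear_odeD(1)[OF \<phi>(1) that] by (cases "k = 1") (simp_all add: ph_def [abs_def] ph'_def)
  have phc: "cont01 (ph k)" for k by (rule DERIV_continuous_on[OF phD])
  define K0 where "K0 = 1 + M / r + \<alpha>\<^sup>2 + K1"
  have K0: "1 <= K0" "M / r <= K0" "\<alpha>\<^sup>2 + K1 <= K0" using M r K1 by (simp_all add: K0_def)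
  have Qb: "\<bar>Q y\<bar> <= K0" "\<bar>c' 1 y\<bar> <= K0" if "y \<in> {0..1}" for y
    using cb(1)[OF that, of 1] cb(2)[OF that, of 1] K0(2) by (simp_all add: Q_def)
  define \<Lambda> where "\<Lambda> = 6 * K0 * zeta2 * (K1 + K1\<^sup>2)"
  have \<Lambda>: "0 < \<Lambda>" using K0 zeta2_pos K1 by (simp add: \<Lambda>_def add_pos_pos)
  \<comment> \<open>The last entry keeps \<open>4 * (\<Lambda> * \<bar>s\<bar>) \<le> r\<close>, the
    range in which the power series of the nonlinearity is controlled.\<close>
  define s0 where "s0 = min s1 (min 1 (r / (4 * \<Lambda>)))"
  have s0: "0 < s0" using s1 r \<Lambda> by (simp add: s0_def)
  have ss: "\<bar>s\<bar> < s1" "\<bar>s\<bar> <= 1" "4 * (\<Lambda> * \<bar>s\<bar>) <= r" if "\<bar>s\<bar> < s0" for s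
    using that \<Lambda> by (auto simp: s0_def field_simps)
  have sq: "s\<^sup>2 <= \<bar>s\<bar>" if "\<bar>s\<bar> < s0" for s
    using mult_left_mono[OF ss(2)[OF that], of "\<bar>s\<bar>"] by (simp add: power2_eq_square abs_mult_self_eq)
  define \<mu> where "\<mu> s = \<alpha>\<^sup>2 + lam s" for s
  have \<mu>: "\<bar>\<mu> s\<bar> <= K0" if "\<bar>s\<bar> < s0" for s
  proof -
    have "K1 * \<bar>s\<bar> <= K1 * 1" using K1 by (intro mult_left_mono ss(2)[OF that]) simp
    then have "\<bar>lam s\<bar> <= K1" using lb[OF ss(1)[OF that]] by linarith
    then show ?thesis using K0(3) abs_triangle_ineq[of "\<alpha>\<^sup>2" "lam s"] by (simp add: \<mu>_def)
  qed
  have zs: "\<bar>0 :: real\<bar> < s0" using s0 by simp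
  \<comment> \<open>At \<open>s = 0\<close> the quadratic bounds make the coefficients vanish, so
    Lipschitz bounds with \<open>t = 0\<close> turn into linear bounds in \<open>s\<close>.\<close>
  have u0: "u 0 k y = 0" and n0: "n 0 k y = 0" if "y \<in> {0..1}" for k y
  proof -
    have p: "0 < (1 + real k) ^ 6" by simp
    have "(1 + real k) ^ 6 * \<bar>u 0 k y - (if k = 1 then 0 * \<phi> y else 0)\<bar> <= K1 * 0\<^sup>2"
      by (rule decayD[OF u1[OF ss(1)[OF zs]] that])
    then show "u 0 k y = 0" using p by (simp add: mult_le_0_iff)
    have "(1 + real k) ^ 6 * \<bar>n 0 k y\<bar> <= K1 * 0\<^sup>2" by (rule decayD[OF n2[OF ss(1)[OF zs]] that])
    then show "n 0 k y = 0" using p by (simp add: mult_le_0_iff)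
  qed
  define U where "U s = tser 0 (u s)" for s
  define N where "N s = tser 0 (n s)" for s
  define Uxx where "Uxx s = tser pi (\<lambda>k y. real k * (real k * u s k y))" for s
  define Ux where "Ux s = tser (pi / 2) (\<lambda>k y. real k * u s k y)" for s
  have snd_in: "snd z \<in> {0..1}" if "z \<in> strip" for z :: "real \<times> real" using that by (auto simp: strip_def)
  have U0: "U 0 z = 0" "N 0 z = 0" if "z \<in> strip" for z
    unfolding U_def N_def tser_def using u0[OF snd_in[OF that]] n0[OF snd_in[OF that]] by simp_all
  have ud: "decay 6 (K1 * \<bar>s\<bar>) (u s)" if "\<bar>s\<bar> < s0" for s
    using ul[OF ss(1)[OF that] ss(1)[OF zs]] u0 unfolding decay_def by simp
  have nd: "decay 6 (K1 * \<bar>s\<bar>) (n s)" if "\<bar>s\<bar> < s0" for s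
    using nl[OF ss(1)[OF that] ss(1)[OF zs]] n0 unfolding decay_def by simp
  \<comment> \<open>The forcing of the difference of two solutions. Besides the difference of the
    nonlinear terms it contains the change of the wave number, acting on \<open>u t\<close> with two
    \<xi>-derivatives.\<close>
  define e where "e s t k y = (n s k y - n t k y) + (lam s - lam t) * (real k * (real k * u t k y))" for s t k y
  have kkd: "decay 4 (K1 * \<bar>s\<bar>) (\<lambda>k y. real k * (real k * u s k y))" if "\<bar>s\<bar> < s0" for s
    using decay_times_k[OF ud[OF that], of 4 2] by (simp add: power2_eq_square mult.assoc)
  have diff_bvp: "dirichlet_bvp (\<lambda>y. Q y + \<mu> s * (real k)\<^sup>2) (e s t k) (\<lambda>y. u s k y - u t k y)"
    if "\<bar>s\<bar> < s0" "\<bar>t\<bar> < s0" for s t k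
  proof -
    have 1: "dirichlet_bvp (\<lambda>y. Q y + \<mu> s * (real k)\<^sup>2) (n s k) (u s k)" unfolding \<mu>_def by (rule bvp[OF ss(1)[OF that(1)]])
    have 2: "dirichlet_bvp (\<lambda>y. Q y + \<mu> s * (real k)\<^sup>2) (\<lambda>y. n t k y - (lam s - lam t) * (real k * (real k * u t k y))) (u t k)"
      by (rule dirichlet_bvp_cong[OF bvp[OF ss(1)[OF that(2)], of k]]) (simp add: \<mu>_def algebra_simps power2_eq_square)
    show ?thesis
      by (rule dirichlet_bvp_cong[OF dirichlet_bvp_diff[OF 1 2]]) (simp add: e_def algebra_simps)
  qed
  have ed: "decay 4 ((K1 + K1\<^sup>2) * \<bar>s - t\<bar>) (e s t)" if "\<bar>s\<bar> < s0" "\<bar>t\<bar> < s0" for s t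
  proof (rule decay_le)
    show "decay 4 (K1 * \<bar>s - t\<bar> + \<bar>lam s - lam t\<bar> * (K1 * \<bar>t\<bar>)) (e s t)"
      unfolding e_def [abs_def]
      by (intro decay_add decay_scale kkd that decay_mono[OF nl[OF ss(1)[OF that(1)] ss(1)[OF that(2)]]]) simp
    have "\<bar>lam s - lam t\<bar> * (K1 * \<bar>t\<bar>) <= (K1 * \<bar>s - t\<bar>) * (K1 * 1)"
      using K1 by (intro mult_mono ll ss that) auto
    then show "K1 * \<bar>s - t\<bar> + \<bar>lam s - lam t\<bar> * (K1 * \<bar>t\<bar>) <= (K1 + K1\<^sup>2) * \<bar>s - t\<bar>"
      by (simp add: algebra_simps power2_eq_square)
  qed
  have uK: "decay 6 ((K1 + K1\<^sup>2) * \<bar>s - t\<bar>) (\<lambda>k y. u s k y - u t k y)" if "\<bar>s\<bar> < s0" "\<bar>t\<bar> < s0" for s t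
    by (rule decay_le[OF ul[OF ss(1)[OF that(1)] ss(1)[OF that(2)]]]) (intro mult_right_mono, simp_all)
  have ud2: "decay 2 (K1 * \<bar>s\<bar>) (u s)" "decay 2 (K1 * \<bar>s\<bar>) (n s)" if "\<bar>s\<bar> < s0" for s
    by (rule decay_mono[OF ud[OF that]], simp, rule decay_mono[OF nd[OF that]], simp)
  have U_diff: "tser 0 (\<lambda>k y. u s k y - u t k y) z = U s z - U t z" if "\<bar>s\<bar> < s0" "\<bar>t\<bar> < s0" "z \<in> strip" for s t z
    unfolding U_def by (rule tser_diff[OF ud2(1)[OF that(1)] ud2(1)[OF that(2)] that(3)])
  have N_diff: "tser 0 (\<lambda>k y. n s k y - n t k y) z = N s z - N t z" if "\<bar>s\<bar> < s0" "\<bar>t\<bar> < s0" "z \<in> strip" for s t z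
    unfolding N_def by (rule tser_diff[OF ud2(2)[OF that(1)] ud2(2)[OF that(2)] that(3)])
  \<comment> \<open>Obtained from the decay of coefficients alone. This breaks a circle: the
    Lipschitz bound of the nonlinear term needs one of \<open>U\<close>, while the full regularity
    theorem needs a Lipschitz bound of the nonlinear term.\<close>
  have Ul: "bounded_lipschitz (\<Lambda> * \<bar>s - t\<bar>) (\<lambda>z. U s z - U t z)" if st: "\<bar>s\<bar> < s0" "\<bar>t\<bar> < s0" for s t
  proof -
    define B where "B = 3 * K0 * ((K1 + K1\<^sup>2) * \<bar>s - t\<bar>)"
    obtain f' f'' where f: "!!k y. y \<in> {0..1} ==> ((\<lambda>y. u s k y - u t k y) has_real_derivative f' k y) (at y within {0..1})"
      "decay 4 B f'"
    proof (rule C2_series_decay[OF Qb(1) \<mu>[OF st(1)] K0(1) uK[OF st] ed[OF st] diff_bvp[OF st]], assumption, goal_cases)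
      case (1 f' f'')
      show ?case by (rule that[of f']) (fact 1, unfold B_def, fact 1)
    qed
    have "(K1 + K1\<^sup>2) * \<bar>s - t\<bar> <= B"
    proof -
      have "0 <= (K1 + K1\<^sup>2) * \<bar>s - t\<bar>" using K1 by simp
      then show ?thesis using mult_right_mono[of 1 "3 * K0" "(K1 + K1\<^sup>2) * \<bar>s - t\<bar>"] K0 by (simp add: B_def)
    qed
    then have "decay 3 B (\<lambda>k y. u s k y - u t k y)" using decay_mono[OF decay_le[OF uK[OF st]], of B 3] by simp
    then have "bounded_lipschitz (2 * (B * zeta2)) (tser 0 (\<lambda>k y. u s k y - u t k y))"
      by (rule tser_lipschitz[OF _ decay_mono[OF f(2)] f(1)]) simp_all
    moreover have "2 * (B * zeta2) = \<Lambda> * \<bar>s - t\<bar>" by (simp add: B_def \<Lambda>_def)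
    ultimately have "bounded_lipschitz (\<Lambda> * \<bar>s - t\<bar>) (tser 0 (\<lambda>k y. u s k y - u t k y))" by simp
    then show ?thesis by (rule bounded_lipschitz_cong) (rule U_diff[OF st])
  qed
  have Us: "bounded_lipschitz (\<Lambda> * \<bar>s\<bar>) (U s)" if "\<bar>s\<bar> < s0" for s
    using bounded_lipschitz_cong[OF Ul[OF that zs], of "U s"] U0 by simp
  have nsz: "(\<lambda>i. c (i + 2) (snd z) * U s z ^ (i + 2)) sums N s z" if "\<bar>s\<bar> < s0" "z \<in> strip" for s z
    using ns[OF ss(1)[OF that(1)] snd_in[OF that(2)], of "fst z"] by (simp add: U_def N_def)
  define K2 where "K2 = 64 * M * \<Lambda>\<^sup>2 / r\<^sup>2"
  have K2: "0 <= K2" using M by (simp add: K2_def)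
  have Nl: "bounded_lipschitz (K2 * \<bar>s - t\<bar>) (\<lambda>z. N s z - N t z)" if st: "\<bar>s\<bar> < s0" "\<bar>t\<bar> < s0" for s t
  proof -
    define \<eta> where "\<eta> = \<Lambda> * max \<bar>s\<bar> \<bar>t\<bar>"
    have \<eta>: "\<Lambda> * \<bar>s\<bar> <= \<eta>" "\<Lambda> * \<bar>t\<bar> <= \<eta>" "4 * \<eta> <= r" "\<eta> <= \<Lambda>"
      using \<Lambda> ss[OF st(1)] ss[OF st(2)] unfolding \<eta>_def by (auto simp: max_def)
    have "bounded_lipschitz (64 * M * (\<Lambda> * \<bar>s - t\<bar>) * \<eta> / r\<^sup>2) (\<lambda>z. N s z - N t z)"
      by (rule bounded_lipschitz_power_series[where c = c and c' = c' and M = M and r = r and U = "U s" and V = "U t",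
            OF c cb r M \<eta>(3) bounded_lipschitz_mono[OF Us[OF st(1)] \<eta>(1)] bounded_lipschitz_mono[OF Us[OF st(2)] \<eta>(2)]
            Ul[OF st] nsz[OF st(1)] nsz[OF st(2)]])
    moreover have "64 * M * (\<Lambda> * \<bar>s - t\<bar>) * \<eta> / r\<^sup>2 <= K2 * \<bar>s - t\<bar>"
    proof -
      have "64 * M * (\<Lambda> * \<bar>s - t\<bar>) * \<eta> / r\<^sup>2 <= 64 * M * (\<Lambda> * \<bar>s - t\<bar>) * \<Lambda> / r\<^sup>2"
        using \<eta>(4) M \<Lambda> by (intro divide_right_mono mult_left_mono) auto
      then show ?thesis by (simp add: K2_def power2_eq_square mult_ac)
    qed
    ultimately show ?thesis by (rule bounded_lipschitz_mono)
  qed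
  \<comment> \<open>Compared with the vanishing term at parameter 0, both the difference and the
    size of the argument are of order \<open>s\<close>, so the result is of second order.\<close>
  have Ns: "bounded_lipschitz (K2 * s\<^sup>2) (N s)" if s: "\<bar>s\<bar> < s0" for s
  proof -
    have "0 <= \<Lambda> * \<bar>s\<bar>" using \<Lambda> by simp
    then have z: "bounded_lipschitz (\<Lambda> * \<bar>s\<bar>) (U 0)" using bounded_lipschitz_mono[OF Us[OF zs]] by simp
    have d: "bounded_lipschitz (\<Lambda> * \<bar>s\<bar>) (\<lambda>z. U s z - U 0 z)" using Ul[OF s zs] by simp
    have "bounded_lipschitz (64 * M * (\<Lambda> * \<bar>s\<bar>) * (\<Lambda> * \<bar>s\<bar>) / r\<^sup>2) (\<lambda>z. N s z - N 0 z)"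
      by (rule bounded_lipschitz_power_series[where c = c and c' = c' and M = M and r = r and U = "U s" and V = "U 0",
            OF c cb r M ss(3)[OF s] Us[OF s] z d nsz[OF s] nsz[OF zs]])
    moreover have "64 * M * (\<Lambda> * \<bar>s\<bar>) * (\<Lambda> * \<bar>s\<bar>) / r\<^sup>2 = K2 * s\<^sup>2"
    proof -
      have "\<bar>s\<bar> * \<bar>s\<bar> = s\<^sup>2" by (simp add: power2_eq_square abs_mult_self_eq)
      then have "64 * M * (\<Lambda> * \<bar>s\<bar>) * (\<Lambda> * \<bar>s\<bar>) = 64 * M * \<Lambda>\<^sup>2 * s\<^sup>2" by (simp add: power2_eq_square mult_ac)
      then show ?thesis by (simp add: K2_def)
    qed
    ultimately have "bounded_lipschitz (K2 * s\<^sup>2) (\<lambda>z. N s z - N 0 z)" by simp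
    then show ?thesis by (rule bounded_lipschitz_cong) (simp add: U0)
  qed
  define Z where "Z = 21 * K0\<^sup>2 * zeta2"
  have Z: "0 < Z" using K0 zeta2_pos by (simp add: Z_def)
  define E1 where "E1 = K1 + K2"
  define E2 where "E2 = (K1 + K1\<^sup>2) + (K2 + K1 * (Z * E1))"
  define E3 where "E3 = K1 + K1 * (16 * \<Phi>) + K2 + K1 * (2 * ((16 * \<Phi>) * zeta2))"
  have E: "0 <= E1" "0 <= E2" "0 <= E3" using K1 K2 Z \<Phi> zeta2_pos by (simp_all add: E1_def E2_def E3_def)
  \<comment> \<open>One predicate, so that the coefficients of the \<open>y\<close>-derivative and
    the second \<open>y\<close>-derivative are chosen simultaneously for every
    \<open>s\<close>.\<close>
  define Pr where "Pr s g w \<longleftrightarrow>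
     has_partials (U s) (Ux s) (tser 0 g) & has_partials (Ux s) (Uxx s) (tser (pi / 2) (\<lambda>k y. real k * g k y)) &
     has_partials (tser 0 g) (tser (pi / 2) (\<lambda>k y. real k * g k y)) w &
     continuous_on strip (U s) & continuous_on strip (Ux s) & continuous_on strip (tser 0 g) &
     continuous_on strip (Uxx s) & continuous_on strip (tser (pi / 2) (\<lambda>k y. real k * g k y)) & continuous_on strip w &
     bounded_lipschitz (Z * (E1 * \<bar>s\<bar>)) (U s) &
     bounded_lipschitz (Z * (E1 * \<bar>s\<bar>)) (Uxx s) & bounded_lipschitz (Z * (E1 * \<bar>s\<bar>)) (tser (pi / 2) (\<lambda>k y. real k * g k y)) &
     bounded_lipschitz (Z * (E1 * \<bar>s\<bar>)) w &
     (\<forall>z\<in>strip. \<bar>Ux s z\<bar> <= Z * (E1 * \<bar>s\<bar>) & \<bar>tser 0 g z\<bar> <= Z * (E1 * \<bar>s\<bar>)) &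
     (\<forall>z\<in>strip. w z = Q (snd z) * U s z - \<mu> s * Uxx s z + N s z)" for s g w
  have "\<exists>g w. Pr s g w" if s: "\<bar>s\<bar> < s0" for s
  proof -
    have 1: "decay 6 (E1 * \<bar>s\<bar>) (u s)"
      by (rule decay_le[OF ud[OF s]]) (use K2 in \<open>intro mult_right_mono, simp_all add: E1_def\<close>)
    have 2: "decay 4 (E1 * \<bar>s\<bar>) (n s)"
      by (rule decay_mono[OF decay_le[OF nd[OF s]]]) (use K2 in \<open>simp_all add: E1_def distrib_right\<close>)
    have "K2 * s\<^sup>2 <= E1 * \<bar>s\<bar>" using K1 K2 by (intro mult_mono sq s) (auto simp: E1_def)
    then have 3: "bounded_lipschitz (E1 * \<bar>s\<bar>) (tser 0 (n s))"
      using bounded_lipschitz_mono[OF Ns[OF s]] unfolding N_def by blast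
    have 4: "dirichlet_bvp (\<lambda>y. Q y + \<mu> s * (real k)\<^sup>2) (n s k) (u s k)" for k unfolding \<mu>_def by (rule bvp[OF ss(1)[OF s]])
    show ?thesis
    proof (rule C2_series[OF Qd Qb \<mu>[OF s] K0(1) 1 2 nc[OF ss(1)[OF s]] 4 3], assumption, assumption, assumption,
        fold U_def Ux_def Uxx_def N_def Z_def, goal_cases)
      case (1 g)
      then obtain w where "has_partials (tser 0 g) (tser (pi / 2) (\<lambda>k y. real k * g k y)) w" "continuous_on strip w"
        "bounded_lipschitz (Z * (E1 * \<bar>s\<bar>)) w" "\<forall>z\<in>strip. w z = Q (snd z) * U s z - \<mu> s * Uxx s z + N s z"
        by blast
      then have "Pr s g w" unfolding Pr_def using 1 by blast
      then show ?case by blast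
    qed
  qed
  then have "\<forall>s. \<exists>g w. \<bar>s\<bar> < s0 --> Pr s g w" by blast
  then obtain g w where gw: "!!s. \<bar>s\<bar> < s0 ==> Pr s (g s) (w s)" by metis
  have lip: "C2_holder_norm \<beta> h <= ennreal (12 * (Z * (E2 * \<bar>s - t\<bar>)))"
    if st: "\<bar>s\<bar> < s0" "\<bar>t\<bar> < s0" and \<beta>: "0 < \<beta>" "\<beta> < 1" and h: "!!z. z \<in> strip ==> h z = U s z - U t z" for s t \<beta> h
  proof -
    have E12: "(K1 + K1\<^sup>2) * \<bar>s - t\<bar> <= E2 * \<bar>s - t\<bar>"
      using K1 K2 Z E(1) by (intro mult_right_mono) (auto simp: E2_def)
    have 1: "decay 6 (E2 * \<bar>s - t\<bar>) (\<lambda>k y. u s k y - u t k y)" by (rule decay_le[OF uK[OF st] E12])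
    have 2: "decay 4 (E2 * \<bar>s - t\<bar>) (e s t)" by (rule decay_le[OF ed[OF st] E12])
    have uc: "cont01 (u t k)" for k by (rule dirichlet_bvp_continuous[OF bvp[OF ss(1)[OF st(2)]]])
    have 3: "cont01 (e s t k)" for k
      unfolding e_def [abs_def] by (intro continuous_intros nc ss(1) st uc)
    have kk2: "decay 2 (K1 * \<bar>t\<bar>) (\<lambda>k y. real k * (real k * u t k y))" by (rule decay_mono[OF kkd[OF st(2)]]) simp
    have nd2: "decay 2 (K1 * \<bar>s - t\<bar>) (\<lambda>k y. n s k y - n t k y)"
      by (rule decay_mono[OF nl[OF ss(1)[OF st(1)] ss(1)[OF st(2)]]]) simp
    \<comment> \<open>The minus sign is due to the phase \<open>pi\<close> in
      \<open>Uxx\<close>.\<close>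
    have et: "tser 0 (e s t) z = (N s z - N t z) + - (lam s - lam t) * Uxx t z" if "z \<in> strip" for z
    proof -
      have "tser 0 (e s t) z = tser 0 (\<lambda>k y. n s k y - n t k y) z +
          tser 0 (\<lambda>k y. (lam s - lam t) * (real k * (real k * u t k y))) z"
        unfolding e_def [abs_def] by (rule tser_add[OF nd2 decay_scale[OF kk2] that])
      also have "tser 0 (\<lambda>k y. (lam s - lam t) * (real k * (real k * u t k y))) z =
          (lam s - lam t) * tser 0 (\<lambda>k y. real k * (real k * u t k y)) z"
        using tser_scale[OF kk2 that, of 0 "\<lambda>_. lam s - lam t"] by simp
      finally show ?thesis using N_diff[OF st that] tser_shift[OF kk2 that, of 0] by (simp add: Uxx_def algebra_simps)
    qed
    have xx: "bounded_lipschitz (Z * E1) (Uxx t)"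
    proof (rule bounded_lipschitz_mono)
      show "bounded_lipschitz (Z * (E1 * \<bar>t\<bar>)) (Uxx t)" using gw[OF st(2)] unfolding Pr_def by blast
      show "Z * (E1 * \<bar>t\<bar>) <= Z * E1"
        using mult_left_mono[OF ss(2)[OF st(2)], of "Z * E1"] Z E(1) by (simp add: mult.assoc)
    qed
    have 4: "bounded_lipschitz (E2 * \<bar>s - t\<bar>) (tser 0 (e s t))"
    proof (rule bounded_lipschitz_cong)
      have "bounded_lipschitz (K2 * \<bar>s - t\<bar> + \<bar>- (lam s - lam t)\<bar> * (Z * E1))
          (\<lambda>z. (N s z - N t z) + - (lam s - lam t) * Uxx t z)"
        by (intro bounded_lipschitz_add bounded_lipschitz_scale Nl st xx)
      moreover have "K2 * \<bar>s - t\<bar> + \<bar>- (lam s - lam t)\<bar> * (Z * E1) <= E2 * \<bar>s - t\<bar>"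
      proof -
        have "\<bar>- (lam s - lam t)\<bar> * (Z * E1) <= (K1 * \<bar>s - t\<bar>) * (Z * E1)"
          unfolding abs_minus_cancel using Z E(1) by (intro mult_right_mono ll ss st) auto
        moreover have "0 <= (K1 + K1\<^sup>2) * \<bar>s - t\<bar>" using K1 by simp
        moreover have "E2 * \<bar>s - t\<bar> = (K1 + K1\<^sup>2) * \<bar>s - t\<bar> + K2 * \<bar>s - t\<bar> + (K1 * \<bar>s - t\<bar>) * (Z * E1)"
          by (simp add: E2_def algebra_simps)
        ultimately show ?thesis by linarith
      qed
      ultimately show "bounded_lipschitz (E2 * \<bar>s - t\<bar>) (\<lambda>z. (N s z - N t z) + - (lam s - lam t) * Uxx t z)"
        by (rule bounded_lipschitz_mono)
    qed (simp add: et)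
    show ?thesis
    proof (rule C2_series[OF Qd Qb \<mu>[OF st(1)] K0(1) 1 2 3 diff_bvp[OF st] 4], assumption, assumption, assumption,
        fold Z_def, goal_cases)
      case (1 g)
      show ?case by (rule 1(3)[OF \<beta>]) (use h U_diff[OF st] in simp)
    qed
  qed
  \<comment> \<open>The remainder beyond the leading mode. Since \<open>\<phi>\<close> solves the
    unshifted equation, the shift leaves only the forcing \<open>lam s * s * \<phi>\<close> in mode
    1, which is of second order like \<open>n s\<close>.\<close>
  define v where "v s k y = u s k y - s * ph k y" for s k y
  have vd: "decay 6 (K1 * s\<^sup>2) (v s)" if s: "\<bar>s\<bar> < s0" for s
  proof -
    have "v s = (\<lambda>k y. u s k y - (if k = 1 then s * \<phi> y else 0))" by (auto simp: v_def ph_def fun_eq_iff)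
    then show ?thesis using u1[OF ss(1)[OF s]] by simp
  qed
  have ph2: "decay 2 (16 * \<Phi>) ph" by (rule decay_mono[OF phd(1)]) simp
  have ts_ph: "tser \<theta> (\<lambda>k y. real k * (real k * ph k y)) z = \<phi> (snd z) * cos (fst z + \<theta>)"
    "tser \<theta> (\<lambda>k y. real k * ph k y) z = \<phi> (snd z) * cos (fst z + \<theta>)"
    "tser \<theta> ph z = \<phi> (snd z) * cos (fst z + \<theta>)" for \<theta> z
  proof -
    have "(\<lambda>k y. real k * (real k * ph k y)) = (\<lambda>k y. if k = 1 then \<phi> y else 0)" "(\<lambda>k y. real k * ph k y) = (\<lambda>k y. if k = 1 then \<phi> y else 0)"
      "ph = (\<lambda>k y. if k = 1 then \<phi> y else 0)" by (auto simp: ph_def fun_eq_iff)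
    then show "tser \<theta> (\<lambda>k y. real k * (real k * ph k y)) z = \<phi> (snd z) * cos (fst z + \<theta>)"
      "tser \<theta> (\<lambda>k y. real k * ph k y) z = \<phi> (snd z) * cos (fst z + \<theta>)"
      "tser \<theta> ph z = \<phi> (snd z) * cos (fst z + \<theta>)"
      using tser_single[of \<theta> 1 \<phi> z] by simp_all
  qed
  have phk: "decay 2 (16 * \<Phi>) (\<lambda>k y. real k * ph k y)" "decay 2 (16 * \<Phi>) (\<lambda>k y. real k * (real k * ph k y))"
    using decay_times_k[OF phd(1), of 2 1] decay_times_k[OF phd(1), of 2 2] by (simp_all add: power2_eq_square mult.assoc)
  have uk: "decay 2 (K1 * \<bar>s\<bar>) (\<lambda>k y. real k * u s k y)" "decay 2 (K1 * \<bar>s\<bar>) (\<lambda>k y. real k * (real k * u s k y))"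
    if "\<bar>s\<bar> < s0" for s
    using decay_times_k[OF ud[OF that], of 2 1] decay_times_k[OF ud[OF that], of 2 2] by (simp_all add: power2_eq_square mult.assoc)
  have tv: "tser \<theta> (\<lambda>k y. p k y - s * q k y) z = tser \<theta> p z - s * tser \<theta> q z"
    if "decay 2 B p" "decay 2 B' q" "z \<in> strip" for \<theta> p q B B' z and s :: real
    using tser_diff[OF that(1) decay_scale[OF that(2)] that(3)] tser_scale[OF that(2,3), of \<theta> "\<lambda>_. s"] by simp
  have vk: "(\<lambda>k y. real k * v s k y) = (\<lambda>k y. real k * u s k y - s * (real k * ph k y))"
    "(\<lambda>k y. real k * (real k * v s k y)) = (\<lambda>k y. real k * (real k * u s k y) - s * (real k * (real k * ph k y)))"
    "v s = (\<lambda>k y. u s k y - s * ph k y)" for s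
    by (simp_all add: v_def fun_eq_iff algebra_simps)
  have tvU: "tser 0 (v s) z = U s z - s * \<phi> (snd z) * cos (fst z)"
    "tser (pi / 2) (\<lambda>k y. real k * v s k y) z = Ux s z + s * \<phi> (snd z) * sin (fst z)"
    "tser pi (\<lambda>k y. real k * (real k * v s k y)) z = Uxx s z + s * \<phi> (snd z) * cos (fst z)"
    if s: "\<bar>s\<bar> < s0" and z: "z \<in> strip" for s z
    unfolding vk(1,2) unfolding vk(3) using tv[OF ud2(1)[OF s] ph2 z, of 0 s] tv[OF uk(1)[OF s] phk(1) z, of "pi / 2" s]
      tv[OF uk(2)[OF s] phk(2) z, of pi s]
    by (simp_all add: ts_ph U_def Ux_def Uxx_def cos_add)
  have lead: "(\<forall>\<beta> h. 0 < \<beta> & \<beta> < 1 & (\<forall>z\<in>strip. h z = U s z - s * \<phi> (snd z) * cos (fst z)) -->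
          C2_holder_norm \<beta> h <= ennreal (12 * (Z * (E3 * s\<^sup>2)))) &
        (\<forall>z\<in>strip. \<bar>Uxx s z + s * \<phi> (snd z) * cos (fst z)\<bar> <= Z * (E3 * s\<^sup>2))"
    if s: "\<bar>s\<bar> < s0" for s
  proof -
    define e' where "e' k y = n s k y + (lam s * s) * ph k y" for k y
    have ls: "\<bar>lam s * s\<bar> <= K1 * s\<^sup>2"
    proof -
      have "\<bar>lam s\<bar> * \<bar>s\<bar> <= K1 * \<bar>s\<bar> * \<bar>s\<bar>" by (intro mult_right_mono lb ss s) auto
      then show ?thesis by (simp add: abs_mult power2_eq_square mult.assoc abs_mult_self_eq)
    qed
    have 1: "decay 6 (E3 * s\<^sup>2) (v s)"
      by (rule decay_le[OF vd[OF s]]) (use K1 K2 \<Phi> zeta2_pos in \<open>intro mult_right_mono, simp_all add: E3_def\<close>)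
    have 2: "decay 4 (E3 * s\<^sup>2) e'"
    proof (rule decay_le)
      show "decay 4 (K1 * s\<^sup>2 + \<bar>lam s * s\<bar> * (16 * \<Phi>)) e'" unfolding e'_def [abs_def]
        by (intro decay_add decay_scale phd decay_mono[OF n2[OF ss(1)[OF s]]]) simp
      have "\<bar>lam s * s\<bar> * (16 * \<Phi>) <= (K1 * s\<^sup>2) * (16 * \<Phi>)" using \<Phi> by (intro mult_right_mono ls) auto
      moreover have "0 <= K2 * s\<^sup>2" "0 <= K1 * (2 * ((16 * \<Phi>) * zeta2)) * s\<^sup>2" using K1 K2 \<Phi> zeta2_pos by simp_all
      moreover have "E3 * s\<^sup>2 = K1 * s\<^sup>2 + (K1 * s\<^sup>2) * (16 * \<Phi>) + K2 * s\<^sup>2 + K1 * (2 * ((16 * \<Phi>) * zeta2)) * s\<^sup>2"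
        by (simp add: E3_def algebra_simps)
      ultimately show "K1 * s\<^sup>2 + \<bar>lam s * s\<bar> * (16 * \<Phi>) <= E3 * s\<^sup>2" by linarith
    qed
    have 3: "cont01 (e' k)" for k
      unfolding e'_def [abs_def] by (intro continuous_intros nc ss s phc)
    have phb: "dirichlet_bvp (\<lambda>y. Q y + \<mu> s * (real k)\<^sup>2) (\<lambda>y. - lam s * ph k y) (ph k)" for k
    proof (cases "k = 1")
      case True
      have "dirichlet_bvp (\<lambda>y. Q y + \<alpha>\<^sup>2) (\<lambda>y. 0) \<phi>" unfolding dirichlet_bvp_def Q_def using \<phi> by blast
      then have "dirichlet_bvp (\<lambda>y. Q y + \<mu> s * (real k)\<^sup>2) (\<lambda>y. - lam s * \<phi> y) \<phi>"
        by (rule dirichlet_bvp_cong) (simp add: True \<mu>_def algebra_simps)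
      then show ?thesis using True by (simp add: ph_def [abs_def])
    next
      case False
      then show ?thesis by (auto simp: ph_def [abs_def] dirichlet_bvp_def linear_ode_def intro!: exI[of _ "\<lambda>_. 0"])
    qed
    have 4: "dirichlet_bvp (\<lambda>y. Q y + \<mu> s * (real k)\<^sup>2) (e' k) (v s k)" for k
    proof -
      have "dirichlet_bvp (\<lambda>y. Q y + \<mu> s * (real k)\<^sup>2) (\<lambda>y. n s k y - s * (- lam s * ph k y)) (\<lambda>y. u s k y - s * ph k y)"
        by (rule dirichlet_bvp_diff[OF _ dirichlet_bvp_scale[OF phb]]) (unfold \<mu>_def, rule bvp[OF ss(1)[OF s]])
      then have "dirichlet_bvp (\<lambda>y. Q y + \<mu> s * (real k)\<^sup>2) (e' k) (\<lambda>y. u s k y - s * ph k y)"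
        by (rule dirichlet_bvp_cong) (simp add: e'_def)
      then show ?thesis by (simp add: v_def [abs_def])
    qed
    have pl: "bounded_lipschitz (2 * ((16 * \<Phi>) * zeta2)) (tser 0 ph)"
      by (rule tser_lipschitz[OF decay_mono[OF phd(1)] decay_mono[OF phd(2)] phD]) simp_all
    have 5: "bounded_lipschitz (E3 * s\<^sup>2) (tser 0 e')"
    proof (rule bounded_lipschitz_cong)
      have "bounded_lipschitz (K2 * s\<^sup>2 + \<bar>lam s * s\<bar> * (2 * ((16 * \<Phi>) * zeta2))) (\<lambda>z. N s z + (lam s * s) * tser 0 ph z)"
        by (intro bounded_lipschitz_add bounded_lipschitz_scale Ns s pl)
      moreover have "K2 * s\<^sup>2 + \<bar>lam s * s\<bar> * (2 * ((16 * \<Phi>) * zeta2)) <= E3 * s\<^sup>2"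
      proof -
        have "\<bar>lam s * s\<bar> * (2 * ((16 * \<Phi>) * zeta2)) <= (K1 * s\<^sup>2) * (2 * ((16 * \<Phi>) * zeta2))"
          using \<Phi> zeta2_pos by (intro mult_right_mono ls) auto
        moreover have "0 <= K1 * s\<^sup>2" "0 <= (K1 * s\<^sup>2) * (16 * \<Phi>)" using K1 \<Phi> by simp_all
        moreover have "E3 * s\<^sup>2 = K1 * s\<^sup>2 + (K1 * s\<^sup>2) * (16 * \<Phi>) + K2 * s\<^sup>2 + (K1 * s\<^sup>2) * (2 * ((16 * \<Phi>) * zeta2))"
          by (simp add: E3_def algebra_simps)
        ultimately show ?thesis by linarith
      qed
      ultimately show "bounded_lipschitz (E3 * s\<^sup>2) (\<lambda>z. N s z + (lam s * s) * tser 0 ph z)" by (rule bounded_lipschitz_mono)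
      show "N s z + (lam s * s) * tser 0 ph z = tser 0 e' z" if "z \<in> strip" for z
        unfolding e'_def [abs_def] N_def
        using tser_add[OF ud2(2)[OF s] decay_scale[OF ph2] that, of 0 "lam s * s"]
          tser_scale[OF ph2 that, of 0 "\<lambda>_. lam s * s"] by simp
    qed
    show ?thesis
    proof (rule C2_series[OF Qd Qb \<mu>[OF s] K0(1) 1 2 3 4 5], assumption, assumption, assumption, fold Z_def, goal_cases)
      case (1 g)
      show ?case
      proof (intro conjI allI impI ballI)
        fix \<beta> :: real and h :: "real \<times> real => real" assume "0 < \<beta> & \<beta> < 1 & (\<forall>z\<in>strip. h z = U s z - s * \<phi> (snd z) * cos (fst z))"
        then show "C2_holder_norm \<beta> h <= ennreal (12 * (Z * (E3 * s\<^sup>2)))"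
          by (intro 1(3)) (auto simp: tvU(1)[OF s])
      next
        fix z assume z: "z \<in> strip"
        show "\<bar>Uxx s z + s * \<phi> (snd z) * cos (fst z)\<bar> <= Z * (E3 * s\<^sup>2)"
          using bounded_lipschitzD(1)[OF 1(5) z] unfolding tvU(3)[OF s z] .
      qed
    qed
  qed
  \<comment> \<open>Each sine in the differentiated remainder is bounded by
    \<open>k * \<bar>sin (fst z)\<bar>\<close>; the additional factor \<open>k\<close> is covered by
    the decay of the coefficients.\<close>
  have sinb: "\<bar>Ux s z + s * \<phi> (snd z) * sin (fst z)\<bar> <= K1 * zeta2 * s\<^sup>2 * \<bar>sin (fst z)\<bar>" if s: "\<bar>s\<bar> < s0" and z: "z \<in> strip" for s z
  proof -
    have b: "\<bar>real k * v s k (snd z) * cos (real k * fst z + pi / 2)\<bar> <= K1 * s\<^sup>2 * \<bar>sin (fst z)\<bar> * (1 / (1 + real k)\<^sup>2)" for k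
    proof -
      have d: "(1 + real k)\<^sup>2 * \<bar>(real k)\<^sup>2 * v s k (snd z)\<bar> <= K1 * s\<^sup>2"
        using decayD[OF decay_times_k[OF vd[OF s], of 2 2] snd_in[OF z], of k] by simp
      have "\<bar>real k * v s k (snd z) * cos (real k * fst z + pi / 2)\<bar> = real k * \<bar>v s k (snd z)\<bar> * \<bar>sin (real k * fst z)\<bar>"
        by (simp add: cos_add abs_mult)
      also have "\<dots> <= real k * \<bar>v s k (snd z)\<bar> * (real k * \<bar>sin (fst z)\<bar>)" by (intro mult_left_mono abs_sin_mult_le) auto
      also have "\<dots> = \<bar>(real k)\<^sup>2 * v s k (snd z)\<bar> * \<bar>sin (fst z)\<bar>" by (simp add: abs_mult power2_eq_square)
      also have "\<dots> <= K1 * s\<^sup>2 / (1 + real k)\<^sup>2 * \<bar>sin (fst z)\<bar>"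
      proof (rule mult_right_mono)
        show "\<bar>(real k)\<^sup>2 * v s k (snd z)\<bar> <= K1 * s\<^sup>2 / (1 + real k)\<^sup>2"
          using d by (subst pos_le_divide_eq) (auto simp: mult.commute)
      qed simp
      finally show ?thesis by simp
    qed
    have su: "summable (\<lambda>k. K1 * s\<^sup>2 * \<bar>sin (fst z)\<bar> * (1 / (1 + real k)\<^sup>2))" by (rule summable_mult[OF summable_zeta2])
    have nrm: "summable (\<lambda>k. norm (real k * v s k (snd z) * cos (real k * fst z + pi / 2)))"
      by (rule summable_comparison_test'[OF su, of 0]) (use b in simp)
    have "\<bar>tser (pi / 2) (\<lambda>k y. real k * v s k y) z\<bar> <= (\<Sum>k. norm (real k * v s k (snd z) * cos (real k * fst z + pi / 2)))"
      unfolding tser_def using summable_norm[OF nrm] by simp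
    also have "\<dots> <= (\<Sum>k. K1 * s\<^sup>2 * \<bar>sin (fst z)\<bar> * (1 / (1 + real k)\<^sup>2))"
      by (rule suminf_le[OF _ nrm su]) (use b in simp)
    also have "\<dots> = K1 * s\<^sup>2 * \<bar>sin (fst z)\<bar> * zeta2" unfolding zeta2_def by (rule suminf_mult[OF summable_zeta2])
    finally show ?thesis unfolding tvU(2)[OF s z] by (simp add: mult_ac)
  qed
  define K where "K = K1 + Z * E1 + 12 * (Z * E2) + 12 * (Z * E3) + K1 * zeta2"
  have nn: "0 <= Z * E1" "0 <= Z * E2" "0 <= Z * E3" "0 <= K1 * zeta2" using Z E K1 zeta2_pos by simp_all
  have K: "0 < K" "K1 <= K" "Z * E1 <= K" "12 * (Z * E2) <= K" "12 * (Z * E3) <= K" "Z * E3 <= K" "K1 * zeta2 <= K"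
    using nn K1 unfolding K_def by linarith+
  define Uy where "Uy s = tser 0 (g s)" for s
  define Uxy where "Uxy s = tser (pi / 2) (\<lambda>k y. real k * g s k y)" for s
  note gw' = gw[unfolded Pr_def, folded Uy_def Uxy_def]
  have up: "x * \<bar>s\<bar> <= K * \<bar>s\<bar>" "x * s\<^sup>2 <= K * s\<^sup>2" if "x <= K" for x s by (intro mult_right_mono that; simp)+
  have up1: "Z * (E1 * \<bar>s\<bar>) <= K * \<bar>s\<bar>" for s using up(1)[OF K(3)] by (simp add: mult.assoc)
  have part1: "\<bar>lam s - lam t\<bar> <= K * \<bar>s - t\<bar> &
       (\<forall>\<beta> h. 0 < \<beta> & \<beta> < 1 & (\<forall>z\<in>strip. h z = U s z - U t z) --> C2_holder_norm \<beta> h <= ennreal (K * \<bar>s - t\<bar>))"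
    if st: "\<bar>s\<bar> < s0 & \<bar>t\<bar> < s0" for s t
  proof (intro conjI allI impI)
    show "\<bar>lam s - lam t\<bar> <= K * \<bar>s - t\<bar>" using ll[of s t] ss(1) st up(1)[OF K(2), of "s - t"] by fastforce
    fix \<beta> :: real and h :: "real \<times> real => real" assume h: "0 < \<beta> & \<beta> < 1 & (\<forall>z\<in>strip. h z = U s z - U t z)"
    have "C2_holder_norm \<beta> h <= ennreal (12 * (Z * (E2 * \<bar>s - t\<bar>)))" by (rule lip) (use h st in auto)
    also have "\<dots> <= ennreal (K * \<bar>s - t\<bar>)" by (rule ennreal_leI) (use up(1)[OF K(4), of "s - t"] in \<open>simp add: mult.assoc\<close>)
    finally show "C2_holder_norm \<beta> h <= ennreal (K * \<bar>s - t\<bar>)" .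
  qed
  have pde: "(\<lambda>i. c (Suc i) (snd z) * U s z ^ Suc i) sums ((\<alpha>\<^sup>2 + lam s) * Uxx s z + w s z)"
    if s: "\<bar>s\<bar> < s0" and z: "z \<in> strip" for s z
  proof -
    have "(\<lambda>i. c (Suc i) (snd z) * U s z ^ Suc i) sums (N s z + c (Suc 0) (snd z) * U s z ^ Suc 0)"
      by (rule sums_Suc) (use nsz[OF s z] in simp)
    moreover have "w s z = Q (snd z) * U s z - \<mu> s * Uxx s z + N s z" using gw'[OF s] z by blast
    ultimately show ?thesis by (simp add: Q_def \<mu>_def add.commute)
  qed
  have per: "U s (x + 2 * pi, y) = U s (x, y)" "U s (- x, y) = U s (x, y)" for s x y
  proof -
    have "cos (real k * (x + 2 * pi)) = cos (real k * x)" for k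
    proof -
      have "real k * (x + 2 * pi) = real k * x + 2 * real k * pi" by (simp add: algebra_simps)
      then show ?thesis by (simp only: cos_add cos_2npi sin_2npi mult_1_right mult_zero_right diff_zero)
    qed
    then show "U s (x + 2 * pi, y) = U s (x, y)" "U s (- x, y) = U s (x, y)" by (simp_all add: U_def tser_def)
  qed
  have bc: "u s k 0 = 0" "u s k 1 = 0" if "\<bar>s\<bar> < s0" for s k
    using bvp[OF ss(1)[OF that], of k] unfolding dirichlet_bvp_def by auto
  show ?thesis
  proof (rule exI[of _ s0], rule exI[of _ K], rule exI[of _ lam], rule exI[of _ U], rule exI[of _ Ux], rule exI[of _ Uy],
      rule exI[of _ Uxx], rule exI[of _ Uxy], rule exI[of _ w], unfold wave_family_def,
      intro conjI allI impI, goal_cases)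
    case 1 show ?case by (rule s0)
  next
    case 2 show ?case by (rule K(1))
  next
    case (3 s t) then show ?case using part1[of s t] by blast
  next
    case (4 s t \<beta> h) then show ?case using part1[of s t] by blast
  next
    case (5 s) then show ?case using lb[OF ss(1)[of s]] up(1)[OF K(2), of s] by simp
  next
    case (15 s) then show ?case using gw'[of s] bounded_lipschitz_mono up1 by blast
  next
    case (16 s) then show ?case using gw'[of s] bounded_lipschitz_mono up1 by blast
  next
    case (17 s) then show ?case using gw'[of s] bounded_lipschitz_mono up1 by blast
  next
    case (18 s)
    show ?case
    proof (intro ballI conjI)
      fix z assume z: "z \<in> strip"
      have "bounded_lipschitz (Z * (E1 * \<bar>s\<bar>)) (U s)" using gw'[OF 18] by blast
      then show "\<bar>U s z\<bar> <= K * \<bar>s\<bar>" using bounded_lipschitzD(1) z up1[of s] by fastforce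
      have "\<bar>Ux s z\<bar> <= Z * (E1 * \<bar>s\<bar>)" "\<bar>Uy s z\<bar> <= Z * (E1 * \<bar>s\<bar>)" using gw'[OF 18] z by blast+
      then show "\<bar>Ux s z\<bar> <= K * \<bar>s\<bar>" "\<bar>Uy s z\<bar> <= K * \<bar>s\<bar>" using up1[of s] by linarith+
      show "\<bar>U s z\<bar> <= r / 2" using ur[OF ss(1)[OF 18] snd_in[OF z], of "fst z"] by (simp add: U_def)
      show "(\<lambda>i. c (Suc i) (snd z) * U s z ^ Suc i) sums ((\<alpha>\<^sup>2 + lam s) * Uxx s z + w s z)" by (rule pde[OF 18 z])
      show "\<bar>Ux s z + s * \<phi> (snd z) * sin (fst z)\<bar> <= K * s\<^sup>2 * \<bar>sin (fst z)\<bar>"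
        by (rule order_trans[OF sinb[OF 18 z]]) (intro mult_right_mono K(7); simp)
      have "\<bar>Uxx s z + s * \<phi> (snd z) * cos (fst z)\<bar> <= Z * (E3 * s\<^sup>2)" using lead[OF 18] z by blast
      then show "\<bar>Uxx s z + s * \<phi> (snd z) * cos (fst z)\<bar> <= K * s\<^sup>2" using up(2)[OF K(6), of s] by (simp add: mult.assoc)
    qed
  next
    case (19 s x)
    show ?case
    proof
      fix y :: real assume "y \<in> {0..1}"
      then show "U s (x, 1 - y) = U s (x, y)" using usym[OF ss(1)[OF 19]] by (simp add: U_def tser_def)
    qed
  next
    case (20 s x y) show ?case by (rule per)
  next
    case (21 s x y) show ?case by (rule per)
  next
    case (22 s x) then show ?case using bc[of s] by (simp add: U_def tser_def)
  next
    case (23 s x) then show ?case using bc[of s] by (simp add: U_def tser_def)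
  next
    case (24 s x) then show ?case using bc[of s] by (simp add: Ux_def tser_def)
  next
    case (25 s x) then show ?case using bc[of s] by (simp add: Ux_def tser_def)
  next
    case (26 s \<beta> h)
    then have "C2_holder_norm \<beta> h <= ennreal (12 * (Z * (E3 * s\<^sup>2)))" using lead[of s] by blast
    also have "\<dots> <= ennreal (K * s\<^sup>2)" by (rule ennreal_leI) (use up(2)[OF K(5), of s] in \<open>simp add: mult.assoc\<close>)
    finally show ?case .
  qed (use gw' in blast)+
qed

lemma tendsto_0_of_lipschitz_bound:
  fixes f :: "real => ennreal"
  assumes "\<forall>\<^sub>F t in at s. f t <= ennreal (K * \<bar>t - s\<bar>)"
  shows "(f \<longlongrightarrow> 0) (at s)"
proof (rule tendsto_sandwich[OF always_eventually assms tendsto_const])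
  have "((\<lambda>t. K * \<bar>t - s\<bar>) \<longlongrightarrow> K * \<bar>s - s\<bar>) (at s)" by (intro tendsto_intros)
  then show "((\<lambda>t. ennreal (K * \<bar>t - s\<bar>)) \<longlongrightarrow> 0) (at s)" using tendsto_ennrealI by fastforce
qed simp

text \<open>Joins the family of perturbations with the vorticity function: the first supplies the
  modes and estimates, the second identifies the summed equation as the vorticity equation and
  provides the pressure. The curve is parametrised by the square of the wave number, where the shift
  \<open>lam\<close> is additive.\<close>

theorem bifurcation_of_cats_eyes:
  fixes A \<beta> \<alpha> :: real and \<phi> \<phi>' :: "real => real" and n :: nat
  assumes A: "0 < A" "A < 1 / (4 * pi)" and n: "1 <= n" and \<beta>: "0 < \<beta>" "\<beta> < 1" and \<alpha>: "0 < \<alpha>"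
    and \<phi>: "linear_ode (\<lambda>y. Qpot A n y + \<alpha>\<^sup>2) (\<lambda>y. 0) \<phi> \<phi>'" "\<phi> 0 = 0" "\<phi> 1 = 0" "!!y. y \<in> {0<..<1} ==> 0 < \<phi> y"
    and nr: "!!m a. \<alpha>\<^sup>2 < m ==> dirichlet_bvp (\<lambda>y. Qpot A n y + m) (\<lambda>y. 0) a ==> \<forall>y\<in>{0..1}. a y = 0"
  shows "\<exists>s0>0. \<exists>\<alpha>s \<psi>. bifurcation_curve A n \<beta> \<alpha> s0 \<alpha>s \<psi> & leading_order A n \<beta> \<phi> \<psi> &
    (\<forall>s. s \<noteq> 0 & \<bar>s\<bar> < s0 --> (\<exists>\<delta>. 0 < \<delta> & \<delta> <= 1 / 2 & cats_eyes \<delta> (rel_stream (\<psi> s)))) &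
    (\<forall>\<delta>. 0 < \<delta> & \<delta> <= 1 / 2 --> (\<forall>\<^sub>F s in at 0. cats_eyes \<delta> (rel_stream (\<psi> s))))"
proof -
  obtain F H c c' r M where r: "0 < r" and M: "0 < M"
    and c: "!!i y. y \<in> {0..1} ==> (c i has_real_derivative c' i y) (at y within {0..1})"
    and cb: "!!i y. y \<in> {0..1} ==> \<bar>c i y\<bar> <= M / r ^ i" "!!i y. y \<in> {0..1} ==> \<bar>c' i y\<bar> <= M / r ^ i"
    and csym: "!!i y. c i (1 - y) = c i y"
    and c0: "!!y. y \<in> {0..1} ==> c 0 y = 1 + 4 * pi * A * cos (4 * real n * pi * y)"
    and c1: "!!y. y \<in> {0..1} ==> c 1 y = Qpot A n y"
    and F: "!!y h. y \<in> {0..1} ==> \<bar>h\<bar> < r ==> (\<lambda>i. c i y * h ^ i) sums F (psi0 A n y + h)"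
    and H: "!!y h. y \<in> {0..1} ==> \<bar>h\<bar> < r ==> (H has_real_derivative F (psi0 A n y + h)) (at (psi0 A n y + h))"
  proof (rule vorticity_function[OF A n], goal_cases)
    case (1 F H c c' r M)
    show ?case
      by (rule that[where r = r and M = M and c = c and c' = c' and F = F and H = H]) (fact 1)+
  qed
  define \<kappa> where "\<kappa> = 4 * real n * pi"
  define w where "w y = shear A n y - 1 / 2" for y
  define w1 where "w1 y = 1 + A / real n * (cos (4 * real n * pi * y) * (4 * real n * pi))" for y
  define w2 where "w2 y = - (A / real n * (sin (4 * real n * pi * y) * (4 * real n * pi) * (4 * real n * pi)))" for y
  have w1c: "w1 y = c 0 y" if "y \<in> {0..1}" for y using n c0[OF that] by (simp add: w1_def)
  have wd: "(w has_real_derivative w1 y) (at y within {0..1})" "(w1 has_real_derivative w2 y) (at y within {0..1})" for y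
    using derivative_shear[where A = A and n = n and y = y]
    by (auto simp: w_def [abs_def] w1_def [abs_def] w2_def intro!: derivative_eq_intros intro: DERIV_subset)
  have cc: "cont01 (c 1)" by (rule DERIV_continuous_on[OF c])
  have wode: "linear_ode (c 1) (\<lambda>y. 0) w w1"
    unfolding linear_ode_def
  proof (intro ballI conjI)
    fix y :: real assume y: "y \<in> {0..1}"
    show "(w has_real_derivative w1 y) (at y within {0..1})" by (rule wd)
    have "c 1 y * w y + 0 = w2 y" using shear_rayleigh[OF A n, of y] c1[OF y] unfolding deriv2_shear by (simp add: w_def w2_def)
    then show "(w1 has_real_derivative c 1 y * w y + 0) (at y within {0..1})" using wd(2)[of y] by simp
  qed
  have w_half: "w (1 / 2) = 0"
  proof -
    have "sin (4 * real n * pi * (1 / 2)) = sin (2 * real n * pi)" by (simp add: algebra_simps)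
    then have "sin (4 * real n * pi * (1 / 2)) = 0" by (simp add: sin_2npi)
    then show ?thesis unfolding w_def shear_def by simp
  qed
  have \<phi>c: "linear_ode (\<lambda>y. c 1 y + \<alpha>\<^sup>2) (\<lambda>y. 0) \<phi> \<phi>'" by (rule linear_ode_cong[OF \<phi>(1)]) (simp add: c1 del: One_nat_def)
  have nr0: "\<forall>y\<in>{0..1}. a y = 0" if "dirichlet_bvp (c 1) (\<lambda>y. 0) a" for a
  proof (rule no_zero_mode[OF cc wode w_half _ _ \<phi>c \<phi>(2,3,4) that])
    show "w y \<noteq> 0" if "y \<noteq> 1 / 2" for y using shear_centre[OF A n that] by (simp add: w_def)
  qed (use \<alpha> in simp_all)
  have nrc: "\<forall>y\<in>{0..1}. a y = 0" if "\<alpha>\<^sup>2 < m" "dirichlet_bvp (\<lambda>y. c 1 y + m) (\<lambda>y. 0) a" for m a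
    by (rule nr[OF that(1) dirichlet_bvp_cong[OF that(2)]]) (simp add: c1 del: One_nat_def)
  have "\<exists>s0 K lam U Ux Uy Uxx Uxy Uyy. wave_family c r \<alpha> \<phi> s0 K lam U Ux Uy Uxx Uxy Uyy"
    by (rule bifurcating_series[where c' = c' and M = M and \<phi>' = \<phi>', OF c r M cb csym \<alpha> \<phi>c \<phi>(2,3,4) nr0 nrc])
  then obtain s1 K lam U Ux Uy Uxx Uxy Uyy where "wave_family c r \<alpha> \<phi> s1 K lam U Ux Uy Uxx Uxy Uyy" by blast
  note W = this[unfolded wave_family_def]
  have s1: "0 < s1" and K: "0 < K" using W by blast+
  note L = W[THEN conjunct2, THEN conjunct2, THEN conjunct1, THEN spec, THEN spec, THEN mp]
  note P = W[THEN conjunct2, THEN conjunct2, THEN conjunct2, THEN spec, THEN mp]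
  have lamb: "\<bar>lam s\<bar> <= K * \<bar>s\<bar>" and Up: "has_partials (U s) (Ux s) (Uy s)" "has_partials (Ux s) (Uxx s) (Uxy s)"
      "has_partials (Uy s) (Uxy s) (Uyy s)"
    and Uc: "continuous_on strip (U s)" "continuous_on strip (Ux s)" "continuous_on strip (Uy s)"
       "continuous_on strip (Uxx s)" "continuous_on strip (Uxy s)" "continuous_on strip (Uyy s)"
    and Ul: "bounded_lipschitz (K * \<bar>s\<bar>) (Uxx s)" "bounded_lipschitz (K * \<bar>s\<bar>) (Uxy s)" "bounded_lipschitz (K * \<bar>s\<bar>) (Uyy s)"
    if "\<bar>s\<bar> < s1" for s using P[OF that] by blast+
  have Ub: "\<bar>U s z\<bar> <= K * \<bar>s\<bar>" "\<bar>Ux s z\<bar> <= K * \<bar>s\<bar>" "\<bar>Uy s z\<bar> <= K * \<bar>s\<bar>" "\<bar>U s z\<bar> <= r / 2"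
    and Us: "(\<lambda>i. c (Suc i) (snd z) * U s z ^ Suc i) sums ((\<alpha>\<^sup>2 + lam s) * Uxx s z + Uyy s z)"
    and Ue: "\<bar>Ux s z + s * \<phi> (snd z) * sin (fst z)\<bar> <= K * s\<^sup>2 * \<bar>sin (fst z)\<bar>"
      "\<bar>Uxx s z + s * \<phi> (snd z) * cos (fst z)\<bar> <= K * s\<^sup>2"
    if "\<bar>s\<bar> < s1" "z \<in> strip" for s z using P[OF that(1)] that(2) by blast+
  have Usym: "y \<in> {0..1} ==> U s (x, 1 - y) = U s (x, y)" and Uper: "U s (x + 2 * pi, y) = U s (x, y)" "U s (- x, y) = U s (x, y)"
    and Ubc: "U s (x, 0) = 0" "U s (x, 1) = 0" "Ux s (x, 0) = 0" "Ux s (x, 1) = 0"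
    if "\<bar>s\<bar> < s1" for s x y using P[OF that] by blast+
  have Uld: "C2_holder_norm \<beta> h <= ennreal (K * s\<^sup>2)"
    if "\<bar>s\<bar> < s1" "!!z. z \<in> strip ==> h z = U s z - s * \<phi> (snd z) * cos (fst z)" for s h
    using P[OF that(1)] that(2) \<beta> by blast
  \<comment> \<open>Adding half of \<open>y\<close> undoes the passage to the moving frame.\<close>
  define \<psi> where "\<psi> s z = psi0 A n (snd z) + snd z / 2 + U s z" for s z
  define \<alpha>s where "\<alpha>s s = sqrt (\<alpha>\<^sup>2 + lam s)" for s
  have rel: "rel_stream (\<psi> s) = (\<lambda>z. psi0 A n (snd z) + U s z)" for s
    by (auto simp: rel_stream_def \<psi>_def)
  define good where "good \<delta> t \<longleftrightarrow> 0 < t & t <= s1 & (\<forall>s. s \<noteq> 0 & \<bar>s\<bar> < t --> cats_eyes \<delta> (rel_stream (\<psi> s)))" for \<delta> t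
  have eyes: "\<exists>t. good \<delta> t" if \<delta>: "0 < \<delta>" "\<delta> <= 1 / 2" for \<delta>
  proof -
    have A1: "0 < 1 - 4 * pi * A" using A by (simp add: field_simps)
    have b: "0 < \<phi> (1 / 2)" by (rule \<phi>(4)) simp
    \<comment> \<open>The three entries secure the sign of the \<xi>-derivative on the axis,
      convexity in \<open>y\<close>, and that the separatrices stay within the band.\<close>
    define q where "q = min (\<phi> (1 / 2)) (min (1 - 4 * pi * A) (1 / 4 * (\<delta> / 2)\<^sup>2))"
    have q: "0 < q" "q <= \<phi> (1 / 2)" "q <= 1 - 4 * pi * A" "q <= 1 / 4 * (\<delta> / 2)\<^sup>2"
    proof -
      show "0 < q" using A1 b \<delta> by (simp add: q_def)
      show "q <= \<phi> (1 / 2)" unfolding q_def by (rule min.cobounded1)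
      show "q <= 1 - 4 * pi * A" unfolding q_def by (rule min.coboundedI2) (rule min.cobounded1)
      show "q <= 1 / 4 * (\<delta> / 2)\<^sup>2" unfolding q_def by (rule min.coboundedI2) (rule min.cobounded2)
    qed
    define t where "t = min s1 (q / K)"
    have "good \<delta> t" unfolding good_def
    proof (intro conjI allI impI)
      show "0 < t" "t <= s1" using s1 q K by (simp_all add: t_def)
      fix s assume "s \<noteq> 0 & \<bar>s\<bar> < t"
      then have s: "s \<noteq> 0" "\<bar>s\<bar> < s1" "\<bar>s\<bar> < q / K" by (simp_all add: t_def)
      have sK: "K * \<bar>s\<bar> < q" using s(3) K by (simp add: field_simps)
      show "cats_eyes \<delta> (rel_stream (\<psi> s))" unfolding rel
      proof (rule cats_eyes_perturbation[OF A n \<delta> Up[OF s(2)] Uc(1)[OF s(2)] Usym[OF s(2)] Uper[OF s(2)] s(1),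
            where K = K and b = "\<phi> (1 / 2)"], assumption)
        show "K * \<bar>s\<bar> < \<phi> (1 / 2)" "K * \<bar>s\<bar> < 1 - 4 * pi * A" "2 * K * \<bar>s\<bar> < 1 / 2 * (\<delta> / 2)\<^sup>2"
          using sK q by linarith+
        show "\<bar>U s z\<bar> <= K * \<bar>s\<bar>" if "z \<in> strip" for z by (rule Ub(1)[OF s(2) that])
        show "\<bar>Uyy s z\<bar> <= K * \<bar>s\<bar>" if "z \<in> strip" for z by (rule bounded_lipschitzD(1)[OF Ul(3)[OF s(2)] that])
        show "\<bar>Ux s (x, 1 / 2) + s * \<phi> (1 / 2) * sin x\<bar> <= K * s\<^sup>2 * \<bar>sin x\<bar>"
          "\<bar>Uxx s (x, 1 / 2) + s * \<phi> (1 / 2) * cos x\<bar> <= K * s\<^sup>2" for x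
          using Ue[OF s(2), of "(x, 1 / 2)"] by simp_all
      qed
    qed
    then show ?thesis by blast
  qed
  \<comment> \<open>The threshold for the widest band fixes one range in which every nonzero
    parameter shows cat's eyes; a narrower band may need smaller parameters.\<close>
  then obtain t0 where t0: "good (1 / 2) t0" by (meson half_gt_zero_iff order_refl zero_less_one)
  \<comment> \<open>The second entry keeps \<open>\<alpha>\<^sup>2 + lam s\<close> positive, so that
    its root is a wave number.\<close>
  define s0 where "s0 = min t0 (\<alpha>\<^sup>2 / (2 * K))"
  have s0: "0 < s0" using t0 \<alpha> K by (simp add: s0_def good_def)
  have ss: "\<bar>s\<bar> < s1" "0 < \<alpha>\<^sup>2 + lam s" if "\<bar>s\<bar> < s0" for s
  proof -
    show 1: "\<bar>s\<bar> < s1" using that t0 by (simp add: s0_def good_def)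
    have "K * \<bar>s\<bar> < \<alpha>\<^sup>2 / 2" using that K by (simp add: s0_def field_simps)
    moreover have "0 < \<alpha>\<^sup>2" using \<alpha> by simp
    ultimately show "0 < \<alpha>\<^sup>2 + lam s" using lamb[OF 1] by linarith
  qed
  define \<psi>y where "\<psi>y s z = shear A n (snd z) + Uy s z" for s z
  define \<psi>yy where "\<psi>yy s z = w1 (snd z) + Uyy s z" for s z
  have base: "has_partials (\<lambda>z. psi0 A n (snd z) + snd z / 2) (\<lambda>z. 0) (\<lambda>z. shear A n (snd z))"
    by (rule has_partials_snd, rule DERIV_subset[of _ _ _ UNIV])
       (auto intro!: derivative_eq_intros derivative_psi0[OF n])
  have base2: "has_partials (\<lambda>z. shear A n (snd z)) (\<lambda>z. 0) (\<lambda>z. w1 (snd z))"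
    unfolding w1_def by (rule has_partials_snd, rule DERIV_subset[of _ _ _ UNIV], rule derivative_shear(1), simp)
  have p1: "has_partials (\<psi> s) (Ux s) (\<psi>y s)" and p3: "has_partials (\<psi>y s) (Uxy s) (\<psi>yy s)" if "\<bar>s\<bar> < s1" for s
    using has_partials_add[OF base Up(1)[OF that]] has_partials_add[OF base2 Up(3)[OF that]]
    by (simp_all add: \<psi>_def [abs_def] \<psi>y_def [abs_def] \<psi>yy_def [abs_def])
  have bc: "cont01 (\<lambda>y. psi0 A n y + y / 2)" "cont01 (shear A n)" "cont01 w1" "cont01 w2"
    unfolding psi0_def [abs_def] phi_star_def [abs_def] shear_def [abs_def] w1_def [abs_def] w2_def [abs_def]
    by (intro continuous_intros; simp)+
  have snd_c: "continuous_on strip (\<lambda>z. g (snd z))" if "cont01 g" for g :: "real => real"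
    by (rule continuous_on_compose2[OF that]) (auto intro!: continuous_intros simp: strip_def)
  have \<psi>c: "continuous_on strip (\<psi> s)" "continuous_on strip (\<psi>y s)" "continuous_on strip (\<psi>yy s)" if "\<bar>s\<bar> < s1" for s
    unfolding \<psi>_def [abs_def] \<psi>y_def [abs_def] \<psi>yy_def [abs_def]
    by (intro continuous_on_add snd_c[OF bc(1)] snd_c[OF bc(2)] snd_c[OF bc(3)] Uc that)+
  have hol: "C2_holder \<beta> (\<psi> s)" if s: "\<bar>s\<bar> < s1" for s
  proof -
    have ck: "Ck_strip 2 (\<psi> s)"
      unfolding numeral_2_eq_2
      by (rule Ck_strip_SucI[OF p1[OF s] \<psi>c(1)[OF s] Ck_strip_SucI[OF Up(2)[OF s] Uc(2)[OF s]] Ck_strip_SucI[OF p3[OF s] \<psi>c(2)[OF s]]])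
         (simp_all add: Uc[OF s] \<psi>c[OF s])
    obtain B1 where B1: "0 < B1" "!!y. y \<in> {0..1} ==> \<bar>psi0 A n y + y / 2\<bar> <= B1" by (rule bounded_abs_on_unit_interval[OF bc(1)]) (rule that)
    obtain B2 where B2: "0 < B2" "!!y. y \<in> {0..1} ==> \<bar>shear A n y\<bar> <= B2" by (rule bounded_abs_on_unit_interval[OF bc(2)]) (rule that)
    obtain B3 where B3: "0 < B3" "!!y. y \<in> {0..1} ==> \<bar>w1 y\<bar> <= B3" by (rule bounded_abs_on_unit_interval[OF bc(3)]) (rule that)
    obtain B4 where B4: "0 < B4" "!!y. y \<in> {0..1} ==> \<bar>w2 y\<bar> <= B4" by (rule bounded_abs_on_unit_interval[OF bc(4)]) (rule that)
    define B where "B = (B1 + B2 + B3 + B4) + K * \<bar>s\<bar>"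
    have BK: "K * \<bar>s\<bar> <= B" "B1 + K * \<bar>s\<bar> <= B" "B2 + K * \<bar>s\<bar> <= B" using B1 B2 B3 B4 by (simp_all add: B_def)
    have snd_in: "snd z \<in> {0..1}" if "z \<in> strip" for z :: "real \<times> real" using that by (auto simp: strip_def)
    have "C2_holder_norm \<beta> (\<psi> s) <= ennreal (12 * B)"
    proof (rule C2_holder_norm_le[OF p1[OF s] Up(2)[OF s] p3[OF s] _ _ _ _ _ _ \<beta>])
      fix z :: "real \<times> real" assume z: "z \<in> strip"
      show "\<bar>\<psi> s z\<bar> <= B" using B1(2)[OF snd_in[OF z]] Ub(1)[OF s z] BK(2) unfolding \<psi>_def by linarith
      show "\<bar>Ux s z\<bar> <= B" using Ub(2)[OF s z] BK(1) by linarith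
      show "\<bar>\<psi>y s z\<bar> <= B" using B2(2)[OF snd_in[OF z]] Ub(3)[OF s z] BK(3) unfolding \<psi>y_def by linarith
    next
      show "bounded_lipschitz B (Uxx s)" "bounded_lipschitz B (Uxy s)"
        by (rule bounded_lipschitz_mono[OF Ul(1)[OF s] BK(1)], rule bounded_lipschitz_mono[OF Ul(2)[OF s] BK(1)])
      have "bounded_lipschitz (B1 + B2 + B3 + B4) (\<lambda>z. w1 (snd z))"
        by (rule bounded_lipschitz_snd[OF wd(2)]) (use B1 B2 B3 B4 in \<open>fastforce+\<close>)
      then show "bounded_lipschitz B (\<psi>yy s)" unfolding \<psi>yy_def [abs_def] B_def
        by (rule bounded_lipschitz_add[OF _ Ul(3)[OF s]])
    qed
    also have "\<dots> < \<infinity>" by simp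
    finally show ?thesis using ck unfolding C2_holder_def by blast
  qed
  have euler: "euler_stream (travelling (\<alpha>s s) (\<psi> s))" if s: "\<bar>s\<bar> < s0" for s
  proof (rule euler_stream_travelling[OF p1[OF ss(1)[OF s]] Up(2)[OF ss(1)[OF s]] p3[OF ss(1)[OF s]]
        \<psi>c(1)[OF ss(1)[OF s]] Uc(2)[OF ss(1)[OF s]] \<psi>c(2)[OF ss(1)[OF s]] Uc(4)[OF ss(1)[OF s]] Uc(5)[OF ss(1)[OF s]]
        \<psi>c(3)[OF ss(1)[OF s]], where F = F and H = H])
    have e: "\<psi> s z - snd z / 2 = psi0 A n (snd z) + U s z" for z by (simp add: \<psi>_def)
    fix z :: "real \<times> real" assume z: "z \<in> strip"
    have y: "snd z \<in> {0..1}" using z by (auto simp: strip_def)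
    have Ur: "\<bar>U s z\<bar> < r" using Ub(4)[OF ss(1)[OF s] z] r by linarith
    show "(H has_real_derivative F (\<psi> s z - snd z / 2)) (at (\<psi> s z - snd z / 2))" unfolding e by (rule H[OF y Ur])
    \<comment> \<open>Prepending the term of order zero, which is the vorticity of the shear,
      completes the Taylor series of \<open>F\<close>.\<close>
    have "(\<lambda>i. c i (snd z) * U s z ^ i) sums (((\<alpha>\<^sup>2 + lam s) * Uxx s z + Uyy s z) + c 0 (snd z) * U s z ^ 0)"
      by (rule sums_Suc[OF Us[OF ss(1)[OF s] z]])
    then have "F (psi0 A n (snd z) + U s z) = (\<alpha>\<^sup>2 + lam s) * Uxx s z + Uyy s z + c 0 (snd z)"
      using sums_unique2[OF F[OF y Ur]] by simp
    moreover have "(\<alpha>s s)\<^sup>2 = \<alpha>\<^sup>2 + lam s" using ss(2)[OF s] by (simp add: \<alpha>s_def)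
    ultimately show "(\<alpha>s s)\<^sup>2 * Uxx s z + \<psi>yy s z = F (\<psi> s z - snd z / 2)"
      unfolding e \<psi>yy_def using w1c[OF y] by simp
  qed (rule Ubc[OF ss(1)[OF s]])+
  have z0: "\<bar>0 :: real\<bar> < s0" using s0 by simp
  have U0: "U 0 z = 0" if "z \<in> strip" for z using Ub(1)[OF ss(1)[OF z0] that] by simp
  have lam0: "lam 0 = 0" using lamb[OF ss(1)[OF z0]] by simp
  have P0: "has_partials (\<psi> 0) (\<lambda>z. 0) (\<lambda>z. shear A n (snd z))"
    by (rule has_partials_cong[OF base]) (simp_all add: \<psi>_def U0)
  have curve: "bifurcation_curve A n \<beta> \<alpha> s0 \<alpha>s \<psi>"
    unfolding bifurcation_curve_def
  proof (intro conjI ballI allI)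
    have "continuous_on {- s0<..<s0} lam"
    proof (rule continuous_onI)
      fix s e :: real assume s: "s \<in> {- s0<..<s0}" and e: "0 < e"
      show "\<exists>d>0. \<forall>t\<in>{- s0<..<s0}. dist t s < d --> dist (lam t) (lam s) <= e"
      proof (intro exI[of _ "e / K"] conjI ballI impI)
        show "0 < e / K" using e K by simp
        fix t assume t: "t \<in> {- s0<..<s0}" "dist t s < e / K"
        have "\<bar>lam t - lam s\<bar> <= K * \<bar>t - s\<bar>" using L[of t s] ss(1)[of t] ss(1)[of s] s t by (auto simp: abs_less_iff)
        also have "\<dots> <= K * (e / K)" using t(2) K by (intro mult_left_mono) (auto simp: dist_real_def)
        finally show "dist (lam t) (lam s) <= e" using K by (simp add: dist_real_def)
      qed
    qed
    then show "continuous_on {- s0<..<s0} \<alpha>s" unfolding \<alpha>s_def [abs_def] by (intro continuous_intros)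
    show "\<alpha>s 0 = \<alpha>" using \<alpha> by (simp add: \<alpha>s_def lam0)
    show "rel_stream (\<psi> 0) z = rel_stream_shear A n z" if "z \<in> strip" for z
      using U0[OF that] by (simp add: rel rel_stream_shear_def case_prod_beta psi0_def)
    show "D2 (\<psi> 0) z = shear A n (snd z)" "D1 (\<psi> 0) z = 0" if "z \<in> strip" for z
      using has_partials_D1_D2[OF P0 that] by simp_all
    fix s assume "s \<in> {- s0<..<s0}"
    then have s: "\<bar>s\<bar> < s0" by auto
    show "((\<lambda>t. C2_holder_norm \<beta> (\<lambda>z. \<psi> t z - \<psi> s z)) \<longlongrightarrow> 0) (at s)"
    proof (rule tendsto_0_of_lipschitz_bound)
      have "\<forall>\<^sub>F t in nhds s. t \<in> {- s0<..<s0}" by (rule eventually_nhds_in_open) (use s in auto)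
      then have "\<forall>\<^sub>F t in at s. t \<in> {- s0<..<s0}" by (rule eventually_nhds_conv_at[THEN iffD1, THEN conjunct1])
      then show "\<forall>\<^sub>F t in at s. C2_holder_norm \<beta> (\<lambda>z. \<psi> t z - \<psi> s z) <= ennreal (K * \<bar>t - s\<bar>)"
      proof eventually_elim
        case (elim t)
        then have "\<bar>t\<bar> < s1 & \<bar>s\<bar> < s1" using ss(1) s by auto
        from L[OF this] show ?case using \<beta> by (simp add: \<psi>_def)
      qed
    qed
    show "0 < \<alpha>s s" using ss(2)[OF s] by (simp add: \<alpha>s_def)
    show "C2_holder \<beta> (\<psi> s)" by (rule hol[OF ss(1)[OF s]])
    show "\<psi> s (\<xi> + 2 * pi, y) = \<psi> s (\<xi>, y)" "\<psi> s (- \<xi>, y) = \<psi> s (\<xi>, y)" for \<xi> y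
      using Uper[OF ss(1)[OF s]] by (simp_all add: \<psi>_def)
    show "\<exists>c. \<forall>\<xi>. \<psi> s (\<xi>, 0) = c" "\<exists>c. \<forall>\<xi>. \<psi> s (\<xi>, 1) = c"
      using Ubc[OF ss(1)[OF s]] by (auto simp: \<psi>_def)
    show "euler_stream (travelling (\<alpha>s s) (\<psi> s))" by (rule euler[OF s])
  qed
  have lead: "leading_order A n \<beta> \<phi> \<psi>"
    unfolding leading_order_def
  proof (intro allI impI)
    fix \<epsilon> :: real assume \<epsilon>: "0 < \<epsilon>"
    define d where "d = min s0 (\<epsilon> / K)"
    have d: "0 < d" using s0 \<epsilon> K by (simp add: d_def)
    have "C2_holder_norm \<beta> (\<lambda>(\<xi>, y). rel_stream (\<psi> s) (\<xi>, y) - (rel_stream_shear A n (\<xi>, y) + s * \<phi> y * cos \<xi>))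
        <= ennreal (\<epsilon> * \<bar>s\<bar>)" if s: "\<bar>s\<bar> < d" for s
    proof -
      have s': "\<bar>s\<bar> < s0" using s by (simp add: d_def)
      have "C2_holder_norm \<beta> (\<lambda>(\<xi>, y). rel_stream (\<psi> s) (\<xi>, y) - (rel_stream_shear A n (\<xi>, y) + s * \<phi> y * cos \<xi>))
          <= ennreal (K * s\<^sup>2)"
        by (rule Uld[OF ss(1)[OF s']]) (simp add: rel rel_stream_shear_def psi0_def case_prod_beta)
      also have "\<dots> <= ennreal (\<epsilon> * \<bar>s\<bar>)"
      proof (rule ennreal_leI)
        have "K * \<bar>s\<bar> <= \<epsilon>" using s K by (simp add: d_def field_simps)
        then have "K * \<bar>s\<bar> * \<bar>s\<bar> <= \<epsilon> * \<bar>s\<bar>" by (rule mult_right_mono) simp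
        then show "K * s\<^sup>2 <= \<epsilon> * \<bar>s\<bar>" by (simp add: power2_eq_square mult.assoc abs_mult_self_eq)
      qed
      finally show ?thesis .
    qed
    then show "\<forall>\<^sub>F s in at 0. C2_holder_norm \<beta> (\<lambda>(\<xi>, y). rel_stream (\<psi> s) (\<xi>, y)
        - (rel_stream_shear A n (\<xi>, y) + s * \<phi> y * cos \<xi>)) <= ennreal (\<epsilon> * \<bar>s\<bar>)"
      unfolding eventually_at using d by (intro exI[of _ d]) (auto simp: dist_real_def)
  qed
  have ev: "\<forall>\<^sub>F s in at 0. cats_eyes \<delta> (rel_stream (\<psi> s))" if "0 < \<delta>" "\<delta> <= 1 / 2" for \<delta>
  proof -
    obtain t where "good \<delta> t" using eyes \<open>0 < \<delta>\<close> \<open>\<delta> <= 1 / 2\<close> by blast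
    then show ?thesis unfolding eventually_at good_def by (intro exI[of _ t]) (auto simp: dist_real_def)
  qed
  have each: "\<exists>\<delta>. 0 < \<delta> & \<delta> <= 1 / 2 & cats_eyes \<delta> (rel_stream (\<psi> s))" if "s \<noteq> 0 & \<bar>s\<bar> < s0" for s
    using t0 that by (intro exI[of _ "1 / 2"]) (auto simp: good_def s0_def)
  show ?thesis using s0 curve lead ev each by blast
qed

theorem theorem5p1:
  fixes A :: real
  assumes "1 / 2 * (1 / (4 * pi)) < A" and "A < 1 / (4 * pi)"
  shows "\<exists>c0>0. \<forall>n::nat. n \<ge> 1 \<longrightarrow>
    (\<exists>\<alpha>n>0.
       lowest_dirichlet_eigenvalue (Qpot A n) (- (\<alpha>n\<^sup>2)) \<and>
       c0 * real n \<le> \<alpha>n \<and>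
       (\<exists>\<phi>. dirichlet_eigenfunction (Qpot A n) (- (\<alpha>n\<^sup>2)) \<phi> \<and> (\<forall>y\<in>{0<..<1}. 0 < \<phi> y)) \<and>
       (\<forall>\<phi>. dirichlet_eigenfunction (Qpot A n) (- (\<alpha>n\<^sup>2)) \<phi> \<and> (\<forall>y\<in>{0<..<1}. 0 < \<phi> y) \<longrightarrow>
          (\<forall>\<beta>. 0 < \<beta> \<and> \<beta> < 1 \<longrightarrow>
             (\<exists>s0>0. \<exists>\<alpha> \<psi>.
                bifurcation_curve A n \<beta> \<alpha>n s0 \<alpha> \<psi> \<and>
                leading_order A n \<beta> \<phi> \<psi> \<and>
                (\<forall>s. s \<noteq> 0 \<and> \<bar>s\<bar> < s0 \<longrightarrow>
                   (\<exists>\<delta>. 0 < \<delta> \<and> \<delta> \<le> 1 / 2 \<and> cats_eyes \<delta> (rel_stream (\<psi> s)))) \<and>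
                (\<forall>\<delta>. 0 < \<delta> \<and> \<delta> \<le> 1 / 2 \<longrightarrow>
                   (\<forall>\<^sub>F s in at 0. cats_eyes \<delta> (rel_stream (\<psi> s))))))))"
proof (rule exI[of _ "4 * pi / sqrt 1000"], intro conjI allI impI)
  show "0 < 4 * pi / sqrt 1000" by simp
  fix n :: nat assume n: "1 \<le> n"
  have "0 < 1 / 2 * (1 / (4 * pi))" by simp
  then have A: "0 < A" using assms(1) by linarith
  define Q where "Q = Qpot A n"
  have Qc: "continuous_on {0..1} Q"
  proof (rule vorticity_function[OF A assms(2) n], goal_cases)
    case (1 F H c c' r M)
    have "continuous_on {0..1} (c 1)" by (rule DERIV_continuous_on[OF 1(3)])
    then show ?case by (rule continuous_on_eq) (simp add: 1(8) Q_def del: One_nat_def)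
  qed
  \<comment> \<open>The largest addition to the potential that the energy estimate is made to
    tolerate; its square root is \<open>4 * pi / sqrt 1000 * real n\<close>.\<close>
  define m0 where "m0 = (4 * pi * real n)\<^sup>2 / 1000"
  have m0: "0 < m0" using n by (simp add: m0_def)
  obtain m f f' where m: "m0 \<le> m" and f: "linear_ode (\<lambda>y. Q y + m) (\<lambda>y. 0) f f'" "f 0 = 0" "f 1 = 0"
    "\<And>y. y \<in> {0<..<1} \<Longrightarrow> 0 < f y"
    and top: "\<And>k a a' y. m < k \<Longrightarrow> linear_ode (\<lambda>y. Q y + k) (\<lambda>y. 0) a a' \<Longrightarrow> a 0 = 0 \<Longrightarrow> a 1 = 0 \<Longrightarrow>
       y \<in> {0..1} \<Longrightarrow> a y = 0"
  proof (rule ground_state_exists[OF Qc, of m0], goal_cases)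
    case (1 f f')
    then show ?case using shear_negative_energy[OF assms n Qc[unfolded Q_def]] unfolding Q_def m0_def by blast
  next
    case (2 m f f')
    show ?case by (rule that[where m = m and f = f and f' = f']) (fact 2)+
  qed
  define \<alpha> where "\<alpha> = sqrt m"
  have \<alpha>: "0 < \<alpha>" "\<alpha>\<^sup>2 = m" using m m0 by (simp_all add: \<alpha>_def)
  have eig: "dirichlet_eigenfunction Q (- (\<alpha>\<^sup>2)) f"
  proof -
    have "f (1 / 2) \<noteq> 0" using f(4)[of "1 / 2"] by simp
    then have "\<exists>y\<in>{0..1}. f y \<noteq> 0" by (intro bexI[of _ "1 / 2"]) auto
    then show ?thesis unfolding dirichlet_eigenfunction_iff using f \<alpha>(2) by auto
  qed
  have low: "lowest_dirichlet_eigenvalue Q (- (\<alpha>\<^sup>2))"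
    unfolding lowest_dirichlet_eigenvalue_def
  proof (intro conjI allI impI)
    show "\<exists>\<phi>. dirichlet_eigenfunction Q (- (\<alpha>\<^sup>2)) \<phi>" using eig by blast
    fix \<mu> \<phi> assume "dirichlet_eigenfunction Q \<mu> \<phi>"
    then obtain \<phi>' where e: "linear_ode (\<lambda>y. Q y - \<mu>) (\<lambda>y. 0) \<phi> \<phi>'" "\<phi> 0 = 0" "\<phi> 1 = 0" "\<exists>y\<in>{0..1}. \<phi> y \<noteq> 0"
      unfolding dirichlet_eigenfunction_iff by blast
    have "linear_ode (\<lambda>y. Q y + - \<mu>) (\<lambda>y. 0) \<phi> \<phi>'" by (rule linear_ode_cong[OF e(1)]) simp
    then have "\<not> m < - \<mu>" using top e(2,3,4) by blast
    then show "- (\<alpha>\<^sup>2) \<le> \<mu>" using \<alpha>(2) by linarith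
  qed
  have c0: "4 * pi / sqrt 1000 * real n \<le> \<alpha>"
  proof -
    have "(4 * pi / sqrt 1000 * real n)\<^sup>2 = m0" by (simp add: m0_def power_mult_distrib power_divide)
    then show ?thesis unfolding \<alpha>_def using m by (intro real_le_rsqrt) simp
  qed
  \<comment> \<open>A positive eigenfunction is determined only up to a factor, and the scale of
    \<open>s\<close> follows the given one, so the curve is constructed for each choice
    separately.\<close>
  have main: "\<exists>s0>0. \<exists>\<alpha>s \<psi>. bifurcation_curve A n \<beta> \<alpha> s0 \<alpha>s \<psi> \<and> leading_order A n \<beta> \<phi> \<psi> \<and>
      (\<forall>s. s \<noteq> 0 \<and> \<bar>s\<bar> < s0 \<longrightarrow> (\<exists>\<delta>. 0 < \<delta> \<and> \<delta> \<le> 1 / 2 \<and> cats_eyes \<delta> (rel_stream (\<psi> s)))) \<and>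
      (\<forall>\<delta>. 0 < \<delta> \<and> \<delta> \<le> 1 / 2 \<longrightarrow> (\<forall>\<^sub>F s in at 0. cats_eyes \<delta> (rel_stream (\<psi> s))))"
    if \<phi>: "dirichlet_eigenfunction Q (- (\<alpha>\<^sup>2)) \<phi>" "\<forall>y\<in>{0<..<1}. 0 < \<phi> y" and \<beta>: "0 < \<beta>" "\<beta> < 1" for \<phi> \<beta>
  proof -
    obtain \<phi>' where e: "linear_ode (\<lambda>y. Q y - - (\<alpha>\<^sup>2)) (\<lambda>y. 0) \<phi> \<phi>'" "\<phi> 0 = 0" "\<phi> 1 = 0"
      using \<phi>(1) unfolding dirichlet_eigenfunction_iff by blast
    have e1: "linear_ode (\<lambda>y. Qpot A n y + \<alpha>\<^sup>2) (\<lambda>y. 0) \<phi> \<phi>'" by (rule linear_ode_cong[OF e(1)]) (simp add: Q_def)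
    show ?thesis
    proof (rule bifurcation_of_cats_eyes[OF A assms(2) n \<beta> \<alpha>(1) e1 e(2,3)])
      show "0 < \<phi> y" if "y \<in> {0<..<1}" for y using \<phi>(2) that by blast
      show "\<forall>y\<in>{0..1}. a y = 0" if "\<alpha>\<^sup>2 < k" "dirichlet_bvp (\<lambda>y. Qpot A n y + k) (\<lambda>y. 0) a" for k a
        using that top unfolding dirichlet_bvp_def \<alpha>(2) Q_def by blast
    qed
  qed
  show "\<exists>\<alpha>n>0. lowest_dirichlet_eigenvalue (Qpot A n) (- (\<alpha>n\<^sup>2)) \<and> 4 * pi / sqrt 1000 * real n \<le> \<alpha>n \<and>
       (\<exists>\<phi>. dirichlet_eigenfunction (Qpot A n) (- (\<alpha>n\<^sup>2)) \<phi> \<and> (\<forall>y\<in>{0<..<1}. 0 < \<phi> y)) \<and>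
       (\<forall>\<phi>. dirichlet_eigenfunction (Qpot A n) (- (\<alpha>n\<^sup>2)) \<phi> \<and> (\<forall>y\<in>{0<..<1}. 0 < \<phi> y) \<longrightarrow>
          (\<forall>\<beta>. 0 < \<beta> \<and> \<beta> < 1 \<longrightarrow>
             (\<exists>s0>0. \<exists>\<alpha> \<psi>.
                bifurcation_curve A n \<beta> \<alpha>n s0 \<alpha> \<psi> \<and>
                leading_order A n \<beta> \<phi> \<psi> \<and>
                (\<forall>s. s \<noteq> 0 \<and> \<bar>s\<bar> < s0 \<longrightarrow>
                   (\<exists>\<delta>. 0 < \<delta> \<and> \<delta> \<le> 1 / 2 \<and> cats_eyes \<delta> (rel_stream (\<psi> s)))) \<and>
                (\<forall>\<delta>. 0 < \<delta> \<and> \<delta> \<le> 1 / 2 \<longrightarrow>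
                   (\<forall>\<^sub>F s in at 0. cats_eyes \<delta> (rel_stream (\<psi> s)))))))"
  proof (rule exI[of _ \<alpha>], intro conjI allI impI)
    show "0 < \<alpha>" by (rule \<alpha>(1))
    show "lowest_dirichlet_eigenvalue (Qpot A n) (- (\<alpha>\<^sup>2))" by (rule low[unfolded Q_def])
    show "4 * pi / sqrt 1000 * real n \<le> \<alpha>" by (rule c0)
    show "\<exists>\<phi>. dirichlet_eigenfunction (Qpot A n) (- (\<alpha>\<^sup>2)) \<phi> \<and> (\<forall>y\<in>{0<..<1}. 0 < \<phi> y)"
      using eig f(4) unfolding Q_def by blast
    fix \<phi> \<beta> assume "dirichlet_eigenfunction (Qpot A n) (- (\<alpha>\<^sup>2)) \<phi> \<and> (\<forall>y\<in>{0<..<1}. 0 < \<phi> y)"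
      and "0 < \<beta> \<and> \<beta> < (1 :: real)"
    then show "\<exists>s0>0. \<exists>\<alpha>s \<psi>. bifurcation_curve A n \<beta> \<alpha> s0 \<alpha>s \<psi> \<and> leading_order A n \<beta> \<phi> \<psi> \<and>
        (\<forall>s. s \<noteq> 0 \<and> \<bar>s\<bar> < s0 \<longrightarrow> (\<exists>\<delta>. 0 < \<delta> \<and> \<delta> \<le> 1 / 2 \<and> cats_eyes \<delta> (rel_stream (\<psi> s)))) \<and>
        (\<forall>\<delta>. 0 < \<delta> \<and> \<delta> \<le> 1 / 2 \<longrightarrow> (\<forall>\<^sub>F s in at 0. cats_eyes \<delta> (rel_stream (\<psi> s))))"
      by (intro main) (simp_all add: Q_def)
  qed
qed

end
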